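(* On a Kähler manifold $X$, any deformation quantization of Wick type is of the form $\star_\alpha$ for some closed formal $(1,1)$-form $\alpha=\sum_{k\ge1}\hbar^k\omega_k$.
   Context: **Kähler conventions.** Summation convention. $\omega=\omega_{\alpha\bar\beta}dz^\alpha\wedge d\bar z^\beta=\sqrt{-1}g_{\alpha\bar\beta}dz^\alpha\wedge d\bar z^\beta$ is the Kähler form, $\omega^{\bar\gamma\alpha}\omega_{\alpha\bar\beta}=\delta^{\bar\gamma}_{\bar\beta}$, $\omega^{\alpha\bar\beta}=-\omega^{\bar\beta\alpha}$. Poisson bracket: $\{f,g\}=\omega^{i\bar j}(\partial_if\,\partial_{\bar j}g-\partial_{\bar j}f\,\partial_ig)$. **Deformation quantization.** An associative $\mathbb{C}[[\hbar]]$-bilinear product $f\star g=fg+\sum_{k\ge1}\hbar^kC_k(f,g)$ on $C^\infty(X)[[\hbar]]$ with $C_k$ bidifferential operators and $\{f,g\}=\lim_{\hbar\to0}\frac1\hbar(f\star g-g\star f)$. It is of *Wick type* if $f\star g=f\cdot g$ whenever $f$ is (locally) antiholomorphic or $g$ is (locally) holomorphic. **Weyl bundle.** $\mathcal{W}_X=\widehat{\mathrm{Sym}}(T^*X)[[\hbar]]$ (holomorphic cotangent bundle, local frame $y^i$), $\mathcal{W}_{X,\mathbb{C}}=\mathcal{W}_X\otimes\widehat{\mathrm{Sym}}(\overline{T^*X})[[\hbar]]$ (further variables $\bar y^j$). $\delta=dz^i\wedge\partial_{y^i}+d\bar z^j\wedge\partial_{\bar y^j}$; $(\delta^{1,0})^{-1}a=\frac{1}{p_1+p_2}y^k\iota_{\partial_{z^k}}a$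 if $a$ has form type $(p_1,q_1)$ and degree $p_2$ in the $y$'s (zero if $p_1+p_2=0$). The symbol map $\sigma$ sets $y^i,\bar y^j$ to $0$. $\nabla=\nabla^{1,0}+\nabla^{0,1}$ is the Levi-Civita connection. Fiberwise Wick product: $a\star b=\sum_k\frac{\hbar^k}{k!}\omega^{i_1\bar j_1}\cdots\omega^{i_k\bar j_k}\partial_{y^{i_1}}\cdots\partial_{y^{i_k}}a\;\partial_{\bar y^{j_1}}\cdots\partial_{\bar y^{j_k}}b$, with form parts wedged; $[-,-]_\star$ is the graded commutator. **The star product $\star_\alpha$.** Let $\alpha=\sum_{k\ge1}\hbar^k\omega_k$ be a closed formal $(1,1)$-form. Curvature: $\nabla^2(y^m)=R_{i\bar jk}^mdz^i\wedge d\bar z^j\otimes y^k$. Put $R_2^*=\frac12R_{i\bar jk}^md\bar z^j\otimes(y^iy^k\otimes\partial_{z^m})$, $R_n^*=(\delta^{1,0})^{-1}\nabla^{1,0}R_{n-1}^*$ for $n\ge3$; write $R_n^*=R_{i_1\cdots i_n,\bar l}^jd\bar z^l\otimes(y^{i_1}\cdots y^{i_n}\otimes\partial_{z^j})$ and $I=\sum_{n\ge2}R_{i_1\cdots i_n,\bar l}^j\omega_{j\bar k}d\bar z^l\otimes y^{i_1}\cdots y^{i_n}\bar y^k$. Choose locally a formal function $g$ with $\alpha=\bar\partial\partial g$ and put $J_\alpha=\sum_{k\ge1}((\delta^{1,0})^{-1}\nabla^{1,0})^k(\bar\partial g)$ (independent of $g$, globally defined). With $I_\alpha=I+J_\alpha$,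 the connection $D_{F,\alpha}=\nabla-\delta+\frac1\hbar[I_\alpha,-]_\star$ is flat. For $f\in C^\infty(X)[[\hbar]]$, $O_f$ is the unique $D_{F,\alpha}$-flat section of $\mathcal{W}_{X,\mathbb{C}}$ with $\sigma(O_f)=f$, and $f\star_\alpha g=\sigma(O_f\star O_g)$. *)

theory Defs
  imports "HOL-Analysis.Analysis" "HOL-Computational_Algebra.Formal_Power_Series"
begin

section \<open>Smooth and holomorphic functions on open sets of complex n-space\<close>

primrec Ck_on :: "nat \<Rightarrow> (complex^'n) set \<Rightarrow> (complex^'n \<Rightarrow> complex) \<Rightarrow> bool" where
  "Ck_on 0 S f \<longleftrightarrow> continuous_on S f"
| "Ck_on (Suc k) S f \<longleftrightarrow>
     (\<forall>z\<in>S. f differentiable (at z)) \<and>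
     (\<forall>v. Ck_on k S (\<lambda>z. frechet_derivative f (at z) v))"

text \<open>Only used for open sets; differentiability is real differentiability.\<close>

definition smooth_on :: "(complex^'n) set \<Rightarrow> (complex^'n \<Rightarrow> complex) \<Rightarrow> bool" where
  "smooth_on S f \<longleftrightarrow> (\<forall>k. Ck_on k S f)"

definition holo_on :: "(complex^'n) set \<Rightarrow> (complex^'n \<Rightarrow> complex) \<Rightarrow> bool" where
  "holo_on S f \<longleftrightarrow>
     (\<forall>z\<in>S. \<exists>D. (f has_derivative D) (at z) \<and> (\<forall>a v. D (a *s v) = a * D v))"

text \<open>Indices of type \<^typ>\<open>'n + 'n\<close> run through the complexified coordinate frame:
  \<^term>\<open>Inl i\<close> stands for the i-th holomorphic and \<^term>\<open>Inr j\<close> for the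
  j-th antiholomorphic direction.\<close>

definition wirtinger :: "'n + 'n \<Rightarrow> (complex^'n \<Rightarrow> complex) \<Rightarrow> complex^'n \<Rightarrow> complex" where
  "wirtinger A f z = (case A of
     Inl i \<Rightarrow> (frechet_derivative f (at z) (axis i 1) - \<i> * frechet_derivative f (at z) (axis i \<i>)) / 2
   | Inr j \<Rightarrow> (frechet_derivative f (at z) (axis j 1) + \<i> * frechet_derivative f (at z) (axis j \<i>)) / 2)"

text \<open>The formal parameter is \<^const>\<open>fps_X\<close>; differentiation acts on each
  coefficient of a formal function.\<close>

definition fwirtinger ::
    "'n + 'n \<Rightarrow> (complex^'n \<Rightarrow> complex fps) \<Rightarrow> complex^'n \<Rightarrow> complex fps" where
  "fwirtinger A h z = Abs_fps (\<lambda>k. wirtinger A (\<lambda>w. fps_nth (h w) k) z)"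

definition fsmooth_on :: "(complex^'n) set \<Rightarrow> (complex^'n \<Rightarrow> complex fps) \<Rightarrow> bool" where
  "fsmooth_on S h \<longleftrightarrow> (\<forall>k. smooth_on S (\<lambda>z. fps_nth (h z) k))"


section \<open>Complex manifolds\<close>

text \<open>A chart is a pair of its domain and its coordinate map; the values of the
  coordinate map outside the domain are irrelevant.\<close>

type_synonym ('a, 'n) chart = "'a set \<times> ('a \<Rightarrow> complex^'n)"

definition chart_image :: "('a, 'n) chart \<Rightarrow> (complex^'n) set" where
  "chart_image c = snd c ` fst c"

definition chart_inv :: "('a, 'n) chart \<Rightarrow> complex^'n \<Rightarrow> 'a" where
  "chart_inv c = inv_into (fst c) (snd c)"

definition transition :: "('a, 'n) chart \<Rightarrow> ('a, 'n) chart \<Rightarrow> complex^'n \<Rightarrow> complex^'n" where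
  "transition c c' = snd c' \<circ> chart_inv c"

definition complex_atlas :: "('a::topological_space, 'n::finite) chart set \<Rightarrow> bool" where
  "complex_atlas \<A> \<longleftrightarrow>
     (\<Union>c\<in>\<A>. fst c) = UNIV \<and>
     (\<forall>c\<in>\<A>. open (fst c) \<and> open (chart_image c) \<and>
            homeomorphism (fst c) (chart_image c) (snd c) (chart_inv c)) \<and>
     (\<forall>c\<in>\<A>. \<forall>c'\<in>\<A>. \<forall>i.
            holo_on (snd c ` (fst c \<inter> fst c')) (\<lambda>z. transition c c' z $ i))"

definition chart_at :: "('a, 'n) chart set \<Rightarrow> 'a \<Rightarrow> ('a, 'n) chart" where
  "chart_at \<A> x = (SOME c. c \<in> \<A> \<and> x \<in> fst c)"

definition smooth_fun :: "('a, 'n::finite) chart set \<Rightarrow> ('a \<Rightarrow> complex) \<Rightarrow> bool" where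
  "smooth_fun \<A> f \<longleftrightarrow> (\<forall>c\<in>\<A>. smooth_on (chart_image c) (\<lambda>z. f (chart_inv c z)))"

text \<open>Elements of the space of formal power series in the parameter with smooth
  coefficients are functions with values in \<^typ>\<open>complex fps\<close>.\<close>

definition formal_fun :: "('a, 'n::finite) chart set \<Rightarrow> ('a \<Rightarrow> complex fps) \<Rightarrow> bool" where
  "formal_fun \<A> f \<longleftrightarrow> (\<forall>k. smooth_fun \<A> (\<lambda>x. fps_nth (f x) k))"

definition holomorphic_fun :: "('a, 'n::finite) chart set \<Rightarrow> 'a set \<Rightarrow> ('a \<Rightarrow> complex) \<Rightarrow> bool" where
  "holomorphic_fun \<A> V f \<longleftrightarrow>
     (\<forall>c\<in>\<A>. holo_on (snd c ` (V \<inter> fst c)) (\<lambda>z. f (chart_inv c z)))"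

definition antiholomorphic_fun :: "('a, 'n::finite) chart set \<Rightarrow> 'a set \<Rightarrow> ('a \<Rightarrow> complex) \<Rightarrow> bool" where
  "antiholomorphic_fun \<A> V f \<longleftrightarrow> holomorphic_fun \<A> V (\<lambda>x. cnj (f x))"

text \<open>Jacobian of a change of coordinates in the complexified frame:
  the derivative in direction A of the coordinate B of the second chart.\<close>

definition jacobian ::
    "('a, 'n) chart \<Rightarrow> ('a, 'n) chart \<Rightarrow> 'n + 'n \<Rightarrow> 'n + 'n \<Rightarrow> complex^'n \<Rightarrow> complex" where
  "jacobian c c' B A z = wirtinger A
     (\<lambda>w. case B of Inl i \<Rightarrow> transition c c' w $ i | Inr j \<Rightarrow> cnj (transition c c' w $ j)) z"


section \<open>Forms of type (1,1) and Kaehler manifolds\<close>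

text \<open>A (1,1)-form is given in each chart by its matrix of coefficients
  with respect to \<open>dz\<^sup>i \<and> d\<bar>z\<^sup>j\<close>.\<close>

type_synonym ('a, 'n) form11 = "('a, 'n) chart \<Rightarrow> complex^'n \<Rightarrow> complex^'n^'n"

definition is_form11 :: "('a, 'n::finite) chart set \<Rightarrow> ('a, 'n) form11 \<Rightarrow> bool" where
  "is_form11 \<A> \<eta> \<longleftrightarrow>
     (\<forall>c\<in>\<A>. \<forall>i j. smooth_on (chart_image c) (\<lambda>z. \<eta> c z $ i $ j)) \<and>
     (\<forall>c\<in>\<A>. \<forall>c'\<in>\<A>. \<forall>z\<in>snd c ` (fst c \<inter> fst c'). \<forall>i j.
        \<eta> c z $ i $ j =
          (\<Sum>p\<in>UNIV. \<Sum>q\<in>UNIV. jacobian c c' (Inl p) (Inl i) z * jacobian c c' (Inr q) (Inr j) z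
                             * \<eta> c' (transition c c' z) $ p $ q))"

definition closed_form11 :: "('a, 'n::finite) chart set \<Rightarrow> ('a, 'n) form11 \<Rightarrow> bool" where
  "closed_form11 \<A> \<eta> \<longleftrightarrow>
     is_form11 \<A> \<eta> \<and>
     (\<forall>c\<in>\<A>. \<forall>z\<in>chart_image c. \<forall>i j k.
        wirtinger (Inl k) (\<lambda>w. \<eta> c w $ i $ j) z = wirtinger (Inl i) (\<lambda>w. \<eta> c w $ k $ j) z \<and>
        wirtinger (Inr k) (\<lambda>w. \<eta> c w $ i $ j) z = wirtinger (Inr j) (\<lambda>w. \<eta> c w $ i $ k) z)"

text \<open>The coefficients of the Kaehler form are \<open>\<i> g\<^sub>i\<^sub>j\<close> with g Hermitian and positive definite.\<close>

definition herm :: "complex^'n^'n \<Rightarrow> 'n \<Rightarrow> 'n \<Rightarrow> complex" where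
  "herm W i j = - \<i> * W $ i $ j"

definition kaehler_manifold ::
    "('a::topological_space, 'n::finite) chart set \<Rightarrow> ('a, 'n) form11 \<Rightarrow> bool" where
  "kaehler_manifold \<A> \<omega> \<longleftrightarrow>
     complex_atlas \<A> \<and> closed_form11 \<A> \<omega> \<and>
     (\<forall>c\<in>\<A>. \<forall>z\<in>chart_image c.
        (\<forall>i j. herm (\<omega> c z) j i = cnj (herm (\<omega> c z) i j)) \<and>
        (\<forall>v::complex^'n. v \<noteq> 0 \<longrightarrow>
           0 < Re (\<Sum>i\<in>UNIV. \<Sum>j\<in>UNIV. herm (\<omega> c z) i j * v $ i * cnj (v $ j))))"

text \<open>The inverse matrix is the matrix with the antiholomorphic index first; exchanging the
  two indices changes the sign.\<close>

definition omega_up :: "complex^'n::finite^'n \<Rightarrow> 'n \<Rightarrow> 'n \<Rightarrow> complex" where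
  "omega_up W i j = - (matrix_inv W $ j $ i)"

definition poisson ::
    "('a, 'n::finite) chart set \<Rightarrow> ('a, 'n) form11 \<Rightarrow>
     ('a \<Rightarrow> complex) \<Rightarrow> ('a \<Rightarrow> complex) \<Rightarrow> 'a \<Rightarrow> complex" where
  "poisson \<A> \<omega> f g x =
     (let c = chart_at \<A> x; z = snd c x; F = (\<lambda>w. f (chart_inv c w)); G = (\<lambda>w. g (chart_inv c w))
      in \<Sum>i\<in>UNIV. \<Sum>j\<in>UNIV. omega_up (\<omega> c z) i j *
           (wirtinger (Inl i) F z * wirtinger (Inr j) G z - wirtinger (Inr j) F z * wirtinger (Inl i) G z))"


section \<open>Deformation quantizations of Wick type\<close>

definition bidifferential_op ::
    "('a, 'n::finite) chart set \<Rightarrow> (('a \<Rightarrow> complex) \<Rightarrow> ('a \<Rightarrow> complex) \<Rightarrow> 'a \<Rightarrow> complex) \<Rightarrow> bool" where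
  "bidifferential_op \<A> C \<longleftrightarrow>
     (\<forall>c\<in>\<A>. \<exists>N a. (\<forall>P Q. smooth_on (chart_image c) (a P Q)) \<and>
        (\<forall>f g. smooth_fun \<A> f \<longrightarrow> smooth_fun \<A> g \<longrightarrow> (\<forall>z\<in>chart_image c.
           C f g (chart_inv c z) =
             (\<Sum>P\<in>{P. length P \<le> N}. \<Sum>Q\<in>{Q. length Q \<le> N}.
                a P Q z * foldr wirtinger P (\<lambda>w. f (chart_inv c w)) z
                        * foldr wirtinger Q (\<lambda>w. g (chart_inv c w)) z))))"

type_synonym 'a star = "('a \<Rightarrow> complex fps) \<Rightarrow> ('a \<Rightarrow> complex fps) \<Rightarrow> 'a \<Rightarrow> complex fps"

definition formal_bilinear :: "('a, 'n::finite) chart set \<Rightarrow> 'a star \<Rightarrow> bool" where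
  "formal_bilinear \<A> S \<longleftrightarrow>
     (\<forall>f f' g. formal_fun \<A> f \<longrightarrow> formal_fun \<A> f' \<longrightarrow> formal_fun \<A> g \<longrightarrow>
        S (\<lambda>x. f x + f' x) g = (\<lambda>x. S f g x + S f' g x) \<and>
        S g (\<lambda>x. f x + f' x) = (\<lambda>x. S g f x + S g f' x)) \<and>
     (\<forall>a f g. formal_fun \<A> f \<longrightarrow> formal_fun \<A> g \<longrightarrow>
        S (\<lambda>x. a * f x) g = (\<lambda>x. a * S f g x) \<and>
        S f (\<lambda>x. a * g x) = (\<lambda>x. a * S f g x))"

text \<open>The expansion in powers of the formal parameter is required for smooth functions;
  bilinearity over the formal power series then determines the product of all
  formal functions.\<close>

definition deformation_quantization ::
    "('a, 'n::finite) chart set \<Rightarrow> ('a, 'n) form11 \<Rightarrow> 'a star \<Rightarrow> bool" where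
  "deformation_quantization \<A> \<omega> S \<longleftrightarrow>
     (\<forall>f g. formal_fun \<A> f \<longrightarrow> formal_fun \<A> g \<longrightarrow> formal_fun \<A> (S f g)) \<and>
     formal_bilinear \<A> S \<and>
     (\<forall>f g h. formal_fun \<A> f \<longrightarrow> formal_fun \<A> g \<longrightarrow> formal_fun \<A> h \<longrightarrow>
        S (S f g) h = S f (S g h)) \<and>
     (\<exists>C. (\<forall>k\<ge>1. bidifferential_op \<A> (C k)) \<and>
        (\<forall>f g. smooth_fun \<A> f \<longrightarrow> smooth_fun \<A> g \<longrightarrow>
           S (\<lambda>x. fps_const (f x)) (\<lambda>x. fps_const (g x)) =
             (\<lambda>x. Abs_fps (\<lambda>k. if k = 0 then f x * g x else C k f g x)))) \<and>
     (\<forall>f g x. smooth_fun \<A> f \<longrightarrow> smooth_fun \<A> g \<longrightarrow>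
        poisson \<A> \<omega> f g x =
          fps_nth ((S (\<lambda>y. fps_const (f y)) (\<lambda>y. fps_const (g y)) x
                  - S (\<lambda>y. fps_const (g y)) (\<lambda>y. fps_const (f y)) x) / fps_X) 0)"

definition wick_type :: "('a::topological_space, 'n::finite) chart set \<Rightarrow> 'a star \<Rightarrow> bool" where
  "wick_type \<A> S \<longleftrightarrow>
     (\<forall>V f g. open V \<longrightarrow> formal_fun \<A> f \<longrightarrow> formal_fun \<A> g \<longrightarrow>
        (\<forall>k. antiholomorphic_fun \<A> V (\<lambda>x. fps_nth (f x) k)) \<or>
        (\<forall>k. holomorphic_fun \<A> V (\<lambda>x. fps_nth (g x) k)) \<longrightarrow>
        (\<forall>x\<in>V. S f g x = f x * g x))"


section \<open>Fibres of the Weyl bundle\<close>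

text \<open>In a chart, a fibre is the algebra of formal power series in the variables
  \<open>y\<^sup>i\<close> (index \<^term>\<open>Inl i\<close>), \<open>\<bar>y\<^sup>j\<close> (index \<^term>\<open>Inr j\<close>) and the formal
  parameter. An element is given by the coefficients of the monomials in the first two
  kinds of variables, which are indexed by their exponents.\<close>

type_synonym 'n fibre = "('n + 'n \<Rightarrow> nat) \<Rightarrow> complex fps"

definition fmult :: "'n::finite fibre \<Rightarrow> 'n fibre \<Rightarrow> 'n fibre" where
  "fmult a b m = (\<Sum>p\<in>{p. p \<le> m}. a p * b (\<lambda>v. m v - p v))"

definition yconst :: "complex fps \<Rightarrow> 'n fibre" where
  "yconst h m = (if m = (\<lambda>_. 0) then h else 0)"

definition ymult :: "'n + 'n \<Rightarrow> 'n fibre \<Rightarrow> 'n fibre" where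
  "ymult A a m = (if m A = 0 then 0 else a (m(A := m A - 1)))"

definition yderiv :: "'n + 'n \<Rightarrow> 'n fibre \<Rightarrow> 'n fibre" where
  "yderiv A a m = of_nat (m A + 1) * a (m(A := m A + 1))"

definition yvar :: "'n + 'n \<Rightarrow> 'n fibre" where
  "yvar A = ymult A (yconst 1)"

definition ydeg :: "('n::finite + 'n \<Rightarrow> nat) \<Rightarrow> nat" where
  "ydeg m = (\<Sum>i\<in>UNIV. m (Inl i))"

text \<open>\<open>wick_term W k a b\<close> is the k-fold contraction of the derivatives of a and b, without
  the factor \<open>1 / k!\<close>. The coefficient of the n-th power of the formal parameter in the
  Wick product receives contributions only from \<open>k \<le> n\<close>.\<close>

primrec wick_term ::
    "complex^'n::finite^'n \<Rightarrow> nat \<Rightarrow> 'n fibre \<Rightarrow> 'n fibre \<Rightarrow> 'n fibre" where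
  "wick_term W 0 a b = fmult a b"
| "wick_term W (Suc k) a b = (\<lambda>m. \<Sum>i\<in>UNIV. \<Sum>j\<in>UNIV.
     fps_const (omega_up W i j) * wick_term W k (yderiv (Inl i) a) (yderiv (Inr j) b) m)"

definition wick :: "complex^'n::finite^'n \<Rightarrow> 'n fibre \<Rightarrow> 'n fibre \<Rightarrow> 'n fibre" where
  "wick W a b m = Abs_fps (\<lambda>n. \<Sum>k\<le>n. fps_nth (wick_term W k a b m) (n - k) / fact k)"


section \<open>The Levi-Civita connection and its curvature\<close>

text \<open>From here on \<open>\<Omega>\<close> is the coefficient matrix of the Kaehler form in a chart, and local
  sections of the Weyl bundle are functions of the coordinates.\<close>

type_synonym 'n local_section = "complex^'n \<Rightarrow> 'n fibre"

text \<open>Complex bilinear extension of the Riemannian metric, up to a constant factor.\<close>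

definition metric :: "complex^'n::finite^'n \<Rightarrow> complex^('n + 'n)^('n + 'n)" where
  "metric W = (\<chi> A B. case (A, B) of
      (Inl i, Inr j) \<Rightarrow> herm W i j
    | (Inr j, Inl i) \<Rightarrow> herm W i j
    | _ \<Rightarrow> 0)"

definition christoffel ::
    "(complex^'n \<Rightarrow> complex^'n::finite^'n) \<Rightarrow> 'n + 'n \<Rightarrow> 'n + 'n \<Rightarrow> 'n + 'n \<Rightarrow> complex^'n \<Rightarrow> complex" where
  "christoffel \<Omega> A B C z = (\<Sum>D\<in>UNIV. matrix_inv (metric (\<Omega> z)) $ A $ D *
      (wirtinger B (\<lambda>w. metric (\<Omega> w) $ D $ C) z
     + wirtinger C (\<lambda>w. metric (\<Omega> w) $ D $ B) z
     - wirtinger D (\<lambda>w. metric (\<Omega> w) $ B $ C) z)) / 2"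

definition nabla ::
    "(complex^'n \<Rightarrow> complex^'n::finite^'n) \<Rightarrow> 'n + 'n \<Rightarrow> 'n local_section \<Rightarrow> 'n local_section" where
  "nabla \<Omega> A s z m = fwirtinger A (\<lambda>w. s w m) z
     - (\<Sum>B\<in>UNIV. \<Sum>C\<in>UNIV. fps_const (christoffel \<Omega> B A C z) * ymult C (yderiv B (s z)) m)"

text \<open>\<open>curv \<Omega> i j k m\<close> is the coefficient of \<open>dz\<^sup>i \<and> d\<bar>z\<^sup>j \<otimes> y\<^sup>k\<close> in the square of
  the connection applied to \<open>y\<^sup>m\<close>.\<close>

definition curv ::
    "(complex^'n \<Rightarrow> complex^'n::finite^'n) \<Rightarrow> 'n \<Rightarrow> 'n \<Rightarrow> 'n \<Rightarrow> 'n \<Rightarrow> complex^'n \<Rightarrow> complex" where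
  "curv \<Omega> i j k m z =
     fps_nth (nabla \<Omega> (Inl i) (nabla \<Omega> (Inr j) (\<lambda>_. yvar (Inl m))) z ((\<lambda>_. 0)(Inl k := 1))
            - nabla \<Omega> (Inr j) (nabla \<Omega> (Inl i) (\<lambda>_. yvar (Inl m))) z ((\<lambda>_. 0)(Inl k := 1))) 0"


section \<open>The Fedosov connection\<close>

text \<open>A (0,1)-form with values in the Weyl bundle is given by its components with respect to
  \<open>d\<bar>z\<^sup>l\<close>. The operator below is the homotopy \<open>(\<delta>\<^sup>1\<^sup>,\<^sup>0)\<^sup>-\<^sup>1\<close> applied to a (1,1)-form,
  for a fixed l: \<open>T k\<close> is the component of \<open>dz\<^sup>k \<and> d\<bar>z\<^sup>l\<close>, which is why \<open>p\<^sub>1 = 1\<close> in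
  the factor \<open>1 / (p\<^sub>1 + p\<^sub>2)\<close>.\<close>

definition delta_inv :: "('n::finite \<Rightarrow> 'n local_section) \<Rightarrow> 'n local_section" where
  "delta_inv T z m =
     (\<Sum>k\<in>UNIV. ymult (Inl k) (\<lambda>p. fps_const (1 / of_nat (1 + ydeg p)) * T k z p) m)"

text \<open>\<open>Rst \<Omega> r l j\<close> is the component of \<open>d\<bar>z\<^sup>l \<otimes> \<partial>\<^sub>z\<^sub>j\<close> in \<open>R\<^sub>n\<^sup>*\<close> for
  \<open>n = r + 2\<close>. The connection also differentiates the vector field factor.\<close>

primrec Rst ::
    "(complex^'n \<Rightarrow> complex^'n::finite^'n) \<Rightarrow> nat \<Rightarrow> 'n \<Rightarrow> 'n \<Rightarrow> 'n local_section" where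
  "Rst \<Omega> 0 = (\<lambda>l j z m. \<Sum>i\<in>UNIV. \<Sum>k\<in>UNIV.
      fps_const (curv \<Omega> i l k j z / 2) * ymult (Inl i) (yvar (Inl k)) m)"
| "Rst \<Omega> (Suc r) = (\<lambda>l j. delta_inv (\<lambda>i z m.
      nabla \<Omega> (Inl i) (Rst \<Omega> r l j) z m
      + (\<Sum>p\<in>UNIV. fps_const (christoffel \<Omega> (Inl j) (Inl i) (Inl p) z) * Rst \<Omega> r l p z m)))"

text \<open>The n-th summands of the following two series are homogeneous of degree n in the
  variables \<open>y\<close>, so that only finitely many of them contribute to a given coefficient.\<close>

definition I_curv :: "(complex^'n \<Rightarrow> complex^'n::finite^'n) \<Rightarrow> 'n \<Rightarrow> 'n local_section" where
  "I_curv \<Omega> l z m = (\<Sum>n=2..ydeg m. \<Sum>j\<in>UNIV. \<Sum>k\<in>UNIV.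
     fps_const (\<Omega> z $ j $ k) * ymult (Inr k) (Rst \<Omega> (n - 2) l j z) m)"

definition J_pot ::
    "(complex^'n \<Rightarrow> complex^'n::finite^'n) \<Rightarrow> (complex^'n \<Rightarrow> complex fps) \<Rightarrow> 'n \<Rightarrow> 'n local_section" where
  "J_pot \<Omega> g l z m = (\<Sum>k=1..ydeg m.
     ((\<lambda>s. delta_inv (\<lambda>i. nabla \<Omega> (Inl i) s)) ^^ k) (\<lambda>w. yconst (fwirtinger (Inr l) g w)) z m)"

text \<open>The formal form \<open>\<alpha>\<close> is given by its coefficients \<open>\<alpha> k\<close>, of which only those with
  \<open>k \<ge> 1\<close> matter.\<close>

definition formal_coeff ::
    "(nat \<Rightarrow> ('a, 'n::finite) form11) \<Rightarrow> ('a, 'n) chart \<Rightarrow> 'n \<Rightarrow> 'n \<Rightarrow> complex^'n \<Rightarrow> complex fps" where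
  "formal_coeff \<alpha> c i j z = Abs_fps (\<lambda>k. if k = 0 then 0 else \<alpha> k c z $ i $ j)"

text \<open>The minus sign comes from
  \<open>\<bar>\<partial>\<partial>g = \<partial>\<^sub>j\<partial>\<^sub>i g d\<bar>z\<^sup>j \<and> dz\<^sup>i = - \<partial>\<^sub>j\<partial>\<^sub>i g dz\<^sup>i \<and> d\<bar>z\<^sup>j\<close>.\<close>

definition local_potential ::
    "(nat \<Rightarrow> ('a, 'n::finite) form11) \<Rightarrow> ('a, 'n) chart \<Rightarrow> (complex^'n) set \<Rightarrow>
     (complex^'n \<Rightarrow> complex fps) \<Rightarrow> bool" where
  "local_potential \<alpha> c V g \<longleftrightarrow>
     open V \<and> V \<subseteq> chart_image c \<and> fsmooth_on V g \<and>
     (\<forall>w\<in>V. \<forall>i j. formal_coeff \<alpha> c i j w = - fwirtinger (Inr j) (fwirtinger (Inl i) g) w)"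

definition J_alpha ::
    "('a, 'n::finite) form11 \<Rightarrow> (nat \<Rightarrow> ('a, 'n) form11) \<Rightarrow> ('a, 'n) chart \<Rightarrow> 'n \<Rightarrow> 'n local_section" where
  "J_alpha \<omega> \<alpha> c l z = J_pot (\<omega> c) (SOME g. \<exists>V. z \<in> V \<and> local_potential \<alpha> c V g) l z"

definition I_alpha ::
    "('a, 'n::finite) form11 \<Rightarrow> (nat \<Rightarrow> ('a, 'n) form11) \<Rightarrow> ('a, 'n) chart \<Rightarrow> 'n \<Rightarrow> 'n local_section" where
  "I_alpha \<omega> \<alpha> c l z m = I_curv (\<omega> c) l z m + J_alpha \<omega> \<alpha> c l z m"

text \<open>Component of the Fedosov connection in direction A, applied to a section. The form
  \<open>I\<^sub>\<alpha>\<close> has type (0,1), hence the commutator only occurs in the antiholomorphic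
  directions.\<close>

definition fedosov ::
    "('a, 'n::finite) form11 \<Rightarrow> (nat \<Rightarrow> ('a, 'n) form11) \<Rightarrow> ('a, 'n) chart \<Rightarrow> 'n + 'n \<Rightarrow>
     'n local_section \<Rightarrow> 'n local_section" where
  "fedosov \<omega> \<alpha> c A s z m =
     nabla (\<omega> c) A s z m - yderiv A (s z) m +
     (case A of Inl _ \<Rightarrow> 0
      | Inr l \<Rightarrow> (wick (\<omega> c z) (I_alpha \<omega> \<alpha> c l z) (s z) m
                - wick (\<omega> c z) (s z) (I_alpha \<omega> \<alpha> c l z) m) / fps_X)"


section \<open>Global sections of the Weyl bundle and the star product\<close>

type_synonym ('a, 'n) weyl = "('a, 'n) chart \<Rightarrow> 'n local_section"

definition jet :: "'n fibre \<Rightarrow> ('n + 'n) list \<Rightarrow> complex fps" where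
  "jet a P = foldr yderiv P a (\<lambda>_. 0)"

text \<open>A section is given by its expressions in all charts. Its Taylor coefficients in the
  fibre variables transform as covariant symmetric tensors. The values outside the
  charts carry no information and are normalized to 0, so that sections are equal
  as soon as they agree on all charts.\<close>

definition weyl_section :: "('a, 'n::finite) chart set \<Rightarrow> ('a, 'n) weyl \<Rightarrow> bool" where
  "weyl_section \<A> s \<longleftrightarrow>
     (\<forall>c\<in>\<A>. \<forall>m. fsmooth_on (chart_image c) (\<lambda>z. s c z m)) \<and>
     (\<forall>c\<in>\<A>. \<forall>c'\<in>\<A>. \<forall>z\<in>snd c ` (fst c \<inter> fst c'). \<forall>P.
        jet (s c z) P =
          (\<Sum>Q\<in>{Q. length Q = length P}.
             (\<Prod>r<length P. fps_const (jacobian c c' (Q ! r) (P ! r) z)) *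
             jet (s c' (transition c c' z)) Q)) \<and>
     (\<forall>c z. c \<notin> \<A> \<or> z \<notin> chart_image c \<longrightarrow> s c z = (\<lambda>_. 0))"

definition symbol :: "('a, 'n) chart set \<Rightarrow> ('a, 'n) weyl \<Rightarrow> 'a \<Rightarrow> complex fps" where
  "symbol \<A> s x = (let c = chart_at \<A> x in s c (snd c x) (\<lambda>_. 0))"

definition flat_section ::
    "('a, 'n::finite) chart set \<Rightarrow> ('a, 'n) form11 \<Rightarrow> (nat \<Rightarrow> ('a, 'n) form11) \<Rightarrow> ('a, 'n) weyl \<Rightarrow> bool" where
  "flat_section \<A> \<omega> \<alpha> s \<longleftrightarrow>
     weyl_section \<A> s \<and>
     (\<forall>c\<in>\<A>. \<forall>z\<in>chart_image c. \<forall>A m. fedosov \<omega> \<alpha> c A (s c) z m = 0)"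

definition flat_lift ::
    "('a, 'n::finite) chart set \<Rightarrow> ('a, 'n) form11 \<Rightarrow> (nat \<Rightarrow> ('a, 'n) form11) \<Rightarrow>
     ('a \<Rightarrow> complex fps) \<Rightarrow> ('a, 'n) weyl" where
  "flat_lift \<A> \<omega> \<alpha> f = (THE s. flat_section \<A> \<omega> \<alpha> s \<and> symbol \<A> s = f)"

definition weyl_wick ::
    "('a, 'n::finite) form11 \<Rightarrow> ('a, 'n) weyl \<Rightarrow> ('a, 'n) weyl \<Rightarrow> ('a, 'n) weyl" where
  "weyl_wick \<omega> s t c z = wick (\<omega> c z) (s c z) (t c z)"

definition star_alpha ::
    "('a, 'n::finite) chart set \<Rightarrow> ('a, 'n) form11 \<Rightarrow> (nat \<Rightarrow> ('a, 'n) form11) \<Rightarrow> 'a star" where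
  "star_alpha \<A> \<omega> \<alpha> f g =
     symbol \<A> (weyl_wick \<omega> (flat_lift \<A> \<omega> \<alpha> f) (flat_lift \<A> \<omega> \<alpha> g))"

end

theory Submission imports Defs "HOL-Complex_Analysis.Complex_Analysis" begin

text \<open>Near a point, the Poincare lemma solves order by order for formal functions \<open>U\<^sub>l\<close> whose left multiplication is
 the derivation \<open>G \<mapsto> U\<^sub>l G + \<hbar> \<partial>G/\<partial>zbar\<^sup>l\<close>. Being of Wick type makes \<open>U\<^sub>l\<close> unique up to antiholomorphic functions, so that the
 positive orders of \<open>\<partial>U\<^sub>l/\<partial>z\<^sup>i\<close> are the coefficients of a global closed form \<open>\<alpha>\<close>, while order zero gives the Kaehler form.

 Right multiplication by \<open>g\<close> expands as \<open>\<Sum> \<hbar>\<^sup>k/k! T\<^sub>J X\<^sup>J\<close>, where the commuting vector fields \<open>X\<^sup>a\<close> are dual to the order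
 zero parts of the \<open>U\<^sub>l\<close> and \<open>T\<^sub>J\<close> is, up to a power of \<open>\<hbar>\<close>, the iterated commutator symbol with these functions. In the frame
 formed by the \<open>X\<^sup>a\<close> and the antiholomorphic fibre directions the Levi-Civita connection is flat in the holomorphic
 directions, and the Fedosov connection becomes a derivative minus a shift of jets plus a commutator with an explicit
 element. Commuting \<open>U\<^sub>l\<close> past the right multiplication shows that \<open>X\<^sup>K T\<^sub>M\<close> satisfies exactly this equation, hence is the
 family of jets of the unique flat lift of \<open>g\<close>; its Wick product with the lift of \<open>f\<close> has symbol
 \<open>\<Sum> \<hbar>\<^sup>k/k! X\<^sup>J f T\<^sub>J = f \<star> g\<close>.\<close>

section \<open>Smooth functions of several complex variables\<close>

text \<open>The product is given on global functions only, while every construction here is local.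
  It consists of bidifferential operators, and every germ extends to a global function by a cutoff;
  hence it descends to formal germs at each point, where all arguments become identities in a
  commutative ring with derivations. The price is paid on the way back: objects chosen separately at
  each point must be shown to fit together, and only finitely many orders are controlled on one
  neighbourhood.

  The frame has a simple meaning: the order zero functions \<open>u\<close> and the conjugate
  coordinates are local coordinates in which the fields \<open>X\<close> are coordinate fields, so a
  right multiplication has a Taylor expansion with iterated commutators as coefficients. A k-fold
  commutator with the \<open>u\<close> is divisible by the k-th power of the parameter, and this
  turns the expansion into a Wick product.

  Because the flat lift is specified by unique existence, no iterative construction of flat sections
  enters: an explicit candidate and a uniqueness argument take its place.\<close>

abbreviation cst :: "'a::zero => 'a fps" where "cst == fps_const"
abbreviation wd :: "'n + 'n => (complex^'n => complex) => complex^'n => complex" where "wd == wirtinger"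
abbreviation fwd :: "'n + 'n => (complex^'n => complex fps) => complex^'n => complex fps" where "fwd == fwirtinger"
abbreviation FD :: "('a::real_normed_vector => 'b::real_normed_vector) => 'a => 'a => 'b" where "FD f z == frechet_derivative f (at z)"
abbreviation near :: "'a::topological_space => ('a => bool) => bool" where "near z P == eventually P (nhds z)"
abbreviation usum :: "('i::finite => 'a::comm_monoid_add) => 'a" (binder "SS " 10) where "usum f == sum f UNIV"
abbreviation circ :: "real => real => complex" where "circ r t == of_real r * exp (2 * of_real pi * \<i> * of_real t)"
abbreviation words :: "nat => 'i list set" where "words k == {J. length J = k}"

notation scaleR (infixr "*R" 75)

lemmas fin_induct = infinite_finite_induct

lemma sum_UNIV_sum: "(SS A. h A) = (SS i. h (Inl i)) + (SS j. h (Inr j))"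
 for h :: "'a::finite + 'b::finite => 'c::comm_monoid_add" by(subst UNIV_Plus_UNIV[symmetric], subst sum.Plus) auto

section \<open>Functions of class C^k and closure properties of smoothness\<close>

lemma Ck_on_cong: assumes "open S" "Ck_on k S f" "!!z. z : S ==> f z = g z" shows "Ck_on k S g" using assms(2,3)
proof(induction k arbitrary: f g)
 case 0 thus ?case by(metis Ck_on.simps(1) continuous_on_cong)
next case (Suc k)
 have d: "g differentiable (at z) & FD f z = FD g z" if "z : S" for z
 proof - have f: "(f has_derivative FD f z) (at z)" using Suc.prems that frechet_derivative_works by auto
  have "(g has_derivative FD f z) (at z)"
   by(rule has_derivative_transform_within_open[OF f `open S` that]) (use Suc.prems in auto)
  thus ?thesis by(metis differentiable_def frechet_derivative_at)
 qed
 show ?case unfolding Ck_on.simps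
 proof(intro conjI ballI allI)
  fix v show "Ck_on k S (%z. FD g z v)" by(rule Suc.IH[of "%z. FD f z v"]) (use Suc.prems d in auto)
 qed (use d in auto)
qed

lemma Ck_on_SucD: "Ck_on (Suc k) S f ==> Ck_on k S f"
proof(induction k arbitrary: f)
 case 0 thus ?case by(auto simp: continuous_on_eq_continuous_at differentiable_imp_continuous_within
    intro!: continuous_at_imp_continuous_on)
next case (Suc k)
 from Suc.prems have 1: "ALL z:S. f differentiable (at z)" and 2: "!!v. Ck_on (Suc k) S (%z. FD f z v)" by(auto simp only: Ck_on.simps(2))
 show ?case using 1 Suc.IH[OF 2] by(simp only: Ck_on.simps(2)) simp
qed

lemma Ck_on_SucI: assumes "open S" "!!z. z : S ==> (f has_derivative f' z) (at z)" "!!v. Ck_on k S (%z. f' z v)"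
 shows "Ck_on (Suc k) S f" unfolding Ck_on.simps
proof(intro conjI ballI allI)
 fix v show "Ck_on k S (%z. FD f z v)" by(rule Ck_on_cong[OF assms(1) assms(3)[of v]]) (metis assms(2) frechet_derivative_at)
qed (use assms(2) differentiable_def in blast)

lemma Ck_on_SucE: assumes "Ck_on (Suc k) S f" "z : S" shows "(f has_derivative FD f z) (at z)" using assms frechet_derivative_works by auto

lemma Ck_on_local: assumes "!!z. z : S ==> EX V. open V & z : V & Ck_on k V f" shows "Ck_on k S f" using assms
proof(induction k arbitrary: f)
 case 0 thus ?case by(metis Ck_on.simps(1) continuous_at_imp_continuous_on continuous_on_eq_continuous_at)
next case (Suc k)
 show ?case unfolding Ck_on.simps
 proof(intro conjI ballI allI)
  fix v show "Ck_on k S (%z. FD f z v)" by(rule Suc.IH) (use Suc.prems in fastforce)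
 qed (use Suc.prems in fastforce)
qed

lemma Ck_on_subset: "Ck_on k S f ==> T \<subseteq> S ==> Ck_on k T f" by(induction k arbitrary: f) (auto intro: continuous_on_subset)

lemma Ck_on_const: "open S ==> Ck_on k S (%_. c)"
proof(induction k arbitrary: c)
 case (Suc k) show ?case by(rule Ck_on_SucI[where f' = "%_ _. 0"]) (use Suc in \<open>auto intro!: derivative_eq_intros\<close>)
qed auto

lemma Ck_on_add: "open S ==> Ck_on k S f ==> Ck_on k S g ==> Ck_on k S (%z. f z + g z)"
proof(induction k arbitrary: f g)
 case 0 thus ?case by(auto intro: continuous_intros)
next case (Suc k)
 show ?case by(rule Ck_on_SucI[OF Suc.prems(1) has_derivative_add[OF Ck_on_SucE[OF Suc.prems(2)] Ck_on_SucE[OF Suc.prems(3)]]])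
   (use Suc in auto)
qed

lemma Ck_on_linear: assumes "bounded_linear h" shows "open S ==> Ck_on k S f ==> Ck_on k S (%z. h (f z))"
proof(induction k arbitrary: f)
 case 0 thus ?case by(auto intro: bounded_linear.continuous_on[OF assms])
next case (Suc k)
 show ?case by(rule Ck_on_SucI[OF Suc.prems(1) bounded_linear.has_derivative[OF assms Ck_on_SucE[OF Suc.prems(2)]]]) (use Suc in auto)
qed

lemma Ck_on_mult: "open S ==> Ck_on k S f ==> Ck_on k S g ==> Ck_on k S (%z. f z * g z)"
proof(induction k arbitrary: f g)
 case 0 thus ?case by(auto intro: continuous_intros)
next case (Suc k)
 show ?case by(rule Ck_on_SucI[OF Suc.prems(1) has_derivative_mult[OF Ck_on_SucE[OF Suc.prems(2)] Ck_on_SucE[OF Suc.prems(3)]]])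
   (use Suc Ck_on_SucD[OF Suc.prems(2)] Ck_on_SucD[OF Suc.prems(3)] in \<open>auto intro!: Ck_on_add\<close>)
qed

lemma Ck_on_inverse: "open S ==> Ck_on k S f ==> (!!z. z : S ==> f z ~= 0) ==> Ck_on k S (%z. inverse (f z))"
proof(induction k arbitrary: f)
 case 0 thus ?case by(auto intro: continuous_intros)
next case (Suc k)
 have 1: "Ck_on k S (%z. inverse (f z))" using Suc Ck_on_SucD by blast
 have 2: "Ck_on k S (%z. - (inverse (f z) * FD f z v * inverse (f z)))" for v
  using Suc.prems by(intro Ck_on_linear[OF bounded_linear_minus[OF bounded_linear_ident]] Ck_on_mult 1) auto
 show ?case by(rule Ck_on_SucI[OF Suc.prems(1) Deriv.has_derivative_inverse[OF _ Ck_on_SucE[OF Suc.prems(2)]] 2]) (use Suc.prems in auto)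
qed

lemma smooth_on_cong: "smooth_on S f ==> open S ==> (!!z. z : S ==> f z = g z) ==> smooth_on S g"
 by(auto simp: smooth_on_def intro: Ck_on_cong)

lemma smooth_on_subset: "smooth_on S f ==> T \<subseteq> S ==> smooth_on T f" by(auto simp: smooth_on_def intro: Ck_on_subset)

lemma smooth_on_local: "(!!z. z : S ==> EX V. open V & z : V & smooth_on V f) ==> smooth_on S f"
 unfolding smooth_on_def by(intro allI Ck_on_local) blast

named_theorems smooth_intros

lemma smooth_on_const [smooth_intros]: "open S ==> smooth_on S (%_. c)" by(simp add: smooth_on_def Ck_on_const)

lemma smooth_on_add [smooth_intros]: "open S ==> smooth_on S f ==> smooth_on S g ==> smooth_on S (%z. f z + g z)"
 by(simp add: smooth_on_def Ck_on_add)

lemma smooth_on_mult [smooth_intros]: "open S ==> smooth_on S f ==> smooth_on S g ==> smooth_on S (%z. f z * g z)"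
 by(simp add: smooth_on_def Ck_on_mult)

lemma smooth_on_linear: "bounded_linear h ==> open S ==> smooth_on S f ==> smooth_on S (%z. h (f z))"
 by(simp add: smooth_on_def Ck_on_linear)

lemma smooth_on_cnj [smooth_intros]: "open S ==> smooth_on S f ==> smooth_on S (%z. cnj (f z))"
 by(rule smooth_on_linear[OF bounded_linear_cnj])

lemma smooth_on_minus [smooth_intros]: "open S ==> smooth_on S f ==> smooth_on S (%z. - f z)"
 by(rule smooth_on_linear[OF bounded_linear_minus[OF bounded_linear_ident]])

lemma smooth_on_diff [smooth_intros]: "open S ==> smooth_on S f ==> smooth_on S g ==> smooth_on S (%z. f z - g z)"
 using smooth_on_add[of S f "%z. - g z", OF _ _ smooth_on_minus[of S g]] by simp

lemma smooth_on_scaleR [smooth_intros]: "open S ==> smooth_on S f ==> smooth_on S (%z. r *R f z)"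
 by(rule smooth_on_linear[OF bounded_linear_scaleR_right])

lemma smooth_on_divide_const [smooth_intros]: "open S ==> smooth_on S f ==> smooth_on S (%z. f z / c)"
 by(rule smooth_on_linear[OF bounded_linear_divide])

lemma smooth_on_sum [smooth_intros]: "open S ==> (!!i. i : I ==> smooth_on S (f i)) ==> smooth_on S (%z. SUM i:I. f i z)"
 by(induction I rule: fin_induct) (auto intro: smooth_intros)

lemma smooth_on_prod [smooth_intros]: "open S ==> (!!i. i : I ==> smooth_on S (f i)) ==> smooth_on S (%z. PROD i:I. f i z)"
 by(induction I rule: fin_induct) (auto intro: smooth_intros)

lemma smooth_on_inverse [smooth_intros]: "open S ==> smooth_on S f ==> (!!z. z : S ==> f z ~= 0) ==> smooth_on S (%z. inverse (f z))"
 by(simp add: smooth_on_def Ck_on_inverse)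

lemma smooth_on_divide [smooth_intros]: "open S ==> smooth_on S f ==> smooth_on S g ==> (!!z. z : S ==> g z ~= 0)
  ==> smooth_on S (%z. f z / g z)" by(simp add: divide_inverse smooth_intros)

lemma smooth_on_bounded_linear: assumes "bounded_linear h" "open S" shows "smooth_on S h" unfolding smooth_on_def
proof
 fix k show "Ck_on k S h"
 proof(cases k)
  case 0 thus ?thesis using assms linear_continuous_on by auto
 next case (Suc m)
  show ?thesis unfolding Suc by(rule Ck_on_SucI[OF assms(2), where f' = "%_. h"])
    (auto intro: bounded_linear_imp_has_derivative assms Ck_on_const)
 qed
qed

lemma smooth_on_component [smooth_intros]: "open S ==> smooth_on S (%z. z $ i)" by(rule smooth_on_bounded_linear[OF bounded_linear_vec_nth])

lemma smooth_on_deriv: "smooth_on S f ==> z : S ==> f differentiable (at z)" unfolding smooth_on_def by(metis Ck_on.simps(2))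

lemma smooth_on_frechet: "smooth_on S f ==> smooth_on S (%z. FD f z v)" unfolding smooth_on_def by(metis Ck_on.simps(2))

lemma smooth_on_wirtinger [smooth_intros]: "open S ==> smooth_on S f ==> smooth_on S (wd A f)"
 unfolding wirtinger_def[abs_def] by(cases A) (auto intro!: smooth_intros smooth_on_frechet)

lemma smooth_on_continuous: "smooth_on S f ==> continuous_on S f" unfolding smooth_on_def by(metis Ck_on.simps(1))

section \<open>Wirtinger derivatives and the chain rule\<close>

definition wcomp :: "'n + 'n => complex^'n => complex" where "wcomp A v = (case A of Inl i => v $ i | Inr j => cnj (v $ j))"

lemma wcomp_simps [simp]: "wcomp (Inl i) v = v $ i" "wcomp (Inr i) v = cnj (v $ i)" by(simp_all add: wcomp_def)

text \<open>Expand \<open>v\<close> in the real basis \<open>axis i 1\<close>,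
  \<open>axis i \<i>\<close> and regroup into its components and their conjugates;
  \<open>wcomp\<close> is the coframe of the dz and their conjugates.\<close>

lemma has_derivative_wirtinger: assumes "f differentiable (at z)" shows "(f has_derivative (%v. SS A. wd A f z * wcomp A v)) (at z)"
proof - let ?D = "FD f z"
 have D: "(f has_derivative ?D) (at z)" using assms frechet_derivative_works by blast
 then interpret D: bounded_linear ?D by(rule has_derivative_bounded_linear)
 have "?D v = (SS A. wd A f z * wcomp A v)" for v
 proof - have "v = (SS i. Re (v $ i) *R axis i 1 + Im (v $ i) *R axis i \<i>)"
  proof(rule vec_eq_iff[THEN iffD2], rule allI)
   fix j have "(SS i. Re (v $ i) *R axis i 1 + Im (v $ i) *R axis i \<i>) $ j
    = (SS i. if i = j then complex_of_real (Re (v $ i)) + complex_of_real (Im (v $ i)) * \<i> else 0)"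
    by(simp only: sum_component) (rule sum.cong, auto simp: axis_def complex_eq_iff)
   also have "... = v $ j" by(simp add: complex_eq_iff)
   finally show "v $ j = (SS i. Re (v $ i) *R axis i 1 + Im (v $ i) *R axis i \<i>) $ j" by simp
  qed
  hence "?D v = ?D (SS i. Re (v $ i) *R axis i 1 + Im (v $ i) *R axis i \<i>)" by simp
  also have "... = (SS i. Re (v $ i) *R ?D (axis i 1) + Im (v $ i) *R ?D (axis i \<i>))" by(simp add: D.sum D.add D.scaleR)
  also have "... = (SS i. wd (Inl i) f z * v $ i + wd (Inr i) f z * cnj (v $ i))"
  proof(rule sum.cong)
   fix i have "v $ i = of_real (Re (v $ i)) + \<i> * of_real (Im (v $ i))"
    "cnj (v $ i) = of_real (Re (v $ i)) - \<i> * of_real (Im (v $ i))" by(simp_all add: complex_eq_iff)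
   moreover have "x * a + y * b = (a - \<i> * b) / 2 * (x + \<i> * y) + (a + \<i> * b) / 2 * (x - \<i> * y)" for a b x y
    by(simp add: field_simps)
   ultimately show "Re (v $ i) *R ?D (axis i 1) + Im (v $ i) *R ?D (axis i \<i>) =
    wd (Inl i) f z * v $ i + wd (Inr i) f z * cnj (v $ i)" unfolding wirtinger_def sum.case scaleR_conv_of_real by metis
  qed simp
  finally show ?thesis by(simp add: sum_UNIV_sum sum.distrib)
 qed
 hence "?D = (%v. SS A. wd A f z * wcomp A v)" by blast
 thus ?thesis using D by simp
qed

text \<open>The forms \<open>wcomp A\<close> are linearly independent over the complex numbers, so a
  differential written in them determines its coefficients. The rules below read Wirtinger
  derivatives off in this way.\<close>

lemma wirtinger_eqI: assumes "(f has_derivative (%v. SS A. c A * wcomp A v)) (at z)" shows "wd A f z = c A"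
proof - let ?D = "%v. SS A. c A * wcomp A v"
 have e: "FD f z = ?D" using assms frechet_derivative_at by metis
 have 1: "?D (axis i 1) = c (Inl i) + c (Inr i)" for i by(simp add: sum_UNIV_sum axis_def if_distrib cong: if_cong)
 have 2: "?D (axis i \<i>) = \<i> * c (Inl i) - \<i> * c (Inr i)" for i by(simp add: sum_UNIV_sum axis_def if_distrib cong: if_cong)
 show ?thesis by(cases A) (simp_all add: wirtinger_def e 1 2 field_simps)
qed

text \<open>Where a function is not differentiable, \<open>frechet_derivative\<close> is an
  arbitrary choice, but one that depends only on the predicate \<open>has_derivative\<close>, which
  is local.\<close>

lemma wirtinger_cong: assumes "open S" "z : S" "!!w. w : S ==> f w = g w" shows "wd A f z = wd A g z"
proof - have "FD f z = FD g z"
 proof(cases "f differentiable (at z)")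
  case True thus ?thesis by(rule frechet_derivative_transform_within_open[OF _ assms])
 next case False
  have "(f has_derivative D) (at z) = (g has_derivative D) (at z)" for D
   using has_derivative_transform_within_open[of f D z UNIV S g, OF _ assms(1,2)]
    has_derivative_transform_within_open[of g D z UNIV S f, OF _ assms(1,2)] assms(3) by auto
  thus ?thesis by(simp add: frechet_derivative_def)
 qed
 thus ?thesis by(cases A) (simp_all add: wirtinger_def)
qed

lemma wirtinger_const [simp]: "wd A (%_. c) z = 0" by(cases A) (simp_all add: wirtinger_def)

lemma wirtinger_add: assumes "f differentiable (at z)" "g differentiable (at z)" shows "wd A (%z. f z + g z) z = wd A f z + wd A g z"
 by(rule wirtinger_eqI[where c = "%A. wd A f z + wd A g z"], rule has_derivative_eq_rhs,
   rule has_derivative_add[OF assms[THEN has_derivative_wirtinger]]) (auto simp: fun_eq_iff algebra_simps sum.distrib)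

lemma wirtinger_mult: assumes "f differentiable (at z)" "g differentiable (at z)"
 shows "wd A (%z. f z * g z) z = wd A f z * g z + f z * wd A g z"
 by(rule wirtinger_eqI[where c = "%A. wd A f z * g z + f z * wd A g z"], rule has_derivative_eq_rhs,
   rule has_derivative_mult[OF assms[THEN has_derivative_wirtinger]]) (auto simp: fun_eq_iff algebra_simps sum.distrib sum_distrib_left)

lemma wirtinger_cmult: assumes "f differentiable (at z)"
 shows "wd A (%z. c * f z) z = c * wd A f z" using wirtinger_mult[OF differentiable_const assms] by simp

lemma wirtinger_uminus: assumes "f differentiable (at z)"
 shows "wd A (%z. - f z) z = - wd A f z" using wirtinger_cmult[OF assms, of A "-1"] by simp

lemma wirtinger_diff: assumes "f differentiable (at z)" "g differentiable (at z)" shows "wd A (%z. f z - g z) z = wd A f z - wd A g z"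
 using wirtinger_add[of f z "%z. - g z"] assms wirtinger_uminus[of g z] differentiable_minus by fastforce

lemma wirtinger_sum: assumes "!!i. i : I ==> f i differentiable (at z)"
 shows "wd A (%z. SUM i:I. f i z) z = (SUM i:I. wd A (f i) z)" using assms
proof(induction I rule: fin_induct)
 case (insert i I) thus ?case by(simp add: wirtinger_add)
qed simp_all

definition conj_index :: "'n + 'n => 'n + 'n" where "conj_index = case_sum Inr Inl"

lemma conj_index_simps [simp]: "conj_index (Inl i) = Inr i" "conj_index (Inr i) = Inl i" "conj_index (conj_index A) = A"
 by(simp_all add: conj_index_def split: sum.split)

lemma wirtinger_cnj: assumes "f differentiable (at z)" shows "wd A (%z. cnj (f z)) z = cnj (wd (conj_index A) f z)"
 by(rule wirtinger_eqI[where c = "%A. cnj (wd (conj_index A) f z)"], rule has_derivative_eq_rhs,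
   rule bounded_linear.has_derivative[OF bounded_linear_cnj has_derivative_wirtinger[OF assms]])
  (auto simp: fun_eq_iff sum_UNIV_sum add.commute)

lemma wirtinger_component [simp]: "wd A (%z. z $ i) z = (if A = Inl i then 1 else 0)"
 by(rule wirtinger_eqI[where c = "%A. if A = Inl i then 1 else 0"], rule has_derivative_eq_rhs,
   rule bounded_linear_imp_has_derivative[OF bounded_linear_vec_nth])
  (auto simp: fun_eq_iff sum_UNIV_sum if_distrib[of "%x. x * _"] cong: if_cong)

lemma wirtinger_inverse: assumes "f differentiable (at z)" "f z ~= 0"
 shows "wd A (%z. inverse (f z)) z = - (inverse (f z) * wd A f z * inverse (f z))"
 by(rule wirtinger_eqI[where c = "%A. - (inverse (f z) * wd A f z * inverse (f z))"], rule has_derivative_eq_rhs,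
   rule Deriv.has_derivative_inverse[OF assms(2) has_derivative_wirtinger[OF assms(1)]])
  (auto simp: fun_eq_iff sum_distrib_left sum_distrib_right sum_negf algebra_simps)

lemma has_derivative_vec_componentwise: fixes \<phi> :: "'b::real_normed_vector => complex^'n"
 assumes "!!i. ((%z. \<phi> z $ i) has_derivative (%v. D v $ i)) (at z)"
 shows "(\<phi> has_derivative D) (at z)" using assms has_derivative_componentwise_within[of \<phi> D z UNIV]
  bounded_linear.has_derivative[OF bounded_linear_inner_left]
proof - have "((%x. \<phi> x \<bullet> b) has_derivative (%x. D x \<bullet> b)) (at z)" if b0: "b : Basis" for b
 proof - obtain u i where b: "b = axis i u" using b0 by(auto simp: Basis_vec_def)
  show ?thesis using bounded_linear.has_derivative[OF bounded_linear_inner_left assms[of i], of u] by(simp add: b inner_axis)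
 qed
 thus ?thesis using has_derivative_componentwise_within[of \<phi> D z UNIV] by simp
qed

lemma has_derivative_wirtinger_compose: fixes \<phi> :: "'a::real_normed_vector => complex^'n"
 assumes f: "f differentiable (at (\<phi> z))" and \<phi>: "!!i. ((%z. \<phi> z $ i) has_derivative (%v. D v $ i)) (at z)"
 shows "((%z. f (\<phi> z)) has_derivative (%v. SS A. wd A f (\<phi> z) * wcomp A (D v))) (at z)"
 using has_derivative_compose[OF has_derivative_vec_componentwise[OF \<phi>] has_derivative_wirtinger[OF f]] .

definition jac :: "(complex^'m => complex^'n) => 'n + 'n => 'm + 'm => complex^'m => complex" where
 "jac \<phi> B A = wd A (%w. wcomp B (\<phi> w))"

lemma wirtinger_compose: fixes \<phi> :: "complex^'m => complex^'n"
 assumes f: "f differentiable (at (\<phi> z))" and \<phi>: "!!i. (%z. \<phi> z $ i) differentiable (at z)"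
 shows "(%z. f (\<phi> z)) differentiable (at z)" and "wd A (%z. f (\<phi> z)) z = (SS B. wd B f (\<phi> z) * jac \<phi> B A z)"
proof - define D where "D v = (\<chi> i. SS A. wd A (%z. \<phi> z $ i) z * wcomp A v)" for v
 have w: "wcomp B (D v) = (SS A. jac \<phi> B A z * wcomp A v)" for B v
 proof(cases B)
  case (Inr j) have "jac \<phi> B A z = cnj (wd (conj_index A) (%z. \<phi> z $ j) z)" for A
   unfolding jac_def Inr wcomp_simps by(rule wirtinger_cnj[OF \<phi>])
  thus ?thesis by(simp add: Inr D_def sum_UNIV_sum add.commute)
 qed (simp add: D_def jac_def)
 have *: "((%z. f (\<phi> z)) has_derivative (%v. SS A. wd A f (\<phi> z) * wcomp A (D v))) (at z)"
  by(rule has_derivative_wirtinger_compose[of f \<phi> z D, OF f])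
   (use has_derivative_wirtinger[OF \<phi>] in \<open>simp add: D_def\<close>)
 thus "(%z. f (\<phi> z)) differentiable (at z)" by(auto simp: differentiable_def)
 have "((%z. f (\<phi> z)) has_derivative (%v. SS A. (SS B. wd B f (\<phi> z) * jac \<phi> B A z) * wcomp A v)) (at z)"
  by(rule has_derivative_eq_rhs[OF *], rule ext, simp add: w sum_distrib_left sum_distrib_right mult.assoc, rule sum.swap)
 thus "wd A (%z. f (\<phi> z)) z = (SS B. wd B f (\<phi> z) * jac \<phi> B A z)" by(rule wirtinger_eqI)
qed

lemma smooth_on_wcomp [smooth_intros]:
 "open S ==> smooth_on S (%z. \<phi> z $ i) ==> (!!i. smooth_on S (%z. \<phi> z $ i)) ==> smooth_on S (%z. wcomp A (\<phi> z))"
 by(cases A) (auto intro: smooth_intros)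

text \<open>A class of differentiable functions whose derivatives are again combinations of members
  with smooth coefficients consists of smooth functions: induct on k. The sums run over sets of
  naturals because the index type cannot be quantified inside the assumption.\<close>

lemma smooth_on_coinduct: assumes S: "open S" and X: "X f" and d: "!!f z. X f ==> z : S ==> f differentiable (at z)"
  and w: "!!f A. X f ==> EX I::nat set. EX c g. finite I & (ALL i:I. smooth_on S (c i) & X (g i)) &
   (ALL z:S. wd A f z = (SUM i:I. c i z * g i z))" shows "smooth_on S f" unfolding smooth_on_def
proof
 fix k show "Ck_on k S f" using X
 proof(induction k arbitrary: f)
  case 0 thus ?case using d by(auto intro!: continuous_at_imp_continuous_on differentiable_imp_continuous_within)
 next case (Suc k)
  have sum: "Ck_on k S (%z. SUM i:I. h i z)" if "finite I" "!!i. i : I ==> Ck_on k S (h i)" for I :: "'b set" and h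
   using that by(induction I rule: finite_induct) (auto intro: Ck_on_const Ck_on_add S)
  have "Ck_on k S (wd A f)" for A
  proof - obtain I :: "nat set" and c g where "finite I" and i: "ALL i:I. smooth_on S (c i) & X (g i)"
    and e: "ALL z:S. wd A f z = (SUM i:I. c i z * g i z)" using w[OF Suc.prems, of A] by(elim exE conjE) (rule that, assumption+)
   have "Ck_on k S (%z. SUM i:I. c i z * g i z)"
    by(rule sum[OF `finite I`]) (use i Suc.IH S in \<open>auto simp: smooth_on_def intro: Ck_on_mult\<close>)
   thus ?thesis by(rule Ck_on_cong[OF S]) (use e in auto)
  qed
  hence *: "Ck_on k S (%z. SS A. wd A f z * wcomp A v)" for v by(intro sum Ck_on_mult Ck_on_const S) auto
  show ?case by(rule Ck_on_SucI[OF S has_derivative_wirtinger *]) (use d Suc.prems in auto)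
 qed
qed

text \<open>The composites with a fixed \<phi> form a class as in \<open>smooth_on_coinduct\<close>;
  the coefficients are the entries of the Jacobian.\<close>

lemma smooth_on_compose: fixes \<phi> :: "complex^'m => complex^'n"
 assumes S: "open S" and T: "open T" and f: "smooth_on T f" and \<phi>: "!!i. smooth_on S (%z. \<phi> z $ i)"
  and m: "!!z. z : S ==> \<phi> z : T" shows "smooth_on S (%z. f (\<phi> z))"
proof(rule smooth_on_coinduct[OF S, where X = "%h. EX g. smooth_on T g & h = (%z. g (\<phi> z))"])
 show "EX g. smooth_on T g & (%z. f (\<phi> z)) = (%z. g (\<phi> z))" by(intro exI[of _ f] conjI f refl)
next fix h z assume "EX g. smooth_on T g & h = (%z. g (\<phi> z))" "z : S"
 then obtain g where "smooth_on T g" "h = (%z. g (\<phi> z))" by blast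
 thus "h differentiable (at z)" using wirtinger_compose(1)[of g \<phi> z] smooth_on_deriv[of T g "\<phi> z"]
   smooth_on_deriv[OF \<phi> `z : S`] m[OF `z : S`] by simp
next fix h :: "complex^'m => complex" and A
 assume "EX g. smooth_on T g & h = (%z. g (\<phi> z))" then obtain g where g: "smooth_on T g" "h = (%z. g (\<phi> z))" by blast
 \<comment> \<open>An encoding of the frame indices as naturals, as the coinduction rule wants
   them.\<close>
 obtain e :: "'n + 'n => nat" where e: "inj e" using finite_imp_inj_to_nat_seg[of "UNIV::('n+'n) set"] by auto
 show "EX I::nat set. EX c g. finite I & (ALL i:I. smooth_on S (c i) & (EX k. smooth_on T k & g i = (%z. k (\<phi> z)))) &
   (ALL z:S. wd A h z = (SUM i:I. c i z * g i z))"
 proof(intro exI conjI ballI)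
  fix z assume "z : S" hence "wd A h z = (SS B. wd B g (\<phi> z) * jac \<phi> B A z)"
   unfolding g(2) using wirtinger_compose(2)[of g \<phi> z] smooth_on_deriv[OF g(1) m[OF `z : S`]]
   smooth_on_deriv[OF \<phi> `z : S`] by simp
  also have "... = (SUM i:range e. jac \<phi> (inv e i) A z * wd (inv e i) g (\<phi> z))"
   by(subst sum.reindex[OF e]) (simp add: e mult.commute)
  finally show "wd A h z = (SUM i:range e. jac \<phi> (inv e i) A z * wd (inv e i) g (\<phi> z))" .
 next fix i show "smooth_on S (jac \<phi> (inv e i) A)" unfolding jac_def by(intro smooth_intros S \<phi>)
  show "smooth_on T (wd (inv e i) g)" by(intro smooth_intros T g)
 qed auto
qed

subsection \<open>Symmetry of second derivatives\<close>

text \<open>Write \<open>G\<close> as the integral of its s-derivative, differentiate under the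
  integral sign in t, and then recover the integrand by differentiating in the upper limit
  s.\<close>

lemma C1_plane_mixed: fixes G :: "real => real => complex" assumes e: "0 < e"
  and s: "!!s t. \<bar>s\<bar> < e ==> \<bar>t\<bar> < e ==> ((%s. G s t) has_vector_derivative Gs s t) (at s)"
  and t: "!!s t. \<bar>s\<bar> < e ==> \<bar>t\<bar> < e ==> ((%t. G s t) has_vector_derivative Gt s t) (at t)"
  and st: "!!s t. \<bar>s\<bar> < e ==> \<bar>t\<bar> < e ==> ((%t. Gs s t) has_vector_derivative Gst s t) (at t)"
  and ts: "!!s t. \<bar>s\<bar> < e ==> \<bar>t\<bar> < e ==> ((%s. Gt s t) has_vector_derivative Gts s t) (at s)"
  and c1: "continuous_on ({-e<..<e} \<times> {-e<..<e}) (%(s, t). Gst s t)"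
  and c0: "continuous_on ({-e<..<e} \<times> {-e<..<e}) (%(s, t). Gs s t)" shows "Gts 0 0 = Gst 0 0"
proof - define U where "U = {-e<..<e}"
 have U: "convex U" "open U" "0 : U" "!!x. x : U \<longleftrightarrow> \<bar>x\<bar> < e" by(auto simp: U_def e)
 define a where "a = e/2" have a: "0 < a" "a < e" using e by(auto simp: a_def)
 have I: "G s t - G (-a) t = integral {-a..s} (%r. Gs r t)" if "\<bar>t\<bar> < e" "-a <= s" "s <= a" for s t
 proof - have "((%r. Gs r t) has_integral (G s t - G (-a) t)) {-a..s}"
   by(rule fundamental_theorem_of_calculus) (use that a s in \<open>auto intro: has_vector_derivative_at_within\<close>)
  thus ?thesis by(simp add: integral_unique)
 qed
 have cU: "continuous_on (U \<times> cbox (-a) s) (%(t, r). Gst r t)" "continuous_on (U \<times> cbox (-a) s) (%(t, r). Gs r t)"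
  if "s <= a" for s using continuous_on_compose2[OF c1 continuous_on_swap, of "U \<times> cbox (-a) s"]
   continuous_on_compose2[OF c0 continuous_on_swap, of "U \<times> cbox (-a) s"] that a
  by(auto simp: U_def case_prod_beta prod.swap_def image_subset_iff)
 have J: "Gt s 0 - Gt (-a) 0 = integral {-a..s} (%r. Gst r 0)" if "-a <= s" "s <= a" for s
 proof - have "((%t. integral (cbox (-a) s) (%r. Gs r t)) has_vector_derivative integral (cbox (-a) s) (%r. Gst r 0)) (at 0 within U)"
  proof(rule leibniz_rule_vector_derivative[OF _ _ cU(1) U(3,1)])
   fix t assume "t : U" thus "(%r. Gs r t) integrable_on cbox (-a) s"
    by(intro integrable_continuous continuous_on_compose2[OF cU(2), of s _ "%r. (t, r)", simplified])
     (auto intro!: continuous_intros simp: that)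
  qed (use st U that a in \<open>auto intro: has_vector_derivative_at_within\<close>)
  hence 1: "((%t. integral {-a..s} (%r. Gs r t)) has_vector_derivative integral {-a..s} (%r. Gst r 0)) (at 0)"
   using U at_within_open[of 0 U] by simp
  have "((%t. G s t - G (-a) t) has_vector_derivative integral {-a..s} (%r. Gst r 0)) (at 0)"
   by(rule has_vector_derivative_transform_within_open[OF 1 U(2,3)]) (use I that U in auto)
  moreover have "((%t. G s t - G (-a) t) has_vector_derivative Gt s 0 - Gt (-a) 0) (at 0)"
   using that a e by(intro has_vector_derivative_diff t) auto
  ultimately show ?thesis using vector_derivative_unique_at by blast
 qed
 have "continuous_on {-a..a} (%r. Gst r 0)"
  by(rule continuous_on_compose2[OF c1, of _ "%r. (r, 0)", simplified]) (use a in \<open>auto intro!: continuous_intros\<close>)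
 from integral_has_vector_derivative[OF this, of 0] a
 have 1: "((%s. integral {-a..s} (%r. Gst r 0)) has_vector_derivative Gst 0 0) (at 0 within {-a..a})" by auto
 have 2: "((%s. integral {-a..s} (%r. Gst r 0)) has_vector_derivative Gst 0 0) (at 0)" using 1 a by(simp add: at_within_Icc_at)
 have "((%s. Gt s 0 - Gt (-a) 0) has_vector_derivative Gst 0 0) (at 0)"
  by(rule has_vector_derivative_transform_within_open[OF 2, of "{-a<..<a}"]) (use J a in auto)
 moreover have "((%s. Gt s 0 - Gt (-a) 0) has_vector_derivative Gts 0 0 - 0) (at 0)"
  by(intro has_vector_derivative_diff ts has_vector_derivative_const) (use e in auto)
 ultimately show ?thesis using vector_derivative_unique_at by fastforce
qed

text \<open>Restrict to the affine real plane through \<open>z\<close> spanned by \<open>u\<close>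
  and \<open>v\<close> and apply \<open>C1_plane_mixed\<close>.\<close>

lemma frechet_derivative_symmetric: fixes f :: "complex^'n => complex" assumes S: "open S" and f: "smooth_on S f" and z: "z : S"
 shows "FD (%z. FD f z u) z v = FD (%z. FD f z v) z u"
proof - define p where "p s t = z + s *R u + t *R v" for s t
 have pc: "continuous_on X (%(s, t). p s t)" for X unfolding p_def case_prod_beta by(intro continuous_intros)
 have "open ((%(s, t). p s t) -` S)" using open_vimage[OF S pc[of UNIV]] .
 moreover have "(0, 0) : (%(s, t). p s t) -` S" by(simp add: p_def z)
 ultimately obtain A B where AB: "open A" "open B" "0 : A" "0 : B" "A \<times> B \<subseteq> (%(s, t). p s t) -` S"
  by(auto elim!: open_prod_elim)
 obtain e1 where e1: "e1 > 0" "ball 0 e1 \<subseteq> A" using AB openE by blast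
 obtain e2 where e2: "e2 > 0" "ball 0 e2 \<subseteq> B" using AB openE by blast define e where "e = min e1 e2"
 have e: "0 < e" and pS: "p s t : S" if "\<bar>s\<bar> < e" "\<bar>t\<bar> < e" for s t
 proof - have "(s, t) : A \<times> B" using that e1 e2 by(auto simp: e_def)
  thus "p s t : S" using AB(5) by auto
  show "0 < e" using e1 e2 by(simp add: e_def)
 qed
 have e0: "0 < e" using e1 e2 by(simp add: e_def)
 have p1: "((%s. p s t) has_derivative (%h. h *R u)) (at s)" for s t unfolding p_def by(auto intro!: derivative_eq_intros)
 have p2: "((%t. p s t) has_derivative (%h. h *R v)) (at t)" for s t unfolding p_def by(auto intro!: derivative_eq_intros)
 have d1: "((%s. g (p s t)) has_vector_derivative FD g (p s t) u) (at s)"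
  and d2: "((%t. g (p s t)) has_vector_derivative FD g (p s t) v) (at t)"
  if "smooth_on S g" "\<bar>s\<bar> < e" "\<bar>t\<bar> < e" for g :: "complex^'n => complex" and s t
 proof - have g: "(g has_derivative FD g (p s t)) (at (p s t))"
   using smooth_on_deriv[OF that(1) pS[OF that(2,3)]] frechet_derivative_works by blast
  hence l: "linear (FD g (p s t))" by(rule has_derivative_linear)
  show "((%s. g (p s t)) has_vector_derivative FD g (p s t) u) (at s)"
   unfolding has_vector_derivative_def using has_derivative_compose[OF p1 g] by(simp add: linear_cmul[OF l])
  show "((%t. g (p s t)) has_vector_derivative FD g (p s t) v) (at t)"
   unfolding has_vector_derivative_def using has_derivative_compose[OF p2 g] by(simp add: linear_cmul[OF l])
 qed
 have sub: "(%x. p (fst x) (snd x)) ` ({-e<..<e} \<times> {-e<..<e}) \<subseteq> S" using pS by auto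
 have c: "continuous_on ({-e<..<e} \<times> {-e<..<e}) (%(s, t). g (p s t))" if "smooth_on S g" for g :: "complex^'n => complex"
  using continuous_on_compose2[OF smooth_on_continuous[OF that] pc, of "{-e<..<e} \<times> {-e<..<e}"] sub by(simp add: case_prod_beta)
 have "FD (%z. FD f z v) (p 0 0) u = FD (%z. FD f z u) (p 0 0) v"
  by(rule C1_plane_mixed[OF e0 d1[OF f] d2[OF f] d2[OF smooth_on_frechet[OF f]] d1[OF smooth_on_frechet[OF f]]
    c[OF smooth_on_frechet[OF smooth_on_frechet[OF f]]] c[OF smooth_on_frechet[OF f]]])
 thus ?thesis by(simp add: p_def)
qed

text \<open>A form common to both kinds of indices, so that the symmetry of second derivatives is
  expanded only once.\<close>

lemma wirtinger_as_frechet: "EX a b u v. ALL f z. wd A f z = a * FD f z u + b * FD f z v"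
proof(cases A)
 case (Inl i) show ?thesis by(rule exI[of _ "1/2"], rule exI[of _ "-\<i>/2"], rule exI[of _ "axis i 1"], rule exI[of _ "axis i \<i>"])
   (simp add: Inl wirtinger_def field_simps)
next case (Inr i)
 show ?thesis by(rule exI[of _ "1/2"], rule exI[of _ "\<i>/2"], rule exI[of _ "axis i 1"], rule exI[of _ "axis i \<i>"])
   (simp add: Inr wirtinger_def field_simps)
qed

lemma wirtinger_commute: assumes S: "open S" and f: "smooth_on S f" and z: "z : S" shows "wd A (wd B f) z = wd B (wd A f) z"
proof - obtain a b u v where 1: "!!f z. wd A f z = a * FD f z u + b * FD f z v" using wirtinger_as_frechet[of A] by blast
 obtain a' b' u' v' where 2: "!!f z. wd B f z = a' * FD f z u' + b' * FD f z v'" using wirtinger_as_frechet[of B] by blast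
 have lin: "FD (%z. c * FD f z x + d * FD f z y) z w = c * FD (%z. FD f z x) z w + d * FD (%z. FD f z y) z w" for c d x y w
 proof - have D: "((%z. FD f z x) has_derivative FD (%z. FD f z x) z) (at z)" for x
   using smooth_on_deriv[OF smooth_on_frechet[OF f] z] frechet_derivative_works by blast
  show ?thesis
   by(subst frechet_derivative_at[OF has_derivative_add[OF has_derivative_mult_right[OF D] has_derivative_mult_right[OF D]], symmetric]) simp
 qed
 have 3: "wd A f = (%z. a * FD f z u + b * FD f z v)" "wd B f = (%z. a' * FD f z u' + b' * FD f z v')" using 1 2 by auto
 show ?thesis unfolding 1[of "wd B f"] 2[of "wd A f"] unfolding 3
  by(simp add: lin frechet_derivative_symmetric[OF S f z, of u u'] frechet_derivative_symmetric[OF S f z, of u v']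
    frechet_derivative_symmetric[OF S f z, of v u'] frechet_derivative_symmetric[OF S f z, of v v'] algebra_simps)
qed

subsection \<open>Parameter integrals\<close>

text \<open>The shape is stable under differentiation in \<open>z\<close>, which only multiplies the
  weight \<open>w\<close> by \<open>s\<close>. It covers circle integrals, the Cauchy transform in
  polar coordinates, and the radial homotopy.\<close>

definition param_int :: "'e::euclidean_space set => ('e => real) => ('e => complex^'n) => ('e => complex)
  => (complex^'n => complex) => complex^'n => complex" where
 "param_int K s \<tau> w F z = integral K (%t. w t * F (s t *R z + \<tau> t))"

lemma norm_axis: "norm (axis i x) = norm x"
 by(simp add: norm_vec_def L2_set_def axis_def if_distrib[of "%x. (norm x)\<^sup>2"] cong: if_cong)

lemma wcomp_scaleR: "wcomp A (r *R v) = of_real r * wcomp A v" by(cases A) (simp_all add: complex_eq_iff)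

lemma bounded_linear_axis: "bounded_linear (axis i :: complex => complex^'n)"
proof(rule bounded_linear_intro[where K = 1])
 show "norm (axis i x :: complex^'n) <= norm x * 1" for x :: complex by(simp add: norm_axis)
qed (auto simp: vec_eq_iff axis_def)

lemma bounded_linear_wcomp: "bounded_linear (wcomp A)"
proof(cases A)
 case (Inl i) thus ?thesis by(auto simp: wcomp_def[abs_def] intro: bounded_linear_vec_nth)
next case (Inr i)
 thus ?thesis by(auto simp: wcomp_def[abs_def] intro: bounded_linear_compose[OF bounded_linear_cnj bounded_linear_vec_nth])
qed

locale param_integral = fixes a b :: "'e::euclidean_space" and s :: "'e => real" and \<tau> :: "'e => complex^'n"
  and V T :: "(complex^'n) set" assumes s: "continuous_on (cbox a b) s" and \<tau>: "continuous_on (cbox a b) \<tau>"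
  and V: "open V" and T: "open T" and m: "!!z t. z : V ==> t : cbox a b ==> s t *R z + \<tau> t : T" begin

lemma continuous_integrand: fixes F :: "complex^'n => complex" assumes w: "continuous_on (cbox a b) w" and F: "continuous_on T F"
 shows "continuous_on (V \<times> cbox a b) (%(z, t). w t * F (s t *R z + \<tau> t))"
proof - have 1: "continuous_on (V \<times> cbox a b) (%p. w (snd p))" "continuous_on (V \<times> cbox a b) (%p. s (snd p))"
  "continuous_on (V \<times> cbox a b) (%p. \<tau> (snd p))"
  by(rule continuous_on_compose2[OF w] continuous_on_compose2[OF s] continuous_on_compose2[OF \<tau>], auto intro: continuous_intros)+
 have "continuous_on (V \<times> cbox a b) (%p. F (s (snd p) *R fst p + \<tau> (snd p)))"
  by(rule continuous_on_compose2[OF F]) (use m 1 in \<open>auto intro!: continuous_intros\<close>)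
 thus ?thesis using 1 by(auto simp: case_prod_beta intro!: continuous_intros)
qed

lemma continuous_param_int: assumes "continuous_on (cbox a b) w" "continuous_on T F"
 shows "continuous_on V (param_int (cbox a b) s \<tau> w F)" unfolding param_int_def[abs_def]
 by(rule integral_continuous_on_param[OF continuous_integrand[OF assms]])

lemma integrable_integrand: fixes F :: "complex^'n => complex" assumes "continuous_on (cbox a b) w" "continuous_on T F" "z : V"
 shows "(%t. w t * F (s t *R z + \<tau> t)) integrable_on cbox a b"
proof(rule integrable_continuous)
 have "continuous_on (cbox a b) (%t. (z, t))" by(intro continuous_intros)
 from continuous_on_compose2[OF continuous_integrand[OF assms(1,2)] this] assms(3)
 show "continuous_on (cbox a b) (%t. w t * F (s t *R z + \<tau> t))" by auto
qed

text \<open>Differentiation under the integral sign; continuity of the Wirtinger derivatives of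
  \<open>F\<close> on \<open>T\<close> is what makes the differential jointly continuous.\<close>

lemma assumes w: "continuous_on (cbox a b) w" and F: "!!z. z : T ==> F differentiable (at z)"
  and F': "!!A. continuous_on T (wd A F)" and z: "z : V"
 shows differentiable_param_int: "param_int (cbox a b) s \<tau> w F differentiable (at z)"
  and wirtinger_param_int: "wd A (param_int (cbox a b) s \<tau> w F) z = param_int (cbox a b) s \<tau> (%t. w t * s t) (wd A F) z"
proof - have cF: "continuous_on T F" using F by(auto intro!: continuous_at_imp_continuous_on differentiable_imp_continuous_within)
 have cws: "continuous_on (cbox a b) (%t. w t * s t)" using w s by(auto intro!: continuous_intros)
 obtain e where e: "e > 0" "ball z e \<subseteq> V" using V z openE by blast
 define W where "W A = Blinfun (wcomp A :: complex^'n => complex)" for A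
 have W: "blinfun_apply (W A) = wcomp A" for A unfolding W_def by(rule bounded_linear_Blinfun_apply[OF bounded_linear_wcomp])
 define c where "c A x t = w t * s t * wd A F (s t *R x + \<tau> t)" for A x t
 \<comment> \<open>The differential of the integrand as an element of the space of bounded linear
   maps, the form in which \<open>leibniz_rule\<close> takes it.\<close>
 define fx where "fx x t = (SS A. blinfun_mult_right (c A x t) o\<^sub>L W A)" for x t
 have fx: "blinfun_apply (fx x t) v = (SS A. c A x t * wcomp A v)" for x t v by(simp add: fx_def blinfun.sum_left W)
 have cc: "continuous_on (ball z e \<times> cbox a b) (%(x, t). c A x t)" for A
  unfolding c_def by(rule continuous_on_subset[OF continuous_integrand[OF cws F']]) (use e in auto)
 have cfx: "continuous_on (ball z e \<times> cbox a b) (%(x, t). fx x t)" unfolding fx_def case_prod_beta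
  by(intro continuous_on_sum bounded_bilinear.continuous_on[OF bounded_bilinear_blinfun_compose] continuous_intros
    bounded_linear.continuous_on[OF bounded_linear_blinfun_mult_right] cc[unfolded case_prod_beta])
 have "((%x. integral (cbox a b) (%t. w t * F (s t *R x + \<tau> t))) has_derivative integral (cbox a b) (fx z)) (at z within ball z e)"
 proof(rule leibniz_rule[OF _ _ cfx])
  fix x t assume xt: "x : ball z e" "t : cbox a b" hence "x : V" using e by auto
  have "((%x. s t *R x + \<tau> t) has_derivative (%v. s t *R v)) (at x)" by(auto intro!: derivative_eq_intros)
  from has_derivative_compose[OF this has_derivative_wirtinger[OF F[OF m[OF `x : V` xt(2)]]]]
  have "((%x. w t * F (s t *R x + \<tau> t)) has_derivative
    (%v. w t * (SS A. wd A F (s t *R x + \<tau> t) * wcomp A (s t *R v)))) (at x)" by(rule has_derivative_mult_right)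
  hence "((%x. w t * F (s t *R x + \<tau> t)) has_derivative blinfun_apply (fx x t)) (at x)"
   by(rule has_derivative_eq_rhs) (simp add: fun_eq_iff fx c_def sum_distrib_left wcomp_scaleR mult_ac)
  thus "((%x. w t * F (s t *R x + \<tau> t)) has_derivative blinfun_apply (fx x t)) (at x within ball z e)"
   by(rule has_derivative_at_withinI)
 next fix x assume "x : ball z e"
  thus "(%t. w t * F (s t *R x + \<tau> t)) integrable_on cbox a b" using integrable_integrand[OF w cF] e by auto
 qed (use e in auto)
 hence D: "(param_int (cbox a b) s \<tau> w F has_derivative integral (cbox a b) (fx z)) (at z)"
  unfolding param_int_def[abs_def] using e at_within_open[of z "ball z e"] by simp
 thus "param_int (cbox a b) s \<tau> w F differentiable (at z)" unfolding differentiable_def by blast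
 have int_fx: "fx z integrable_on cbox a b"
 proof(rule integrable_continuous)
  have "continuous_on (cbox a b) (%t. (z, t))" by(intro continuous_intros)
  moreover have "Pair z ` cbox a b \<subseteq> ball z e \<times> cbox a b" using e by auto
  ultimately show "continuous_on (cbox a b) (fx z)" using continuous_on_compose2[OF cfx] by fastforce
 qed
 have "integral (cbox a b) (fx z) v = (SS A. param_int (cbox a b) s \<tau> (%t. w t * s t) (wd A F) z * wcomp A v)" for v
 proof - have "integral (cbox a b) (fx z) v = integral (cbox a b) (%t. fx z t v)"
   using integral_linear[OF int_fx blinfun.bounded_linear_left[of v]] by(simp add: o_def)
  also have "... = (SS A. integral (cbox a b) (%t. c A z t * wcomp A v))" unfolding fx
  proof(rule integral_sum)
   fix A show "(%t. c A z t * wcomp A v) integrable_on cbox a b"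
    unfolding c_def using integrable_integrand[OF cws F' z] by(rule integrable_on_mult_left)
  qed simp
  finally show ?thesis by(simp add: c_def param_int_def)
 qed
 hence e: "blinfun_apply (integral (cbox a b) (fx z)) =
   (%v. SS A. param_int (cbox a b) s \<tau> (%t. w t * s t) (wd A F) z * wcomp A v)" by blast
 from D have "(param_int (cbox a b) s \<tau> w F has_derivative
   (%v. SS A. param_int (cbox a b) s \<tau> (%t. w t * s t) (wd A F) z * wcomp A v)) (at z)" unfolding e .
 thus "wd A (param_int (cbox a b) s \<tau> w F) z = param_int (cbox a b) s \<tau> (%t. w t * s t) (wd A F) z" by(rule wirtinger_eqI)
qed

lemma smooth_on_param_int: assumes w: "continuous_on (cbox a b) w" and F: "smooth_on T F"
 shows "smooth_on V (param_int (cbox a b) s \<tau> w F)"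
proof(rule smooth_on_coinduct[OF V, where X = "%h. EX w F. continuous_on (cbox a b) w & smooth_on T F & h = param_int (cbox a b) s \<tau> w F"])
 show "EX w' F'. continuous_on (cbox a b) w' & smooth_on T F' & param_int (cbox a b) s \<tau> w F = param_int (cbox a b) s \<tau> w' F'"
  using w F by blast
next fix h z assume "EX w F. continuous_on (cbox a b) w & smooth_on T F & h = param_int (cbox a b) s \<tau> w F" "z : V"
 thus "h differentiable (at z)" using differentiable_param_int smooth_on_deriv smooth_on_continuous smooth_on_wirtinger T by metis
next fix h A assume "EX w F. continuous_on (cbox a b) w & smooth_on T F & h = param_int (cbox a b) s \<tau> w F"
 then obtain w F where w: "continuous_on (cbox a b) w" "smooth_on T F" "h = param_int (cbox a b) s \<tau> w F" by blast
 have c: "continuous_on (cbox a b) (%t. w t * s t)" using w s by(auto intro!: continuous_intros)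
 show "EX I::nat set. EX c g. finite I & (ALL i:I. smooth_on V (c i) &
   (EX w F. continuous_on (cbox a b) w & smooth_on T F & g i = param_int (cbox a b) s \<tau> w F)) &
   (ALL z:V. wd A h z = (SUM i:I. c i z * g i z))"
 proof(intro exI conjI ballI)
  fix z assume "z : V" thus "wd A h z = (SUM i:{0}. 1 * param_int (cbox a b) s \<tau> (%t. w t * s t) (wd A F) z)"
   using wirtinger_param_int[OF w(1)] smooth_on_deriv[OF w(2)]
    smooth_on_continuous[OF smooth_on_wirtinger[OF T w(2)]] by(simp add: w(3))
 qed (auto intro!: smooth_intros V T w c)
qed

end

subsection \<open>Holomorphic functions are smooth\<close>

lemma holo_on_iff: "holo_on S f \<longleftrightarrow> (ALL z:S. f differentiable (at z) & (ALL j. wd (Inr j) f z = 0))"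
proof(intro iffI ballI)
 fix z assume "holo_on S f" "z : S"
 then obtain D where D: "(f has_derivative D) (at z)" "!!a v. D (a *s v) = a * D v" by(auto simp: holo_on_def)
 have e: "FD f z = D" using frechet_derivative_at[OF D(1)] by simp
 have "axis j \<i> = \<i> *s (axis j 1 :: complex^'a)" for j by(simp add: vec_eq_iff axis_def)
 hence "wd (Inr j) f z = 0" for j by(simp add: wirtinger_def e D(2))
 thus "f differentiable (at z) & (ALL j. wd (Inr j) f z = 0)" using D(1) differentiable_def by blast
next assume *: "ALL z:S. f differentiable (at z) & (ALL j. wd (Inr j) f z = 0)"
 show "holo_on S f" unfolding holo_on_def
 proof
  fix z assume "z : S" hence f: "f differentiable (at z)" "!!j. wd (Inr j) f z = 0" using * by auto
  show "EX D. (f has_derivative D) (at z) & (ALL a v. D (a *s v) = a * D v)"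
   by(rule exI, rule conjI, rule has_derivative_wirtinger[OF f(1)]) (simp add: sum_UNIV_sum f(2) sum_distrib_left mult_ac)
 qed
qed

text \<open>Cauchy's formula for the first derivative on a small circle in direction i. It expresses
  the partial derivative through \<open>f\<close> alone, which is how regularity of the derivative
  is gained from mere differentiability.\<close>

lemma holo_partial_integral: assumes S: "open S" and f: "holo_on S f" and z0: "z0 : S" obtains r where "r > 0"
  "!!z t. z : ball z0 r ==> 1 *R z + axis i (circ r t) : S" "!!z. z : ball z0 r ==> wd (Inl i) f z =
   param_int (cbox 0 1) (%_. 1) (%t::real. axis i (circ r t)) (%t. inverse (circ r t)) f z"
proof - obtain e where e: "e > 0" "ball z0 e \<subseteq> S" using S z0 openE by blast
 \<comment> \<open>A ball of radius r thickened by discs of radius 2r stays inside the ball of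
   radius e.\<close>
 define r where "r = e / 3" have r: "r > 0" using e by(simp add: r_def) define \<gamma> where "\<gamma> t = circ r t" for t :: real
 have inS: "z + axis i \<zeta> : S" if "z : ball z0 r" "norm \<zeta> < 2 * r" for z \<zeta>
 proof - have "dist z0 (z + axis i \<zeta>) <= dist z0 z + dist z (z + axis i \<zeta>)" by(rule dist_triangle)
  also have "... < r + 2 * r" using that by(simp add: norm_axis dist_norm norm_minus_commute)
  finally show ?thesis using e by(auto simp: r_def)
 qed
 have "wd (Inl i) f z = param_int (cbox 0 1) (%_. 1) (%t. axis i (\<gamma> t)) (%t. inverse (\<gamma> t)) f z" if z: "z : ball z0 r" for z
 proof - let ?h = "%\<zeta>. f (z + axis i \<zeta>)"
  have dh: "(?h has_field_derivative wd (Inl i) f (z + axis i \<zeta>)) (at \<zeta>)" if "norm \<zeta> < 2 * r" for \<zeta>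
  proof - have f': "f differentiable (at (z + axis i \<zeta>))" "!!j. wd (Inr j) f (z + axis i \<zeta>) = 0"
    using f inS[OF z that] by(auto simp: holo_on_iff)
   have ax: "axis i x $ j = (if j = i then x else 0)" for x :: complex and j by(simp add: axis_def)
   have "((%\<zeta>. z + axis i \<zeta>) has_derivative (%v. axis i v)) (at \<zeta>)"
    by(auto intro!: derivative_eq_intros bounded_linear_imp_has_derivative bounded_linear_axis)
   from has_derivative_compose[OF this has_derivative_wirtinger[OF f'(1)]]
   have "(?h has_derivative (%v. SS A. wd A f (z + axis i \<zeta>) * wcomp A (axis i v))) (at \<zeta>)" .
   thus ?thesis unfolding has_field_derivative_def by(rule has_derivative_eq_rhs)
     (simp add: fun_eq_iff sum_UNIV_sum f'(2) ax if_distrib[of "%x. _ * x"] cong: if_cong)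
  qed
  have hol: "?h holomorphic_on ball 0 (2 * r)" unfolding holomorphic_on_def field_differentiable_def
   using dh has_field_derivative_at_within by(metis mem_ball_0)
  have "((%u. ?h u / (u - 0)^(Suc 1)) has_contour_integral ((of_real (2 * pi) * \<i>) / (fact 1) * (deriv ^^ 1) ?h 0)) (circlepath 0 r)"
  proof(rule Cauchy_has_contour_integral_higher_derivative_circlepath)
   show "continuous_on (cball 0 r) ?h" using hol r by(auto intro: continuous_on_subset[OF holomorphic_on_imp_continuous_on])
   show "?h holomorphic_on ball 0 r" using hol r by(auto intro: holomorphic_on_subset)
  qed (use r in auto)
  moreover have "deriv ?h 0 = wd (Inl i) f z"
   proof - have "axis i (0::complex) = (0::complex^'a)" by(simp add: vec_eq_iff axis_def)
    hence "wd (Inl i) f (z + axis i 0) = wd (Inl i) f z" by(simp only: add_0_right)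
    thus ?thesis using DERIV_imp_deriv[OF dh[of 0]] r by simp
   qed
  ultimately have "((%u. ?h u / u^2) has_contour_integral (of_real (2 * pi) * \<i>) * wd (Inl i) f z) (circlepath 0 r)"
   by(simp add: power2_eq_square)
  hence "((%t. ?h (circlepath 0 r t) / (circlepath 0 r t)^2 * vector_derivative (circlepath 0 r) (at t within {0..1}))
    has_integral (of_real (2 * pi) * \<i>) * wd (Inl i) f z) {0..1}" by(simp add: has_contour_integral_def)
  hence *: "((%t. (of_real (2 * pi) * \<i>) * (inverse (\<gamma> t) * f (1 *R z + axis i (\<gamma> t)))) has_integral (of_real (2 * pi) * \<i>) * wd (Inl i) f z) {0..1}"
  proof(rule has_integral_eq[rotated])
   fix t :: real assume "t : {0..1}"
   hence v: "vector_derivative (circlepath 0 r) (at t within {0..1}) = of_real (2 * pi) * \<i> * \<gamma> t"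
    by(simp add: vector_derivative_circlepath01 \<gamma>_def)
   have c: "circlepath 0 r t = \<gamma> t" by(simp add: circlepath \<gamma>_def)
   have "\<gamma> t ~= 0" using r by(simp add: \<gamma>_def)
   thus "?h (circlepath 0 r t) / (circlepath 0 r t)^2 * vector_derivative (circlepath 0 r) (at t within {0..1}) =
    (of_real (2 * pi) * \<i>) * (inverse (\<gamma> t) * f (1 *R z + axis i (\<gamma> t)))"
    by(simp add: v c field_simps power2_eq_square)
  qed
  have "((%t. inverse (\<gamma> t) * f (1 *R z + axis i (\<gamma> t))) has_integral wd (Inl i) f z) {0..1}"
  proof - have "inverse (of_real (2 * pi) * \<i>) * (of_real (2 * pi) * \<i> * x) = x" for x :: complex
    by(subst mult.assoc[symmetric], subst left_inverse) simp_all
   thus ?thesis using has_integral_mult_right[OF *, of "inverse (of_real (2 * pi) * \<i>)"] by(simp only:)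
  qed
  thus ?thesis unfolding param_int_def by(simp add: integral_unique)
 qed
 moreover have "1 *R z + axis i (\<gamma> t) : S" if "z : ball z0 r" for z t
  using inS[OF that, of "\<gamma> t"] r by(simp add: \<gamma>_def norm_mult)
 ultimately show ?thesis using that r unfolding \<gamma>_def by blast
qed

text \<open>The class of holomorphic functions is closed under Wirtinger derivatives, so
  \<open>smooth_on_coinduct\<close> applies to it.\<close>

lemma holo_on_smooth: assumes S: "open S" and f: "holo_on S f" shows "smooth_on S f"
proof(rule smooth_on_coinduct[OF S, where X = "holo_on S"])
 have par: "param_integral 0 1 (%_. 1) (%t::real. axis i (circ r t)) (ball z0 r) S"
  if "!!z t. z : ball z0 r ==> 1 *R z + axis i (circ r t) : S" for i r and z0 :: "complex^'a"
 proof
  show "continuous_on (cbox 0 1) (%t::real. axis i (circ r t) :: complex^'a)"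
   by(intro bounded_linear.continuous_on[OF bounded_linear_axis] continuous_intros)
 qed (use that S in auto)
 have w: "continuous_on (cbox 0 1) (%t::real. inverse (circ r t) :: complex)" if "r > 0" for r using that by(auto intro!: continuous_intros)
 have w0: "wd (Inr j) f z = 0" "f differentiable (at z)" if "holo_on S f" "z : S" for f j z using that by(auto simp: holo_on_iff)
 have c: "continuous_on S f" if "holo_on S f" for f
  using w0[OF that] by(auto intro!: continuous_at_imp_continuous_on differentiable_imp_continuous_within)
 \<comment> \<open>Continuity of the derivatives comes from the integral formula and the continuity
   of \<open>f\<close>.\<close>
 have cw: "continuous_on S (wd A f)" if f: "holo_on S f" for f A
 proof(cases A)
  case (Inr j) thus ?thesis using w0[OF f] by(simp cong: continuous_on_cong)
 next case (Inl i)
  show ?thesis unfolding Inl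
  proof(rule continuous_at_imp_continuous_on, rule ballI)
   fix z0 assume "z0 : S" from holo_partial_integral[OF S f this, of i] obtain r where r: "r > 0"
    "!!z t. z : ball z0 r ==> 1 *R z + axis i (circ r t) : S"
    and e: "!!z. z : ball z0 r ==> wd (Inl i) f z = param_int (cbox 0 1) (%_. 1) (%t::real. axis i (circ r t))
      (%t. inverse (circ r t)) f z" by blast
   interpret param_integral 0 1 "%_. 1" "%t::real. axis i (circ r t)" "ball z0 r" S by(rule par[OF r(2)])
   have "continuous_on (ball z0 r) (wd (Inl i) f)"
    by(rule continuous_on_eq[OF continuous_param_int[OF w[OF r(1)] c[OF f]]]) (rule e[symmetric])
   thus "isCont (wd (Inl i) f) z0" using r by(simp add: continuous_on_eq_continuous_at)
  qed
 qed
 show "holo_on S f" by(rule f)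
 show "h differentiable (at z)" if "holo_on S h" "z : S" for h z using w0[OF that] by blast
 \<comment> \<open>With continuous derivatives at hand the integral may be differentiated once more,
   and the conjugate derivatives vanish under the integral sign.\<close>
 have hw: "holo_on S (wd A f)" if f: "holo_on S f" for f A
 proof(cases A)
  case (Inr j) have "((wd (Inr j) f) has_derivative (%_. 0)) (at z)" if "z : S" for z
   by(rule has_derivative_transform_within_open[OF has_derivative_const[of 0] S that]) (use w0 f in auto)
  thus ?thesis unfolding holo_on_def Inr by(intro ballI exI[of _ "%_. 0"]) auto
 next case (Inl i)
  show ?thesis unfolding Inl holo_on_iff
  proof
   fix z0 assume "z0 : S" from holo_partial_integral[OF S f this, of i] obtain r where r: "r > 0"
    "!!z t. z : ball z0 r ==> 1 *R z + axis i (circ r t) : S"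
    and e: "!!z. z : ball z0 r ==> wd (Inl i) f z = param_int (cbox 0 1) (%_. 1) (%t::real. axis i (circ r t))
      (%t. inverse (circ r t)) f z" by blast
   interpret P: param_integral 0 1 "%_. 1" "%t::real. axis i (circ r t)" "ball z0 r" S by(rule par[OF r(2)])
   let ?P = "param_int (cbox 0 1) (%_. 1) (%t::real. axis i (circ r t)) (%t. inverse (circ r t)) f" have z: "z0 : ball z0 r" using r by simp
   have "?P differentiable (at z0)" by(rule P.differentiable_param_int[OF w[OF r(1)] w0(2)[OF f] cw[OF f] z])
   hence "wd (Inl i) f differentiable (at z0)"
    by(metis (no_types, lifting) differentiable_def has_derivative_transform_within_open[OF _ open_ball z] e)
   moreover have "wd (Inr j) (wd (Inl i) f) z0 = 0" for j
   proof - have "wd (Inr j) (wd (Inl i) f) z0 = wd (Inr j) ?P z0" by(rule wirtinger_cong[OF open_ball z e])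
    also have "... = param_int (cbox 0 1) (%_. 1) (%t::real. axis i (circ r t))
      (%t. inverse (circ r t) * complex_of_real 1) (wd (Inr j) f) z0" by(rule P.wirtinger_param_int[OF w[OF r(1)] w0(2)[OF f] cw[OF f] z])
    also have "... = 0" unfolding param_int_def by(simp only: w0(1)[OF f r(2)[OF z]] mult_zero_right integral_0)
    finally show ?thesis .
   qed
   ultimately show "wd (Inl i) f differentiable (at z0) & (ALL j. wd (Inr j) (wd (Inl i) f) z0 = 0)" by blast
  qed
 qed
 show "EX I::nat set. EX c g. finite I & (ALL i:I. smooth_on S (c i) & holo_on S (g i)) &
   (ALL z:S. wd A h z = (SUM i:I. c i z * g i z))" if "holo_on S h" for h A
  by(rule exI[of _ "{0}"], rule exI[of _ "%_ _. 1"], rule exI[of _ "%_. wd A h"])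
   (use hw[OF that] S in \<open>auto intro: smooth_intros\<close>)
qed

subsection \<open>Cutoff functions\<close>

text \<open>The polynomial factor makes the family closed under differentiation: p becomes X^2 (p -
  p').\<close>

definition exp_cutoff :: "real poly => real => real" where "exp_cutoff p x = (if x > 0 then poly p (1 / x) * exp (- (1 / x)) else 0)"

lemma poly_exp_tendsto_0: "((%y::real. poly p y * exp (- y)) \<longlongrightarrow> 0) at_top"
proof - have "((%y::real. SUM i<=degree p. coeff p i * (y ^ i / exp y)) \<longlongrightarrow> (SUM i<=degree p. coeff p i * 0)) at_top"
  by(intro tendsto_intros tendsto_power_div_exp_0)
 thus ?thesis by(simp add: poly_altdef exp_minus field_simps sum_distrib_left)
qed

lemma exp_cutoff_derivative: "(exp_cutoff p has_real_derivative exp_cutoff ([:0, 0, 1:] * (p - pderiv p)) x) (at x)"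
proof - consider "x > 0" | "x < 0" | "x = 0" by linarith
 thus ?thesis
 proof cases
  case 1 have "((%x. poly p (1 / x) * exp (- (1 / x))) has_real_derivative exp_cutoff ([:0, 0, 1:] * (p - pderiv p)) x) (at x)"
   using 1 by(auto intro!: derivative_eq_intros DERIV_chain'[OF _ poly_DERIV] simp: exp_cutoff_def field_simps power2_eq_square)
  thus ?thesis by(rule has_field_derivative_transform_within_open[of _ _ _ "{0<..}"]) (use 1 in \<open>auto simp: exp_cutoff_def\<close>)
 next case 2
  have "((%_. 0) has_real_derivative 0) (at x)" by simp
  hence "(exp_cutoff p has_real_derivative 0) (at x)"
   by(rule has_field_derivative_transform_within_open[of _ _ _ "{..<0}"]) (use 2 in \<open>auto simp: exp_cutoff_def\<close>)
  thus ?thesis using 2 by(simp add: exp_cutoff_def)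
 next case 3
  \<comment> \<open>With y = 1/x the difference quotient is a polynomial in y times exp(-y).\<close>
  have "((%x. exp_cutoff p x / x) \<longlongrightarrow> 0) (at_right 0)"
  proof(rule Lim_transform_eventually)
   have "filterlim (%x::real. inverse x) at_top (at_right 0)" by(rule filterlim_inverse_at_top_right)
   from filterlim_compose[OF poly_exp_tendsto_0[of "[:0, 1:] * p"] this]
   show "((%x. poly ([:0, 1:] * p) (inverse x) * exp (- inverse x)) \<longlongrightarrow> 0) (at_right 0)" .
   show "\<forall>\<^sub>F x in at_right 0. poly ([:0, 1:] * p) (inverse x) * exp (- inverse x) = exp_cutoff p x / x"
    by(auto simp: eventually_at_filter exp_cutoff_def field_simps intro!: always_eventually)
  qed
  moreover have "((%x. exp_cutoff p x / x) \<longlongrightarrow> 0) (at_left 0)"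
   by(rule Lim_transform_eventually[OF tendsto_const]) (auto simp: eventually_at_filter exp_cutoff_def intro!: always_eventually)
  ultimately have "((%x. exp_cutoff p x / x) \<longlongrightarrow> 0) (at 0)" by(simp add: filterlim_split_at)
  thus ?thesis using 3 by(simp add: has_field_derivative_iff exp_cutoff_def)
 qed
qed

text \<open>Varying \<open>p\<close> gives the class for \<open>smooth_on_coinduct\<close>.
  \<open>N\<close> is real valued but is differentiated as a complex function.\<close>

lemma fixes N :: "complex^'n => real" assumes N: "smooth_on UNIV (%z. of_real (N z))"
 shows smooth_on_exp_cutoff: "smooth_on UNIV (%z. of_real (exp_cutoff p (N z)))"
  and wirtinger_exp_cutoff: "wd A (%z. of_real (exp_cutoff p (N z))) z
   = of_real (exp_cutoff ([:0, 0, 1:] * (p - pderiv p)) (N z)) * wd A (%z. of_real (N z)) z"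
proof - have *: "((%z. complex_of_real (exp_cutoff p (N z))) has_derivative
   (%v. SS A. (of_real (exp_cutoff ([:0, 0, 1:] * (p - pderiv p)) (N z)) * wd A (%z. of_real (N z)) z) * wcomp A v)) (at z)" for p z
 proof - let ?D = "%v. SS A. wd A (%z. of_real (N z)) z * wcomp A v"
  have D: "((%z. complex_of_real (N z)) has_derivative ?D) (at z)" by(rule has_derivative_wirtinger[OF smooth_on_deriv[OF N]]) simp
  have DN: "(N has_derivative (%v. Re (?D v))) (at z)" using bounded_linear.has_derivative[OF bounded_linear_Re D] by simp
  have "((%z. complex_of_real (N z)) has_derivative (%v. of_real (Re (?D v)))) (at z)"
   using bounded_linear.has_derivative[OF bounded_linear_of_real DN] .
  \<comment> \<open>The differential of a real function takes real values, so no information is lost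
    under \<open>Re\<close>.\<close>
  hence r: "of_real (Re (?D v)) = ?D v" for v using has_derivative_unique[OF D] by(metis (no_types, lifting))
  have "((%z. exp_cutoff p (N z)) has_derivative (%v. exp_cutoff ([:0, 0, 1:] * (p - pderiv p)) (N z) * Re (?D v))) (at z)"
   using has_derivative_compose[OF DN exp_cutoff_derivative[unfolded has_field_derivative_def]] .
  hence "((%z. complex_of_real (exp_cutoff p (N z))) has_derivative
    (%v. complex_of_real (exp_cutoff ([:0, 0, 1:] * (p - pderiv p)) (N z) * Re (?D v)))) (at z)"
   by(rule bounded_linear.has_derivative[OF bounded_linear_of_real])
  hence "((%z. complex_of_real (exp_cutoff p (N z))) has_derivative
    (%v. of_real (exp_cutoff ([:0, 0, 1:] * (p - pderiv p)) (N z)) * ?D v)) (at z)" unfolding of_real_mult r .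
  thus ?thesis by(simp only: sum_distrib_left mult.assoc)
 qed
 thus w: "wd A (%z. of_real (exp_cutoff p (N z))) z
   = of_real (exp_cutoff ([:0, 0, 1:] * (p - pderiv p)) (N z)) * wd A (%z. of_real (N z)) z" for p A z by(rule wirtinger_eqI)
 show "smooth_on UNIV (%z. of_real (exp_cutoff p (N z)))"
 proof(rule smooth_on_coinduct[OF open_UNIV, where X = "%h. EX p. h = (%z. of_real (exp_cutoff p (N z)))"])
  fix h A assume "EX p. h = (%z. complex_of_real (exp_cutoff p (N z)))"
  then obtain p where h: "h = (%z. complex_of_real (exp_cutoff p (N z)))" by blast
  show "EX I::nat set. EX c g. finite I & (ALL i:I. smooth_on UNIV (c i) & (EX p. g i = (%z. of_real (exp_cutoff p (N z))))) &
    (ALL z:UNIV. wd A h z = (SUM i:I. c i z * g i z))" by(rule exI[of _ "{0}"], rule exI[of _ "%_. wd A (%z. of_real (N z))"],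
     rule exI[of _ "%_ z. of_real (exp_cutoff ([:0, 0, 1:] * (p - pderiv p)) (N z))"]) (auto simp: h w mult.commute intro!: smooth_intros N)
 qed (use * differentiable_def in blast)+
qed

text \<open>The usual quotient of two one-sided exponentials. The last property is what the d-bar
  equation needs: a cutoff in one coordinate has no derivative in the other ones.\<close>

lemma smooth_cutoff: fixes N :: "complex^'n => real" assumes N: "smooth_on UNIV (%z. of_real (N z))" and ab: "a < b"
 obtains \<phi> :: "complex^'n => complex" where "smooth_on UNIV \<phi>" "!!z. N z <= a ==> \<phi> z = 1" "!!z. N z >= b ==> \<phi> z = 0"
  "!!A z. wd A (%z. of_real (N z)) z = 0 ==> wd A \<phi> z = 0"
proof - have N1: "smooth_on UNIV (%z. complex_of_real (b - N z))" "smooth_on UNIV (%z. complex_of_real (N z - a))"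
  by(auto simp: of_real_diff intro!: smooth_intros N)
 define e1 e2 where "e1 z = complex_of_real (exp_cutoff 1 (b - N z))" and "e2 z = complex_of_real (exp_cutoff 1 (N z - a))" for z
 have sm: "smooth_on UNIV e1" "smooth_on UNIV e2"
  unfolding e1_def[abs_def] e2_def[abs_def] by(rule smooth_on_exp_cutoff[OF N1(1)], rule smooth_on_exp_cutoff[OF N1(2)])
 have nz: "e1 z + e2 z ~= 0" for z
 proof - have "exp_cutoff 1 (b - N z) + exp_cutoff 1 (N z - a) > 0" using ab by(auto simp: exp_cutoff_def intro: add_pos_pos)
  thus ?thesis unfolding e1_def e2_def using of_real_eq_0_iff of_real_add by(metis less_irrefl)
 qed
 let ?\<phi> = "%z. e1 z * inverse (e1 z + e2 z)" show ?thesis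
 proof(rule that[of ?\<phi>])
  show "smooth_on UNIV ?\<phi>" by(intro smooth_intros open_UNIV sm nz)
  show "?\<phi> z = 1" if "N z <= a" for z using that nz[of z] by(simp add: e2_def exp_cutoff_def)
  show "?\<phi> z = 0" if "N z >= b" for z using that by(simp add: e1_def exp_cutoff_def)
  show "wd A ?\<phi> z = 0" if z: "wd A (%z. of_real (N z)) z = 0" for A z
  proof - have d: "(%z. complex_of_real (N z)) differentiable (at z)" using smooth_on_deriv[OF N] by simp
   have w: "wd A (%z. complex_of_real (b - N z)) z = 0" "wd A (%z. complex_of_real (N z - a)) z = 0"
    by(simp_all add: of_real_diff wirtinger_diff d z)
   have w1: "wd A e1 z = 0" "wd A e2 z = 0"
    unfolding e1_def[abs_def] e2_def[abs_def] wirtinger_exp_cutoff[OF N1(1)] wirtinger_exp_cutoff[OF N1(2)] w by simp_all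
   have d1: "e1 differentiable (at z)" "e2 differentiable (at z)" using sm smooth_on_deriv by auto
   have d2: "(%z. inverse (e1 z + e2 z)) differentiable (at z)"
    by(rule smooth_on_deriv[of UNIV]) (auto intro!: smooth_intros sm nz)
   show ?thesis by(simp add: wirtinger_mult[OF d1(1) d2] w1 wirtinger_inverse[OF _ nz] wirtinger_add d1)
  qed
 qed
qed

text \<open>The cutoff is applied to the squared distance, which is polynomial in the coordinates
  and therefore smooth also at the centre.\<close>

lemma smooth_bump: fixes z0 :: "complex^'n" assumes "0 < r"
 obtains \<phi> :: "complex^'n => complex" where "smooth_on UNIV \<phi>" "!!z. dist z0 z <= r / 2 ==> \<phi> z = 1" "!!z. dist z0 z >= r ==> \<phi> z = 0"
proof - define N where "N z = (norm (z - z0))\<^sup>2" for z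
 have e: "complex_of_real (N z) = (SS i. (z $ i - z0 $ i) * cnj (z $ i - z0 $ i))" for z unfolding N_def norm_vec_def L2_set_def
  by(subst real_sqrt_pow2, intro sum_nonneg, simp) (simp only: of_real_sum complex_norm_square vector_minus_component)
 have N: "smooth_on UNIV (%z. of_real (N z))" unfolding e by(intro smooth_intros open_UNIV)
 have "(r/2)\<^sup>2 < r\<^sup>2" using assms by(intro power_strict_mono) auto
 from smooth_cutoff[OF N this] obtain \<phi> where \<phi>: "smooth_on UNIV \<phi>" "!!z. N z <= (r/2)\<^sup>2 ==> \<phi> z = 1" "!!z. N z >= r\<^sup>2 ==> \<phi> z = 0"
  by metis
 show ?thesis by(rule that[OF \<phi>(1)]; rule \<phi>)
   (use assms in \<open>auto simp: N_def dist_norm norm_minus_commute intro!: power_mono\<close>)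
qed

subsection \<open>Local solutions of the d-bar equation\<close>

definition polydisc :: "complex^'n => real => (complex^'n) set" where "polydisc c r = {z. ALL i. norm (z $ i - c $ i) < r}"

lemma open_polydisc: "open (polydisc c r)"
proof - have "polydisc c r = (INT i:UNIV. {z. norm (z $ i - c $ i) < r})" by(auto simp: polydisc_def)
 also have "open ..." by(intro open_INT ballI open_Collect_less continuous_intros) auto
 finally show ?thesis .
qed

lemma polydisc_subset_ball: fixes c :: "complex^'n" assumes "e > 0" obtains r where "r > 0" "polydisc c r \<subseteq> ball c e"
proof - define r where "r = e / (real CARD('n) + 1)"
 have r: "r > 0" using assms by(auto simp: r_def)
 have "polydisc c r \<subseteq> ball c e"
 proof
  fix z assume z: "z : polydisc c r" have "norm (z - c) <= (SS i. norm ((z - c) $ i))" by(simp add: norm_vec_def L2_set_le_sum)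
  also have "... <= (SUM i:(UNIV::'n set). r)" using z by(intro sum_mono) (auto simp: polydisc_def less_imp_le)
  also have "... < e" using assms by(simp add: r_def field_simps)
  finally show "z : ball c e" by(simp add: dist_norm norm_minus_commute)
 qed
 with r show ?thesis by(rule that)
qed

lemma polydisc_mono: "r <= r' ==> polydisc c r \<subseteq> polydisc c r'" by(auto simp: polydisc_def intro: less_le_trans)

lemma center_in_polydisc: "r > 0 ==> c : polydisc c r" by(simp add: polydisc_def)

text \<open>In polar coordinates the area element cancels the pole of the Cauchy kernel and leaves
  \<open>cis (- \<theta>)\<close>. Twice the integrand is \<open>A - B\<close>: \<open>A\<close> is
  the radial derivative and integrates to the value at the centre, \<open>B\<close> is the angular
  derivative divided by i \<rho> and integrates to zero by periodicity.\<close>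

lemma cauchy_transform_polar: fixes G :: "complex^'n => complex"
 assumes T: "open T" and G: "smooth_on T G" and z: "!!\<zeta>. z + axis l \<zeta> : T"
  and R: "R > 0" "!!\<zeta>. norm \<zeta> = R ==> G (z + axis l \<zeta>) = 0" shows "integral (cbox (0::real, 0::real) (R, 2 * pi))
   (%(\<rho>, \<theta>). cis (- \<theta>) * wd (Inr l) G (z + axis l (of_real \<rho> * cis \<theta>))) = - (of_real pi * G z)"
proof - define g where "g A \<rho> \<theta> = wd A G (z + axis l (of_real \<rho> * cis \<theta>))" for A \<rho> \<theta>
 define F where "F \<rho> \<theta> = G (z + axis l (of_real \<rho> * cis \<theta>))" for \<rho> \<theta>
 have ccis: "continuous_on X (%x. cis (f x))" if "continuous_on X f" for X :: "(real \<times> real) set" and f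
  unfolding cis_conv_exp using that by(auto intro!: continuous_intros)
 have cg: "continuous_on X (%x. g A (fst x) (snd x))" for A and X :: "(real \<times> real) set" unfolding g_def
  by(rule continuous_on_compose2[OF smooth_on_continuous[OF smooth_on_wirtinger[OF T G]]])
   (auto intro!: continuous_intros bounded_linear.continuous_on[OF bounded_linear_axis] ccis simp: z)
 have dF: "((%\<zeta>. G (z + axis l \<zeta>)) has_derivative (%v. wd (Inl l) G (z + axis l \<zeta>) * v + wd (Inr l) G (z + axis l \<zeta>) * cnj v)) (at \<zeta>)" for \<zeta>
 proof - have ax: "axis l x $ j = (if j = l then x else 0)" for x :: complex and j by(simp add: axis_def)
  have "((%\<zeta>. z + axis l \<zeta>) has_derivative (%v. axis l v)) (at \<zeta>)"
   by(auto intro!: derivative_eq_intros bounded_linear_imp_has_derivative bounded_linear_axis)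
  from has_derivative_compose[OF this has_derivative_wirtinger[OF smooth_on_deriv[OF G z]]]
  show ?thesis by(rule has_derivative_eq_rhs)
    (simp add: fun_eq_iff sum_UNIV_sum ax if_distrib[of "%x. _ * x"] if_distrib[of cnj] cong: if_cong)
 qed
 have dr: "((%\<rho>. F \<rho> \<theta>) has_vector_derivative (g (Inl l) \<rho> \<theta> * cis \<theta> + g (Inr l) \<rho> \<theta> * cis (- \<theta>))) (at \<rho>)" for \<rho> \<theta>
 proof - have "((%\<rho>. of_real \<rho> * cis \<theta>) has_derivative (%h. of_real h * cis \<theta>)) (at \<rho>)"
   by(auto intro!: derivative_eq_intros)
  from has_derivative_compose[OF this dF]
  show ?thesis unfolding has_vector_derivative_def F_def g_def
   by(rule has_derivative_eq_rhs) (auto simp: fun_eq_iff scaleR_conv_of_real cis_cnj algebra_simps)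
 qed
 have dt: "((%\<theta>. F \<rho> \<theta>) has_vector_derivative (\<i> * of_real \<rho> * (g (Inl l) \<rho> \<theta> * cis \<theta> - g (Inr l) \<rho> \<theta> * cis (- \<theta>)))) (at \<theta>)" for \<rho> \<theta>
 proof -
  have "((%\<theta>. of_real \<rho> * exp (\<i> * of_real \<theta>)) has_derivative (%h. of_real h * (\<i> * of_real \<rho> * exp (\<i> * of_real \<theta>)))) (at \<theta>)"
  proof -
   have "((%\<theta>. exp (\<i> * complex_of_real \<theta>)) has_derivative (%h. exp (\<i> * of_real \<theta>) * (\<i> * of_real h))) (at \<theta>)"
    by(rule has_derivative_compose[OF _ DERIV_exp[unfolded has_field_derivative_def]]) (auto intro!: derivative_eq_intros)
   from has_derivative_mult_right[OF this, of "of_real \<rho>"] show ?thesis by(simp add: mult_ac)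
  qed
  hence "((%\<theta>. of_real \<rho> * cis \<theta>) has_derivative (%h. of_real h * (\<i> * of_real \<rho> * cis \<theta>))) (at \<theta>)"
   by(simp add: cis_conv_exp)
  from has_derivative_compose[OF this dF]
  show ?thesis unfolding has_vector_derivative_def F_def g_def
   by(rule has_derivative_eq_rhs) (auto simp: fun_eq_iff scaleR_conv_of_real cis_cnj algebra_simps)
 qed
 define A where "A \<rho> \<theta> = g (Inl l) \<rho> \<theta> * cis \<theta> + g (Inr l) \<rho> \<theta> * cis (- \<theta>)" for \<rho> \<theta>
 define B where "B \<rho> \<theta> = g (Inl l) \<rho> \<theta> * cis \<theta> - g (Inr l) \<rho> \<theta> * cis (- \<theta>)" for \<rho> \<theta>
 have cA: "continuous_on X (%x. A (fst x) (snd x))" and cB: "continuous_on X (%x. B (fst x) (snd x))" for X :: "(real \<times> real) set"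
  unfolding A_def B_def by(auto intro!: continuous_intros cg ccis)
 have IA: "integral (cbox (0, 0) (R, 2 * pi)) (%(\<rho>, \<theta>). A \<rho> \<theta>) = - (2 * of_real pi * G z)"
 proof -
  have "integral (cbox (0, 0) (R, 2 * pi)) (%(\<rho>, \<theta>). A \<rho> \<theta>) = integral (cbox 0 R) (%\<rho>. integral (cbox 0 (2 * pi)) (A \<rho>))"
   using integral_prod_continuous[of 0 0 R "2 * pi" "%x. A (fst x) (snd x)"] cA by(simp add: case_prod_unfold)
  also have "... = integral (cbox 0 (2 * pi)) (%\<theta>. integral (cbox 0 R) (%\<rho>. A \<rho> \<theta>))"
   by(rule integral_swap_continuous) (use cA in \<open>simp add: case_prod_beta\<close>)
  also have "... = integral (cbox 0 (2 * pi)) (%\<theta>. - G z)"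
  proof(rule integral_cong)
   fix \<theta> :: real have "((%\<rho>. A \<rho> \<theta>) has_integral (F R \<theta> - F 0 \<theta>)) {0..R}"
    by(rule fundamental_theorem_of_calculus) (use R(1) in \<open>auto intro!: has_vector_derivative_at_within[OF dr] simp: A_def\<close>)
   moreover have "F R \<theta> = 0" using R by(simp add: F_def norm_mult)
   moreover have "F 0 \<theta> = G z"
   proof - have "axis l (0::complex) = (0::complex^'n)" by(simp add: vec_eq_iff axis_def)
    thus ?thesis unfolding F_def of_real_0 mult_zero_left by(simp only: add_0_right)
   qed
   ultimately show "integral (cbox 0 R) (%\<rho>. A \<rho> \<theta>) = - G z" by(simp add: integral_unique)
  qed
  also have "... = - (2 * of_real pi * G z)" by(simp add: scaleR_conv_of_real)
  finally show ?thesis .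
 qed
 have IB: "integral (cbox (0, 0) (R, 2 * pi)) (%(\<rho>, \<theta>). B \<rho> \<theta>) = 0"
 proof -
  have "integral (cbox (0, 0) (R, 2 * pi)) (%(\<rho>, \<theta>). B \<rho> \<theta>) = integral (cbox 0 R) (%\<rho>. integral (cbox 0 (2 * pi)) (B \<rho>))"
   using integral_prod_continuous[of 0 0 R "2 * pi" "%x. B (fst x) (snd x)"] cB by(simp add: case_prod_unfold)
  also have "... = integral (cbox 0 R) (%\<rho>. 0)"
  \<comment> \<open>The division by \<rho> in the angular integral fails only on the null set where
    \<rho> is zero.\<close>
  proof(rule integral_spike[of "{0}"])
   fix \<rho> assume "\<rho> : cbox 0 R - {0}" hence \<rho>: "\<rho> ~= 0" by auto
   have "((%\<theta>. \<i> * of_real \<rho> * B \<rho> \<theta>) has_integral (F \<rho> (2 * pi) - F \<rho> 0)) {0..2 * pi}"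
    by(rule fundamental_theorem_of_calculus) (auto intro!: has_vector_derivative_at_within[OF dt] simp: B_def)
   moreover have "F \<rho> (2 * pi) = F \<rho> 0" by(simp add: F_def)
   ultimately have "((%\<theta>. \<i> * of_real \<rho> * B \<rho> \<theta>) has_integral 0) {0..2 * pi}" by simp
   from has_integral_mult_right[OF this, of "inverse (\<i> * of_real \<rho>)"] \<rho>
   have "(B \<rho> has_integral 0) {0..2 * pi}" by(simp add: field_simps)
   thus "0 = integral (cbox 0 (2 * pi)) (B \<rho>)" by(simp add: integral_unique)
  qed auto
  finally show ?thesis by simp
 qed
 have "integral (cbox (0, 0) (R, 2 * pi)) (%(\<rho>, \<theta>). cis (- \<theta>) * g (Inr l) \<rho> \<theta>)
  = integral (cbox (0, 0) (R, 2 * pi)) (%x. (1/2) * ((case x of (\<rho>, \<theta>) => A \<rho> \<theta>) - (case x of (\<rho>, \<theta>) => B \<rho> \<theta>)))"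
  by(rule integral_cong) (auto simp: A_def B_def)
 also have "... = (1/2) * (integral (cbox (0, 0) (R, 2 * pi)) (%(\<rho>, \<theta>). A \<rho> \<theta>) - integral (cbox (0, 0) (R, 2 * pi)) (%(\<rho>, \<theta>). B \<rho> \<theta>))"
  by(subst integral_mult_right, subst integral_diff) (use cA cB in \<open>auto intro!: integrable_continuous simp: case_prod_beta\<close>)
 finally show ?thesis by(simp add: IA IB g_def)
qed

text \<open>The Cauchy transform of \<open>F\<close> in the single variable l. The cutoff depends on
  that variable alone, so the other variables are parameters and the conjugate derivatives vanishing
  in them vanish for the solution too.\<close>

lemma dbar_solve_one: fixes F :: "complex^'n => complex" assumes r: "0 < r'" "r' < r" and F: "smooth_on (polydisc c r) F"
 obtains h where "smooth_on (polydisc c r') h" "!!z. z : polydisc c r' ==> wd (Inr l) h z = F z"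
  "!!m z. m ~= l ==> (!!w. w : polydisc c r ==> wd (Inr m) F w = 0) ==> z : polydisc c r' ==> wd (Inr m) h z = 0"
proof - define N where "N z = (norm (z $ l - c $ l))\<^sup>2" for z :: "complex^'n"
 have eN: "complex_of_real (N z) = (z $ l - c $ l) * cnj (z $ l - c $ l)" for z unfolding N_def by(rule complex_norm_square)
 have N: "smooth_on UNIV (%z. of_real (N z))" unfolding eN by(intro smooth_intros open_UNIV)
 define b where "b = (r + r') / 2" have b: "r' < b" "b < r" using r by(auto simp: b_def)
 have "r'\<^sup>2 < b\<^sup>2" using b r by(intro power_strict_mono) auto
 from smooth_cutoff[OF N this] obtain \<phi> where \<phi>: "smooth_on UNIV \<phi>" "!!z. N z <= r'\<^sup>2 ==> \<phi> z = 1" "!!z. N z >= b\<^sup>2 ==> \<phi> z = 0"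
  and \<phi>w: "!!A z. wd A (%z. of_real (N z)) z = 0 ==> wd A \<phi> z = 0" by metis
 have \<phi>0: "\<phi> z = 0" if "b <= norm (z $ l - c $ l)" for z using that b r by(intro \<phi>(3)) (auto simp: N_def intro!: power_mono)
 have wm: "wd (Inr m) \<phi> z = 0" if "m ~= l" for m z
 proof(rule \<phi>w)
  have d: "(%z. (z $ l - c $ l)) differentiable (at z)" "(%z. cnj (z $ l - c $ l)) differentiable (at z)"
   by(rule smooth_on_deriv[of UNIV], auto intro!: smooth_intros)+
  have d1: "(%z. z $ l) differentiable (at z)" by(rule smooth_on_deriv[of UNIV]) (auto intro!: smooth_intros)
  show "wd (Inr m) (%z. complex_of_real (N z)) z = 0"
   unfolding eN using that by(simp only: wirtinger_mult[OF d] wirtinger_cnj[OF d(1)] wirtinger_diff[OF d1 differentiable_const]) simp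
 qed
 \<comment> \<open>The l-th coordinate is unrestricted here, since the transform integrates
   \<open>G\<close> over a large disc in that direction.\<close>
 define T where "T = {z::complex^'n. ALL m. m ~= l --> norm (z $ m - c $ m) < r}" have T: "open T"
 proof - have "T = (INT m:UNIV - {l}. {z. norm (z $ m - c $ m) < r})" by(auto simp: T_def)
  also have "open ..." by(intro open_INT ballI open_Collect_less continuous_intros) auto
  finally show ?thesis .
 qed
 define G where "G z = (if norm (z $ l - c $ l) < r then \<phi> z * F z else 0)" for z have G: "smooth_on T G"
 proof(rule smooth_on_local)
  fix z assume z: "z : T" show "EX V. open V & z : V & smooth_on V G"
  proof(cases "norm (z $ l - c $ l) < r")
   case True hence "z : polydisc c r" using z by(auto simp: T_def polydisc_def)
   moreover have "smooth_on (polydisc c r) (%z. \<phi> z * F z)"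
    by(intro smooth_intros open_polydisc F smooth_on_subset[OF \<phi>(1)] subset_UNIV)
   hence "smooth_on (polydisc c r) G" by(rule smooth_on_cong) (auto simp: open_polydisc, simp add: G_def polydisc_def)
   ultimately show ?thesis using open_polydisc by blast
  next case False
   let ?V = "{z::complex^'n. b < norm (z $ l - c $ l)}" have V: "open ?V" by(intro open_Collect_less continuous_intros)
   moreover have "smooth_on ?V G" by(rule smooth_on_cong[OF smooth_on_const[OF V, of 0] V]) (auto simp: G_def \<phi>0)
   ultimately show ?thesis using False b by(intro exI[of _ ?V]) auto
  qed
 qed
 \<comment> \<open>A shift of size 2r from a point within r' of the centre leads beyond distance r,
   where \<open>G\<close> vanishes.\<close>
 define R where "R = 2 * r" have R: "R > 0" using r by(simp add: R_def)
 define \<tau> where "\<tau> t = axis l (of_real (fst t) * cis (snd t)) " for t :: "real \<times> real"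
 define w where "w t = - (1 / of_real pi) * cis (- snd t)" for t :: "real \<times> real"
 have ccis: "continuous_on X (%x. cis (f x))" if "continuous_on X f" for X :: "(real \<times> real) set" and f
  unfolding cis_conv_exp using that by(auto intro!: continuous_intros)
 have w: "continuous_on X w" for X unfolding w_def by(intro continuous_intros ccis)
 interpret P: param_integral "(0, 0)" "(R, 2 * pi)" "%_. 1" \<tau> "polydisc c r'" T
 proof
  show "continuous_on (cbox (0, 0) (R, 2 * pi)) \<tau>"
   unfolding \<tau>_def by(intro continuous_intros bounded_linear.continuous_on[OF bounded_linear_axis] ccis)
  show "open (polydisc c r')" by(rule open_polydisc)
  show "open T" by(rule T)
 qed (use r in \<open>auto simp: T_def polydisc_def \<tau>_def axis_def intro: less_trans\<close>)
 define h where "h = param_int (cbox (0, 0) (R, 2 * pi)) (%_. 1) \<tau> w G"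
 have wh: "wd A h z = param_int (cbox (0, 0) (R, 2 * pi)) (%_. 1) \<tau> w (wd A G) z" if "z : polydisc c r'" for A z
  unfolding h_def using P.wirtinger_param_int[OF w _ _ that, of G A] smooth_on_deriv[OF G]
   smooth_on_continuous[OF smooth_on_wirtinger[OF T G]] by simp
 show ?thesis
 proof(rule that[of h])
  show "smooth_on (polydisc c r') h" unfolding h_def by(rule P.smooth_on_param_int[OF w G])
 next fix z assume z: "z : polydisc c r'"
  have zT: "z + axis l \<zeta> : T" for \<zeta> using z r by(auto simp: T_def polydisc_def axis_def intro: less_trans)
  have GR: "G (z + axis l \<zeta>) = 0" if "norm \<zeta> = R" for \<zeta>
  proof - have "norm \<zeta> <= norm ((z + axis l \<zeta>) $ l - c $ l) + norm (z $ l - c $ l)"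
    using norm_triangle_ineq4[of "(z + axis l \<zeta>) $ l - c $ l" "z $ l - c $ l"] by(simp add: axis_def)
   moreover have "norm (z $ l - c $ l) < r'" using z by(simp add: polydisc_def)
   ultimately show ?thesis using that r by(simp add: G_def R_def)
  qed
  have "wd (Inr l) h z = - (1 / of_real pi) * integral (cbox (0, 0) (R, 2 * pi))
   (%(\<rho>, \<theta>). cis (- \<theta>) * wd (Inr l) G (z + axis l (of_real \<rho> * cis \<theta>)))"
   unfolding wh[OF z] param_int_def w_def \<tau>_def
   by(subst integral_mult_right[symmetric]) (simp add: case_prod_beta mult.assoc add.commute)
  also have "... = G z" using cauchy_transform_polar[OF T G zT R GR] by simp
  also have "... = F z"
  proof - have "norm (z $ l - c $ l) < r'" using z by(simp add: polydisc_def)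
   hence "N z <= r'\<^sup>2" unfolding N_def by(intro power_mono) auto
   thus ?thesis using `norm (z $ l - c $ l) < r'` r by(simp add: G_def \<phi>)
  qed
  finally show "wd (Inr l) h z = F z" .
 next fix m z assume m: "m ~= l" "!!w. w : polydisc c r ==> wd (Inr m) F w = 0" and z: "z : polydisc c r'"
  have 0: "wd (Inr m) G w = 0" if "w : T" for w
  proof(cases "norm (w $ l - c $ l) < r")
   case True hence w: "w : polydisc c r" using that by(auto simp: T_def polydisc_def)
   have "wd (Inr m) G w = wd (Inr m) (%z. \<phi> z * F z) w" by(rule wirtinger_cong[OF open_polydisc w]) (auto simp: G_def polydisc_def)
   also have "... = 0" using smooth_on_deriv[OF \<phi>(1), of w] smooth_on_deriv[OF F w]
    by(simp add: wirtinger_mult wm m w)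
   finally show ?thesis .
  next case False
   let ?V = "{z::complex^'n. b < norm (z $ l - c $ l)}" have V: "open ?V" by(intro open_Collect_less continuous_intros)
   have "wd (Inr m) G w = wd (Inr m) (%_. 0) w" by(rule wirtinger_cong[OF V]) (use False b in \<open>auto simp: G_def \<phi>0\<close>)
   thus ?thesis by simp
  qed
  show "wd (Inr m) h z = 0" unfolding wh[OF z] param_int_def using P.m[OF z] 0
   by(intro integral_unique has_integral_eq[OF _ has_integral_0]) (simp add: case_prod_beta)
 qed
qed

text \<open>Induction on a set of indices outside which \<open>v\<close> vanishes: solve in one
  direction, subtract, and the set has lost that direction. The polydisc shrinks at each step, so
  the two radii are generalised.\<close>

lemma dbar_poincare: fixes v :: "'n => complex^'n => complex" assumes r: "0 < r'" "r' < r" and v: "!!l. smooth_on (polydisc c r) (v l)"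
  and closed: "!!l m z. z : polydisc c r ==> wd (Inr m) (v l) z = wd (Inr l) (v m) z"
 shows "EX h. smooth_on (polydisc c r') h & (ALL z:polydisc c r'. ALL l. wd (Inr l) h z = v l z)"
proof - have "EX h. smooth_on (polydisc c r') h & (ALL z:polydisc c r'. ALL l. wd (Inr l) h z = v l z)"
  if "finite K" "0 < r'" "r' < r" "!!l. smooth_on (polydisc c r) (v l)"
   "!!l m z. z : polydisc c r ==> wd (Inr m) (v l) z = wd (Inr l) (v m) z"
   "!!l z. l ~: K ==> z : polydisc c r ==> v l z = 0" for K r r' and v :: "'n => complex^'n => complex" using that
 proof(induction K arbitrary: r v rule: finite_induct)
  case empty show ?case
   by(rule exI[of _ "%_. 0"]) (use empty polydisc_mono[of r' r c] in \<open>auto intro!: smooth_intros open_polydisc\<close>)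
 next case (insert l K)
  define s where "s = (r + r') / 2" have s: "r' < s" "s < r" "0 < s" using insert.prems by(auto simp: s_def)
  have sub: "polydisc c s \<subseteq> polydisc c r" using s by(intro polydisc_mono) auto
  obtain h1 where h1: "smooth_on (polydisc c s) h1" "!!z. z : polydisc c s ==> wd (Inr l) h1 z = v l z"
   "!!m z. m ~= l ==> (!!w. w : polydisc c r ==> wd (Inr m) (v l) w = 0) ==> z : polydisc c s ==> wd (Inr m) h1 z = 0"
   using dbar_solve_one[OF s(3,2) insert.prems(3)[of l], of l] by metis
  define u where "u m z = v m z - wd (Inr m) h1 z" for m z
  have vs: "smooth_on (polydisc c s) (v m)" for m using insert.prems(3) sub by(rule smooth_on_subset)
  have us: "smooth_on (polydisc c s) (u m)" for m unfolding u_def by(intro smooth_intros open_polydisc vs h1)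
  have uw: "wd A (u m) z = wd A (v m) z - wd A (wd (Inr m) h1) z" if "z : polydisc c s" for A m z
   unfolding u_def by(rule wirtinger_diff) (use smooth_on_deriv[OF vs that] smooth_on_deriv[OF smooth_on_wirtinger[OF open_polydisc h1(1)] that] in auto)
  have "EX h. smooth_on (polydisc c r') h & (ALL z:polydisc c r'. ALL l. wd (Inr l) h z = u l z)"
  proof(rule insert.IH[OF insert.prems(1) s(1) us])
   fix k m z assume z: "z : polydisc c s" thus "wd (Inr m) (u k) z = wd (Inr k) (u m) z"
    using insert.prems(4)[of z m k] sub wirtinger_commute[OF open_polydisc h1(1) z, of "Inr m" "Inr k"] by(auto simp: uw[OF z])
  next fix m z assume m: "m ~: K" and z: "z : polydisc c s"
   show "u m z = 0"
   proof(cases "m = l")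
    case True thus ?thesis using h1(2)[OF z] by(simp add: u_def)
   next case False
    \<comment> \<open>Closedness moves the derivative to the component m, which is identically zero;
      so the solution in direction l leaves the directions outside the set untouched.\<close>
    have "wd (Inr m) (v l) w = 0" if w: "w : polydisc c r" for w
    proof - have "wd (Inr l) (v m) w = wd (Inr l) (%_. 0) w"
      by(rule wirtinger_cong[OF open_polydisc w]) (use insert.prems(5) m False in auto)
     thus ?thesis using insert.prems(4)[OF w, of m l] by simp
    qed
    from h1(3)[OF False this z] show ?thesis using insert.prems(5)[of m z] m False z sub by(auto simp: u_def)
   qed
  qed
  then obtain h2 where h2: "smooth_on (polydisc c r') h2" "!!z l. z:polydisc c r' ==> wd (Inr l) h2 z = u l z" by blast
  have sub': "polydisc c r' \<subseteq> polydisc c s" using s by(intro polydisc_mono) auto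
  have h1': "smooth_on (polydisc c r') h1" using h1(1) sub' by(rule smooth_on_subset)
  show ?case
  proof(intro exI[of _ "%z. h1 z + h2 z"] conjI ballI allI)
   show "smooth_on (polydisc c r') (%z. h1 z + h2 z)" by(intro smooth_intros open_polydisc h1' h2)
   fix z m assume z: "z : polydisc c r'" show "wd (Inr m) (%z. h1 z + h2 z) z = v m z"
    using smooth_on_deriv[OF h1' z] smooth_on_deriv[OF h2(1) z] h2(2)[OF z] by(simp add: wirtinger_add u_def)
  qed
 qed
 from this[of UNIV r' r v, OF finite r v closed] show ?thesis by simp
qed

text \<open>The conjugate of \<open>dbar_poincare\<close>.\<close>

lemma d_poincare: fixes v :: "'n => complex^'n => complex" assumes r: "0 < r'" "r' < r" and v: "!!l. smooth_on (polydisc c r) (v l)"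
  and closed: "!!l m z. z : polydisc c r ==> wd (Inl m) (v l) z = wd (Inl l) (v m) z"
 shows "EX h. smooth_on (polydisc c r') h & (ALL z:polydisc c r'. ALL l. wd (Inl l) h z = v l z)"
proof - have "EX h. smooth_on (polydisc c r') h & (ALL z:polydisc c r'. ALL l. wd (Inr l) h z = cnj (v l z))"
 proof(rule dbar_poincare[OF r, where v = "%l z. cnj (v l z)"])
  fix l show "smooth_on (polydisc c r) (%z. cnj (v l z))" by(intro smooth_intros open_polydisc v)
 next fix l m z assume z: "z : polydisc c r"
  show "wd (Inr m) (%z. cnj (v l z)) z = wd (Inr l) (%z. cnj (v m z)) z"
   using closed[OF z] by(simp add: wirtinger_cnj smooth_on_deriv[OF v z])
 qed
 then obtain h where h: "smooth_on (polydisc c r') h" "!!z l. z:polydisc c r' ==> wd (Inr l) h z = cnj (v l z)" by blast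
 show ?thesis by(rule exI[of _ "%z. cnj (h z)"])
   (auto intro!: smooth_intros open_polydisc h simp: wirtinger_cnj smooth_on_deriv[OF h(1)] h(2))
qed

text \<open>The radial primitive of the form splits into a (0,1)-part \<beta> and a (1,0)-part
  \<gamma>, each closed for its own operator. Solving d-bar for the first and d for the second and
  adding the two solutions gives the potential.\<close>

lemma ddbar_poincare: fixes \<alpha> :: "'n => 'n => complex^'n => complex"
 assumes r: "0 < r'" "r' < r" and \<alpha>: "!!i l. smooth_on (polydisc c r) (\<alpha> i l)"
  and c1: "!!i k l z. z : polydisc c r ==> wd (Inl k) (\<alpha> i l) z = wd (Inl i) (\<alpha> k l) z"
  and c2: "!!i k l z. z : polydisc c r ==> wd (Inr k) (\<alpha> i l) z = wd (Inr l) (\<alpha> i k) z"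
 shows "EX g. smooth_on (polydisc c r') g & (ALL z:polydisc c r'. ALL i l. wd (Inr l) (wd (Inl i) g) z = \<alpha> i l z)"
proof - let ?D = "polydisc c r"
 interpret P: param_integral "0::real" 1 "%t. t" "%t. (1 - t) *R c" ?D ?D
 proof
  fix z and t :: real assume z: "z : ?D" and "t : cbox 0 1" hence t: "0 <= t" "t <= 1" by auto
  show "t *R z + (1 - t) *R c : ?D" unfolding polydisc_def
  proof(intro CollectI allI)
   fix i have "(t *R z + (1 - t) *R c) $ i - c $ i = t *R (z $ i - c $ i)" by(simp add: algebra_simps)
   hence "norm ((t *R z + (1 - t) *R c) $ i - c $ i) = t * norm (z $ i - c $ i)" using t by simp
   also have "... <= norm (z $ i - c $ i)" using t by(intro mult_left_le_one_le) auto
   also have "... < r" using z by(simp add: polydisc_def)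
   finally show "norm ((t *R z + (1 - t) *R c) $ i - c $ i) < r" .
  qed
 qed (auto simp: open_polydisc intro!: continuous_intros)
 define I where "I k F = param_int (cbox (0::real) 1) (%t. t) (%t. (1 - t) *R c) (%t. of_real (t ^ k)) F" for k F
 have ck: "continuous_on (cbox (0::real) 1) (%t. complex_of_real (t ^ k))" for k by(intro continuous_intros)
 have sI: "smooth_on ?D (I k F)" if "smooth_on ?D F" for k F unfolding I_def by(rule P.smooth_on_param_int[OF ck that])
 have wI: "wd A (I k F) z = I (Suc k) (wd A F) z" if "smooth_on ?D F" "z : ?D" for A k F z
 proof - have "wd A (I k F) z = param_int (cbox 0 1) (%t. t) (%t. (1 - t) *R c) (%t. of_real (t ^ k) * of_real t) (wd A F) z"
   unfolding I_def by(rule P.wirtinger_param_int[OF ck _ _ that(2)])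
    (use smooth_on_deriv[OF that(1)] smooth_on_continuous[OF smooth_on_wirtinger[OF open_polydisc that(1)]] in auto)
  thus ?thesis by(simp add: I_def mult.commute)
 qed
 have Icong: "I k F z = I k G z" if "!!w. w : ?D ==> F w = G w" "z : ?D" for k F G z
  unfolding I_def param_int_def by(rule integral_cong) (use that P.m in auto)
 have sc: "smooth_on ?D (%z. z $ i - c $ i)" "smooth_on ?D (%z. cnj (z $ i - c $ i))" for i by(intro smooth_intros open_polydisc)+
 have wc: "wd A (%z. z $ i - c $ i) z = (if A = Inl i then 1 else 0)"
  "wd A (%z. cnj (z $ i - c $ i)) z = (if A = Inr i then 1 else 0)" for A i z
 proof - have d: "(%z. z $ i) differentiable (at z)" "(%z. z $ i - c $ i) differentiable (at z)"
   by(rule smooth_on_deriv[of UNIV], auto intro!: smooth_intros)+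
  show 1: "wd A (%z. z $ i - c $ i) z = (if A = Inl i then 1 else 0)" for A using wirtinger_diff[OF d(1) differentiable_const] by simp
  show "wd A (%z. cnj (z $ i - c $ i)) z = (if A = Inr i then 1 else 0)" by(subst wirtinger_cnj[OF d(2)], subst 1, cases A) auto
 qed
 \<comment> \<open>Contraction of the form with the radial field in its holomorphic slot and, for
   \<gamma>, in its antiholomorphic slot; the weight t is the one of the homotopy operator on
   2-forms.\<close>
 define \<beta> where "\<beta> l z = (SS i. (z $ i - c $ i) * I 1 (\<alpha> i l) z)" for l z
 define \<gamma> where "\<gamma> k z = (SS l. cnj (z $ l - c $ l) * I 1 (\<alpha> k l) z)" for k z
 have s\<beta>: "smooth_on ?D (\<beta> l)" and s\<gamma>: "smooth_on ?D (\<gamma> l)" for l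
  unfolding \<beta>_def \<gamma>_def by(intro smooth_intros open_polydisc sI \<alpha>)+
 have w\<beta>: "wd A (\<beta> l) z = (SS i. (if A = Inl i then I 1 (\<alpha> i l) z else 0) + (z $ i - c $ i) * I 2 (wd A (\<alpha> i l)) z)"
  and w\<gamma>: "wd A (\<gamma> l) z = (SS i. (if A = Inr i then I 1 (\<alpha> l i) z else 0) + cnj (z $ i - c $ i) * I 2 (wd A (\<alpha> l i)) z)"
  if z: "z : ?D" for A l z
 proof - have d: "I 1 (\<alpha> i l) differentiable (at z)" for i l by(rule smooth_on_deriv[OF sI[OF \<alpha>] z])
  have d': "(%z. z $ i - c $ i) differentiable (at z)" "(%z. cnj (z $ i - c $ i)) differentiable (at z)" for i
   using smooth_on_deriv[OF sc(1) z] smooth_on_deriv[OF sc(2) z] by auto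
  have dm: "(%z. (z $ i - c $ i) * I 1 (\<alpha> j l) z) differentiable (at z)" "(%z. cnj (z $ i - c $ i) * I 1 (\<alpha> j l) z) differentiable (at z)" for i j l
   using d d' by(auto intro!: differentiable_mult)
  show "wd A (\<beta> l) z = (SS i. (if A = Inl i then I 1 (\<alpha> i l) z else 0) + (z $ i - c $ i) * I 2 (wd A (\<alpha> i l)) z)"
   unfolding \<beta>_def by(subst wirtinger_sum[OF dm(1)], rule sum.cong[OF refl], subst wirtinger_mult[OF d'(1) d], subst wc, subst wI[OF \<alpha> z]) (simp add: numeral_2_eq_2)
  show "wd A (\<gamma> l) z = (SS i. (if A = Inr i then I 1 (\<alpha> l i) z else 0) + cnj (z $ i - c $ i) * I 2 (wd A (\<alpha> l i)) z)"
   unfolding \<gamma>_def by(subst wirtinger_sum[OF dm(2)], rule sum.cong[OF refl], subst wirtinger_mult[OF d'(2) d], subst wc, subst wI[OF \<alpha> z]) (simp add: numeral_2_eq_2)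
 qed
 have c\<beta>: "wd (Inr m) (\<beta> l) z = wd (Inr l) (\<beta> m) z" if z: "z : ?D" for l m z
  unfolding w\<beta>[OF z] by(auto intro!: sum.cong Icong[OF _ z] c2)
 have c\<gamma>: "wd (Inl m) (\<gamma> l) z = wd (Inl l) (\<gamma> m) z" if z: "z : ?D" for l m z
  unfolding w\<gamma>[OF z] by(auto intro!: sum.cong Icong[OF _ z] c1)
 \<comment> \<open>Integrate the t-derivative of t^2 \<alpha> along the segment from the centre to
   \<open>z\<close>.\<close>
 have main: "wd (Inl k) (\<beta> l) z + wd (Inr l) (\<gamma> k) z = \<alpha> k l z" if z: "z : ?D" for k l z
 proof - let ?p = "%t::real. t *R z + (1 - t) *R c"
  let ?F = "%t. (SS A. wd A (\<alpha> k l) (?p t) * wcomp A (z - c))"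
  have ftc: "((%t. of_real (2 * t) * \<alpha> k l (?p t) + of_real (t^2) * ?F t) has_integral
    (of_real (1^2) * \<alpha> k l (?p 1) - of_real (0^2) * \<alpha> k l (?p 0))) {0..1}"
  proof(rule fundamental_theorem_of_calculus)
   fix t :: real assume t: "t : {0..1}"
   have "(?p has_derivative (%h. h *R (z - c))) (at t)" by(auto intro!: derivative_eq_intros simp: algebra_simps)
   moreover have "\<alpha> k l differentiable (at (?p t))" using smooth_on_deriv[OF \<alpha> P.m[OF z, of t]] t by auto
   ultimately have "((%t. \<alpha> k l (?p t)) has_derivative (%h. SS A. wd A (\<alpha> k l) (?p t) * wcomp A (h *R (z - c)))) (at t)"
    using has_derivative_compose[OF _ has_derivative_wirtinger] by blast
   hence 1: "((%t. \<alpha> k l (?p t)) has_vector_derivative ?F t) (at t)" unfolding has_vector_derivative_def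
    by(rule has_derivative_eq_rhs) (simp add: fun_eq_iff wcomp_scaleR scaleR_sum_right scaleR_conv_of_real[where 'a=complex] sum_distrib_left mult_ac)
   have 2: "((%t. complex_of_real (t^2)) has_vector_derivative of_real (2 * t)) (at t)"
    by(auto intro!: derivative_eq_intros simp: has_vector_derivative_def scaleR_conv_of_real fun_eq_iff)
   have "((%t. of_real (t^2) * \<alpha> k l (?p t)) has_vector_derivative (of_real (t^2) * ?F t + of_real (2 * t) * \<alpha> k l (?p t))) (at t)"
    by(rule has_vector_derivative_mult[OF 2 1])
   thus "((%t. of_real (t^2) * \<alpha> k l (?p t)) has_vector_derivative (of_real (2 * t) * \<alpha> k l (?p t) + of_real (t^2) * ?F t)) (at t within {0..1})"
    by(simp add: add.commute has_vector_derivative_at_within)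
  qed simp
  have ii: "(%t. of_real (t ^ j) * F (?p t)) integrable_on {0..1}" if "smooth_on ?D F" for j F
   using P.integrable_integrand[OF ck[of j] smooth_on_continuous[OF that] z] by simp
  have "I 1 (\<alpha> k l) z + I 1 (\<alpha> k l) z + (SS A. I 2 (wd A (\<alpha> k l)) z * wcomp A (z - c)) = \<alpha> k l z"
  proof - have "((%t. (of_real (t^1) * \<alpha> k l (?p t) + of_real (t^1) * \<alpha> k l (?p t)) +
     (SS A. of_real (t^2) * wd A (\<alpha> k l) (?p t) * wcomp A (z - c))) has_integral
     (I 1 (\<alpha> k l) z + I 1 (\<alpha> k l) z) + (SS A. I 2 (wd A (\<alpha> k l)) z * wcomp A (z - c))) {0..1}"
    unfolding I_def param_int_def cbox_interval
    by(intro has_integral_add has_integral_sum has_integral_mult_left integrable_integral ii \<alpha> smooth_on_wirtinger open_polydisc) auto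
   moreover have "((%t. (of_real (t^1) * \<alpha> k l (?p t) + of_real (t^1) * \<alpha> k l (?p t)) +
     (SS A. of_real (t^2) * wd A (\<alpha> k l) (?p t) * wcomp A (z - c))) has_integral \<alpha> k l z) {0..1}"
    by(rule has_integral_eq_rhs[OF has_integral_eq[OF _ ftc]]) (auto simp: sum_distrib_left mult.assoc)
   ultimately show ?thesis using has_integral_unique by blast
  qed
  moreover have "wd (Inl k) (\<beta> l) z = I 1 (\<alpha> k l) z + (SS i. (z $ i - c $ i) * I 2 (wd (Inl i) (\<alpha> k l)) z)"
   unfolding w\<beta>[OF z] by(auto simp: sum.distrib intro!: sum.cong Icong[OF _ z] c1)
  moreover have "wd (Inr l) (\<gamma> k) z = I 1 (\<alpha> k l) z + (SS i. cnj (z $ i - c $ i) * I 2 (wd (Inr i) (\<alpha> k l)) z)"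
   unfolding w\<gamma>[OF z] by(auto simp: sum.distrib intro!: sum.cong Icong[OF _ z] c2)
  ultimately show ?thesis by(simp add: sum_UNIV_sum mult.commute)
 qed
 obtain h1 where h1: "smooth_on (polydisc c r') h1" "!!z l. z:polydisc c r' ==> wd (Inr l) h1 z = \<beta> l z"
  using dbar_poincare[OF r s\<beta> c\<beta>] by blast
 obtain h2 where h2: "smooth_on (polydisc c r') h2" "!!z l. z:polydisc c r' ==> wd (Inl l) h2 z = \<gamma> l z"
  using d_poincare[OF r s\<gamma> c\<gamma>] by blast
 have sub: "polydisc c r' \<subseteq> ?D" using r by(intro polydisc_mono) auto
 let ?D' = "polydisc c r'" show ?thesis
 proof(intro exI[of _ "%z. h1 z + h2 z"] conjI ballI allI)
  show "smooth_on ?D' (%z. h1 z + h2 z)" by(intro smooth_intros open_polydisc h1 h2)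
  fix z i l assume z: "z : ?D'" have "wd (Inr l) (wd (Inl i) (%z. h1 z + h2 z)) z = wd (Inr l) (%z. wd (Inl i) h1 z + wd (Inl i) h2 z) z"
   by(rule wirtinger_cong[OF open_polydisc z])
    (auto intro!: wirtinger_add smooth_on_deriv[OF h1(1)] smooth_on_deriv[OF h2(1)])
  also have "... = wd (Inr l) (wd (Inl i) h1) z + wd (Inr l) (wd (Inl i) h2) z"
   by(auto intro!: wirtinger_add smooth_on_deriv[OF _ z] smooth_on_wirtinger open_polydisc h1 h2)
  also have "wd (Inr l) (wd (Inl i) h1) z = wd (Inl i) (wd (Inr l) h1) z" by(rule wirtinger_commute[OF open_polydisc h1(1) z])
  also have "... = wd (Inl i) (\<beta> l) z" by(rule wirtinger_cong[OF open_polydisc z h1(2)])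
  also have "wd (Inr l) (wd (Inl i) h2) z = wd (Inr l) (\<gamma> i) z" by(rule wirtinger_cong[OF open_polydisc z h2(2)])
  finally show "wd (Inr l) (wd (Inl i) (%z. h1 z + h2 z)) z = \<alpha> i l z" using main z sub by auto
 qed
qed

section \<open>Germs of smooth functions\<close>

definition smooth_at :: "complex^'n => (complex^'n => complex) => bool" where
 "smooth_at z f \<longleftrightarrow> (EX V. open V & z : V & smooth_on V f)"

lemma smooth_atE: assumes "smooth_at z f" "smooth_at z g" obtains V where "open V" "z : V" "smooth_on V f" "smooth_on V g"
proof - obtain V W where "open V" "z : V" "smooth_on V f" "open W" "z : W" "smooth_on W g" using assms by(auto simp: smooth_at_def)
 thus ?thesis using that[of "V \<inter> W"] by(auto intro: smooth_on_subset)
qed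

lemma smooth_atI: "smooth_on V f ==> open V ==> z : V ==> smooth_at z f" by(auto simp: smooth_at_def)

named_theorems smooth_at_intros

lemma smooth_at_const [smooth_at_intros]: "smooth_at z (%_. c)" by(rule smooth_atI[of UNIV]) (auto intro: smooth_intros)

lemma smooth_at_add [smooth_at_intros]: "smooth_at z f ==> smooth_at z g ==> smooth_at z (%w. f w + g w)"
 by(rule smooth_atE, assumption, assumption) (rule smooth_atI[OF smooth_on_add], assumption+)

lemma smooth_at_diff [smooth_at_intros]: "smooth_at z f ==> smooth_at z g ==> smooth_at z (%w. f w - g w)"
 by(rule smooth_atE, assumption, assumption) (rule smooth_atI[OF smooth_on_diff], assumption+)

lemma smooth_at_mult [smooth_at_intros]: "smooth_at z f ==> smooth_at z g ==> smooth_at z (%w. f w * g w)"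
 by(rule smooth_atE, assumption, assumption) (rule smooth_atI[OF smooth_on_mult], assumption+)

lemma smooth_at_minus [smooth_at_intros]: "smooth_at z f ==> smooth_at z (%w. - f w)" unfolding smooth_at_def by(blast intro: smooth_intros)

lemma smooth_at_cnj [smooth_at_intros]: "smooth_at z f ==> smooth_at z (%w. cnj (f w))"
 unfolding smooth_at_def by(blast intro: smooth_intros)

lemma smooth_at_scaleR [smooth_at_intros]: "smooth_at z f ==> smooth_at z (%w. r *R f w)"
 unfolding smooth_at_def by(blast intro: smooth_intros)

lemma smooth_at_wirtinger [smooth_at_intros]: "smooth_at z f ==> smooth_at z (wd A f)"
 unfolding smooth_at_def by(blast intro: smooth_intros)

lemma smooth_at_component [smooth_at_intros]: "smooth_at z (%w. w $ i)" by(rule smooth_atI[of UNIV]) (auto intro: smooth_intros)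

lemma smooth_at_sum [smooth_at_intros]: "(!!i. i : I ==> smooth_at z (f i)) ==> smooth_at z (%w. SUM i:I. f i w)"
 by(induction I rule: fin_induct) (auto intro: smooth_at_intros)

lemma smooth_at_differentiable: "smooth_at z f ==> f differentiable (at z)" by(auto simp: smooth_at_def smooth_on_deriv)

lemma smooth_at_eventually: "smooth_at z f ==> near z (%w. smooth_at w f)" by(auto simp: smooth_at_def eventually_nhds)

lemma smooth_at_cong: assumes "smooth_at z f" "near z (%w. f w = g w)" shows "smooth_at z g"
proof - obtain V W where "open V" "z : V" "smooth_on V f" "open W" "z : W" "ALL w:W. f w = g w"
  using assms by(auto simp: smooth_at_def eventually_nhds)
 thus ?thesis by(intro smooth_atI[of "V \<inter> W"]) (auto intro: smooth_on_cong[OF smooth_on_subset[of V f]])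
qed

lemma wirtinger_eventually_cong: "near z (%w. f w = g w) ==> wd A f z = wd A g z" unfolding eventually_nhds using wirtinger_cong by metis

lemma eventually_wirtinger_cong: "near z (%w. f w = g w) ==> near z (%w. wd A f w = wd A g w)"
 unfolding eventually_nhds using wirtinger_cong by metis

lemma smooth_at_translate: assumes "smooth_at (z + a) f" shows "smooth_at a (%w. f (z + w))"
proof - obtain V where V: "open V" "z + a : V" "smooth_on V f" using assms by(auto simp: smooth_at_def)
 have o: "open ((+) z -` V)" using V(1) by(intro open_vimage continuous_intros)
 show ?thesis by(rule smooth_atI[OF smooth_on_compose[OF o V(1,3)] o]) (use V in \<open>auto intro!: smooth_intros o\<close>)
qed

lemma wirtinger_translate: assumes "smooth_at (z + w) f" shows "wd A (%w. f (z + w)) w = wd A f (z + w)"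
proof - have "((%w. z + w) has_derivative (%v. v)) (at w)" by(auto intro!: derivative_eq_intros)
 from has_derivative_compose[OF this has_derivative_wirtinger[OF smooth_at_differentiable[OF assms]]]
 show ?thesis by(rule wirtinger_eqI)
qed

lemma eventually_nhds_translate: fixes z :: "'a::real_normed_vector"
 shows "(\<forall>\<^sub>F w in nhds 0. P (z + w)) \<longleftrightarrow> (\<forall>\<^sub>F w in nhds z. P w)"
proof - have "nhds z = filtermap ((+) z) (nhds 0)" using filtermap_nhds_shift[of "-z" 0] by(simp add: add.commute[of _ z])
 thus ?thesis by(simp add: eventually_filtermap)
qed

text \<open>All germs are placed at the origin, so that one type serves every base point;
  \<open>germ z\<close> translates \<open>z\<close> to 0. The relation is partial because only
  functions smooth near 0 have germs.\<close>

definition germ_rel :: "(complex^'n => complex) => (complex^'n => complex) => bool" where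
 "germ_rel f g \<longleftrightarrow> smooth_at 0 f & smooth_at 0 g & (\<forall>\<^sub>F w in nhds 0. f w = g w)"

quotient_type 'n germ = "complex^('n::finite) => complex" / partial: germ_rel
proof(rule part_equivpI)
 show "EX f. germ_rel f f" by(rule exI[of _ "%_. 0"]) (simp add: germ_rel_def smooth_at_intros)
 show "symp germ_rel" by(auto simp: symp_def germ_rel_def eq_commute)
 show "transp germ_rel" by(auto simp: transp_def germ_rel_def elim: eventually_elim2)
qed

text \<open>Real scalars are included because the expansions of differential operators divide by
  factorials.\<close>

instantiation germ :: (finite) "{comm_ring_1, real_algebra_1}" begin

lift_definition zero_germ :: "'a germ" is "%_. 0" by(simp add: germ_rel_def smooth_at_intros)
lift_definition one_germ :: "'a germ" is "%_. 1" by(simp add: germ_rel_def smooth_at_intros)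
lift_definition plus_germ :: "'a germ => 'a germ => 'a germ" is "%f g z. f z + g z"
 by(auto simp: germ_rel_def intro: smooth_at_intros elim: eventually_elim2)
lift_definition minus_germ :: "'a germ => 'a germ => 'a germ" is "%f g z. f z - g z"
 by(auto simp: germ_rel_def intro: smooth_at_intros elim: eventually_elim2)
lift_definition times_germ :: "'a germ => 'a germ => 'a germ" is "%f g z. f z * g z"
 by(auto simp: germ_rel_def intro: smooth_at_intros elim: eventually_elim2)
lift_definition uminus_germ :: "'a germ => 'a germ" is "%f z. - f z"
 by(auto simp: germ_rel_def intro: smooth_at_intros elim: eventually_mono)
lift_definition scaleR_germ :: "real => 'a germ => 'a germ" is "%r f z. r *R f z"
 by(auto simp: germ_rel_def intro: smooth_at_intros elim: eventually_mono)

instance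
proof
 fix a b c :: "'a germ" and r s :: real
 show "a * b * c = a * (b * c)" by transfer (auto simp: germ_rel_def mult.assoc intro!: smooth_at_intros)
 show "a * b = b * a" by transfer (auto simp: germ_rel_def mult.commute intro!: smooth_at_intros)
 show "1 * a = a" by transfer (auto simp: germ_rel_def intro!: smooth_at_intros)
 show "a * 1 = a" by transfer (auto simp: germ_rel_def intro!: smooth_at_intros)
 show "a + b + c = a + (b + c)" by transfer (auto simp: germ_rel_def add.assoc intro!: smooth_at_intros)
 show "a + b = b + a" by transfer (auto simp: germ_rel_def add.commute intro!: smooth_at_intros)
 show "0 + a = a" by transfer (auto simp: germ_rel_def intro!: smooth_at_intros)
 show "- a + a = 0" by transfer (auto simp: germ_rel_def intro!: smooth_at_intros)
 show "a - b = a + - b" by transfer (auto simp: germ_rel_def intro!: smooth_at_intros)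
 show "(a + b) * c = a * c + b * c" by transfer (auto simp: germ_rel_def algebra_simps intro!: smooth_at_intros)
 show "a * (b + c) = a * b + a * c" by transfer (auto simp: germ_rel_def algebra_simps intro!: smooth_at_intros)
 show "(0::'a germ) ~= 1" by transfer (auto simp: germ_rel_def eventually_nhds)
 show "r *R (a + b) = r *R a + r *R b" by transfer (auto simp: germ_rel_def algebra_simps intro!: smooth_at_intros)
 show "(r + s) *R a = r *R a + s *R a" by transfer (auto simp: germ_rel_def algebra_simps intro!: smooth_at_intros)
 show "r *R s *R a = (r * s) *R a" by transfer (auto simp: germ_rel_def intro!: smooth_at_intros)
 show "1 *R a = a" by transfer (auto simp: germ_rel_def intro!: smooth_at_intros)
 show "r *R a * b = r *R (a * b)" by transfer (auto simp: germ_rel_def intro!: smooth_at_intros)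
 show "a * r *R b = r *R (a * b)" by transfer (auto simp: germ_rel_def intro!: smooth_at_intros)
qed

end

lift_definition gconst :: "complex => 'n::finite germ" is "%c _. c" by(simp add: germ_rel_def smooth_at_intros)

lift_definition gD :: "'n + 'n => 'n::finite germ => 'n germ" is wd
 by(auto simp: germ_rel_def intro: smooth_at_intros eventually_wirtinger_cong)

lift_definition gev :: "'n::finite germ => complex" is "%f. f 0" by(auto simp: germ_rel_def eventually_nhds)

definition germ :: "complex^'n => (complex^'n => complex) => 'n::finite germ" where "germ z f = abs_germ (%w. f (z + w))"

lemma germ_rel_translate: "smooth_at z f ==> germ_rel (%w. f (z + w)) (%w. f (z + w))"
 using smooth_at_translate[of z 0 f] by(simp add: germ_rel_def)

lemma germ_eq_iff: assumes "smooth_at z f" "smooth_at z g"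
 shows "germ z f = germ z g \<longleftrightarrow> (\<forall>\<^sub>F w in nhds z. f w = g w)"
 using Quotient3_rel[OF Quotient3_germ, of "%w. f (z + w)" "%w. g (z + w)"]
  germ_rel_translate[OF assms(1)] germ_rel_translate[OF assms(2)] eventually_nhds_translate[of "%w. f w = g w" z]
 by(auto simp: germ_def germ_rel_def)

lemma germ_exhaust: obtains f where "smooth_at z f" "G = germ z f"
proof - define h where "h = rep_germ G"
 have h: "germ_rel h h" "abs_germ h = G"
  unfolding h_def using Quotient3_rep_reflp[OF Quotient3_germ] Quotient3_abs_rep[OF Quotient3_germ] by auto
 have "smooth_at (- z + z) h" using h by(simp add: germ_rel_def)
 from smooth_at_translate[OF this] show ?thesis using h by(intro that[of "%w. h (- z + w)"]) (auto simp: germ_def)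
qed

lemma germ_const: "germ z (%_. c) = gconst c" by(simp add: germ_def gconst.abs_eq)

lemma germ_zero: "germ z (%_. 0) = 0" and germ_one: "germ z (%_. 1) = 1" by(simp_all add: germ_def zero_germ.abs_eq one_germ.abs_eq)

lemma germ_add: "smooth_at z f ==> smooth_at z g ==> germ z (%w. f w + g w) = germ z f + germ z g"
 by(simp add: germ_def plus_germ.abs_eq germ_rel_translate)

lemma germ_diff: "smooth_at z f ==> smooth_at z g ==> germ z (%w. f w - g w) = germ z f - germ z g"
 by(simp add: germ_def minus_germ.abs_eq germ_rel_translate)

lemma germ_mult: "smooth_at z f ==> smooth_at z g ==> germ z (%w. f w * g w) = germ z f * germ z g"
 by(simp add: germ_def times_germ.abs_eq germ_rel_translate)

lemma germ_minus: "smooth_at z f ==> germ z (%w. - f w) = - germ z f" by(simp add: germ_def uminus_germ.abs_eq germ_rel_translate)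

lemma germ_cong: "smooth_at z f ==> \<forall>\<^sub>F w in nhds z. f w = g w ==> germ z f = germ z g"
 using germ_eq_iff smooth_at_cong by blast

lemma germ_sum: "(!!i. i : I ==> smooth_at z (f i)) ==> germ z (%w. SUM i:I. f i w) = (SUM i:I. germ z (f i))"
 by(induction I rule: fin_induct) (auto simp: germ_zero germ_add smooth_at_intros)

lemma germ_wirtinger: assumes "smooth_at z f" shows "germ z (wd A f) = gD A (germ z f)"
proof - have "gD A (germ z f) = abs_germ (wd A (%w. f (z + w)))" by(simp add: germ_def gD.abs_eq germ_rel_translate[OF assms])
 also have "... = germ 0 (wd A (%w. f (z + w)))" by(simp add: germ_def)
 also have "... = germ 0 (%w. wd A f (z + w))"
 proof(rule germ_cong)
  show "smooth_at 0 (wd A (%w. f (z + w)))" using assms by(intro smooth_at_intros smooth_at_translate) simp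
  show "near 0 (%w. wd A (%w. f (z + w)) w = wd A f (z + w))"
   using eventually_nhds_translate[THEN iffD2, OF smooth_at_eventually[OF assms]] by eventually_elim (rule wirtinger_translate)
 qed
 finally show ?thesis by(simp add: germ_def)
qed

lemma gev_germ: "smooth_at z f ==> gev (germ z f) = f z" by(simp add: germ_def gev.abs_eq germ_rel_translate)

lemma gev_simps [simp]: "gev 0 = 0" "gev 1 = 1" "gev (a + b) = gev a + gev b" "gev (a - b) = gev a - gev b"
 "gev (a * b) = gev a * gev b" "gev (- a) = - gev a" "gev (r *R a) = r *R gev a" "gev (gconst c) = c" by(transfer, force)+

lemma gev_sum: "gev (sum f I) = (SUM i:I. gev (f i))" by(induction I rule: fin_induct) auto

lemma gconst_simps [simp]: "gconst 0 = 0" "gconst 1 = 1" by(transfer, force simp: germ_rel_def smooth_at_intros)+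

lemma gD_const [simp]: "gD A (gconst c) = 0" by transfer (simp add: germ_rel_def smooth_at_intros)

lemma gD_zero [simp]: "gD A 0 = 0" and gD_one [simp]: "gD A 1 = 0" using gD_const[of A 0] gD_const[of A 1] by simp_all

lemma gD_add: "gD A (f + g) = gD A f + gD A g"
proof - obtain f' g' where f: "smooth_at 0 f'" "f = germ 0 f'" and g: "smooth_at 0 g'" "g = germ 0 g'" by(metis germ_exhaust)
 have "germ 0 (wd A (%w. f' w + g' w)) = germ 0 (%w. wd A f' w + wd A g' w)" by(rule germ_cong, intro smooth_at_intros f g)
   (use smooth_at_eventually[OF f(1)] smooth_at_eventually[OF g(1)] in \<open>eventually_elim, auto intro: wirtinger_add smooth_at_differentiable\<close>)
 thus ?thesis using f g by(simp add: germ_wirtinger germ_add smooth_at_intros)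
qed

lemma gD_mult: "gD A (f * g) = gD A f * g + f * gD A g"
proof - obtain f' g' where f: "smooth_at 0 f'" "f = germ 0 f'" and g: "smooth_at 0 g'" "g = germ 0 g'" by(metis germ_exhaust)
 have "germ 0 (wd A (%w. f' w * g' w)) = germ 0 (%w. wd A f' w * g' w + f' w * wd A g' w)" by(rule germ_cong, intro smooth_at_intros f g)
   (use smooth_at_eventually[OF f(1)] smooth_at_eventually[OF g(1)] in \<open>eventually_elim, auto intro: wirtinger_mult smooth_at_differentiable\<close>)
 thus ?thesis using f g by(simp add: germ_wirtinger germ_add germ_mult smooth_at_intros)
qed

lemma gD_commute: "gD A (gD B f) = gD B (gD A f)"
proof - obtain f' where f: "smooth_at 0 f'" "f = germ 0 f'" by(metis germ_exhaust)
 obtain V where V: "open V" "0 : V" "smooth_on V f'" using f by(auto simp: smooth_at_def)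
 have "germ 0 (wd A (wd B f')) = germ 0 (wd B (wd A f'))" by(rule germ_cong, intro smooth_at_intros f)
   (use V in \<open>auto simp: eventually_nhds intro!: exI[of _ V] wirtinger_commute\<close>)
 thus ?thesis using f by(simp add: germ_wirtinger smooth_at_intros)
qed

lemma gD_minus: "gD A (- f) = - gD A f" using gD_add[of A f "- f"] by(simp add: eq_neg_iff_add_eq_0 add.commute)

lemma gD_diff: "gD A (f - g) = gD A f - gD A g" using gD_add[of A f "- g"] by(simp add: gD_minus)

lemma gD_sum: "gD A (sum f I) = (SUM i:I. gD A (f i))" by(induction I rule: fin_induct) (auto simp: gD_add)

lemma scaleR_germ_conv: "r *R f = gconst (of_real r) * f"
 by transfer (auto simp: germ_rel_def scaleR_conv_of_real intro!: smooth_at_intros)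

lemma gD_scaleR: "gD A (r *R f) = r *R gD A f" by(simp add: scaleR_germ_conv gD_mult)

text \<open>For \<open>z = 0\<close> these are the coordinates centred at the base point, and that
  is the case used on germs at every point.\<close>

definition gcoord :: "complex^'n::finite => 'n + 'n => 'n germ" where "gcoord z A = germ z (wcomp A)"

lemma smooth_at_wcomp: "smooth_at z (wcomp A)"
 by(rule smooth_atI[OF smooth_on_bounded_linear[OF bounded_linear_wcomp open_UNIV] open_UNIV UNIV_I])

lemma gD_gcoord: "gD B (gcoord z A) = (if A = B then 1 else 0)"
proof - have "wd B (wcomp A) w = (if A = B then 1 else 0)" for w :: "complex^'a"
  by(rule wirtinger_eqI[where c = "%B. if A = B then 1 else 0"], rule has_derivative_eq_rhs,
    rule bounded_linear_imp_has_derivative[OF bounded_linear_wcomp]) (auto simp: fun_eq_iff if_distrib[of "%x. x * _"] cong: if_cong)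
 hence "wd B (wcomp A) = (%_. if A = B then 1 else 0 :: complex)" by auto
 thus ?thesis using germ_wirtinger[OF smooth_at_wcomp[of z A], of B] by(simp add: gcoord_def germ_zero germ_one split: if_splits)
qed

text \<open>Finitely many germs have representatives on a common polydisc, where
  \<open>d_poincare\<close> applies after halving the radius.\<close>

lemma germ_d_poincare: fixes \<rho> :: "'n::finite => 'n germ"
 assumes "!!i k. gD (Inl k) (\<rho> i) = gD (Inl i) (\<rho> k)" obtains u where "!!i. gD (Inl i) u = \<rho> i"
proof - have "EX f. smooth_at 0 f & \<rho> i = germ 0 f" for i by(metis germ_exhaust)
 then obtain f where f: "!!i. smooth_at 0 (f i)" "!!i. \<rho> i = germ 0 (f i)" by metis
 have "near 0 (%w. wd (Inl k) (f i) w = wd (Inl i) (f k) w)" for i k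
  using assms[of k i] f by(simp add: germ_wirtinger[symmetric] germ_eq_iff smooth_at_intros)
 hence "near 0 (%w. ALL k i. wd (Inl k) (f i) w = wd (Inl i) (f k) w)" by(simp add: eventually_all_finite)
 then obtain V where V: "open V" "0 : V" "!!w k i. w : V ==> wd (Inl k) (f i) w = wd (Inl i) (f k) w" unfolding eventually_nhds by blast
 obtain W where W: "!!i. open (W i)" "!!i. 0 : W i" "!!i. smooth_on (W i) (f i)" using f(1) unfolding smooth_at_def by metis
 have "open (V \<inter> (INT i:UNIV. W i))" using V W by(intro open_Int open_INT) auto
 moreover have "0 : V \<inter> (INT i:UNIV. W i)" using V W by auto
 ultimately obtain e where e: "e > 0" "ball 0 e \<subseteq> V \<inter> (INT i:UNIV. W i)" using openE by blast
 obtain r where r: "r > 0" "polydisc (0::complex^'n) r \<subseteq> ball 0 e" using polydisc_subset_ball[OF e(1)] by blast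
 have sub: "polydisc (0::complex^'n) r \<subseteq> V" "!!i. polydisc (0::complex^'n) r \<subseteq> W i" using r e by auto
 have "EX h. smooth_on (polydisc 0 (r/2)) h & (ALL z:polydisc 0 (r/2). ALL l. wd (Inl l) h z = f l z)"
  by(rule d_poincare[where r = r]) (use r sub V(3) smooth_on_subset[OF W(3) sub(2)] in auto)
 then obtain h where h: "smooth_on (polydisc 0 (r/2)) h" "!!z l. z:polydisc 0 (r/2) ==> wd (Inl l) h z = f l z" by blast
 have P: "open (polydisc (0::complex^'n) (r/2))" "0 : polydisc (0::complex^'n) (r/2)" using open_polydisc center_in_polydisc[of "r/2"] r by auto
 have sh: "smooth_at 0 h" by(rule smooth_atI[OF h(1) P])
 have "gD (Inl l) (germ 0 h) = \<rho> l" for l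
  using P h(2) f sh by(auto simp: germ_wirtinger[symmetric] germ_eq_iff smooth_at_intros eventually_nhds)
 thus ?thesis by(rule that)
qed

subsection \<open>Formal power series of germs\<close>

definition fD :: "'n + 'n => 'n::finite germ fps => 'n germ fps" where "fD A F = Abs_fps (%n. gD A (F $ n))"

lemma fD_nth [simp]: "fD A F $ n = gD A (F $ n)" by(simp add: fD_def)

lemma fD_zero [simp]: "fD A 0 = 0" by(simp add: fps_eq_iff)

lemma fD_one [simp]: "fD A 1 = 0" by(simp add: fps_eq_iff fps_one_nth)

lemma fD_add: "fD A (F + G) = fD A F + fD A G" by(simp add: fps_eq_iff gD_add)

lemma fD_minus: "fD A (- F) = - fD A F" by(simp add: fps_eq_iff gD_minus)

lemma fD_diff: "fD A (F - G) = fD A F - fD A G" by(simp add: fps_eq_iff gD_diff)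

lemma fD_sum: "fD A (sum f I) = (SUM i:I. fD A (f i))" by(induction I rule: fin_induct) (auto simp: fD_add)

lemma fD_mult: "fD A (F * G) = fD A F * G + F * fD A G" by(simp add: fps_eq_iff fps_mult_nth gD_sum gD_mult sum.distrib)

lemma fD_commute: "fD A (fD B F) = fD B (fD A F)" by(simp add: fps_eq_iff gD_commute)

lemma fD_X [simp]: "fD A fps_X = 0" by(simp add: fps_eq_iff fps_X_nth)

lemma fD_fps_const [simp]: "fD A (cst c) = cst (gD A c)" by(simp add: fps_eq_iff)

definition fgerm :: "complex^'n => (complex^'n => complex fps) => 'n::finite germ fps" where
 "fgerm z F = Abs_fps (%n. germ z (%w. F w $ n))"

definition fev :: "'n::finite germ fps => complex fps" where "fev F = Abs_fps (%n. gev (F $ n))"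

definition fsmooth_at :: "complex^'n => (complex^'n => complex fps) => bool" where
 "fsmooth_at z F \<longleftrightarrow> (ALL n. smooth_at z (%w. F w $ n))"

lemma fgerm_nth [simp]: "fgerm z F $ n = germ z (%w. F w $ n)" by(simp add: fgerm_def)

lemma fev_nth [simp]: "fev F $ n = gev (F $ n)" by(simp add: fev_def)

lemma fev_simps [simp]: "fev 0 = 0" "fev 1 = 1" "fev (a + b) = fev a + fev b" "fev (a - b) = fev a - fev b"
 "fev (a * b) = fev a * fev b" "fev (- a) = - fev a" "fev (cst c) = cst (gev c)" "fev fps_X = fps_X"
 by(simp_all add: fps_eq_iff fps_mult_nth gev_sum fps_one_nth fps_X_nth)

lemma fev_sum: "fev (sum f I) = (SUM i:I. fev (f i))" by(induction I rule: fin_induct) auto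

lemma fev_fgerm: "fsmooth_at z F ==> fev (fgerm z F) = F z" by(simp add: fps_eq_iff fsmooth_at_def gev_germ)

lemma fgerm_fwirtinger: "fsmooth_at z F ==> fgerm z (fwd A F) = fD A (fgerm z F)"
 by(simp add: fps_eq_iff fsmooth_at_def fwirtinger_def germ_wirtinger)

lemma fwirtinger_fev: "fsmooth_at z F ==> fwd A F z = fev (fD A (fgerm z F))"
 by(simp add: fps_eq_iff fsmooth_at_def fwirtinger_def germ_wirtinger[symmetric] gev_germ smooth_at_intros)

lemma fsmooth_at_fwirtinger: "fsmooth_at z F ==> fsmooth_at z (fwd A F)" by(simp add: fsmooth_at_def fwirtinger_def smooth_at_intros)

lemma fsmooth_at_add: "fsmooth_at z F ==> fsmooth_at z G ==> fsmooth_at z (%w. F w + G w)" by(simp add: fsmooth_at_def smooth_at_intros)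

lemma fsmooth_at_diff: "fsmooth_at z F ==> fsmooth_at z G ==> fsmooth_at z (%w. F w - G w)" by(simp add: fsmooth_at_def smooth_at_intros)

lemma fsmooth_at_minus: "fsmooth_at z F ==> fsmooth_at z (%w. - F w)" by(simp add: fsmooth_at_def smooth_at_intros)

lemma fsmooth_at_mult: "fsmooth_at z F ==> fsmooth_at z G ==> fsmooth_at z (%w. F w * G w)"
 by(simp add: fsmooth_at_def fps_mult_nth smooth_at_intros)

lemma fsmooth_at_sum: "(!!i. i : I ==> fsmooth_at z (f i)) ==> fsmooth_at z (%w. SUM i:I. f i w)"
 by(simp add: fsmooth_at_def fps_sum_nth smooth_at_intros)

lemma fsmooth_at_const: "fsmooth_at z (%_. c)" by(simp add: fsmooth_at_def smooth_at_intros)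

lemma fsmooth_at_fps_const: "smooth_at z f ==> fsmooth_at z (%w. cst (f w))" unfolding fsmooth_at_def
proof
 fix n assume "smooth_at z f" thus "smooth_at z (%w. cst (f w) $ n)" by(cases "n = 0") (simp_all add: smooth_at_intros)
qed

lemmas fsmooth_at_intros = fsmooth_at_fwirtinger fsmooth_at_add fsmooth_at_diff fsmooth_at_minus
 fsmooth_at_mult fsmooth_at_sum fsmooth_at_const fsmooth_at_fps_const

lemma fgerm_add: "fsmooth_at z F ==> fsmooth_at z G ==> fgerm z (%w. F w + G w) = fgerm z F + fgerm z G"
 by(simp add: fps_eq_iff fsmooth_at_def germ_add)

lemma fgerm_diff: "fsmooth_at z F ==> fsmooth_at z G ==> fgerm z (%w. F w - G w) = fgerm z F - fgerm z G"
 by(simp add: fps_eq_iff fsmooth_at_def germ_diff)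

lemma fgerm_mult: "fsmooth_at z F ==> fsmooth_at z G ==> fgerm z (%w. F w * G w) = fgerm z F * fgerm z G"
 by(simp add: fps_eq_iff fsmooth_at_def fps_mult_nth germ_sum germ_mult smooth_at_intros)

lemma fgerm_sum: "(!!i. i : I ==> fsmooth_at z (f i)) ==> fgerm z (%w. SUM i:I. f i w) = (SUM i:I. fgerm z (f i))"
 by(simp add: fps_eq_iff fsmooth_at_def fps_sum_nth germ_sum)

lemma fgerm_fps_const: "smooth_at z f ==> fgerm z (%w. cst (f w)) = cst (germ z f)" unfolding fps_eq_iff
proof
 fix n show "fgerm z (%w. cst (f w)) $ n = cst (germ z f) $ n" by(cases "n = 0") (simp_all add: germ_zero)
qed

lemma fgerm_cong: "fsmooth_at z F ==> \<forall>\<^sub>F w in nhds z. F w = G w ==> fgerm z F = fgerm z G"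
 unfolding fps_eq_iff fgerm_nth fsmooth_at_def by(intro allI germ_cong) (auto elim: eventually_mono)

lemma fsmooth_at_cong: "fsmooth_at z F ==> \<forall>\<^sub>F w in nhds z. F w = G w ==> fsmooth_at z G" unfolding fsmooth_at_def
 by(rule allI, rule smooth_at_cong, erule spec, erule eventually_mono) simp

lemma fsmooth_on_iff: assumes "open S"
 shows "fsmooth_on S F \<longleftrightarrow> (ALL z:S. fsmooth_at z F)" unfolding fsmooth_on_def fsmooth_at_def
 using assms by(meson smooth_at_def smooth_on_local)

lemma smooth_on_iff_at: "open S ==> smooth_on S f \<longleftrightarrow> (ALL z:S. smooth_at z f)" by(meson smooth_at_def smooth_on_local)

section \<open>Differential operators on germs and their symbols\<close>

lemma lists_length_Suc: "words (Suc k) = (%(j, J). j # J) ` (UNIV \<times> words k)" by(auto simp: length_Suc_conv image_iff)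

lemma sum_lists_Suc: "(SUM J:{J::'i::finite list. length J = Suc k}. f J) = (SS j. SUM J:words k. f (j # J))"
 unfolding lists_length_Suc by(subst sum.reindex) (auto simp: inj_on_def sum.cartesian_product case_prod_unfold)

lemma lists_length_0: "words 0 = {[]}" by auto

lemma sum_lists_Inl: fixes f :: "('i::finite + 'j::finite) list => 'c::comm_monoid_add" assumes "!!J l. Inr l : set J ==> f J = 0"
 shows "(SUM J:words k. f J) = (SUM J:words k. f (map Inl J))" using assms
proof(induction k arbitrary: f)
 case 0 thus ?case by(simp add: lists_length_0[simplified])
next case (Suc k)
 have "(SUM J:words k. f (Inl i # J)) = (SUM J:words k. f (Inl i # map Inl J))" for i by(rule Suc.IH) (use Suc.prems in auto)
 moreover have "(SUM J:words k. f (Inr i # J)) = 0" for i by(intro sum.neutral ballI Suc.prems[of i]) auto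
 ultimately show ?case by(simp only: sum_lists_Suc sum_UNIV_sum sum.neutral_const list.map add_0_right)
qed

text \<open>The commutator of the operator \<open>R\<close> with multiplication by \<open>h\<close>;
  \<open>ads\<close> iterates it along a word, and the order of the letters is irrelevant because
  multiplications commute.\<close>

definition ad :: "'r::comm_ring_1 => ('r => 'r) => 'r => 'r" where "ad h R = (%f. R (h * f) - h * R f)"

primrec ads :: "('i => 'r::comm_ring_1) => 'i list => ('r => 'r) => 'r => 'r" where "ads x [] R = R"
| "ads x (B # L) R = ads x L (ad (x B) R)"

lemma ads_append: "ads x (K @ L) R = ads x L (ads x K R)" by(induction K arbitrary: R) auto

lemma ad_commute: "ad g (ad h R) = ad h (ad g R)" by(auto simp: ad_def fun_eq_iff algebra_simps)

lemma ads_ad: "ads x L (ad h R) = ad h (ads x L R)"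
proof(induction L arbitrary: R)
 case (Cons a L) show ?case using Cons[of "ad (x a) R"] by(simp add: ad_commute[of "x a" h])
qed simp

lemma ads_perm: "mset K = mset L ==> ads x K R = ads x L R"
proof(induction K arbitrary: L R)
 case (Cons a K) then obtain L1 L2 where L: "L = L1 @ a # L2" by(metis list.set_intros(1) mset_eq_setD split_list)
 hence "mset K = mset (L1 @ L2)" using Cons.prems by simp
 from Cons.IH[OF this] show ?case by(simp add: L ads_append ads_ad)
qed auto

lemma ads_zero: "(!!f. R f = 0) ==> ads x L R f = 0" by(induction L arbitrary: R f) (auto simp: ad_def)

lemma ads_lin: assumes "!!f. R f = a * P f + b * Q f" shows "ads x L R f = a * ads x L P f + b * ads x L Q f"
 using assms by(induction L arbitrary: R P Q f) (auto simp: ad_def algebra_simps)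

text \<open>Commuting coordinate fields together with their coordinates. It is used for the chart
  coordinates and again for the coordinates formed by the order zero functions \<open>u\<close> and
  the conjugates.\<close>

locale derivations = fixes D :: "'i::finite => 'r::{comm_ring_1,real_algebra_1} => 'r" and x :: "'i => 'r"
 assumes D_add: "D A (f + g) = D A f + D A g" and D_mult: "D A (f * g) = D A f * g + f * D A g"
  and D_commute: "D A (D B f) = D B (D A f)" and D_x: "D A (x B) = (if A = B then 1 else 0)" begin

lemma D_one: "D A 1 = 0" using D_mult[of A 1 1] by simp

text \<open>Derivations are composed on the right, because the commutators of \<open>R\<close> after
  \<open>D A\<close> with coordinates then reduce to those of \<open>R\<close>.\<close>

inductive dop :: "('r => 'r) => bool" where dop_id: "dop (%f. f)"
| dop_add: "dop R ==> dop Q ==> dop (%f. R f + Q f)"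
| dop_lmult: "dop R ==> dop (%f. c * R f)"
| dop_D: "dop R ==> dop (%f. R (D A f))"

lemma dop_zero: "dop (%_. 0)" using dop_lmult[OF dop_id, of 0] by simp

lemma dop_sum: "(!!i. i : I ==> dop (R i)) ==> dop (%f. SUM i:I. R i f)"
 by(induction I rule: fin_induct) (auto intro: dop_zero dop_add)

lemma dop_minus: "dop R ==> dop (%f. - R f)" using dop_lmult[of R "-1"] by simp

lemma dop_diff: "dop R ==> dop Q ==> dop (%f. R f - Q f)" using dop_add[of R "%f. - Q f"] dop_minus by auto

lemma dop_additive: "dop R ==> R (f + g) = R f + R g" by(induction arbitrary: f g rule: dop.induct) (auto simp: D_add algebra_simps)

lemma dop_rmult: "dop R ==> dop (%f. R (m * f))"
proof(induction arbitrary: m rule: dop.induct)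
 case dop_id show ?case by(rule dop_lmult[OF dop.dop_id])
next case (dop_D R A)
 have "dop (%f. R (D A m * f) + R (m * D A f))" by(rule dop_add[OF dop_D.IH dop.dop_D[OF dop_D.IH]])
 moreover have "R (D A m * f) + R (m * D A f) = R (D A (m * f))" for f by(simp add: D_mult dop_additive[OF dop_D.hyps])
 ultimately show ?case by simp
qed (auto intro: dop.intros)

lemma dop_foldr: "dop (foldr D P)"
proof(induction P rule: rev_induct)
 case Nil thus ?case using dop_id by(simp add: id_def)
next case (snoc A P)
 from dop_D[OF snoc, of A] show ?case by(simp add: comp_def)
qed

text \<open>The sum over all occurrences of A in the word of the iterated commutator along the word
  with that occurrence deleted.\<close>

primrec cnt :: "'i => 'i list => ('r => 'r) => 'r => 'r" where "cnt A [] R f = 0"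
| "cnt A (B # L) R f = cnt A L (ad (x B) R) f + (if A = B then ads x L R f else 0)"

lemma additive_zero: fixes R :: "'r => 'r" assumes "!!f g. R (f + g) = R f + R g" shows "R 0 = 0" using assms[of 0 0] by simp

text \<open>Each commutator with a coordinate either hits \<open>R\<close> or consumes the
  derivation, where it leaves a Kronecker delta.\<close>

lemma ads_comp_D: assumes "!!f g. R (f + g) = R f + R g" shows "ads x L (%f. R (D A f)) f = ads x L R (D A f) + cnt A L R f" using assms
proof(induction L arbitrary: R f)
 case (Cons B L) let ?\<delta> = "if A = B then 1 else 0 :: 'r"
 have 1: "ad (x B) (%f. R (D A f)) f = 1 * ad (x B) R (D A f) + ?\<delta> * R f" for f
  using additive_zero[of R, OF Cons.prems] by(auto simp: ad_def D_mult D_x Cons.prems)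
 have "ads x (B # L) (%f. R (D A f)) f = 1 * ads x L (%f. ad (x B) R (D A f)) f + ?\<delta> * ads x L R f"
  by(simp only: ads.simps) (rule ads_lin[OF 1])
 also have "ads x L (%f. ad (x B) R (D A f)) f = ads x L (ad (x B) R) (D A f) + cnt A L (ad (x B) R) f"
  by(rule Cons.IH) (simp add: ad_def Cons.prems algebra_simps)
 finally show ?case by simp
qed auto

text \<open>The value on 1 of an iterated commutator with coordinates is, for the word
  \<open>L\<close>, the factorial multiple of the symmetrised coefficient of the operator.\<close>

definition sig :: "'i list => ('r => 'r) => 'r" where "sig L R = ads x L R 1"

lemma foldr_D_commute: "foldr D J (D A f) = D A (foldr D J f)" by(induction J) (auto simp: D_commute)

text \<open>Every one of the Suc k positions in a word can hold the deleted letter A, and by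
  symmetry all of them contribute equally.\<close>

lemma sum_sig_comp_D: assumes "!!f g. R (f + g) = R f + R g" shows "(SUM J:words (Suc k). sig J (%f. R (D A f)) * foldr D J f)
  = of_nat (Suc k) * (SUM J:words k. sig J R * foldr D J (D A f))"
proof - have R0: "ads x L R 0 = 0" if "!!f g. R (f + g) = R f + R g" for L R using that
 proof(induction L arbitrary: R)
  case Nil thus ?case using additive_zero by auto
 next case (Cons B L)
  have "ads x L (ad (x B) R) 0 = 0" by(rule Cons.IH) (simp add: ad_def Cons.prems algebra_simps)
  thus ?case by simp
 qed
 have sg: "sig J (%f. R (D A f)) = cnt A J R 1" for J unfolding sig_def ads_comp_D[OF assms] by(simp add: D_one R0[OF assms])
 have "(SUM J:words (Suc k). cnt A J R 1 * foldr D J f) = of_nat (Suc k) * (SUM J:words k. sig J R * foldr D J (D A f))" using assms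
 proof(induction k arbitrary: R f)
  case 0 show ?case by(simp add: sum_lists_Suc lists_length_0[simplified] sig_def if_distrib[of "%x. x * _"] cong: if_cong)
 next case (Suc k)
  have ab: "ad h R (f + g) = ad h R f + ad h R g" for h f g by(simp add: ad_def Suc.prems algebra_simps)
  have "(SUM J:{J. length J = Suc (Suc k)}. cnt A J R 1 * foldr D J f)
   = (SS B. SUM J:words (Suc k). cnt A J (ad (x B) R) 1 * foldr D J (D B f))
    + (SS B. SUM J:words (Suc k). (if A = B then sig J R else 0) * foldr D J (D B f))"
   unfolding sig_def by(subst sum_lists_Suc) (simp add: sum.distrib[symmetric] algebra_simps foldr_D_commute)
  also have "(SS B. SUM J:words (Suc k). (if A = B then sig J R else 0) * foldr D J (D B f))
   = (SS B. if A = B then SUM J:words (Suc k). sig J R * foldr D J (D B f) else 0)" by(rule sum.cong) auto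
  also have "... = (SUM J:words (Suc k). sig J R * foldr D J (D A f))" by simp
  also have "(SS B. SUM J:words (Suc k). cnt A J (ad (x B) R) 1 * foldr D J (D B f))
   = (SS B. of_nat (Suc k) * (SUM J:words k. sig J (ad (x B) R) * foldr D J (D A (D B f))))" by(rule sum.cong[OF refl], rule Suc.IH[OF ab])
  also have "... = of_nat (Suc k) * (SUM J:words (Suc k). sig J R * foldr D J (D A f))"
   by(subst sum_lists_Suc) (simp add: sum_distrib_left[symmetric] sig_def foldr_D_commute D_commute[of A])
  finally show ?case by(simp add: algebra_simps)
 qed
 thus ?thesis by(simp add: sg)
qed

lemma of_nat_mult_scaleR: "of_nat n * y = real n *R (y::'r)" by(induction n) (simp_all add: algebra_simps)

text \<open>Taylor formula for operators. The bound is stated for all large N, since orders are not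
  recorded and summands of different order have to be combined.\<close>

theorem dop_expansion: assumes "dop R"
 shows "EX N0. ALL N>=N0. ALL f. R f = (SUM k<=N. (1 / fact k) *R (SUM J:words k. sig J R * foldr D J f))" using assms
proof(induction rule: dop.induct)
 case dop_id have "ads x L (%f. f) f = (if L = [] then f else 0)" for L and f :: 'r
 proof(cases L)
  case (Cons B L') thus ?thesis by(simp add: ads_zero ad_def)
 qed auto
 hence s: "sig L (%f. f) = (if L = [] then 1 else 0)" for L by(simp add: sig_def)
 have "(SUM J:words k. sig J (%f. f) * foldr D J f) = (if k = 0 then f else 0)" for k f
  by(cases k) (auto simp: s lists_length_0[simplified] intro!: sum.neutral)
 moreover have "f = (SUM k<=N. (1 / fact k) *R (if k = 0 then f else 0))" for N and f :: 'r
  by(simp add: if_distrib sum.delta cong: if_cong)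
 ultimately show ?case by(intro exI[of _ 0] allI impI) (simp only:)
next case (dop_add R Q)
 then obtain N1 N2 where 1: "!!N f. N >= N1 ==> R f = (SUM k<=N. (1 / fact k) *R (SUM J:words k. sig J R * foldr D J f))"
  and 2: "!!N f. N >= N2 ==> Q f = (SUM k<=N. (1 / fact k) *R (SUM J:words k. sig J Q * foldr D J f))" by blast
 have s: "sig J (%f. R f + Q f) = sig J R + sig J Q" for J unfolding sig_def by(subst ads_lin[of _ 1 R 1 Q]) auto
 show ?case
 proof(intro exI[of _ "max N1 N2"] allI impI)
  fix N f assume "max N1 N2 <= N" thus "R f + Q f = (SUM k<=N. (1 / fact k) *R (SUM J:words k. sig J (%f. R f + Q f) * foldr D J f))"
   using 1[of N f] 2[of N f] by(simp add: s sum.distrib distrib_right scaleR_add_right)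
 qed
next case (dop_lmult R c)
 have s: "sig J (%f. c * R f) = c * sig J R" for J unfolding sig_def by(subst ads_lin[of _ c R 0 R]) auto
 from dop_lmult.IH obtain N1 where
  1: "!!N f. N >= N1 ==> R f = (SUM k<=N. (1 / fact k) *R (SUM J:words k. sig J R * foldr D J f))" by blast
 show ?case
 proof(intro exI[of _ N1] allI impI)
  fix N f assume "N1 <= N"
  from 1[OF this, of f] show "c * R f = (SUM k<=N. (1 / fact k) *R (SUM J:words k. sig J (%f. c * R f) * foldr D J f))"
   by(simp add: s sum_distrib_left mult.assoc)
 qed
next case (dop_D R A)
 then obtain N1 where 1: "!!N f. N >= N1 ==> R f = (SUM k<=N. (1 / fact k) *R (SUM J:words k. sig J R * foldr D J f))" by blast
 have ab: "R (f + g) = R f + R g" for f g by(rule dop_additive[OF dop_D.hyps])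
 have s0: "sig [] (%f. R (D A f)) = 0" by(simp add: sig_def D_one additive_zero[OF ab])
 show ?case
 proof(intro exI[of _ "Suc N1"] allI impI)
  fix N f assume "Suc N1 <= N" then obtain M where M: "N = Suc M" "N1 <= M" by(cases N) auto
  define Y where "Y k = (SUM J:words k. sig J R * foldr D J (D A f))" for k
  define Z where "Z k = (1 / fact k) *R (SUM J:words k. sig J (%f. R (D A f)) * foldr D J f)" for k
  have Z: "Z (Suc k) = (1 / fact k) *R Y k" for k
  proof - have "Z (Suc k) = (1 / fact (Suc k)) *R (of_nat (Suc k) * Y k)"
    unfolding Z_def Y_def using sum_sig_comp_D[of R A f k, OF ab] by simp
   also have "... = (1 / fact k) *R Y k"
   proof - have "1 / fact (Suc k) * real (Suc k) = (1 / fact k :: real)" by(simp add: fact_Suc del: of_nat_Suc)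
    thus ?thesis by(simp only: of_nat_mult_scaleR scaleR_scaleR)
   qed
   finally show ?thesis .
  qed
  have Z0: "Z 0 = 0" by(simp add: Z_def lists_length_0[simplified] s0)
  have "(SUM k<=N. Z k) = (SUM k<=M. (1 / fact k) *R Y k)" unfolding M(1) sum.atMost_Suc_shift by(simp only: Z Z0 add_0_left)
  also have "... = R (D A f)" using 1[OF M(2), of "D A f"] by(simp only: Y_def)
  finally show "R (D A f) = (SUM k<=N. (1 / fact k) *R (SUM J:words k. sig J (%f. R (D A f)) * foldr D J f))" by(simp only: Z_def)
 qed
qed

text \<open>Commutators with coordinates vanish, so all symbols of positive length do, and the
  remaining one is the value at 1.\<close>

lemma dop_eq_zero: assumes "dop R" "!!A f. R (x A * f) = x A * R f" "R 1 = 0" shows "R f = 0"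
proof - obtain N where "R f = (SUM k<=N. (1 / fact k) *R (SUM J:words k. sig J R * foldr D J f))"
  using dop_expansion[OF assms(1)] by blast
 moreover have "sig J R = 0" for J by(cases J) (auto simp: sig_def assms ads_zero ad_def)
 ultimately show ?thesis by simp
qed

end

text \<open>Differential operators do not depend on the coordinates, as one set of derivations is a
  combination of the other with coefficients in the ring.\<close>

lemma dop_change: fixes D :: "'i::finite => 'r::{comm_ring_1,real_algebra_1} => 'r" and D' :: "'j::finite => 'r => 'r"
 assumes 1: "derivations D x" and 2: "derivations D' x'" and m: "!!A f. D A f = (SS B. m A B * D' B f)"
  and R: "derivations.dop D R" shows "derivations.dop D' R"
proof - interpret A: derivations D x by(rule 1)
 interpret B: derivations D' x' by(rule 2)
 show ?thesis using R
 proof(induction rule: A.dop.induct)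
  case (dop_D R A) have "B.dop (%f. SS C. R (m A C * D' C f))" by(rule B.dop_sum) (rule B.dop_D[OF B.dop_rmult[OF dop_D.IH]])
  moreover have "(SS C. R (m A C * D' C f)) = R (D A f)" for f
  proof - have "R (sum h I) = (SUM i:I. R (h i))" for h and I :: "'j set" using A.dop_additive[OF dop_D.hyps] A.additive_zero[of R]
    by(induction I rule: fin_induct) auto
   thus ?thesis by(simp add: m)
  qed
  ultimately show ?case by simp
 qed (auto intro: B.dop.intros)
qed

lemma derivations_germ: "derivations gD (gcoord (z::complex^'n::finite))" by unfold_locales (auto simp: gD_add gD_mult gD_commute gD_gcoord)

section \<open>Star products of Wick type on formal germs\<close>

text \<open>The extension of the sequence of bidifferential operators that is bilinear over the
  power series in the parameter.\<close>

definition fstar :: "(nat => 'r::comm_ring_1 => 'r => 'r) => 'r fps => 'r fps => 'r fps" where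
 "fstar C F G = Abs_fps (%n. SUM i<=n. SUM j<=n - i. C (n - i - j) (F $ i) (G $ j))"

definition op_fps :: "(nat => 'r => 'r::comm_ring_1) => 'r fps => 'r fps" where "op_fps r F = Abs_fps (%n. SUM i<=n. r (n - i) (F $ i))"

lemma op_fps_nth: "op_fps r F $ n = (SUM i<=n. r (n - i) (F $ i))" by(simp add: op_fps_def)

lemma op_fps_add: "(!!m f g. r m (f + g) = r m f + r m g) ==> op_fps r (F + G) = op_fps r F + op_fps r G"
 by(simp add: fps_eq_iff op_fps_nth sum.distrib)

lemma op_fps_X: assumes "!!m. r m 0 = 0" shows "op_fps r (fps_X * F) = fps_X * op_fps r F"
proof(rule fps_ext)
 fix n show "op_fps r (fps_X * F) $ n = (fps_X * op_fps r F) $ n"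
 proof(cases n)
  case (Suc m) show ?thesis unfolding Suc op_fps_nth sum.atMost_Suc_shift by(simp add: op_fps_nth assms)
 qed (simp add: op_fps_nth assms)
qed

lemma op_fps_const: "(!!m. r m 0 = 0) ==> op_fps r (cst f) $ n = r n f"
proof - assume 0: "!!m. r m 0 = 0"
 have "op_fps r (cst f) $ n = (SUM i<=n. if i = 0 then r n f else 0)" unfolding op_fps_nth by(rule sum.cong) (auto simp: 0)
 thus ?thesis by simp
qed

lemma fps_mult_eq_op: "h * F = op_fps (%m f. h $ m * f) F"
proof(rule fps_ext)
 fix n have "(h * F) $ n = (F * h) $ n" by(simp only: mult.commute)
 also have "... = (SUM i<=n. h $ (n - i) * F $ i)" unfolding fps_mult_nth atLeast0AtMost by(rule sum.cong[OF refl], rule mult.commute)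
 finally show "(h * F) $ n = op_fps (%m f. h $ m * f) F $ n" by(simp only: op_fps_nth)
qed

lemma fps_X_cancel: "fps_X * F = fps_X * G ==> F = G" for F G :: "'r::comm_ring_1 fps"
proof(rule fps_ext)
 fix n assume "fps_X * F = fps_X * G" from arg_cong[OF this, of "%F. F $ Suc n"] show "F $ n = G $ n" by simp
qed

lemma ad_op_fps: "ad (cst a) (op_fps r) = op_fps (%m. ad a (r m))"
 by(auto simp: fun_eq_iff fps_eq_iff ad_def op_fps_nth sum_subtractf sum_distrib_left)

lemma ads_op_fps: "ads (%a. cst (u a)) L (op_fps r) = op_fps (%m. ads u L (r m))" by(induction L arbitrary: r) (auto simp: ad_op_fps)

lemma sum_triangle_swap:
 "(SUM i<=n. SUM j<=n - i. f i j) = (SUM j<=n. SUM i<=n - j. f i j)" for n :: nat and f :: "nat => nat => 'c::comm_monoid_add"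
proof - have "(SUM i<=n. SUM j<=n - i. f i j) = (SUM (i, j):Sigma {..n} (%i. {..n - i}). f i j)" by(rule sum.Sigma) auto
 also have "... = (SUM (j, i):Sigma {..n} (%j. {..n - j}). f i j)"
  by(rule sum.reindex_bij_witness[of _ "%(i, j). (j, i)" "%(i, j). (j, i)"]) auto
 also have "... = (SUM j<=n. SUM i<=n - j. f i j)" by(rule sum.Sigma[symmetric]) auto
 finally show ?thesis .
qed

text \<open>The coefficients of right multiplication by \<open>G\<close>, as a sequence of operators
  on germs; \<open>lop\<close> is the same for left multiplication.\<close>

definition rop :: "(nat => 'r::comm_ring_1 => 'r => 'r) => 'r fps => nat => 'r => 'r" where "rop C G m f = (SUM j<=m. C (m - j) f (G $ j))"

definition lop :: "(nat => 'r::comm_ring_1 => 'r => 'r) => 'r fps => nat => 'r => 'r" where "lop C F m g = (SUM i<=m. C (m - i) (F $ i) g)"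

lemma fstar_rop: "fstar C F G = op_fps (rop C G) F" by(simp add: fps_eq_iff fstar_def op_fps_nth rop_def)

lemma fstar_lop: "fstar C F G = op_fps (lop C F) G"
proof(rule fps_ext)
 fix n have "fstar C F G $ n = (SUM j<=n. SUM i<=n - j. C (n - i - j) (F $ i) (G $ j))"
  unfolding fstar_def fps_nth_Abs_fps by(rule sum_triangle_swap)
 also have "... = op_fps (lop C F) G $ n" by(simp add: op_fps_nth lop_def add.commute)
 finally show "fstar C F G $ n = op_fps (lop C F) G $ n" .
qed

abbreviation antihol :: "'n::finite germ fps => bool" where "antihol F == (ALL i. fD (Inl i) F = 0)"

abbreviation ybar :: "'n::finite => 'n germ fps" where "ybar m == cst (gcoord 0 (Inr m))"

interpretation gd: derivations gD "gcoord (0::complex^'n::finite)" by(rule derivations_germ)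

definition wvf :: "('n + 'n => 'n::finite germ) => 'n germ => 'n germ" where "wvf p f = (SS A. p A * gD A f)"

lemma wvf_add: "wvf p (f + g) = wvf p f + wvf p g" by(simp add: wvf_def gD_add algebra_simps sum.distrib)

lemma wvf_mult: "wvf p (f * g) = wvf p f * g + f * wvf p g" by(simp add: wvf_def gD_mult algebra_simps sum.distrib sum_distrib_left)

lemma wvf_zero [simp]: "wvf p 0 = 0" and wvf_one [simp]: "wvf p 1 = 0" by(simp_all add: wvf_def)

lemma wvf_sum: "wvf p (sum f I) = (SUM i:I. wvf p (f i))" by(induction I rule: fin_induct) (auto simp: wvf_add)

lemma wvf_bracket: "wvf p (wvf q f) - wvf q (wvf p f) = (SS A. (wvf p (q A) - wvf q (p A)) * gD A f)"
proof - have e: "wvf p (wvf q f) = (SS A. wvf p (q A) * gD A f) + (SS A B. q A * p B * gD B (gD A f))" for p q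
  unfolding wvf_def[of q f] wvf_sum wvf_mult sum.distrib by(simp add: wvf_def[of p "gD _ f"] sum_distrib_left mult.assoc)
 have "(SS A B. q A * p B * gD B (gD A f)) = (SS A B. p A * q B * gD B (gD A f))" by(subst sum.swap) (simp add: gD_commute mult.commute)
 thus ?thesis by(simp add: e sum_subtractf left_diff_distrib)
qed

text \<open>The product at one point. \<open>W\<close> holds the coefficients of the Kaehler form
  and \<open>w\<close> those of its inverse with the holomorphic index first, which explains the
  values -1 in their contractions.\<close>

locale wick_germ = fixes C :: "nat => 'n::finite germ => 'n germ => 'n germ" and w W :: "'n => 'n => 'n germ"
 assumes C0: "C 0 f g = f * g" and C_dop1: "gd.dop (%f. C k f g)" and C_dop2: "gd.dop (%g. C k f g)"
  and C_antihol: "0 < k ==> (!!i. gD (Inl i) f = 0) ==> C k f g = 0" and C_hol: "0 < k ==> (!!i. gD (Inr i) g = 0) ==> C k f g = 0"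
  and C1: "C 1 f g - C 1 g f = (SS i j. w i j * (gD (Inl i) f * gD (Inr j) g - gD (Inr j) f * gD (Inl i) g))"
  and assoc: "fstar C (fstar C F G) H = fstar C F (fstar C G H)" and wW1: "(SS j. w i j * W p j) = (if i = p then -1 else 0)"
  and wW2: "(SS i. w i j * W i l) = (if j = l then -1 else 0)" and W_closed1: "gD (Inl p) (W i j) = gD (Inl i) (W p j)"
  and W_closed2: "gD (Inr p) (W i j) = gD (Inr j) (W i p)" begin

abbreviation star (infixl "\<star>" 70) where "F \<star> G == fstar C F G"

lemma C_add1: "C k (f + f') g = C k f g + C k f' g" and C_add2: "C k f (g + g') = C k f g + C k f g'"
 using gd.dop_additive[OF C_dop1] gd.dop_additive[OF C_dop2] by auto

lemma C_zero1 [simp]: "C k 0 g = 0" and C_zero2 [simp]: "C k f 0 = 0"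
 using gd.additive_zero[of "%f. C k f g"] gd.additive_zero[of "%g. C k f g"] C_add1 C_add2 by auto

lemma rop_dop: "gd.dop (rop C G m)" and lop_dop: "gd.dop (lop C F m)"
 unfolding rop_def[abs_def] lop_def[abs_def] by(intro gd.dop_sum C_dop1 C_dop2)+

lemma rop_add: "rop C G m (f + g) = rop C G m f + rop C G m g" and lop_add: "lop C F m (f + g) = lop C F m f + lop C F m g"
 using gd.dop_additive[OF rop_dop] gd.dop_additive[OF lop_dop] by auto

lemma rop_zero [simp]: "rop C G m 0 = 0" and lop_zero [simp]: "lop C F m 0 = 0" by(simp_all add: rop_def lop_def)

lemma star_add1: "(F + F') \<star> G = F \<star> G + F' \<star> G" and star_add2: "F \<star> (G + G') = F \<star> G + F \<star> G'"
 by(simp_all add: fstar_rop op_fps_add rop_add) (simp add: fstar_rop[symmetric] fstar_lop op_fps_add lop_add)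

lemma star_X1: "(fps_X * F) \<star> G = fps_X * (F \<star> G)" and star_X2: "F \<star> (fps_X * G) = fps_X * (F \<star> G)"
 by(simp_all add: fstar_rop op_fps_X) (simp add: fstar_rop[symmetric] fstar_lop op_fps_X)

lemma star_zero1 [simp]: "0 \<star> G = 0" and star_zero2 [simp]: "F \<star> 0 = 0" by(simp_all add: fstar_def fps_eq_iff)

lemma star_minus1: "(- F) \<star> G = - (F \<star> G)" using star_add1[of F "- F" G] by(simp add: eq_neg_iff_add_eq_0 add.commute)

lemma star_diff1: "(F - F') \<star> G = F \<star> G - F' \<star> G" using star_add1[of F "- F'" G] by(simp add: star_minus1)

lemma antihol_star: assumes "antihol q" shows "q \<star> G = q * G"
proof(rule fps_ext)
 fix n have q: "gD (Inl i) (q $ k) = 0" for i k using assms by(metis fD_nth fps_zero_nth)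
 have "(q \<star> G) $ n = (SUM i<=n. SUM j<=n - i. if j = n - i then q $ i * G $ j else 0)"
  unfolding fstar_def fps_nth_Abs_fps by(intro sum.cong refl) (auto simp: C0 intro!: C_antihol q)
 also have "... = (q * G) $ n" by(simp add: fps_mult_nth atLeast0AtMost)
 finally show "(q \<star> G) $ n = (q * G) $ n" .
qed

lemma star_hol: assumes "!!i. fD (Inr i) h = 0" shows "F \<star> h = F * h"
proof(rule fps_ext)
 fix n have q: "gD (Inr i) (h $ k) = 0" for i k using assms by(metis fD_nth fps_zero_nth)
 have "(F \<star> h) $ n = (SUM i<=n. SUM j<=n - i. if j = n - i then F $ i * h $ j else 0)"
  unfolding fstar_def fps_nth_Abs_fps by(intro sum.cong refl) (auto simp: C0 intro!: C_hol q)
 also have "... = (F * h) $ n" by(simp add: fps_mult_nth atLeast0AtMost)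
 finally show "(F \<star> h) $ n = (F * h) $ n" .
qed

lemma star_antihol_mult: "antihol q ==> (q * F) \<star> G = q * (F \<star> G)" using assoc[of q F G] by(simp add: antihol_star)

lemma star_hol_mult: "(!!i. fD (Inr i) h = 0) ==> F \<star> (G * h) = (F \<star> G) * h" using assoc[of F G h] by(simp add: star_hol)

lemma star_one [simp]: "1 \<star> G = G" "F \<star> 1 = F" by(simp_all add: antihol_star star_hol)

lemma antihol_ybar: "antihol (ybar m)" by(simp add: gD_gcoord)

text \<open>The Hamiltonian field, up to sign convention, of the conjugate coordinate a; its
  coefficients are those of the inverse form.\<close>

definition X :: "'n => 'n germ => 'n germ" where "X a f = (SS i. w i a * gD (Inl i) f)"

lemma X_add: "X a (f + g) = X a f + X a g" and X_minus: "X a (- f) = - X a f"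
 by(simp_all add: X_def gD_add gD_minus algebra_simps sum.distrib sum_negf)

lemma X_diff: "X a (f - g) = X a f - X a g" using X_add[of a f "- g"] by(simp add: X_minus)

lemma X_const [simp]: "X a 0 = 0" "X a 1 = 0" by(simp_all add: X_def)

lemma gD_X: "gD (Inl i) f = - (SS a. W i a * X a f)"
proof - have "(SS a. W i a * X a f) = (SS a k. w k a * W i a * gD (Inl k) f)" by(simp add: X_def sum_distrib_left mult_ac)
 also have "... = (SS k. (SS a. w k a * W i a) * gD (Inl k) f)" by(subst sum.swap) (simp add: sum_distrib_right)
 also have "... = - gD (Inl i) f" by(simp add: wW1 if_distrib[of "%x. x * _"] cong: if_cong)
 finally show ?thesis by simp
qed

text \<open>One of the two terms of the commutator vanishes by the Wick property, so the Poisson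
  bracket alone fixes the first-order operator on conjugate coordinates.\<close>

lemma C1_ybar: "C 1 f (gcoord 0 (Inr m)) = X m f"
proof - have "C 1 (gcoord 0 (Inr m)) f = 0" by(rule C_antihol) (auto simp: gD_gcoord)
 thus ?thesis using C1[of f "gcoord 0 (Inr m)"] by(simp add: gD_gcoord X_def if_distrib[of "%x. _ * x"] cong: if_cong)
qed

lemma star_ybar_nth: "(F \<star> ybar m) $ n = (SUM i<=n. C (n - i) (F $ i) (gcoord 0 (Inr m)))"
proof - have "rop C (ybar m) k f = C k f (gcoord 0 (Inr m))" for k f
 proof - have "rop C (ybar m) k f = (SUM j<=k. if j = 0 then C k f (gcoord 0 (Inr m)) else 0)" unfolding rop_def by(rule sum.cong) auto
  thus ?thesis by simp
 qed
 thus ?thesis by(simp add: fstar_rop op_fps_nth)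
qed

text \<open>Inverting \<open>w\<close> turns the system into one for the holomorphic gradient of
  \<open>r\<close>. It is integrable because of the assumed symmetry together with the closedness of
  the Kaehler form.\<close>

lemma solve_X: assumes t: "!!m p. X p (t m) = X m (t p)" obtains r where "!!m. X m r = t m"
proof - define \<rho> where "\<rho> i = - (SS m. W i m * t m)" for i
 have e: "gD (Inl k) (\<rho> i) = - (SS m. gD (Inl k) (W i m) * t m) + (SS m b. W i m * W k b * X b (t m))" for i k
  unfolding \<rho>_def gD_minus gD_sum gD_mult sum.distrib gD_X[of k "t _"] by(simp add: sum_distrib_left sum_negf mult.assoc)
 have "(SS m b. W i m * W k b * X b (t m)) = (SS m b. W k m * W i b * X b (t m))" for i k by(subst sum.swap) (simp add: t mult.commute)
 hence "gD (Inl k) (\<rho> i) = gD (Inl i) (\<rho> k)" for i k unfolding e by(simp add: W_closed1[of k i])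
 from germ_d_poincare[of \<rho>, OF this] obtain r where r: "!!i. gD (Inl i) r = \<rho> i" by blast
 have "X m r = t m" for m
 proof - have "X m r = - (SS i a. w i m * W i a * t a)" by(simp add: X_def r \<rho>_def sum_distrib_left sum_negf mult.assoc)
  also have "... = - (SS a. (SS i. w i m * W i a) * t a)" by(subst sum.swap) (simp add: sum_distrib_right)
  also have "... = t m" by(simp add: wW2 if_distrib[of "%x. x * _"] cong: if_cong)
  finally show ?thesis .
 qed
 thus ?thesis by(rule that)
qed

text \<open>The star product of U with conjugate coordinates, solved order by order. In each order
  the unknown enters only through the first-order operator, that is through the fields
  \<open>X\<close>; associativity provides the integrability condition.\<close>

lemma ex_left_derivation_coeffs:
 "EX U::nat => 'n germ. ALL n m. C 1 (U n) (gcoord 0 (Inr m)) + (SUM i<n. C (Suc n - i) (U i) (gcoord 0 (Inr m)))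
   = (if n = 0 & m = l then 1 else 0)"
proof - let ?Y = "%m. gcoord 0 (Inr m) :: 'n germ"
 let ?\<delta> = "%(n::nat) m. if n = 0 & m = l then 1 else 0 :: 'n germ"
 let ?P = "%U n r. ALL m. C 1 r (?Y m) + (SUM i<n. C (Suc n - i) (U i) (?Y m)) = ?\<delta> n m" have "EX U. ALL n. ?P U n (U n)"
 proof(rule dependent_wellorder_choice[where P = ?P])
  fix r :: "'n germ" and f g :: "nat => 'n germ" and x :: nat assume "!!y. y < x ==> f y = g y" thus "?P f x r = ?P g x r" by simp
 next fix n and U :: "nat => 'n germ"
  assume U: "!!k. k < n ==> ?P U k (U k)" define F where "F = Abs_fps (%i. if i < n then U i else 0)"
  define E where "E m = F \<star> ybar m - F * ybar m" for m
  have Ek: "E m $ Suc k = (SUM i<=k. C (Suc k - i) (F $ i) (?Y m))" for m k by(simp add: E_def star_ybar_nth C0)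
  have Elow: "E m $ i = (if i = 1 & m = l then 1 else 0)" if "i <= n" for m i
  proof(cases i)
   case 0 thus ?thesis by(simp add: E_def star_ybar_nth C0)
  next case (Suc k)
   hence k: "k < n" using that by simp
   have "E m $ Suc k = C 1 (U k) (?Y m) + (SUM i<k. C (Suc k - i) (U i) (?Y m))"
    unfolding Ek using k by(simp add: F_def lessThan_Suc_atMost[symmetric] add.commute)
   thus ?thesis using U[OF k] Suc by simp
  qed
  have E1: "E m $ Suc n = (SUM i<n. C (Suc n - i) (U i) (?Y m))" for m unfolding Ek by(simp add: F_def lessThan_Suc_atMost[symmetric])
  \<comment> \<open>Two ways of multiplying \<open>F\<close> by a product of two conjugate
    coordinates.\<close>
  have sym: "ybar m * E p + E m \<star> ybar p = ybar p * E m + E p \<star> ybar m" for m p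
  proof - have "F \<star> (ybar m * ybar p) = ybar m * (F * ybar p) + (ybar m * E p + E m \<star> ybar p)" for m p
   proof - have "F \<star> (ybar m * ybar p) = (F \<star> ybar m) \<star> ybar p" unfolding assoc antihol_star[OF antihol_ybar] ..
    also have "F \<star> ybar m = ybar m * F + E m" by(simp only: E_def mult.commute[of "ybar m"]) simp
    also have "(ybar m * F + E m) \<star> ybar p = ybar m * (F \<star> ybar p) + E m \<star> ybar p"
     by(simp only: star_add1 star_antihol_mult[OF antihol_ybar])
    also have "F \<star> ybar p = F * ybar p + E p" by(simp only: E_def) simp
    finally show ?thesis by(simp only: distrib_left add.assoc)
   qed
   from this[of m p] this[of p m] show ?thesis by(simp only: mult.commute[of "ybar p" "ybar m"]) (simp add: mult_ac)
  qed
  have X: "X p (E m $ Suc n) = X m (E p $ Suc n)" for m p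
  \<comment> \<open>The orders of \<open>E m\<close> up to n are constants, which the higher
    operators annihilate; what remains at order n + 2 is an ordinary product and a derivative along
    \<open>X p\<close>.\<close>
  proof - have "(E m \<star> ybar p) $ Suc (Suc n) = ?Y p * E m $ Suc (Suc n) + X p (E m $ Suc n)" for m p
   proof - have "(SUM i<=n. C (Suc (Suc n) - i) (E m $ i) (?Y p)) = 0" by(rule sum.neutral) (auto simp: Elow intro!: C_antihol)
    thus ?thesis unfolding star_ybar_nth by(simp add: C0 C1_ybar[unfolded One_nat_def] mult.commute)
   qed
   thus ?thesis using arg_cong[OF sym[of m p], of "%F. F $ Suc (Suc n)"] by simp
  qed
  have "X p (?\<delta> n m - E m $ Suc n) = X m (?\<delta> n p - E p $ Suc n)" for m p unfolding X_diff X by simp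
  from solve_X[of "%m. ?\<delta> n m - E m $ Suc n", OF this] obtain r where "!!m. X m r = ?\<delta> n m - E m $ Suc n" by blast
  thus "EX r. ?P U n r" by(intro exI[of _ r] allI) (simp only: C1_ybar E1 diff_add_cancel)
 qed
 thus ?thesis by blast
qed

text \<open>In every order the difference of the two sides is a differential operator in
  \<open>G\<close> that vanishes at 1 and commutes with all coordinates: with the holomorphic ones
  by the Wick property, with the conjugate ones by the assumption and associativity.\<close>

lemma left_derivation_of_coeffs: assumes "!!m. U \<star> ybar m = U * ybar m + (if m = l then fps_X else 0)"
 shows "U \<star> G = U * G + fps_X * fD (Inr l) G"
proof - define Q where "Q m g = lop C U m g - U $ m * g - (if m = 1 then gD (Inr l) g else 0)" for m g
 have Q: "op_fps Q G = U \<star> G - U * G - fps_X * fD (Inr l) G" for G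
 proof(rule fps_ext)
  fix n have "(SUM i<=n. if n - i = 1 then gD (Inr l) (G $ i) else 0) = (fps_X * fD (Inr l) G) $ n"
  proof(cases n)
   case (Suc k) have "(SUM i<=n. if n - i = 1 then gD (Inr l) (G $ i) else 0) = (SUM i<=n. if i = k then gD (Inr l) (G $ i) else 0)"
    by(rule sum.cong) (auto simp: Suc)
   thus ?thesis by(simp add: Suc)
  qed simp
  thus "op_fps Q G $ n = (U \<star> G - U * G - fps_X * fD (Inr l) G) $ n"
   unfolding Q_def fstar_lop fps_mult_eq_op[of U G] by(simp add: op_fps_nth sum_subtractf)
 qed
 have Q0: "Q m 0 = 0" for m by(simp add: Q_def)
 have Qn: "Q m g = (U \<star> cst g - U * cst g - fps_X * fD (Inr l) (cst g)) $ m" for m g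
  unfolding Q[symmetric] op_fps_const[of Q, OF Q0] ..
 have "Q m g = 0" for m g
 proof(rule gd.dop_eq_zero[of "Q m"])
  have "gd.dop (%g. if m = 1 then gD (Inr l) g else 0)" using gd.dop_D[OF gd.dop_id] gd.dop_zero by(cases "m = 1") auto
  thus "gd.dop (Q m)" unfolding Q_def[abs_def] by(intro gd.dop_diff lop_dop gd.dop_lmult[OF gd.dop_id]) auto
  show "Q m 1 = 0" unfolding Qn by simp
  fix A g show "Q m (gcoord 0 A * g) = gcoord 0 A * Q m g"
  proof(cases A)
   case (Inl i) have h: "fD (Inr j) (cst (gcoord 0 (Inl i))) = 0" for j by(simp add: gD_gcoord)
   have "U \<star> (cst g * cst (gcoord 0 (Inl i))) = (U \<star> cst g) * cst (gcoord 0 (Inl i))" by(rule star_hol_mult[OF h])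
   thus ?thesis unfolding Qn Inl by(simp only: fps_const_mult[symmetric] fD_mult h mult.commute[of "cst (gcoord 0 (Inl i))"])
     (simp add: algebra_simps)
  next case (Inr j)
   have "U \<star> (ybar j * cst g) = (U \<star> ybar j) \<star> cst g" unfolding assoc antihol_star[OF antihol_ybar] ..
   also have "... = ybar j * (U \<star> cst g) + (if j = l then fps_X * cst g else 0)"
    unfolding assms mult.commute[of U] star_add1 star_antihol_mult[OF antihol_ybar] by(simp add: star_X1[of 1, simplified])
   finally have e: "U \<star> (ybar j * cst g) = ybar j * (U \<star> cst g) + (if j = l then fps_X * cst g else 0)" .
   have fd: "fD (Inr l) (ybar j) = (if j = l then 1 else 0)" by(auto simp: gD_gcoord)
   have "U \<star> cst (gcoord 0 (Inr j) * g) - U * cst (gcoord 0 (Inr j) * g) - fps_X * fD (Inr l) (cst (gcoord 0 (Inr j) * g))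
    = ybar j * (U \<star> cst g - U * cst g - fps_X * fD (Inr l) (cst g))"
    by(simp only: fps_const_mult[symmetric] fD_mult e fd) (simp add: algebra_simps)
   thus ?thesis unfolding Qn Inr by simp
  qed
 qed
 hence "op_fps Q G = 0" by(simp add: fps_eq_iff op_fps_nth)
 thus ?thesis using Q[of G] by(simp add: algebra_simps)
qed

definition left_derivation :: "'n => 'n germ fps => bool" where
 "left_derivation l U \<longleftrightarrow> (ALL G. U \<star> G = U * G + fps_X * fD (Inr l) G)"

lemma ex_left_derivation: "EX U. left_derivation l U"
proof - obtain U where U: "!!n m. C 1 (U n) (gcoord 0 (Inr m)) + (SUM i<n. C (Suc n - i) (U i) (gcoord 0 (Inr m)))
   = (if n = 0 & m = l then 1 else 0)" using ex_left_derivation_coeffs[of l] by blast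
 have "Abs_fps U \<star> ybar m = Abs_fps U * ybar m + (if m = l then fps_X else 0)" for m
 proof(rule fps_ext)
  fix n show "(Abs_fps U \<star> ybar m) $ n = (Abs_fps U * ybar m + (if m = l then fps_X else 0)) $ n"
  proof(cases n)
   case 0 thus ?thesis by(simp add: star_ybar_nth C0)
  next case (Suc k)
   have "(Abs_fps U \<star> ybar m) $ Suc k = U (Suc k) * gcoord 0 (Inr m) +
     (C 1 (U k) (gcoord 0 (Inr m)) + (SUM i<k. C (Suc k - i) (U i) (gcoord 0 (Inr m))))"
    unfolding star_ybar_nth by(simp add: C0 lessThan_Suc_atMost[symmetric] add_ac)
   thus ?thesis unfolding U Suc by simp
  qed
 qed
 from left_derivation_of_coeffs[OF this] show ?thesis unfolding left_derivation_def by blast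
qed

text \<open>Order n + 1 of the assumption says that the fields \<open>X\<close> annihilate the
  coefficient n, once the lower ones are known to be antiholomorphic.\<close>

lemma antihol_if_left_mult: assumes "!!m. F \<star> ybar m = F * ybar m" shows "antihol F"
proof - have "ALL i. gD (Inl i) (F $ n) = 0" for n
 proof(induction n rule: less_induct)
  case (less n) have "X m (F $ n) = 0" for m
  proof - have "(SUM i<=Suc n. C (Suc n - i) (F $ i) (gcoord 0 (Inr m))) = F $ Suc n * gcoord 0 (Inr m)"
    using arg_cong[OF assms[of m], of "%F. F $ Suc n"] by(simp add: star_ybar_nth)
   moreover have "(SUM i<n. C (Suc n - i) (F $ i) (gcoord 0 (Inr m))) = 0"
    by(rule sum.neutral) (use less in \<open>auto intro!: C_antihol\<close>)
   ultimately show ?thesis by(simp add: C0 lessThan_Suc_atMost[symmetric] C1_ybar[unfolded One_nat_def])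
  qed
  thus ?case by(simp add: gD_X)
 qed
 thus ?thesis by(simp add: fps_eq_iff)
qed

lemma left_derivation_unique: assumes "left_derivation l U" "left_derivation l U'" shows "antihol (U - U')"
 by(rule antihol_if_left_mult) (use assms in \<open>simp add: left_derivation_def star_diff1 algebra_simps\<close>)

text \<open>The left multiplications by U and U' are a function plus a multiple of a coordinate
  derivative, so their commutator is multiplication by a function, divisible by the parameter. By
  \<open>antihol_if_left_mult\<close> the quotient is antiholomorphic. This yields the second half
  of the closedness of \<alpha>.\<close>

lemma left_derivation_sym: assumes "left_derivation l U" "left_derivation m U'"
 shows "fD (Inl i) (fD (Inr m) U) = fD (Inl i) (fD (Inr l) U')"
proof - define c where "c = fD (Inr l) U' - fD (Inr m) U"
 have UU: "U \<star> U' - U' \<star> U = fps_X * c" using assms by(simp add: left_derivation_def c_def algebra_simps)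
 have "(U \<star> U' - U' \<star> U) \<star> G = fps_X * (c * G)" for G unfolding star_diff1 assoc using assms
  by(simp add: left_derivation_def star_add2 star_X2 fD_add fD_mult fD_commute c_def algebra_simps)
 hence "fps_X * (c \<star> G) = fps_X * (c * G)" for G unfolding UU star_X1 .
 hence "c \<star> G = c * G" for G by(rule fps_X_cancel)
 hence "antihol c" by(intro antihol_if_left_mult)
 thus ?thesis by(simp add: c_def fD_diff)
qed

text \<open>The order one part of the product with conjugate coordinates says that the order zero
  part of U is dual to the fields \<open>X\<close>.\<close>

lemma left_derivation_leading: assumes "left_derivation l U" shows "gD (Inl i) (fps_nth U 0) = - W i l"
proof - have "X m (U $ 0) = (if m = l then 1 else 0)" for m
 proof - have "(U \<star> ybar m) $ 1 = (U * ybar m + fps_X * fD (Inr l) (ybar m)) $ 1" using assms by(simp add: left_derivation_def)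
  thus ?thesis unfolding star_ybar_nth by(simp add: C0 C1_ybar[unfolded One_nat_def] gD_gcoord split: if_splits)
 qed
 thus ?thesis by(simp add: gD_X if_distrib[of "%x. _ * x"] cong: if_cong)
qed

end

section \<open>Symbols of right multiplications\<close>

text \<open>The Leibniz rule for families of jets: each letter of the word goes to one of the two
  factors.\<close>

primrec jprod :: "'i list => ('i list => 'r::comm_ring_1) => ('i list => 'r) => 'r" where "jprod [] a b = a [] * b []"
| "jprod (A # L) a b = jprod L (%M. a (A # M)) b + jprod L a (%M. b (A # M))"

text \<open>The part of the Leibniz rule in which exactly one letter goes to the first
  factor.\<close>

primrec zsum :: "'i list => ('i => 'r::comm_ring_1) => ('i list => 'r) => 'r" where "zsum [] c t = 0"
| "zsum (a # M) c t = zsum M c (%N. t (a # N)) + c a * t M"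

lemma jprod_const: "(!!N. N ~= [] ==> c N = 0) ==> jprod M c t = c [] * t M"
proof(induction M arbitrary: t c)
 case (Cons a M) have "jprod M (%N. c (a # N)) t = c [a] * t M" by(rule Cons.IH) (simp add: Cons.prems)
 moreover have "jprod M c (%N. t (a # N)) = c [] * t (a # M)" by(rule Cons.IH) (simp add: Cons.prems)
 ultimately show ?case by(simp add: Cons.prems)
qed simp

lemma jprod_short: "(!!N. 2 <= length N ==> c N = 0) ==> jprod M c t = c [] * t M + zsum M (%a. c [a]) t"
proof(induction M arbitrary: t)
 case (Cons a M) have "jprod M (%N. c (a # N)) t = c [a] * t M" by(rule jprod_const) (auto simp: Cons.prems neq_Nil_conv)
 thus ?case using Cons.IH[OF Cons.prems] by(simp add: add_ac)
qed simp

lemma zsum_nth_zero: fixes t :: "'i list => 'r::comm_ring_1 fps"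
 assumes "!!N i. length M <= Suc (length N) ==> i <= n ==> t N $ i = 0" shows "zsum M c t $ n = 0" using assms
proof(induction M arbitrary: t)
 case (Cons a M) have "zsum M c (%N. t (a # N)) $ n = 0" by(rule Cons.IH) (use Cons.prems in auto)
 moreover have "(c a * t M) $ n = 0" using Cons.prems by(simp add: fps_mult_nth)
 ultimately show ?case by simp
qed simp

lemma zsum_X_power: fixes t :: "'i list => 'r::comm_ring_1 fps"
 shows "fps_X * zsum M c (%N. fps_X ^ (length N + k) * t N) = fps_X ^ (length M + k) * zsum M c t"
proof(induction M arbitrary: t)
 case (Cons a M) have "fps_X * zsum M c (%N. fps_X ^ (length (a # N) + k) * t (a # N)) =
  fps_X * (fps_X * zsum M c (%N. fps_X ^ (length N + k) * t (a # N)))"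
 proof - have "zsum M c (%N. fps_X * t N) = fps_X * zsum M c t" for t by(induction M arbitrary: t) (auto simp: algebra_simps)
  thus ?thesis by(simp add: mult.assoc)
 qed
 also have "... = fps_X ^ (length (a # M) + k) * zsum M c (%N. t (a # N))" unfolding Cons.IH[of "%N. t (a # N)"] by(simp add: mult.assoc)
 finally show ?case by(simp add: algebra_simps)
qed simp

lemma ads_map: "ads x (map f L) R = ads (%a. x (f a)) L R" by(induction L arbitrary: R) auto

definition fX_op :: "('n germ => 'n germ) => 'n::finite germ fps => 'n germ fps" where "fX_op X F = Abs_fps (%n. X (F $ n))"

lemma fX_op_nth [simp]: "fX_op X F $ n = X (F $ n)" by(simp add: fX_op_def)

lemma foldr_fX_nth: "foldr (%a. fX_op (X a)) J F $ n = foldr X J (F $ n)" by(induction J) auto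

text \<open>Expansions hold for all large N, but once the terms beyond n are known to vanish the sum
  may be cut at n.\<close>

lemma sum_cut: fixes f :: "nat => 'a::comm_monoid_add" assumes "EX N0. ALL N>=N0. y = sum f {a..N}" "!!k. n < k ==> f k = 0"
 shows "y = sum f {a..n}"
proof - obtain N0 where "!!N. N >= N0 ==> y = sum f {a..N}" using assms by blast
 hence "y = sum f {a..max N0 n}" by simp
 also have "... = sum f {a..n}" by(rule sum.mono_neutral_right) (use assms(2) in auto)
 finally show ?thesis .
qed

locale wick_germ_pot = wick_germ C w W for C :: "nat => 'n::finite germ => 'n germ => 'n germ" and w W +
 fixes U :: "'n => 'n germ fps" assumes U: "left_derivation l (U l)" begin

definition u :: "'n => 'n germ" where "u l = fps_nth (U l) 0"
text \<open>The part of positive order; its holomorphic derivatives are the form \<alpha>, while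
  those of \<open>u\<close> are minus the Kaehler form.\<close>

definition ub :: "'n => 'n germ fps" where "ub l = U l - cst (u l)"
abbreviation uc :: "'n => 'n germ fps" where "uc l == cst (u l)"

lemma ub_0 [simp]: "fps_nth (ub l) 0 = 0" by(simp add: ub_def u_def)

lemma U_split: "U l = uc l + ub l" by(simp add: ub_def)

lemma gD_u: "gD (Inl i) (u l) = - W i l" unfolding u_def by(rule left_derivation_leading[OF U])

lemma X_u: "X a (u l) = (if a = l then 1 else 0)" by(simp add: X_def gD_u wW2 sum_negf)

text \<open>The components of the coordinate fields for the coordinates formed by the
  \<open>u\<close> and the conjugates: the fields \<open>X\<close>, and the conjugate derivatives
  corrected so that they annihilate \<open>u\<close>.\<close>

definition pvec :: "'n + 'n => 'n + 'n => 'n germ" where "pvec A = (case A of Inl a => case_sum (%i. w i a) (%_. 0)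
   | Inr l => case_sum (%i. - (SS m. gD (Inr l) (u m) * w i m)) (%j. if j = l then 1 else 0))"

definition D' :: "'n + 'n => 'n germ => 'n germ" where "D' A = wvf (pvec A)"

definition x' :: "'n + 'n => 'n germ" where "x' = case_sum u (%l. gcoord 0 (Inr l))"

lemma D'_Inl: "D' (Inl a) f = X a f" by(simp add: D'_def wvf_def pvec_def sum_UNIV_sum X_def)

lemma D'_Inr: "D' (Inr l) f = gD (Inr l) f - (SS m. gD (Inr l) (u m) * X m f)"
proof - have "(SS i. (SS m. gD (Inr l) (u m) * w i m) * gD (Inl i) f) = (SS m. gD (Inr l) (u m) * X m f)"
  by(simp add: X_def sum_distrib_left sum_distrib_right mult.assoc) (rule sum.swap)
 thus ?thesis by(simp add: D'_def wvf_def pvec_def sum_UNIV_sum sum_negf if_distrib[of "%x. x * _"] cong: if_cong)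
qed

lemma D'_x': "D' A (x' B) = (if A = B then 1 else 0)"
proof(cases A; cases B)
 fix l c assume "A = Inr l" "B = Inl c" thus ?thesis by(simp add: x'_def D'_Inr X_u if_distrib[of "%x. _ * x"] cong: if_cong)
next have Xg: "X a (gcoord 0 (Inr l)) = 0" for a l by(simp add: X_def gD_gcoord)
 fix a l assume "A = Inl a" "B = Inr l" thus ?thesis by(simp add: x'_def D'_Inl Xg)
next have Xg: "X a (gcoord 0 (Inr l)) = 0" for a l by(simp add: X_def gD_gcoord)
 fix a l assume "A = Inr a" "B = Inr l" thus ?thesis by(simp add: x'_def D'_Inr Xg gD_gcoord)
qed (simp add: x'_def D'_Inl X_u)

text \<open>The bracket of two fields that take constant values on a coordinate system annihilates
  it, and a vector field that does so is zero because \<open>W\<close> is invertible.\<close>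

lemma D'_commute: "D' A (D' B f) = D' B (D' A f)"
proof - define \<kappa> where "\<kappa> C = D' A (pvec B C) - D' B (pvec A C)" for C
 have br: "D' A (D' B f) - D' B (D' A f) = (SS C. \<kappa> C * gD C f)" for f unfolding \<kappa>_def D'_def by(rule wvf_bracket)
 have pc: "pvec E (Inr j) : {0, 1}" for E j by(cases E) (auto simp: pvec_def)
 have "D' E 0 = 0" "D' E 1 = 0" for E by(simp_all add: D'_def)
 hence c: "\<kappa> (Inr j) = 0" for j using pc[of A j] pc[of B j] by(auto simp: \<kappa>_def)
 \<comment> \<open>The fields have constant values on \<open>u c\<close>, so the bracket annihilates
   it.\<close>
 have "(SS i. \<kappa> (Inl i) * W i c) = 0" for c
 proof - have "x' (Inl c) = u c" by(simp add: x'_def)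
  hence "D' E (u c) : {0, 1}" for E using D'_x'[of E "Inl c"] by auto
  hence "D' A (D' B (u c)) - D' B (D' A (u c)) = 0" by(smt (verit, best) D'_def diff_self insertE singletonD wvf_one wvf_zero)
  thus ?thesis unfolding br by(simp add: sum_UNIV_sum c gD_u sum_negf)
 qed
 hence "\<kappa> (Inl p) = 0" for p
 proof - assume a: "!!c. (SS i. \<kappa> (Inl i) * W i c) = 0"
  have "(SS c. w p c * (SS i. \<kappa> (Inl i) * W i c)) = (SS i. \<kappa> (Inl i) * (SS c. w p c * W i c))"
   by(simp add: sum_distrib_left mult_ac) (rule sum.swap)
  also have "... = - \<kappa> (Inl p)" by(simp add: wW1 if_distrib[of "%x. _ * x"] cong: if_cong)
  finally show ?thesis by(simp add: a)
 qed
 thus ?thesis using br[of f] c by(simp add: sum_UNIV_sum)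
qed

sublocale vd: derivations D' x' by unfold_locales (auto simp: D'_commute D'_x', auto simp: D'_def wvf_add wvf_mult)

lemma dop_vd: "gd.dop R ==> vd.dop R"
proof(rule dop_change[OF derivations_germ vd.derivations_axioms, where
  m = "%A. case A of Inl i => case_sum (%a. - W i a) (%_. 0) | Inr l => case_sum (%m. gD (Inr l) (u m)) (%j. if j = l then 1 else 0)"])
 fix A f show "gD A f = (SS B. (case A of Inl i => case_sum (%a. - W i a) (%_. 0)
   | Inr l => case_sum (%m. gD (Inr l) (u m)) (%j. if j = l then 1 else 0)) B * D' B f)"
  by(cases A) (simp_all add: sum_UNIV_sum D'_Inl D'_Inr gD_X sum_negf if_distrib[of "%x. x * _"] cong: if_cong)
qed

lemma X_commute: "X a (X b f) = X b (X a f)" using D'_commute[of "Inl a" "Inl b"] by(simp add: D'_Inl)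

text \<open>Unfolding the vanishing bracket of a holomorphic and a corrected antiholomorphic
  coordinate field.\<close>

lemma V_commute: "X a (gD (Inr l) f) - gD (Inr l) (X a f) = (SS m. X a (gD (Inr l) (u m)) * X m f)"
proof - have Xm: "X a (f * g) = X a f * g + f * X a g" for f g using vd.D_mult[of "Inl a" f g] by(simp add: D'_Inl)
 have Xs: "X a (sum h I) = (SUM i:I. X a (h i))" for h and I :: "'n set" by(induction I rule: fin_induct) (auto simp: X_add)
 show ?thesis using D'_commute[of "Inl a" "Inr l" f] by(simp add: D'_Inl D'_Inr X_diff Xs Xm sum.distrib X_commute[of a] algebra_simps)
qed

text \<open>Differential operators involving holomorphic directions only. Right multiplications are
  of this kind by the Wick property.\<close>

definition hol_op :: "('n germ => 'n germ) => bool" where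
 "hol_op r \<longleftrightarrow> gd.dop r & (ALL q f. (ALL i. gD (Inl i) q = 0) --> r (q * f) = q * r f)"

lemma hol_op_ad: "hol_op r ==> hol_op (ad h r)" unfolding hol_op_def
proof(intro conjI allI impI)
 assume r: "gd.dop r & (ALL q f. (ALL i. gD (Inl i) q = 0) --> r (q * f) = q * r f)"
 show "gd.dop (ad h r)" unfolding ad_def using r by(intro gd.dop_diff gd.dop_rmult gd.dop_lmult) auto
 fix q f :: "'n germ" assume q: "ALL i. gD (Inl i) q = 0"
 have "r (h * (q * f)) = q * r (h * f)" using r q by(simp only: mult.left_commute[of h]) blast
 moreover have "r (q * f) = q * r f" using r q by blast
 ultimately show "ad h r (q * f) = q * ad h r f" by(simp add: ad_def algebra_simps)
qed

lemma hol_op_ads: "hol_op r ==> hol_op (ads x L r)" by(induction L arbitrary: r) (auto simp: hol_op_ad)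

lemma hol_op_rop: "hol_op (rop C G m)" unfolding hol_op_def
proof(intro conjI allI impI)
 show "gd.dop (rop C G m)" by(rule rop_dop)
 fix q f :: "'n germ" assume q: "ALL i. gD (Inl i) q = 0"
 hence "(cst q * cst f) \<star> G = cst q * (cst f \<star> G)" by(intro star_antihol_mult) simp
 from arg_cong[OF this, of "%F. F $ m"] show "rop C G m (q * f) = q * rop C G m f" by(simp add: fstar_rop op_fps_const)
qed

text \<open>The commutator with a conjugate coordinate is zero, whatever commutators were taken
  before it.\<close>

lemma sig_Inr: assumes "hol_op r" "Inr l : set J" shows "vd.sig J r = 0" using assms
proof(induction J arbitrary: r)
 case (Cons A J) show ?case
 proof(cases A)
  case (Inl a) hence "vd.sig J (ad (x' A) r) = 0" using Cons hol_op_ad by auto thus ?thesis by(simp add: vd.sig_def)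
 next case (Inr m)
  have "ad (x' A) r f = 0" for f using Cons.prems(1) by(simp add: ad_def hol_op_def Inr x'_def gD_gcoord)
  thus ?thesis by(simp add: vd.sig_def ads_zero)
 qed
qed simp

lemma hol_op_expansion: assumes "hol_op r"
 shows "EX N0. ALL N>=N0. ALL f. r f = (SUM k<=N. (1 / fact k) *R (SUM J:words k. ads u J r 1 * foldr X J f))"
proof - have "(SUM J:words k. vd.sig J r * foldr D' J f) = (SUM J:words k. ads u J r 1 * foldr X J f)" for k f
 proof - have "foldr D' (map Inl J) f = foldr X J f" for J by(induction J) (auto simp: D'_Inl)
  moreover have "(%a. x' (Inl a)) = u" by(simp add: x'_def)
  ultimately show ?thesis by(subst sum_lists_Inl) (simp_all add: sig_Inr[OF assms], simp add: vd.sig_def ads_map)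
 qed
 thus ?thesis using vd.dop_expansion[OF dop_vd, of r] assms by(auto simp: hol_op_def)
qed

abbreviation Xs :: "'n list => 'n germ fps => 'n germ fps" where "Xs J F == foldr (%a. fX_op (X a)) J F"

text \<open>A fixed power of the parameter involves finitely many operators, so one bound serves all
  of them.\<close>

lemma op_fps_expansion: assumes "!!m. hol_op (r m)" shows "EX N0. ALL N>=N0. op_fps r h $ n =
  (SUM k:{0..N}. (1 / fact k) *R ((SUM J:words k. ads uc J (op_fps r) 1 * Xs J h) $ n))"
proof - have a0: "ads u J (r m) 0 = 0" for J m using gd.additive_zero gd.dop_additive hol_op_ads[OF assms] unfolding hol_op_def by blast
 have s: "ads uc J (op_fps r) 1 $ n = ads u J (r n) 1" for J n
  using op_fps_const[of "%m. ads u J (r m)" 1 n, OF a0] by(simp add: ads_op_fps)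
 have "ALL m. EX N0. ALL N>=N0. ALL f. r m f = (SUM k<=N. (1 / fact k) *R (SUM J:words k. ads u J (r m) 1 * foldr X J f))"
  by(rule allI, rule hol_op_expansion[OF assms])
 from choice[OF this] obtain N0 where N0: "!!m N f. N >= N0 m ==> r m f = (SUM k<=N. (1 / fact k) *R (SUM J:words k. ads u J (r m) 1 * foldr X J f))"
  by blast
 show ?thesis
 proof(intro exI[of _ "Max (N0 ` {..n})"] allI impI)
  fix N assume N: "Max (N0 ` {..n}) <= N" have N': "N0 m <= N" if "m <= n" for m
   using that N by(meson Max_ge atMost_iff finite_atMost finite_imageI image_eqI order_trans)
  have "op_fps r h $ n = (SUM i<=n. SUM k<=N. (1 / fact k) *R (SUM J:words k. ads u J (r (n - i)) 1 * foldr X J (h $ i)))"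
   unfolding op_fps_nth by(intro sum.cong refl N0 N') auto
  also have "... = (SUM k<=N. (1 / fact k) *R (SUM i<=n. SUM J:words k. ads u J (r (n - i)) 1 * foldr X J (h $ i)))"
   by(subst sum.swap) (simp add: scaleR_sum_right)
  also have "... = (SUM k<=N. (1 / fact k) *R ((SUM J:words k. ads uc J (op_fps r) 1 * Xs J h) $ n))"
  proof - have "(ads uc J (op_fps r) 1 * Xs J h) $ n = (SUM i<=n. ads u J (r (n - i)) 1 * foldr X J (h $ i))" for J
    unfolding mult.commute[of "ads uc J (op_fps r) 1"] fps_mult_nth atLeast0AtMost by(simp add: s foldr_fX_nth mult.commute)
   thus ?thesis by(simp add: fps_sum_nth) (subst sum.swap, simp)
  qed
  finally show "op_fps r h $ n = (SUM k:{0..N}. (1 / fact k) *R ((SUM J:words k. ads uc J (op_fps r) 1 * Xs J h) $ n))"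
   by(simp add: atLeast0AtMost)
 qed
qed

context fixes G :: "'n germ fps" begin

text \<open>The symbol of right multiplication by \<open>G\<close> in the coordinates
  \<open>u\<close>, before the division by powers of the parameter.\<close>

definition S :: "'n list => 'n germ fps" where "S L = ads uc L (%F. F \<star> G) 1"

abbreviation RM :: "'n list => 'n germ fps => 'n germ fps" where "RM M == ads uc M (%F. F \<star> G)"

lemma RM_op: "RM M = op_fps (%m. ads u M (rop C G m))"
proof - have "(%F. F \<star> G) = op_fps (rop C G)" by(simp add: fun_eq_iff fstar_rop)
 thus ?thesis by(simp add: ads_op_fps)
qed

lemma S_perm: "mset K = mset L ==> S K = S L" unfolding S_def by(simp add: ads_perm[of K L])

lemma RM_expansion: "EX N0. ALL N>=N0. RM M h $ n = (SUM k:{0..N}. (1 / fact k) *R ((SUM J:words k. S (M @ J) * Xs J h) $ n))"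
 using op_fps_expansion[of "%m. ads u M (rop C G m)" h n, OF hol_op_ads[OF hol_op_rop]] unfolding RM_op[symmetric] S_def ads_append by simp

text \<open>The commutator with a multiplication removes the term without derivatives from the
  expansion, so the sum begins at k = 1.\<close>

lemma tau_expansion:
 "EX N0. ALL N>=N0. ad h (RM M) 1 $ n = (SUM k:{1..N}. (1 / fact k) *R ((SUM J:words k. S (M @ J) * Xs J h) $ n))"
proof - obtain N0 where N0: "!!N. N >= N0 ==> RM M h $ n = (SUM k:{0..N}. (1 / fact k) *R ((SUM J:words k. S (M @ J) * Xs J h) $ n))"
  using RM_expansion by blast
 have "ad h (RM M) 1 = RM M h - h * S M" by(simp add: ad_def S_def)
 thus ?thesis using N0 by(intro exI[of _ N0]) (simp add: sum.atLeast_Suc_atMost[of 0] lists_length_0[simplified] mult.commute[of h])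
qed

text \<open>The correction that arises when the conjugate derivative is moved out of a chain of
  commutators, since the functions \<open>u\<close> themselves depend on the conjugate
  coordinates.\<close>

primrec Zf :: "'n => 'n list => ('n germ fps => 'n germ fps) => 'n germ fps" where "Zf l [] R = 0"
| "Zf l (a # M) R = Zf l M (ad (uc a) R) + ad (fD (Inr l) (uc a)) (ads uc M R) 1"

lemma ads_commutator: assumes "!!F F'. R (F + F') = R F + R F'"
 shows "ads uc M (%F. fD (Inr l) (R F) - R (fD (Inr l) F)) 1 = fD (Inr l) (ads uc M R 1) - Zf l M R" using assms
proof(induction M arbitrary: R)
 case Nil from Nil[of 0 0] have "R 0 = 0" by simp thus ?case by simp
next case (Cons a M)
 define K where "K R F = fD (Inr l) (R F) - R (fD (Inr l) F)" for R and F :: "'n germ fps" let ?d = "fD (Inr l) (uc a)"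
 have "ad (uc a) (K R) F = 1 * K (ad (uc a) R) F + (-1) * ad ?d R F" for F
  unfolding K_def ad_def fD_mult fD_diff Cons.prems by(simp add: algebra_simps)
 from ads_lin[of "ad (uc a) (K R)", OF this]
 have "ads uc M (ad (uc a) (K R)) 1 = ads uc M (K (ad (uc a) R)) 1 - ads uc M (ad ?d R) 1" by simp
 also have "ads uc M (K (ad (uc a) R)) 1 = fD (Inr l) (ads uc M (ad (uc a) R) 1) - Zf l M (ad (uc a) R)"
  unfolding K_def by(rule Cons.IH) (simp add: ad_def Cons.prems algebra_simps)
 finally show ?case by(simp add: K_def ads_ad)
qed

text \<open>In each term one letter of M is replaced by a commutator with a derivative of its
  \<open>u\<close>, which \<open>tau_expansion\<close> expresses through symbols again.\<close>

lemma Zf_expansion: "EX N0. ALL N>=N0. Zf l M (RM K) $ n =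
  (SUM k:{1..N}. (1 / fact k) *R ((SUM J:words k. zsum M (%a. Xs J (fD (Inr l) (uc a))) (%N. S (K @ N @ J))) $ n))"
proof(induction M arbitrary: K)
 case Nil thus ?case by simp
next case (Cons a M)
 obtain N1 where 1: "!!N. N >= N1 ==> Zf l M (RM (K @ [a])) $ n =
  (SUM k:{1..N}. (1 / fact k) *R ((SUM J:words k. zsum M (%a. Xs J (fD (Inr l) (uc a))) (%N. S ((K @ [a]) @ N @ J))) $ n))"
  using Cons.IH by blast
 obtain N2 where 2: "!!N. N >= N2 ==> ad (fD (Inr l) (uc a)) (RM (K @ M)) 1 $ n =
  (SUM k:{1..N}. (1 / fact k) *R ((SUM J:words k. S ((K @ M) @ J) * Xs J (fD (Inr l) (uc a))) $ n))" using tau_expansion by blast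
 show ?case
 proof(intro exI[of _ "max N1 N2"] allI impI)
  fix N assume "max N1 N2 <= N" hence N: "N1 <= N" "N2 <= N" by auto
  have "Zf l (a # M) (RM K) = Zf l M (RM (K @ [a])) + ad (fD (Inr l) (uc a)) (RM (K @ M)) 1" by(simp add: ads_append)
  thus "Zf l (a # M) (RM K) $ n = (SUM k:{1..N}. (1 / fact k) *R
    ((SUM J:words k. zsum (a # M) (%a. Xs J (fD (Inr l) (uc a))) (%N. S (K @ N @ J))) $ n))"
   using 1[OF N(1)] 2[OF N(2)] by(simp add: sum.distrib scaleR_add_right mult.commute[of "Xs _ _"])
 qed
qed

text \<open>Associativity with left factor \<open>U l\<close> says that the commutator of right
  multiplication with \<open>U l\<close> is the parameter times its commutator with the conjugate
  derivative. Splitting \<open>U l\<close> into \<open>u\<close> and \<open>ub\<close> and applying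
  the remaining commutators gives a recursion for symbols.\<close>

lemma S_Cons: "S (l # M) + ad (ub l) (RM M) 1 = fps_X * (fD (Inr l) (S M) - Zf l M (%F. F \<star> G))"
proof - let ?R = "%F. F \<star> G"
 have "(U l * F + fps_X * fD (Inr l) F) \<star> G = U l * (F \<star> G) + fps_X * fD (Inr l) (F \<star> G)" for F
  using assoc[of "U l" F G] U[of l] unfolding left_derivation_def by simp
 hence "ad (U l) ?R F = fps_X * (fD (Inr l) (?R F) - ?R (fD (Inr l) F)) + 0 * F" for F
  unfolding ad_def star_add1 star_X1 by(simp add: algebra_simps eq_diff_eq)
 moreover have "ad (U l) ?R F = 1 * ad (uc l) ?R F + 1 * ad (ub l) ?R F" for F by(simp add: ad_def U_split[of l] star_add1 algebra_simps)
 moreover have com: "ads uc M (%F. fD (Inr l) (?R F) - ?R (fD (Inr l) F)) 1 = fD (Inr l) (S M) - Zf l M ?R"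
  using ads_commutator[of ?R M l] by(simp add: S_def star_add1)
 ultimately have e: "1 * ad (uc l) ?R F + 1 * ad (ub l) ?R F = fps_X * (fD (Inr l) (?R F) - ?R (fD (Inr l) F)) + 0 * F" for F by metis
 have "ads uc M (%F. 1 * ad (uc l) ?R F + 1 * ad (ub l) ?R F) 1 = S (l # M) + ad (ub l) (RM M) 1"
  by(subst ads_lin[of _ 1 "ad (uc l) ?R" 1 "ad (ub l) ?R"]) (auto simp: S_def ads_ad)
 moreover have "ads uc M (%F. fps_X * (fD (Inr l) (?R F) - ?R (fD (Inr l) F)) + 0 * F) 1 = fps_X * (fD (Inr l) (S M) - Zf l M ?R)"
  by(subst ads_lin[of _ fps_X "%F. fD (Inr l) (?R F) - ?R (fD (Inr l) F)" 0 "%F. F"]) (simp_all add: com)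
 ultimately show ?thesis by(simp only: e)
qed

text \<open>Each letter accounts for one power of the parameter. In the recursion both corrections
  gain: \<open>ub\<close> has positive order, and the other one carries an explicit factor while its
  words lose one letter and gain at least one.\<close>

theorem S_natural: "n < length L ==> S L $ n = 0"
proof(induction n arbitrary: L rule: less_induct)
 case (less n) then obtain l M where L: "L = l # M" "n <= length M" by(cases L) auto
 have IH: "S N $ i = 0" if "i < n" "i < length N" for N i using less.IH that by blast
 have 1: "ad (ub l) (RM M) 1 $ n = 0"
 proof - obtain N where "ad (ub l) (RM M) 1 $ n = (SUM k:{1..N}. (1 / fact k) *R ((SUM J:words k. S (M @ J) * Xs J (ub l)) $ n))"
   using tau_expansion[of "ub l" M n] by blast
  also have "... = 0"
  proof(rule sum.neutral, rule ballI)
   fix k assume k: "k : {1..N}" have "(S (M @ J) * Xs J (ub l)) $ n = 0" if "length J = k" for J unfolding fps_mult_nth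
   proof(rule sum.neutral, rule ballI)
    fix i assume i: "i : {0..n}" show "S (M @ J) $ i * Xs J (ub l) $ (n - i) = 0"
    proof(cases "i = n")
     \<comment> \<open>The other factor is then taken at order zero, where \<open>ub\<close>
       vanishes.\<close>
     case True have "foldr X J 0 = 0" by(induction J) auto thus ?thesis using True by(simp add: foldr_fX_nth)
    next case False
     thus ?thesis using IH[of i "M @ J"] i k L(2) by simp
    qed
   qed
   thus "(1 / fact k) *R ((SUM J:words k. S (M @ J) * Xs J (ub l)) $ n) = 0" by(simp add: fps_sum_nth)
  qed
  finally show ?thesis .
 qed
 have 2: "(fps_X * (fD (Inr l) (S M) - Zf l M (%F. F \<star> G))) $ n = 0"
 proof(cases n)
  case (Suc m) have "S M $ m = 0" by(rule IH) (use L Suc in auto)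
  moreover have "Zf l M (RM []) $ m = 0"
  proof - obtain N where "Zf l M (RM []) $ m = (SUM k:{1..N}. (1 / fact k) *R
     ((SUM J:words k. zsum M (%a. Xs J (fD (Inr l) (uc a))) (%N. S ([] @ N @ J))) $ m))" using Zf_expansion[of l M "[]" m] by blast
   also have "... = 0"
   proof(rule sum.neutral, rule ballI)
    fix k assume k: "k : {1..N}" have "zsum M (%a. Xs J (fD (Inr l) (uc a))) (%N. S ([] @ N @ J)) $ m = 0" if "length J = k" for J
     by(rule zsum_nth_zero, rule IH) (use Suc L k that in auto)
    thus "(1 / fact k) *R ((SUM J:words k. zsum M (%a. Xs J (fD (Inr l) (uc a))) (%N. S ([] @ N @ J))) $ m) = 0"
     by(simp add: fps_sum_nth)
   qed
   finally show ?thesis .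
  qed
  ultimately show ?thesis by(simp add: Suc)
 qed simp
 show ?case using arg_cong[OF S_Cons[of l M], of "%F. F $ n"] 1 2 L by simp
qed

definition T :: "'n list => 'n germ fps" where "T L = fps_shift (length L) (S L)"

lemma S_T: "S L = fps_X ^ length L * T L" by(rule fps_ext) (auto simp: T_def fps_X_power_mult_nth S_natural)

lemma T_Nil [simp]: "T [] = G" by(simp add: T_def S_def)

lemma T_perm: "mset K = mset L ==> T K = T L" using S_perm[of K L] mset_eq_length[of K L] by(simp add: T_def)

text \<open>The expansion of right multiplication with the powers of the parameter split off; it is
  already a Wick contraction of the jets of the two factors.\<close>

theorem star_T: "(F \<star> G) $ n = (SUM k<=n. (1 / fact k) *R ((SUM J:words k. Xs J F * T J) $ (n - k)))"
proof - have c: "((SUM J:words k. S ([] @ J) * Xs J F) $ n) = (if k <= n then (SUM J:words k. Xs J F * T J) $ (n - k) else 0)" for k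
 proof - have "(SUM J:words k. S ([] @ J) * Xs J F) = fps_X ^ k * (SUM J:words k. Xs J F * T J)"
   unfolding sum_distrib_left by(rule sum.cong) (auto simp: S_T mult_ac)
  thus ?thesis by(auto simp: fps_X_power_mult_nth)
 qed
 have "RM [] F $ n = (SUM k:{0..n}. (1 / fact k) *R ((SUM J:words k. S ([] @ J) * Xs J F) $ n))"
  by(rule sum_cut[OF RM_expansion]) (unfold c, simp)
 thus ?thesis unfolding c by(simp add: atLeast0AtMost)
qed

text \<open>The components, in the frame, of the element whose commutator occurs in the Fedosov
  equation: a holomorphic word J and an antiholomorphic word N of length at most one.\<close>

definition hc :: "'n => 'n list => 'n list => 'n germ fps" where
 "hc l J N = (case N of [] => - Xs J (ub l) | [m] => - Xs J (fD (Inr l) (uc m)) | _ => 0)"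

text \<open>The recursion for symbols after the powers have been divided out. This is the
  antiholomorphic part of the flatness equation on words without holomorphic letters.\<close>

theorem T_Cons: "T (l # M) $ n = gD (Inr l) (T M $ n)
  + (SUM k:{1..Suc n}. (1 / fact k) *R ((SUM J:words k. jprod M (hc l J) (%N. T (J @ N))) $ (Suc n - k)))"
proof - let ?p = "length M"
 have Tp: "T (N @ J) = T (J @ N)" for N J by(rule T_perm) simp
 \<comment> \<open>The symbol of \<open>l # M\<close> carries \<open>Suc (length M)\<close> powers,
   so coefficient n of its \<open>T\<close> is read at \<open>Suc n + length M\<close>.\<close>
 have nth: "(fps_X ^ (?p + k) * y) $ (Suc n + ?p) = (if k <= Suc n then y $ (Suc n - k) else 0)" for k and y :: "'n germ fps"
  by(auto simp: fps_X_power_mult_nth)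
 define A where "A k = (SUM J:words k. T (M @ J) * Xs J (ub l))" for k
 define B where "B k = (SUM J:words k. zsum M (%a. Xs J (fD (Inr l) (uc a))) (%N. T (N @ J)))" for k
 have A: "(SUM J:words k. S (M @ J) * Xs J (ub l)) = fps_X ^ (?p + k) * A k" for k
  unfolding A_def sum_distrib_left by(rule sum.cong) (auto simp: S_T mult_ac)
 have B: "fps_X * (SUM J:words k. zsum M (%a. Xs J (fD (Inr l) (uc a))) (%N. S ([] @ N @ J))) = fps_X ^ (?p + k) * B k" for k
  unfolding B_def sum_distrib_left by(rule sum.cong) (auto simp: S_T zsum_X_power[symmetric])
 have 1: "ad (ub l) (RM M) 1 $ (Suc n + ?p) = (SUM k:{1..Suc n}. (1 / fact k) *R (A k $ (Suc n - k)))"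
 proof -
  have "ad (ub l) (RM M) 1 $ (Suc n + ?p) = (SUM k:{1..Suc n}. (1 / fact k) *R ((SUM J:words k. S (M @ J) * Xs J (ub l)) $ (Suc n + ?p)))"
   by(rule sum_cut[OF tau_expansion]) (unfold A nth, simp)
  thus ?thesis unfolding A nth by simp
 qed
 have 2: "(fps_X * Zf l M (RM [])) $ (Suc n + ?p) = (SUM k:{1..Suc n}. (1 / fact k) *R (B k $ (Suc n - k)))"
 proof -
  have c: "(SUM J:words k. zsum M (%a. Xs J (fD (Inr l) (uc a))) (%N. S ([] @ N @ J))) $ (n + ?p) = (if k <= Suc n then B k $ (Suc n - k) else 0)" for k
   using arg_cong[OF B[of k], of "%F. F $ (Suc n + ?p)"] unfolding nth by simp
  have "Zf l M (RM []) $ (n + ?p) = (SUM k:{1..Suc n}. (1 / fact k) *R ((SUM J:words k. zsum M (%a. Xs J (fD (Inr l) (uc a))) (%N. S ([] @ N @ J))) $ (n + ?p)))"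
   by(rule sum_cut[OF Zf_expansion]) (unfold c, simp)
  thus ?thesis unfolding c by simp
 qed
 have AB: "(SUM J:words k. jprod M (hc l J) (%N. T (J @ N))) = - A k - B k" for k
 proof - have "jprod M (hc l J) (%N. T (J @ N)) = - (T (M @ J) * Xs J (ub l)) - zsum M (%a. Xs J (fD (Inr l) (uc a))) (%N. T (N @ J))" for J
  proof - have "zsum M (%a. - c a) t = - zsum M c t" for c and t :: "'n list => 'n germ fps" by(induction M arbitrary: t) auto
   moreover have "jprod M (hc l J) (%N. T (J @ N)) = hc l J [] * T (J @ M) + zsum M (%a. hc l J [a]) (%N. T (J @ N))"
    by(rule jprod_short) (auto simp: hc_def split: list.split)
   ultimately show ?thesis by(simp add: hc_def Tp mult.commute)
  qed
  thus ?thesis by(simp add: A_def B_def sum_negf sum_subtractf)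
 qed
 have "S (l # M) $ (Suc n + ?p) = T (l # M) $ n" by(simp add: T_def)
 moreover have "S M $ (n + ?p) = T M $ n" by(simp add: T_def)
 moreover have "S (l # M) $ (Suc n + ?p) + ad (ub l) (RM M) 1 $ (Suc n + ?p) = gD (Inr l) (S M $ (n + ?p)) - (fps_X * Zf l M (RM [])) $ (Suc n + ?p)"
  using arg_cong[OF S_Cons[of l M], of "%F. F $ (Suc n + ?p)"] by simp
 ultimately show ?thesis unfolding AB 1 2 by(simp add: sum_subtractf sum_negf scaleR_diff_right algebra_simps)
qed

text \<open>Another choice of order zero functions differs by antiholomorphic ones, which commute
  with right multiplications. Hence the symbols do not depend on the solution chosen at the
  point.\<close>

lemma S_independent: assumes "!!a i. gD (Inl i) (v a) = - W i a" shows "ads (%a. cst (v a)) L (%F. F \<star> G) 1 = S L"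
proof - have "ads (%a. cst (v a)) L R = ads uc L R"
  if "!!q F. antihol q ==> R (q * F) = q * R F" "!!F F'. R (F + F') = R F + R F'" for R using that
 proof(induction L arbitrary: R)
  case (Cons a L) have "ad (cst (v a)) R = ad (uc a) R"
  proof
   fix F have q: "antihol (cst (v a - u a))" by(simp add: gD_diff assms gD_u) have "cst (v a) = cst (v a - u a) + uc a" by simp
   thus "ad (cst (v a)) R F = ad (uc a) R F"
    using Cons.prems(1)[OF q, of F] unfolding ad_def by(simp only: distrib_right Cons.prems(2)) (simp add: algebra_simps)
  qed
  moreover have "ads (%a. cst (v a)) L (ad (uc a) R) = ads uc L (ad (uc a) R)"
   by(rule Cons.IH) (use Cons.prems in \<open>auto simp: ad_def mult.left_commute[of _ "cst _"] algebra_simps\<close>)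
  ultimately show ?case by simp
 qed simp
 thus ?thesis unfolding S_def by(simp add: star_antihol_mult star_add1)
qed

end

end

section \<open>Charts and extension of germs\<close>

definition lf :: "('a, 'n) chart => ('a => 'b) => complex^'n => 'b" where "lf c f = (%z. f (chart_inv c z))"

lemma jacobian_eq: "jacobian c c' B A = jac (transition c c') B A" by(cases B) (simp_all add: jacobian_def jac_def wcomp_def fun_eq_iff)

locale atlas = fixes \<A> :: "('a::{t2_space, second_countable_topology}, 'n::finite) chart set" assumes atlas: "complex_atlas \<A>" begin

abbreviation "ff == formal_fun \<A>"
abbreviation "sf == smooth_fun \<A>"

lemma chart_homeo: "c : \<A> ==> homeomorphism (fst c) (chart_image c) (snd c) (chart_inv c)"
 and open_chart: "c : \<A> ==> open (fst c)" and open_chart_image: "c : \<A> ==> open (chart_image c)"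
 using atlas by(auto simp: complex_atlas_def)

lemma chart_inv_apply [simp]: "c : \<A> ==> x : fst c ==> chart_inv c (snd c x) = x" using chart_homeo homeomorphism_apply1 by blast

lemma chart_apply_inv [simp]: "c : \<A> ==> z : chart_image c ==> snd c (chart_inv c z) = z" using chart_homeo homeomorphism_apply2 by blast

lemma chart_inv_in [simp]: "c : \<A> ==> z : chart_image c ==> chart_inv c z : fst c" using chart_homeo homeomorphism_image2 by blast

lemma chart_in_image [simp]: "x : fst c ==> snd c x : chart_image c" by(simp add: chart_image_def)

lemma ex_chart: obtains c where "c : \<A>" "x : fst c"
proof - have "x : (UN c:\<A>. fst c)" using atlas by(simp add: complex_atlas_def)
 thus ?thesis using that by blast
qed

lemma chart_at: "chart_at \<A> x : \<A>" "x : fst (chart_at \<A> x)"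
proof - obtain c where "c : \<A> & x : fst c" using ex_chart by metis
 hence "chart_at \<A> x : \<A> & x : fst (chart_at \<A> x)" unfolding chart_at_def by(rule someI)
 thus "chart_at \<A> x : \<A>" "x : fst (chart_at \<A> x)" by auto
qed

text \<open>Transport of neighbourhood filters through a chart, the bridge between statements on the
  manifold and statements in coordinates.\<close>

lemma eventually_chart: assumes "c : \<A>" "x : fst c"
 shows "(\<forall>\<^sub>F w in nhds (snd c x). P (chart_inv c w)) \<longleftrightarrow> (\<forall>\<^sub>F y in nhds x. P y)"
proof
 assume P: "near (snd c x) (%w. P (chart_inv c w))" have "isCont (snd c) x" using homeomorphism_cont1[OF chart_homeo[OF assms(1)]] assms(2)
   continuous_on_eq_continuous_at[OF open_chart[OF assms(1)], of "snd c"] by blast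
 hence "filterlim (snd c) (nhds (snd c x)) (nhds x)" by(simp only: isCont_def tendsto_at_iff_tendsto_nhds)
 from eventually_compose_filterlim[OF P this]
 have "near x (%y. P (chart_inv c (snd c y)))" .
 moreover have "near x (%y. y : fst c)" by(rule eventually_nhds_in_open[OF open_chart[OF assms(1)] assms(2)])
 ultimately show "near x (%y. P y)" by eventually_elim (simp add: assms)
next assume P: "near x (%y. P y)"
 have "isCont (chart_inv c) (snd c x)" using homeomorphism_cont2[OF chart_homeo[OF assms(1)]] chart_in_image[OF assms(2)]
   continuous_on_eq_continuous_at[OF open_chart_image[OF assms(1)], of "chart_inv c"] by blast
 hence "filterlim (chart_inv c) (nhds (chart_inv c (snd c x))) (nhds (snd c x))" by(simp only: isCont_def tendsto_at_iff_tendsto_nhds)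
 hence "filterlim (chart_inv c) (nhds x) (nhds (snd c x))" by(simp only: chart_inv_apply[OF assms])
 from eventually_compose_filterlim[OF P this]
 show "near (snd c x) (%w. P (chart_inv c w))" .
qed

lemma near_chart_image: "c : \<A> ==> x : fst c ==> near (snd c x) (%w. w : chart_image c)"
 using eventually_nhds_in_open[OF open_chart_image chart_in_image] by blast

abbreviation overlap :: "('a, 'n) chart => ('a, 'n) chart => (complex^'n) set" where "overlap c c' == snd c ` (fst c \<inter> fst c')"

lemma overlap_iff: assumes "c : \<A>" shows "z : overlap c c' \<longleftrightarrow> z : chart_image c & chart_inv c z : fst c'"
 using assms by(auto simp: image_iff chart_image_def)

lemma open_overlap: assumes "c : \<A>" "c' : \<A>" shows "open (overlap c c')"
proof - have "overlap c c' = chart_image c \<inter> chart_inv c -` fst c'" using overlap_iff[OF assms(1)] by blast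
 thus ?thesis using continuous_on_open_vimage[OF open_chart_image[OF assms(1)], of "chart_inv c"]
   homeomorphism_cont2[OF chart_homeo[OF assms(1)]] open_chart[OF assms(2)] by(simp add: Int_commute)
qed

lemma transition_apply: "c : \<A> ==> x : fst c ==> transition c c' (snd c x) = snd c' x" by(simp add: transition_def)

lemma smooth_on_transition: assumes "c : \<A>" "c' : \<A>" shows "smooth_on (overlap c c') (%z. transition c c' z $ i)"
 by(rule holo_on_smooth[OF open_overlap[OF assms]]) (use atlas assms in \<open>auto simp: complex_atlas_def\<close>)

lemma transition_differentiable: assumes "c : \<A>" "c' : \<A>" "x : fst c" "x : fst c'"
 shows "(%z. transition c c' z $ i) differentiable (at (snd c x))"
 using smooth_on_deriv[OF smooth_on_transition[OF assms(1,2)]] assms by blast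

lemma smooth_at_lf_change: assumes c: "c : \<A>" "c' : \<A>" "x : fst c" "x : fst c'" and f: "smooth_at (snd c x) (lf c f)"
 shows "smooth_at (snd c' x) (lf c' f)"
proof - obtain V where V: "open V" "snd c x : V" "smooth_on V (lf c f)" using f by(auto simp: smooth_at_def)
 let ?O = "overlap c' c" let ?\<phi> = "transition c' c" have cont: "continuous_on ?O ?\<phi>"
 proof - have "continuous_on ?O (%z. \<chi> i. ?\<phi> z $ i)"
   by(intro continuous_on_vec_lambda smooth_on_continuous smooth_on_transition c)
  thus ?thesis by simp
 qed
 have O: "open ?O" by(rule open_overlap) (use c in auto)
 have W: "open (?\<phi> -` V \<inter> ?O)" using continuous_on_open_vimage[OF O] cont V(1) by blast
 have "smooth_on (?\<phi> -` V \<inter> ?O) (%z. lf c f (?\<phi> z))"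
  by(rule smooth_on_compose[OF W V(1,3)]) (use smooth_on_subset[OF smooth_on_transition[OF c(2,1)]] in auto)
 hence "smooth_on (?\<phi> -` V \<inter> ?O) (lf c' f)"
  by(rule smooth_on_cong[OF _ W]) (use c overlap_iff[OF c(2)] in \<open>auto simp: lf_def transition_def\<close>)
 moreover have "snd c' x : ?\<phi> -` V \<inter> ?O" using c V(2) by(auto simp: transition_apply)
 ultimately show ?thesis using W smooth_atI by blast
qed

lemma smooth_fun_iff: "sf f \<longleftrightarrow> (ALL c:\<A>. ALL x:fst c. smooth_at (snd c x) (lf c f))"
 unfolding smooth_fun_def using open_chart_image by(auto simp: smooth_on_iff_at chart_image_def lf_def)

lemma smooth_funD: "sf f ==> c : \<A> ==> x : fst c ==> smooth_at (snd c x) (lf c f)" by(simp add: smooth_fun_iff)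

lemma smooth_funI: assumes "!!x. EX c:\<A>. x : fst c & smooth_at (snd c x) (lf c f)"
 shows "sf f" unfolding smooth_fun_iff using assms smooth_at_lf_change by blast

lemma wirtinger_lf_change: assumes c: "c : \<A>" "c' : \<A>" "x : fst c" "x : fst c'" and f: "smooth_at (snd c' x) (lf c' f)"
 shows "wd A (lf c f) (snd c x) = (SS B. wd B (lf c' f) (snd c' x) * jacobian c c' B A (snd c x))"
proof - have e: "transition c c' (snd c x) = snd c' x" using c by(simp add: transition_apply)
 have "wd A (lf c f) (snd c x) = wd A (%z. lf c' f (transition c c' z)) (snd c x)"
  by(rule wirtinger_cong[OF open_overlap[OF c(1,2)]]) (use c in \<open>auto simp: lf_def transition_def\<close>)
 also have "... = (SS B. wd B (lf c' f) (snd c' x) * jacobian c c' B A (snd c x))" unfolding jacobian_eq e[symmetric]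
  by(rule wirtinger_compose(2)) (use smooth_at_differentiable[OF f] transition_differentiable[OF c] in \<open>auto simp: e\<close>)
 finally show ?thesis .
qed

lemma jacobian_mixed: assumes c: "c : \<A>" "c' : \<A>" "z : overlap c c'"
 shows "jacobian c c' (Inl i) (Inr j) z = 0" "jacobian c c' (Inr i) (Inl j) z = 0"
  "jacobian c c' (Inr i) (Inr j) z = cnj (jacobian c c' (Inl i) (Inl j) z)"
proof - have h: "holo_on (overlap c c') (%z. transition c c' z $ i)" for i using atlas c by(auto simp: complex_atlas_def)
 hence d: "(%z. transition c c' z $ i) differentiable (at z)" "wd (Inr j) (%z. transition c c' z $ i) z = 0" for i j
  using c(3) by(auto simp: holo_on_iff)
 show "jacobian c c' (Inl i) (Inr j) z = 0" "jacobian c c' (Inr i) (Inl j) z = 0"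
  "jacobian c c' (Inr i) (Inr j) z = cnj (jacobian c c' (Inl i) (Inl j) z)" by(simp_all add: jacobian_def wirtinger_cnj d)
qed

lemma smooth_on_jacobian: assumes "c : \<A>" "c' : \<A>" shows "smooth_on (overlap c c') (jacobian c c' B A)" unfolding jacobian_eq jac_def
 by(intro smooth_intros open_overlap smooth_on_transition assms)

text \<open>The chain rule applied to the coordinate functions of \<open>c\<close>, seen in the
  other chart.\<close>

lemma jacobian_inverse: assumes c: "c : \<A>" "c' : \<A>" "x : fst c" "x : fst c'"
 shows "(SS B. jacobian c' c A B (snd c' x) * jacobian c c' B C (snd c x)) = (if A = C then 1 else 0)"
proof - have "smooth_at (snd c x) (wcomp A)" by(rule smooth_at_wcomp)
 hence s: "smooth_at (snd c x) (lf c (%y. wcomp A (snd c y)))"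
  by(rule smooth_at_cong) (use near_chart_image[OF c(1,3)] c in \<open>auto simp: lf_def elim: eventually_mono\<close>)
 have e1: "wd C (lf c (%y. wcomp A (snd c y))) (snd c x) = wd C (wcomp A) (snd c x)"
  by(rule wirtinger_eventually_cong) (use near_chart_image[OF c(1,3)] c in \<open>auto simp: lf_def elim: eventually_mono\<close>)
 have "wd C (wcomp A) (snd c x) = (if A = C then 1 else 0)"
  by(rule wirtinger_eqI[where c = "%C. if A = C then 1 else 0"], rule has_derivative_eq_rhs,
    rule bounded_linear_imp_has_derivative[OF bounded_linear_wcomp]) (auto simp: fun_eq_iff if_distrib[of "%x. x * _"] cong: if_cong)
 moreover have "wd B (lf c' (%y. wcomp A (snd c y))) (snd c' x) = jacobian c' c A B (snd c' x)" for B
  unfolding jacobian_eq jac_def lf_def transition_def comp_def ..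
 ultimately show ?thesis using wirtinger_lf_change[OF c smooth_at_lf_change[OF c s], of C] e1 by simp
qed

text \<open>Cut the germ off inside the chart and continue by zero. Through this lemma statements
  about the product of global functions become statements about germs.\<close>

lemma extension: assumes c: "c : \<A>" "x : fst c" and g: "smooth_at (snd c x) g"
 obtains f where "sf f" "near (snd c x) (%w. lf c f w = g w)"
proof - define z where "z = snd c x"
 obtain V where V: "open V" "z : V" "smooth_on V g" using g by(auto simp: smooth_at_def z_def)
 have "open (V \<inter> chart_image c)" "z : V \<inter> chart_image c"
  using V open_chart_image[OF c(1)] c by(auto simp: z_def intro: open_Int)
 then obtain r where r: "r > 0" "cball z r \<subseteq> V \<inter> chart_image c" using open_contains_cball by blast
 obtain \<phi> where \<phi>: "smooth_on UNIV \<phi>" "!!w. dist z w <= r/2/2 ==> \<phi> w = 1" "!!w. dist z w >= r/2 ==> \<phi> w = 0"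
  using smooth_bump[of "r/2" z] r by auto
 define h where "h w = (if dist z w < r then \<phi> w * g w else 0)" for w have h: "smooth_at w h" for w
 proof(cases "dist z w < r")
  case True have "smooth_on (ball z r) (%w. \<phi> w * g w)"
   by(intro smooth_intros open_ball smooth_on_subset[OF \<phi>(1)] smooth_on_subset[OF V(3)]) (use r in auto)
  hence "smooth_on (ball z r) h" by(rule smooth_on_cong) (auto simp: h_def)
  thus ?thesis using True by(intro smooth_atI) auto
 next case False
  have o: "open (- cball z (r/2))" by(rule open_Compl[OF closed_cball])
  have "smooth_on (- cball z (r/2)) h" by(rule smooth_on_cong[OF smooth_on_const[OF o, of 0] o]) (auto simp: h_def \<phi>(3))
  thus ?thesis using False r by(intro smooth_atI[OF _ o]) auto
 qed
 define f where "f y = (if y : fst c then h (snd c y) else 0)" for y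
 have lfh: "lf c f w = h w" if "w : chart_image c" for w using that c by(simp add: lf_def f_def)
 \<comment> \<open>The support lies in a compact set, which is closed because the space is
   Hausdorff; so the extension vanishes near every point outside the chart domain.\<close>
 have K: "closed (chart_inv c ` cball z r)"
 proof(rule compact_imp_closed, rule compact_continuous_image)
  show "continuous_on (cball z r) (chart_inv c)" using homeomorphism_cont2[OF chart_homeo[OF c(1)]] r by(auto intro: continuous_on_subset)
 qed simp
 have f0: "f y = 0" if "y ~: chart_inv c ` cball z r" for y
 proof(cases "y : fst c")
  case True have "~ dist z (snd c y) < r"
  proof
   assume "dist z (snd c y) < r" hence "chart_inv c (snd c y) : chart_inv c ` cball z r" by(intro imageI) auto
   thus False using that c True by simp
  qed
  thus ?thesis by(simp add: f_def h_def)
 qed (simp add: f_def)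
 have "sf f"
 proof(rule smooth_funI)
  fix y show "EX c':\<A>. y : fst c' & smooth_at (snd c' y) (lf c' f)"
  proof(cases "y : fst c")
   case True have "smooth_at (snd c y) (lf c f)"
    by(rule smooth_at_cong[OF h]) (use near_chart_image[OF c(1) True] lfh in \<open>auto elim: eventually_mono\<close>)
   thus ?thesis using c True by blast
  next case False
   obtain c' where c': "c' : \<A>" "y : fst c'" using ex_chart by blast have "chart_inv c ` cball z r \<subseteq> fst c" using r c by auto
   hence "y : - chart_inv c ` cball z r" using False by blast
   hence "near y (%y. y : - chart_inv c ` cball z r)" using K open_Compl eventually_nhds by blast
   hence "near y (%y. f y = 0)" by eventually_elim (simp add: f0)
   hence "near (snd c' y) (%w. f (chart_inv c' w) = 0)" using eventually_chart[OF c', of "%y. f y = 0"] by simp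
   hence "near (snd c' y) (%w. 0 = lf c' f w)" by eventually_elim (simp add: lf_def)
   hence "smooth_at (snd c' y) (lf c' f)" by(rule smooth_at_cong[OF smooth_at_const])
   thus ?thesis using c' by blast
  qed
 qed
 moreover have "near z (%w. lf c f w = g w)"
 proof - have "near z (%w. w : ball z (r/2/2))" using r by(intro eventually_nhds_in_open) auto
  moreover have "near z (%w. w : chart_image c)" unfolding z_def by(rule near_chart_image[OF c])
  ultimately show ?thesis by eventually_elim (use r \<phi>(2) in \<open>auto simp: lfh h_def\<close>)
 qed
 ultimately show ?thesis using that by(simp add: z_def)
qed

section \<open>Germs of global functions in a chart\<close>

definition cg :: "('a, 'n) chart => 'a => ('a => complex) => 'n germ" where "cg c x f = germ (snd c x) (lf c f)"

definition fcg :: "('a, 'n) chart => 'a => ('a => complex fps) => 'n germ fps" where "fcg c x F = fgerm (snd c x) (lf c F)"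

lemma fcg_nth: "fcg c x F $ n = cg c x (%y. F y $ n)" by(simp add: fcg_def cg_def lf_def)

lemma cg_exhaust: assumes "c : \<A>" "x : fst c" obtains f where "sf f" "g = cg c x f"
proof - obtain h where h: "smooth_at (snd c x) h" "g = germ (snd c x) h" using germ_exhaust by blast
 obtain f where f: "sf f" "near (snd c x) (%w. lf c f w = h w)" using extension[OF assms h(1)] by blast show ?thesis
 proof(rule that[OF f(1)])
  show "g = cg c x f" unfolding cg_def h(2) by(rule germ_cong[OF smooth_funD[OF f(1) assms] f(2), symmetric])
 qed
qed

text \<open>Each coefficient is extended on its own; there need not be a common neighbourhood on
  which all coefficients represent the given germs.\<close>

lemma fcg_exhaust: assumes "c : \<A>" "x : fst c" obtains F where "ff F" "G = fcg c x F"
proof - have "ALL n. EX f. sf f & G $ n = cg c x f" using cg_exhaust[OF assms] by metis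
 from choice[OF this] obtain f where f: "!!n. sf (f n)" "!!n. G $ n = cg c x (f n)" by blast
 show ?thesis
 proof(rule that)
  show "ff (%y. Abs_fps (%n. f n y))" using f(1) by(simp add: formal_fun_def)
  show "G = fcg c x (%y. Abs_fps (%n. f n y))" by(rule fps_ext) (simp only: f(2) fcg_nth fps_nth_Abs_fps)
 qed
qed

lemma cg_eq_iff: assumes "c : \<A>" "x : fst c" "sf f" "sf g"
 shows "cg c x f = cg c x g \<longleftrightarrow> (\<forall>\<^sub>F y in nhds x. f y = g y)"
 unfolding cg_def using germ_eq_iff[OF smooth_funD[OF assms(3,1,2)] smooth_funD[OF assms(4,1,2)]]
  eventually_chart[OF assms(1,2), of "%y. f y = g y"] by(simp add: lf_def)

lemma gev_cg: "c : \<A> ==> x : fst c ==> sf f ==> gev (cg c x f) = f x"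
 unfolding cg_def by(subst gev_germ) (auto simp: smooth_funD, simp add: lf_def)

lemma fev_fcg: "c : \<A> ==> x : fst c ==> ff F ==> fev (fcg c x F) = F x" by(simp add: fps_eq_iff fcg_nth gev_cg formal_fun_def)

lemma lf_simps: "lf c (%y. f y + g y) = (%w. lf c f w + lf c g w)" "lf c (%y. f y * g y) = (%w. lf c f w * lf c g w)"
 "lf c (%y. f y - g y) = (%w. lf c f w - lf c g w)" "lf c (%y. - f y) = (%w. - lf c f w)" "lf c (%_. k) = (%_. k)"
 "lf c (%y. cnj (p y)) = (%w. cnj (lf c p w))" "lf c (%y. sum (%i. q i y) I) = (%w. sum (%i. lf c (q i) w) I)" by(simp_all add: lf_def)

lemma smooth_fun_mult: "sf f ==> sf g ==> sf (%y. f y * g y)" and smooth_fun_add: "sf f ==> sf g ==> sf (%y. f y + g y)"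
 and smooth_fun_diff: "sf f ==> sf g ==> sf (%y. f y - g y)"
 and smooth_fun_const: "sf (%_. k)" unfolding smooth_fun_iff lf_simps by(blast intro: smooth_at_intros)+

lemma smooth_fun_sum: "(!!i. i : I ==> sf (f i)) ==> sf (%y. SUM i:I. f i y)"
 unfolding smooth_fun_iff lf_simps by(intro ballI smooth_at_intros) blast

lemma cg_mult: "c : \<A> ==> x : fst c ==> sf f ==> sf g ==> cg c x (%y. f y * g y) = cg c x f * cg c x g"
 and cg_add: "c : \<A> ==> x : fst c ==> sf f ==> sf g ==> cg c x (%y. f y + g y) = cg c x f + cg c x g"
 and cg_diff: "c : \<A> ==> x : fst c ==> sf f ==> sf g ==> cg c x (%y. f y - g y) = cg c x f - cg c x g"
 and cg_const: "cg c x (%_. k) = gconst k" unfolding cg_def lf_simps by(auto simp: germ_mult germ_add germ_diff germ_const smooth_funD)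

lemma cg_sum: "c : \<A> ==> x : fst c ==> (!!i. i : I ==> sf (f i)) ==> cg c x (%y. SUM i:I. f i y) = (SUM i:I. cg c x (f i))"
 unfolding cg_def lf_simps by(rule germ_sum) (auto simp: smooth_funD)

lemma formal_fun_const: "sf f ==> ff (%y. cst (f y))" unfolding formal_fun_def
proof
 fix k assume "sf f" thus "sf (%x. cst (f x) $ k)" by(cases "k = 0") (auto simp: smooth_fun_const)
qed

lemma fcg_fps_const: "fcg c x (%y. cst (f y)) = cst (cg c x f)"
proof(rule fps_ext)
 fix k show "fcg c x (%y. cst (f y)) $ k = cst (cg c x f) $ k" by(cases "k = 0") (simp_all add: fcg_nth cg_const)
qed

text \<open>A germ condition becomes a condition on a neighbourhood, in all charts at once, which is
  the form in which the Wick property is assumed.\<close>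

lemma holomorphic_near: assumes c: "c : \<A>" "x : fst c" and f: "sf f" and h: "!!i. gD (Inr i) (cg c x f) = 0"
 obtains V where "open V" "x : V" "holomorphic_fun \<A> V f"
proof - have "near (snd c x) (%w. wd (Inr i) (lf c f) w = 0)" for i
 proof - have "germ (snd c x) (wd (Inr i) (lf c f)) = germ (snd c x) (%_. 0)"
   using h[of i] by(simp add: cg_def germ_wirtinger smooth_funD[OF f c] germ_zero)
  thus ?thesis by(subst (asm) germ_eq_iff) (auto intro: smooth_at_intros smooth_funD[OF f c])
 qed
 hence "near (snd c x) (%w. w : chart_image c & (ALL i. wd (Inr i) (lf c f) w = 0))"
  using near_chart_image[OF c] by(simp add: eventually_conj_iff eventually_all_finite)
 hence "near (snd c x) (%w. chart_inv c w : fst c & (ALL i. wd (Inr i) (lf c f) (snd c (chart_inv c w)) = 0))"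
  by eventually_elim (auto simp: c)
 hence "near x (%y. y : fst c & (ALL i. wd (Inr i) (lf c f) (snd c y) = 0))" by(subst eventually_chart[OF c, symmetric]) simp
 then obtain V where V: "open V" "x : V" "!!y. y : V ==> y : fst c & (ALL i. wd (Inr i) (lf c f) (snd c y) = 0)"
  unfolding eventually_nhds by blast
 have "holomorphic_fun \<A> V f" unfolding holomorphic_fun_def holo_on_iff
 proof(intro ballI conjI allI)
  fix c' z assume c': "c' : \<A>" and "z : snd c' ` (V \<inter> fst c')" then obtain y where y: "y : V" "y : fst c'" "z = snd c' y" by blast
  have yc: "y : fst c" using V y by blast
  show "(%z. f (chart_inv c' z)) differentiable (at z)" using smooth_at_differentiable[OF smooth_funD[OF f c' y(2)]] by(simp add: lf_def y)
  have "snd c' y : overlap c' c" using y yc by blast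
  hence "wd (Inr j) (lf c' f) (snd c' y) = 0" for j
   using V(3)[OF y(1)] wirtinger_lf_change[OF c' c(1) y(2) yc smooth_funD[OF f c(1) yc], of "Inr j"]
    jacobian_mixed(1)[OF c' c(1)] by(simp add: sum_UNIV_sum)
  thus "wd (Inr j) (%z. f (chart_inv c' z)) z = 0" for j by(simp add: lf_def y)
 qed
 thus ?thesis using that V by blast
qed

lemma antiholomorphic_near: assumes c: "c : \<A>" "x : fst c" and f: "sf f" and h: "!!i. gD (Inl i) (cg c x f) = 0"
 obtains V where "open V" "x : V" "antiholomorphic_fun \<A> V f"
proof - have f': "sf (%y. cnj (f y))" using f unfolding smooth_fun_iff lf_simps by(blast intro: smooth_at_intros)
 have "gD (Inr i) (cg c x (%y. cnj (f y))) = 0" for i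
 proof - have s: "smooth_at (snd c x) (lf c f)" by(rule smooth_funD[OF f c])
  have "germ (snd c x) (wd (Inl i) (lf c f)) = germ (snd c x) (%_. 0)" using h[of i] by(simp add: cg_def germ_wirtinger s germ_zero)
  hence "near (snd c x) (%w. wd (Inl i) (lf c f) w = 0)" by(subst (asm) germ_eq_iff) (auto intro: smooth_at_intros s)
  moreover have "near (snd c x) (%w. smooth_at w (lf c f))" by(rule smooth_at_eventually[OF s])
  ultimately have "near (snd c x) (%w. wd (Inr i) (%w. cnj (lf c f w)) w = 0)"
   by eventually_elim (simp add: wirtinger_cnj smooth_at_differentiable)
  hence "germ (snd c x) (wd (Inr i) (%w. cnj (lf c f w))) = germ (snd c x) (%_. 0)" by(subst germ_eq_iff) (auto intro: smooth_at_intros s)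
  thus ?thesis by(simp add: cg_def lf_simps germ_wirtinger smooth_at_intros s germ_zero)
 qed
 from holomorphic_near[OF c f' this] show ?thesis using that by(auto simp: antiholomorphic_fun_def)
qed

end

section \<open>The star product on germs\<close>

lemma matrix_inv_right: "A ** matrix_inv A = mat 1" and matrix_inv_left: "matrix_inv A ** A = mat 1"
 if "invertible A" for A :: "complex^'n^'n"
proof - have "A ** matrix_inv A = mat 1 & matrix_inv A ** A = mat 1"
  unfolding matrix_inv_def by(rule someI_ex) (use that in \<open>simp add: invertible_def\<close>)
 thus "A ** matrix_inv A = mat 1" "matrix_inv A ** A = mat 1" by auto
qed

text \<open>Makes the entries of the inverse visibly rational in those of the matrix, for the sake
  of smoothness.\<close>

lemma matrix_inv_cramer: fixes A :: "complex^'n^'n" assumes "invertible A"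
 shows "matrix_inv A $ k $ l = det (\<chi> i j. if j = k then (if i = l then 1 else 0) else A $ i $ j) / det A"
proof - have "det A ~= 0" using assms invertible_det_nz by blast
 have "A *v (matrix_inv A *v axis l 1) = axis l 1" using matrix_inv_right[OF assms] by(simp add: matrix_vector_mul_assoc)
 hence "matrix_inv A *v axis l 1 = (\<chi> k. det (\<chi> i j. if j = k then (axis l 1 :: complex^'n) $ i else A $ i $ j) / det A)"
  using cramer[OF `det A ~= 0`] by blast
 hence "(matrix_inv A *v axis l 1) $ k = det (\<chi> i j. if j = k then (axis l 1 :: complex^'n) $ i else A $ i $ j) / det A" by simp
 moreover have "(matrix_inv A *v axis l 1) $ k = matrix_inv A $ k $ l"
  by(simp add: matrix_vector_mult_def axis_def if_distrib[of "%x. _ * x"] cong: if_cong)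
 moreover have "(\<chi> i j. if j = k then (axis l 1 :: complex^'n) $ i else A $ i $ j) = (\<chi> i j. if j = k then (if i = l then 1 else 0) else A $ i $ j)"
  by(simp add: vec_eq_iff axis_def)
 ultimately show ?thesis by simp
qed

lemma smooth_on_det: fixes A :: "complex^'m => complex^'n^'n" assumes "open S" "!!i j. smooth_on S (%z. A z $ i $ j)"
 shows "smooth_on S (%z. det (A z))" unfolding det_def using assms by(intro smooth_intros) auto

lemma smooth_on_matrix_inv: fixes A :: "complex^'m => complex^'n^'n"
 assumes S: "open S" and A: "!!i j. smooth_on S (%z. A z $ i $ j)" and i: "!!z. z : S ==> invertible (A z)"
 shows "smooth_on S (%z. matrix_inv (A z) $ k $ l)"
proof - have "smooth_on S (%z. det (\<chi> i j. if j = k then (if i = l then 1 else 0) else A z $ i $ j) / det (A z))"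
 proof(intro smooth_intros S smooth_on_det)
  show "smooth_on S (%z. A z $ i $ j)" for i j by(rule A)
  show "det (A z) ~= 0" if "z : S" for z using i[OF that] invertible_det_nz by blast
  fix i j show "smooth_on S (%z. (\<chi> i j. if j = k then (if i = l then 1 else 0) else A z $ i $ j) $ i $ j)"
   using A S by(cases "j = k") (auto intro: smooth_intros)
 qed
 thus ?thesis by(rule smooth_on_cong[OF _ S]) (simp add: matrix_inv_cramer i)
qed

lemma omega_up_right: assumes "invertible W" shows "(SS j. omega_up W i j * W $ p $ j) = (if i = p then -1 else 0)"
proof - have "(SS j. omega_up W i j * W $ p $ j) = - (W ** matrix_inv W) $ p $ i"
  unfolding omega_up_def matrix_matrix_mult_def sum_negf[symmetric] vec_lambda_beta by(rule sum.cong[OF refl]) simp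
 thus ?thesis by(auto simp: matrix_inv_right[OF assms] mat_def)
qed

lemma omega_up_left: assumes "invertible W" shows "(SS i. omega_up W i j * W $ i $ l) = (if j = l then -1 else 0)"
proof - have "(SS i. omega_up W i j * W $ i $ l) = - (matrix_inv W ** W) $ j $ l" by(simp add: omega_up_def matrix_matrix_mult_def sum_negf)
 thus ?thesis by(simp add: matrix_inv_left[OF assms] mat_def)
qed

lemma fps_shift_split: "F = cst (F $ 0) + fps_X * fps_shift 1 F" for F :: "complex fps"
 by(rule fps_ext) (auto simp: fps_X_mult_nth not_less)

lemma germ_foldr: "smooth_at z f ==> smooth_at z (foldr wd P f) & germ z (foldr wd P f) = foldr gD P (germ z f)"
 by(induction P) (auto simp: germ_wirtinger smooth_at_intros)

locale kaehler_wick = atlas \<A> for \<A> :: "('a::{t2_space, second_countable_topology}, 'n::finite) chart set" +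
 fixes \<omega> :: "('a, 'n) form11" and S :: "'a star"
 assumes kaehler: "kaehler_manifold \<A> \<omega>" and dq: "deformation_quantization \<A> \<omega> S" and wick: "wick_type \<A> S" begin

lemma omega_closed: "closed_form11 \<A> \<omega>" using kaehler by(simp add: kaehler_manifold_def)

lemma smooth_on_omega: "c : \<A> ==> smooth_on (chart_image c) (%z. \<omega> c z $ i $ j)"
 using omega_closed by(simp add: closed_form11_def is_form11_def)

text \<open>A kernel vector of the transpose would be isotropic for the positive definite Hermitian
  form.\<close>

lemma invertible_omega: assumes "c : \<A>" "z : chart_image c" shows "invertible (\<omega> c z)"
proof - have "v = 0" if v: "transpose (\<omega> c z) *v v = 0" for v
 proof(rule ccontr)
  assume "v ~= 0" hence "0 < Re (SS i j. herm (\<omega> c z) i j * v $ i * cnj (v $ j))"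
   using kaehler assms unfolding kaehler_manifold_def by blast
  also have "(SS i j. herm (\<omega> c z) i j * v $ i * cnj (v $ j)) = (SS j. - \<i> * (transpose (\<omega> c z) *v v) $ j * cnj (v $ j))"
   unfolding herm_def matrix_vector_mult_def transpose_def vec_lambda_beta sum_distrib_left sum_distrib_right
   by(subst sum.swap) (intro sum.cong refl, simp only: mult_ac)
  also have "... = 0" by(simp only: v) simp
  finally show False by simp
 qed
 hence "invertible (transpose (\<omega> c z))"
  using matrix_left_invertible_ker[of "transpose (\<omega> c z)"] invertible_left_inverse by blast
 thus ?thesis by(simp add: invertible_det_nz)
qed

lemma smooth_on_omega_up: "c : \<A> ==> smooth_on (chart_image c) (%z. omega_up (\<omega> c z) i j)" unfolding omega_up_def
 by(intro smooth_intros smooth_on_matrix_inv open_chart_image smooth_on_omega invertible_omega) auto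

lemma omega_change: assumes c: "c : \<A>" "c' : \<A>" "x : fst c" "x : fst c'"
 shows "\<omega> c (snd c x) $ i $ j = (SS p q. jacobian c c' (Inl p) (Inl i) (snd c x) *
  jacobian c c' (Inr q) (Inr j) (snd c x) * \<omega> c' (snd c' x) $ p $ q)"
proof - have "ALL z:overlap c c'. \<omega> c z $ i $ j = (SS p q. jacobian c c' (Inl p) (Inl i) z *
  jacobian c c' (Inr q) (Inr j) z * \<omega> c' (transition c c' z) $ p $ q)"
  using omega_closed c(1,2) unfolding closed_form11_def is_form11_def by blast
 hence "\<omega> c (snd c x) $ i $ j = (SS p q. jacobian c c' (Inl p) (Inl i) (snd c x) *
  jacobian c c' (Inr q) (Inr j) (snd c x) * \<omega> c' (transition c c' (snd c x)) $ p $ q)" using c by blast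
 thus ?thesis by(simp only: transition_apply[OF c(1,3)])
qed

lemma jacobian_inverse_matrix: assumes c: "c : \<A>" "c' : \<A>" "x : fst c" "x : fst c'"
 shows "(\<chi> i p. jacobian c' c (Inl i) (Inl p) (snd c' x)) ** (\<chi> p k. jacobian c c' (Inl p) (Inl k) (snd c x)) = mat 1"
  "(\<chi> i p. jacobian c' c (Inr i) (Inr p) (snd c' x)) ** (\<chi> p k. jacobian c c' (Inr p) (Inr k) (snd c x)) = mat 1"
proof - have o: "snd c x : overlap c c'" "snd c' x : overlap c' c" using c by auto
 show "(\<chi> i p. jacobian c' c (Inl i) (Inl p) (snd c' x)) ** (\<chi> p k. jacobian c c' (Inl p) (Inl k) (snd c x)) = mat 1"
  using jacobian_inverse[OF c, of "Inl _" "Inl _"] jacobian_mixed[OF c(2,1) o(2)]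
  by(simp add: vec_eq_iff matrix_matrix_mult_def mat_def sum_UNIV_sum)
 show "(\<chi> i p. jacobian c' c (Inr i) (Inr p) (snd c' x)) ** (\<chi> p k. jacobian c c' (Inr p) (Inr k) (snd c x)) = mat 1"
  using jacobian_inverse[OF c, of "Inr _" "Inr _"] jacobian_mixed[OF c(2,1) o(2)]
  by(simp add: vec_eq_iff matrix_matrix_mult_def mat_def sum_UNIV_sum)
qed

lemma omega_up_change: assumes c: "c : \<A>" "c' : \<A>" "x : fst c" "x : fst c'"
 shows "omega_up (\<omega> c' (snd c' x)) p q = (SS i j. jacobian c c' (Inl p) (Inl i) (snd c x) *
  jacobian c c' (Inr q) (Inr j) (snd c x) * omega_up (\<omega> c (snd c x)) i j)"
proof - define Jl where "Jl = (\<chi> p k. jacobian c c' (Inl p) (Inl k) (snd c x))"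
 define Jr where "Jr = (\<chi> p k. jacobian c c' (Inr p) (Inr k) (snd c x))"
 define Kl where "Kl = (\<chi> p k. jacobian c' c (Inl p) (Inl k) (snd c' x))"
 define Kr where "Kr = (\<chi> p k. jacobian c' c (Inr p) (Inr k) (snd c' x))"
 let ?W = "\<omega> c (snd c x)" and ?W' = "\<omega> c' (snd c' x)" have JK: "Kl ** Jl = mat 1" "Jr ** Kr = mat 1"
  unfolding Jl_def Jr_def Kl_def Kr_def using jacobian_inverse_matrix[OF c] jacobian_inverse_matrix[OF c(2,1,4,3)] by auto
 have W': "?W' = transpose Kl ** ?W ** Kr" using omega_change[OF c(2,1,4,3)]
  by(simp add: vec_eq_iff matrix_matrix_mult_def transpose_def Kl_def Kr_def sum_distrib_left sum_distrib_right mult_ac)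
   (intro allI, rule sum.swap)
 have inv: "invertible ?W" "invertible ?W'" using invertible_omega c by auto
 have "(Jr ** matrix_inv ?W ** transpose Jl) ** ?W' = Jr ** (matrix_inv ?W ** (transpose Jl ** transpose Kl) ** ?W) ** Kr"
  unfolding W' by(simp only: matrix_mul_assoc)
 also have "transpose Jl ** transpose Kl = mat 1" by(simp add: matrix_transpose_mul[symmetric] JK)
 also have "Jr ** (matrix_inv ?W ** mat 1 ** ?W) ** Kr = mat 1" by(simp add: matrix_inv_left[OF inv(1)] JK)
 finally have "(Jr ** matrix_inv ?W ** transpose Jl) ** ?W' = mat 1" .
 hence "matrix_inv ?W' = Jr ** matrix_inv ?W ** transpose Jl"
  by(metis inv(2) matrix_inv_right matrix_mul_assoc matrix_mul_lid matrix_mul_rid)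
 thus ?thesis
  by(simp add: omega_up_def matrix_matrix_mult_def transpose_def Jl_def Jr_def sum_distrib_left sum_distrib_right mult_ac sum_negf)
qed

definition Xv :: "('a, 'n) chart => 'n => ('a => complex) => complex^'n => complex" where
 "Xv c j f z = (SS i. omega_up (\<omega> c z) i j * wd (Inl i) (lf c f) z)"

lemma wirtinger_lf_change_pure: assumes c: "c : \<A>" "c' : \<A>" "x : fst c" "x : fst c'" and f: "sf f"
 shows "wd (Inl i) (lf c f) (snd c x) = (SS p. jacobian c c' (Inl p) (Inl i) (snd c x) * wd (Inl p) (lf c' f) (snd c' x))"
  and "wd (Inr j) (lf c f) (snd c x) = (SS q. jacobian c c' (Inr q) (Inr j) (snd c x) * wd (Inr q) (lf c' f) (snd c' x))"
proof - have o: "snd c x : overlap c c'" using c by auto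
 show "wd (Inl i) (lf c f) (snd c x) = (SS p. jacobian c c' (Inl p) (Inl i) (snd c x) * wd (Inl p) (lf c' f) (snd c' x))"
  "wd (Inr j) (lf c f) (snd c x) = (SS q. jacobian c c' (Inr q) (Inr j) (snd c x) * wd (Inr q) (lf c' f) (snd c' x))"
  using wirtinger_lf_change[OF c smooth_funD[OF f c(2,4)]] jacobian_mixed[OF c(1,2) o] by(simp_all add: sum_UNIV_sum mult.commute)
qed

text \<open>The holomorphic Jacobians cancel between the inverse form and the derivative, and the
  fields \<open>X\<close> transform by the conjugate Jacobian alone.\<close>

lemma Xv_change: assumes c: "c : \<A>" "c' : \<A>" "x : fst c" "x : fst c'" and f: "sf f"
 shows "Xv c' q f (snd c' x) = (SS j. jacobian c c' (Inr q) (Inr j) (snd c x) * Xv c j f (snd c x))"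
proof - let ?Jl = "%p i. jacobian c c' (Inl p) (Inl i) (snd c x)" and ?Jr = "%q j. jacobian c c' (Inr q) (Inr j) (snd c x)"
 let ?d = "%p. wd (Inl p) (lf c' f) (snd c' x)" and ?u = "omega_up (\<omega> c (snd c x))"
 have "Xv c' q f (snd c' x) = (SS p i j. ?Jl p i * ?Jr q j * ?u i j * ?d p)"
  unfolding Xv_def omega_up_change[OF c] by(simp add: sum_distrib_right)
 also have "... = (SS i j p. ?Jl p i * ?Jr q j * ?u i j * ?d p)" by(subst sum.swap) (rule sum.cong[OF refl], rule sum.swap)
 also have "... = (SS j i p. ?Jl p i * ?Jr q j * ?u i j * ?d p)" by(rule sum.swap)
 also have "... = (SS j. ?Jr q j * Xv c j f (snd c x))"
  unfolding Xv_def wirtinger_lf_change_pure(1)[OF c f] by(simp add: sum_distrib_left mult_ac)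
 finally show ?thesis .
qed

text \<open>The definition uses a chart selected at each point; pairing the fields \<open>X\<close>
  with conjugate derivatives shows that any chart gives the same value.\<close>

lemma poisson_chart: assumes c: "c : \<A>" "x : fst c" and f: "sf f" and g: "sf g"
 shows "poisson \<A> \<omega> f g x = (SS i j. omega_up (\<omega> c (snd c x)) i j *
   (wd (Inl i) (lf c f) (snd c x) * wd (Inr j) (lf c g) (snd c x) - wd (Inr j) (lf c f) (snd c x) * wd (Inl i) (lf c g) (snd c x)))"
proof - define B where "B c f g = (SS j. Xv c j f (snd c x) * wd (Inr j) (lf c g) (snd c x))" for c :: "('a, 'n) chart" and f g
 have e: "(SS i j. omega_up (\<omega> c (snd c x)) i j * (wd (Inl i) (lf c f) (snd c x) * wd (Inr j) (lf c g) (snd c x)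
    - wd (Inr j) (lf c f) (snd c x) * wd (Inl i) (lf c g) (snd c x))) = B c f g - B c g f" for c unfolding B_def Xv_def
  by(subst sum.swap) (simp add: sum_subtractf[symmetric] sum_distrib_right sum_distrib_left algebra_simps)
 have B: "B c f g = B c' f g" if c: "c : \<A>" "c' : \<A>" "x : fst c" "x : fst c'" and f: "sf f" and g: "sf g" for c c' f g
 proof - let ?Jr = "%q j. jacobian c c' (Inr q) (Inr j) (snd c x)"
  have "B c f g = (SS j q. ?Jr q j * Xv c j f (snd c x) * wd (Inr q) (lf c' g) (snd c' x))"
   unfolding B_def wirtinger_lf_change_pure(2)[OF c g] by(simp add: sum_distrib_left mult_ac)
  also have "... = B c' f g" unfolding B_def Xv_change[OF c f] by(subst sum.swap) (simp add: sum_distrib_right)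
  finally show ?thesis .
 qed
 have "poisson \<A> \<omega> f g x = B (chart_at \<A> x) f g - B (chart_at \<A> x) g f" unfolding poisson_def Let_def e[symmetric] lf_def ..
 also have "... = B c f g - B c g f" using B[OF chart_at(1) c(1) chart_at(2) c(2)] f g by simp
 finally show ?thesis unfolding e .
qed

definition CC :: "nat => ('a => complex) => ('a => complex) => 'a => complex" where
 "CC = (SOME C. (ALL k>=1. bidifferential_op \<A> (C k)) & (ALL f g. sf f --> sf g -->
      S (%x. cst (f x)) (%x. cst (g x)) = (%x. Abs_fps (%k. if k = 0 then f x * g x else C k f g x))))"

lemma CC: "k >= 1 ==> bidifferential_op \<A> (CC k)" and S_const: "sf f ==> sf g ==>
   S (%x. cst (f x)) (%x. cst (g x)) x = Abs_fps (%k. if k = 0 then f x * g x else CC k f g x)"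
proof - have ex: "EX C. (ALL k>=1. bidifferential_op \<A> (C k)) & (ALL f g. sf f --> sf g -->
      S (%x. cst (f x)) (%x. cst (g x)) = (%x. Abs_fps (%k. if k = 0 then f x * g x else C k f g x)))"
  using dq unfolding deformation_quantization_def by blast
 have "(ALL k>=1. bidifferential_op \<A> (CC k)) & (ALL f g. sf f --> sf g -->
      S (%x. cst (f x)) (%x. cst (g x)) = (%x. Abs_fps (%k. if k = 0 then f x * g x else CC k f g x)))"
  using someI_ex[OF ex] unfolding CC_def[symmetric] .
 thus "k >= 1 ==> bidifferential_op \<A> (CC k)" "sf f ==> sf g ==>
   S (%x. cst (f x)) (%x. cst (g x)) x = Abs_fps (%k. if k = 0 then f x * g x else CC k f g x)" by auto
qed

lemma S_formal: "ff f ==> ff g ==> ff (S f g)"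
 and S_assoc: "ff f ==> ff g ==> ff h ==> S (S f g) h = S f (S g h)" using dq by(auto simp: deformation_quantization_def)

lemma S_add1: "ff f ==> ff f' ==> ff g ==> S (%x. f x + f' x) g = (%x. S f g x + S f' g x)"
 and S_add2: "ff f ==> ff f' ==> ff g ==> S g (%x. f x + f' x) = (%x. S g f x + S g f' x)"
 and S_scale1: "ff f ==> ff g ==> S (%x. a * f x) g = (%x. a * S f g x)"
 and S_scale2: "ff f ==> ff g ==> S f (%x. a * g x) = (%x. a * S f g x)"
 using dq unfolding deformation_quantization_def formal_bilinear_def by blast+

lemma formal_fun_shift: "ff F ==> ff (%x. fps_shift 1 (F x))" by(simp add: formal_fun_def)

lemma formal_fun_X: "ff F ==> ff (%x. fps_X * F x)" unfolding formal_fun_def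
proof
 fix k assume "ALL k. sf (%x. F x $ k)" thus "sf (%x. (fps_X * F x) $ k)" by(cases k) (auto simp: smooth_fun_const)
qed

lemma formal_fun_coeff: "ff F ==> ff (%x. cst (F x $ i))" by(rule formal_fun_const) (simp add: formal_fun_def)

text \<open>Split off the constant coefficient and divide the rest by the parameter, n times.
  Linearity over power series thus reduces order n to finitely many functions, with no completeness
  assumption on the operator.\<close>

lemma linear_expansion: assumes add: "!!F G. ff F ==> ff G ==> T (%x. F x + G x) = (%x. T F x + T G x)"
  and scale: "!!a F. ff F ==> T (%x. a * F x) = (%x. a * T F x)" and F: "ff F"
 shows "T F x $ n = (SUM i<=n. T (%x. cst (F x $ i)) x $ (n - i))" using F
proof(induction n arbitrary: F)
 have e: "T F = (%x. T (%x. cst (F x $ 0)) x + fps_X * T (%x. fps_shift 1 (F x)) x)" if "ff F" for F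
 proof - have "T F = T (%x. cst (F x $ 0) + fps_X * fps_shift 1 (F x))" by(simp only: fps_shift_split[symmetric])
  thus ?thesis by(simp only: add[OF formal_fun_coeff[OF that] formal_fun_X[OF formal_fun_shift[OF that]]] scale[OF formal_fun_shift[OF that]])
 qed
 case 0 show ?case by(subst e[OF 0]) simp case (Suc n F)
 have "T F x $ Suc n = T (%x. cst (F x $ 0)) x $ Suc n + T (%x. fps_shift 1 (F x)) x $ n" by(subst e[OF Suc(2)]) simp
 also have "... = T (%x. cst (F x $ 0)) x $ Suc n + (SUM i<=n. T (%x. cst (F x $ Suc i)) x $ (n - i))"
  using Suc.IH[OF formal_fun_shift[OF Suc(2)]] by simp
 finally show ?case by(simp only: sum.atMost_Suc_shift diff_zero diff_Suc_Suc)
qed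

lemma S_left: "ff F ==> ff G ==> S F G x $ n = (SUM i<=n. S (%x. cst (F x $ i)) G x $ (n - i))"
 by(rule linear_expansion[of "%F. S F G"]) (simp_all add: S_add1 S_scale1)

lemma S_right: "ff F ==> ff G ==> S F G x $ n = (SUM i<=n. S F (%x. cst (G x $ i)) x $ (n - i))"
 by(rule linear_expansion) (simp_all add: S_add2 S_scale2)

definition CK :: "nat => ('a => complex) => ('a => complex) => 'a => complex" where
 "CK k f g = (%x. if k = 0 then f x * g x else CC k f g x)"

lemma S_nth: assumes "ff F" "ff G" shows "S F G x $ n = (SUM i<=n. SUM j<=n - i. CK (n - i - j) (%x. F x $ i) (%x. G x $ j) x)"
proof - have s: "sf (%x. F x $ i)" "sf (%x. G x $ i)" for i using assms by(auto simp: formal_fun_def)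
 show ?thesis unfolding S_left[OF assms] S_right[OF formal_fun_coeff[OF assms(1)] assms(2)]
  by(intro sum.cong refl) (simp add: S_const s CK_def)
qed

lemma smooth_fun_CK: "sf f ==> sf g ==> sf (CK k f g)"
 using S_formal[OF formal_fun_const formal_fun_const, of f g] by(auto simp: formal_fun_def S_const CK_def fun_eq_iff)

text \<open>One coefficient system per chart and order, fixed independently of the point, so that
  the operators on germs at different points of a chart come from the same data.\<close>

definition bdata :: "('a, 'n) chart => nat => nat \<times> (('n + 'n) list => ('n + 'n) list => complex^'n => complex)" where
 "bdata c k = (SOME (N, a). (ALL P Q. smooth_on (chart_image c) (a P Q)) &
    (ALL f g. sf f --> sf g --> (ALL z:chart_image c. CC k f g (chart_inv c z) =
       (SUM P:{P. length P <= N}. SUM Q:{Q. length Q <= N}. a P Q z * foldr wd P (%w. f (chart_inv c w)) z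
            * foldr wd Q (%w. g (chart_inv c w)) z))))"

lemma bdata: assumes "c : \<A>" "k >= 1" shows "smooth_on (chart_image c) (snd (bdata c k) P Q)"
  and "sf f ==> sf g ==> z : chart_image c ==> lf c (CC k f g) z =
       (SUM P:{P. length P <= fst (bdata c k)}. SUM Q:{Q. length Q <= fst (bdata c k)}.
        snd (bdata c k) P Q z * foldr wd P (lf c f) z * foldr wd Q (lf c g) z)"
proof - let ?P = "%(N, a). (ALL P Q. smooth_on (chart_image c) (a P Q)) &
    (ALL f g. sf f --> sf g --> (ALL z:chart_image c. CC k f g (chart_inv c z) =
       (SUM P:{P. length P <= N}. SUM Q:{Q. length Q <= N}. a P Q z * foldr wd P (%w. f (chart_inv c w)) z
            * foldr wd Q (%w. g (chart_inv c w)) z)))"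
 have "EX p. ?P p" using CC[OF assms(2)] assms(1) unfolding bidifferential_op_def by simp
 hence "?P (bdata c k)" unfolding bdata_def by(rule someI_ex)
 thus "smooth_on (chart_image c) (snd (bdata c k) P Q)" and "sf f ==> sf g ==> z : chart_image c ==> lf c (CC k f g) z =
       (SUM P:{P. length P <= fst (bdata c k)}. SUM Q:{Q. length Q <= fst (bdata c k)}.
        snd (bdata c k) P Q z * foldr wd P (lf c f) z * foldr wd Q (lf c g) z)" by(auto simp: case_prod_beta lf_def)
qed

definition gC :: "('a, 'n) chart => 'a => nat => 'n germ => 'n germ => 'n germ" where "gC c x k f g = (if k = 0 then f * g else
   (SUM P:{P. length P <= fst (bdata c k)}. SUM Q:{Q. length Q <= fst (bdata c k)}.
    germ (snd c x) (snd (bdata c k) P Q) * foldr gD P f * foldr gD Q g))"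

definition wg :: "('a, 'n) chart => 'a => 'n => 'n => 'n germ" where "wg c x i j = germ (snd c x) (%z. omega_up (\<omega> c z) i j)"

definition Wg :: "('a, 'n) chart => 'a => 'n => 'n => 'n germ" where "Wg c x i j = germ (snd c x) (%z. \<omega> c z $ i $ j)"

lemma smooth_at_chart: "c : \<A> ==> x : fst c ==> smooth_on (chart_image c) f ==> smooth_at (snd c x) f"
 by(rule smooth_atI[OF _ open_chart_image chart_in_image])

lemma cg_CK: assumes c: "c : \<A>" "x : fst c" and f: "sf f" and g: "sf g" shows "cg c x (CK k f g) = gC c x k (cg c x f) (cg c x g)"
proof(cases "k = 0")
 case True thus ?thesis by(simp add: CK_def gC_def cg_mult[OF c f g])
next case False
 let ?z = "snd c x" have sm: "smooth_at ?z (lf c f)" "smooth_at ?z (lf c g)" using smooth_funD c f g by auto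
 have sa: "smooth_at ?z (snd (bdata c k) P Q)" for P Q using smooth_at_chart[OF c bdata(1)] c False by auto
 have "cg c x (CK k f g) = germ ?z (%w. (SUM P:{P. length P <= fst (bdata c k)}. SUM Q:{Q. length Q <= fst (bdata c k)}.
        snd (bdata c k) P Q w * foldr wd P (lf c f) w * foldr wd Q (lf c g) w))" unfolding cg_def
 proof(rule germ_cong[OF smooth_funD[OF smooth_fun_CK[OF f g] c]])
  show "\<forall>\<^sub>F w in nhds ?z. lf c (CK k f g) w = (SUM P:{P. length P <= fst (bdata c k)}. SUM Q:{Q. length Q <= fst (bdata c k)}.
        snd (bdata c k) P Q w * foldr wd P (lf c f) w * foldr wd Q (lf c g) w)"
   using near_chart_image[OF c] bdata(2)[OF c(1) _ f g, of k] False by(auto simp: CK_def elim: eventually_mono)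
 qed
 also have "... = (SUM P:{P. length P <= fst (bdata c k)}. SUM Q:{Q. length Q <= fst (bdata c k)}.
    germ ?z (snd (bdata c k) P Q) * foldr gD P (cg c x f) * foldr gD Q (cg c x g))"
  using germ_foldr[OF sm(1)] germ_foldr[OF sm(2)] sa by(simp add: germ_sum germ_mult smooth_at_intros cg_def)
 finally show ?thesis using False by(simp add: gC_def)
qed

text \<open>Taking germs is a homomorphism from global formal functions to formal germs with the
  product built from \<open>gC\<close>.\<close>

lemma fcg_S: assumes c: "c : \<A>" "x : fst c" and F: "ff F" and G: "ff G" shows "fcg c x (S F G) = fstar (gC c x) (fcg c x F) (fcg c x G)"
proof(rule fps_ext)
 fix n have s: "sf (%x. F x $ i)" "sf (%x. G x $ i)" for i using F G by(auto simp: formal_fun_def)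
 show "fcg c x (S F G) $ n = fstar (gC c x) (fcg c x F) (fcg c x G) $ n" unfolding fcg_nth S_nth[OF F G] fstar_def fps_nth_Abs_fps
  by(simp add: cg_sum[OF c] smooth_fun_sum smooth_fun_CK s cg_CK[OF c])
qed

text \<open>Each property is transferred from global functions, using that all germs and formal
  germs are germs of such functions.\<close>

lemma wick_germ_at: assumes c: "c : \<A>" "x : fst c" shows "wick_germ (gC c x) (wg c x) (Wg c x)"
proof
 let ?z = "snd c x" show "gC c x 0 f g = f * g" for f g by(simp add: gC_def) show "gd.dop (%f. gC c x k f g)" for k g
 proof(cases "k = 0")
  case True thus ?thesis using gd.dop_lmult[OF gd.dop_id, of g] by(simp add: gC_def mult.commute)
 next case False
  have "gd.dop (%f. SUM P:{P. length P <= fst (bdata c k)}. SUM Q:{Q. length Q <= fst (bdata c k)}.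
    (germ ?z (snd (bdata c k) P Q) * foldr gD Q g) * foldr gD P f)" by(intro gd.dop_sum gd.dop_lmult gd.dop_foldr)
  thus ?thesis using False by(simp add: gC_def mult_ac)
 qed
 show "gd.dop (%g. gC c x k f g)" for k f
 proof(cases "k = 0")
  case True thus ?thesis using gd.dop_lmult[OF gd.dop_id, of f] by(simp add: gC_def)
 next case False
  have "gd.dop (%g. SUM P:{P. length P <= fst (bdata c k)}. SUM Q:{Q. length Q <= fst (bdata c k)}.
    (germ ?z (snd (bdata c k) P Q) * foldr gD P f) * foldr gD Q g)" by(intro gd.dop_sum gd.dop_lmult gd.dop_foldr)
  thus ?thesis using False by(simp add: gC_def mult_ac)
 qed
 \<comment> \<open>The Wick property on a neighbourhood removes all higher terms there, hence also
   their germs.\<close>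
 have zero: "gC c x k f g = 0" if k: "0 < k" and fg: "f = cg c x f'" "g = cg c x g'" "sf f'" "sf g'"
  and V: "open V" "x : V" "antiholomorphic_fun \<A> V f' \<or> holomorphic_fun \<A> V g'" for k f g f' g' V
 proof - have h0: "antiholomorphic_fun \<A> V (%_. 0)" "holomorphic_fun \<A> V (%_. 0)"
   by(auto simp: antiholomorphic_fun_def holomorphic_fun_def holo_on_iff)
  have "(ALL k. antiholomorphic_fun \<A> V (%x. cst (f' x) $ k)) \<or> (ALL k. holomorphic_fun \<A> V (%x. cst (g' x) $ k))" using V(3)
  proof
   assume "antiholomorphic_fun \<A> V f'" hence "antiholomorphic_fun \<A> V (%x. cst (f' x) $ k)" for k using h0 by(cases "k = 0") auto
   thus ?thesis by blast
  next assume "holomorphic_fun \<A> V g'"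
   hence "holomorphic_fun \<A> V (%x. cst (g' x) $ k)" for k using h0 by(cases "k = 0") auto
   thus ?thesis by blast
  qed
  hence Sy: "S (%x. cst (f' x)) (%x. cst (g' x)) y = cst (f' y) * cst (g' y)" if "y : V" for y
   using wick formal_fun_const fg(3,4) V(1) that unfolding wick_type_def by blast
  have "CK k f' g' y = 0" if "y : V" for y
  proof - have "S (%x. cst (f' x)) (%x. cst (g' x)) y $ k = (cst (f' y) * cst (g' y)) $ k" by(simp only: Sy[OF that])
   thus ?thesis using k by(simp add: S_const fg CK_def)
  qed
  hence "near x (%y. CK k f' g' y = 0)" using V(1,2) eventually_nhds by blast
  hence "cg c x (CK k f' g') = cg c x (%_. 0)" by(subst cg_eq_iff[OF c smooth_fun_CK[OF fg(3,4)] smooth_fun_const])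
  thus ?thesis by(simp add: cg_CK[OF c fg(3,4)] fg cg_const)
 qed
 show "gC c x k f g = 0" if k: "0 < k" and f: "!!i. gD (Inl i) f = 0" for k f g
 proof - obtain f' g' where fg: "f = cg c x f'" "g = cg c x g'" "sf f'" "sf g'" using cg_exhaust[OF c] by metis
  obtain V where "open V" "x : V" "antiholomorphic_fun \<A> V f'" using antiholomorphic_near[OF c fg(3)] f fg(1) by metis
  thus ?thesis using zero[OF k fg] by blast
 qed
 show "gC c x k f g = 0" if k: "0 < k" and g: "!!i. gD (Inr i) g = 0" for k f g
 proof - obtain f' g' where fg: "f = cg c x f'" "g = cg c x g'" "sf f'" "sf g'" using cg_exhaust[OF c] by metis
  obtain V where "open V" "x : V" "holomorphic_fun \<A> V g'" using holomorphic_near[OF c fg(4)] g fg(2) by metis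
  thus ?thesis using zero[OF k fg] by blast
 qed
 have sw: "smooth_at ?z (%z. omega_up (\<omega> c z) i j)" "smooth_at ?z (%z. \<omega> c z $ i $ j)" for i j
  using smooth_at_chart[OF c] smooth_on_omega_up[OF c(1)] smooth_on_omega[OF c(1)] by auto
 show "gC c x 1 f g - gC c x 1 g f = (SS i j. wg c x i j * (gD (Inl i) f * gD (Inr j) g - gD (Inr j) f * gD (Inl i) g))" for f g
 proof - obtain f' g' where fg: "f = cg c x f'" "g = cg c x g'" "sf f'" "sf g'" using cg_exhaust[OF c] by metis
  have sm: "smooth_at ?z (lf c f')" "smooth_at ?z (lf c g')" using smooth_funD c fg by auto
  have p: "poisson \<A> \<omega> f' g' y = CK 1 f' g' y - CK 1 g' f' y" for y
   using dq fg(3,4) by(simp add: deformation_quantization_def S_const CK_def)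
  have "gC c x 1 f g - gC c x 1 g f = germ ?z (lf c (%y. CK 1 f' g' y - CK 1 g' f' y))"
   unfolding fg(1,2) cg_CK[OF c fg(3,4), symmetric] cg_CK[OF c fg(4,3), symmetric]
   by(subst cg_diff[OF c, symmetric]) (auto intro: smooth_fun_CK fg simp: cg_def)
  also have "... = germ ?z (%w. SS i j. omega_up (\<omega> c w) i j * (wd (Inl i) (lf c f') w * wd (Inr j) (lf c g') w
    - wd (Inr j) (lf c f') w * wd (Inl i) (lf c g') w))"
  proof(rule germ_cong)
   show "smooth_at ?z (lf c (%y. CK 1 f' g' y - CK 1 g' f' y))" by(intro smooth_funD[OF smooth_fun_diff] smooth_fun_CK fg c)
   show "\<forall>\<^sub>F w in nhds ?z. lf c (%y. CK 1 f' g' y - CK 1 g' f' y) w = (SS i j. omega_up (\<omega> c w) i j *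
    (wd (Inl i) (lf c f') w * wd (Inr j) (lf c g') w
     - wd (Inr j) (lf c f') w * wd (Inl i) (lf c g') w))" using near_chart_image[OF c]
   proof eventually_elim
    case (elim w) thus ?case using poisson_chart[OF c(1) chart_inv_in[OF c(1) elim] fg(3,4)] p[of "chart_inv c w"] by(simp add: c lf_def)
   qed
  qed
  also have "... = (SS i j. wg c x i j * (gD (Inl i) f * gD (Inr j) g - gD (Inr j) f * gD (Inl i) g))"
   by(simp add: germ_sum germ_mult germ_diff germ_wirtinger smooth_at_intros sm sw wg_def fg cg_def)
  finally show ?thesis .
 qed
 show "fstar (gC c x) (fstar (gC c x) F G) H = fstar (gC c x) F (fstar (gC c x) G H)" for F G H
 proof - obtain F' where F: "ff F'" "F = fcg c x F'" using fcg_exhaust[OF c] by blast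
  obtain G' where G: "ff G'" "G = fcg c x G'" using fcg_exhaust[OF c] by blast
  obtain H' where H: "ff H'" "H = fcg c x H'" using fcg_exhaust[OF c] by blast
  show ?thesis unfolding F(2) G(2) H(2) using S_assoc[OF F(1) G(1) H(1)] by(simp add: fcg_S[OF c, symmetric] F G H S_formal)
 qed
 have ev: "\<forall>\<^sub>F w in nhds ?z. invertible (\<omega> c w)"
  using near_chart_image[OF c] by eventually_elim (rule invertible_omega[OF c(1)])
 show "(SS j. wg c x i j * Wg c x p j) = (if i = p then -1 else 0)" for i p
 proof - have "(SS j. wg c x i j * Wg c x p j) = germ ?z (%w. SS j. omega_up (\<omega> c w) i j * \<omega> c w $ p $ j)"
   by(simp add: wg_def Wg_def germ_sum germ_mult sw smooth_at_intros)
  also have "... = germ ?z (%w. if i = p then -1 else 0)"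
   by(rule germ_cong, intro smooth_at_intros sw) (rule eventually_mono[OF ev], rule omega_up_right)
  finally show ?thesis by(auto simp: germ_zero germ_minus[OF smooth_at_const] germ_one)
 qed
 show "(SS i. wg c x i j * Wg c x i l) = (if j = l then -1 else 0)" for j l
 proof - have "(SS i. wg c x i j * Wg c x i l) = germ ?z (%w. SS i. omega_up (\<omega> c w) i j * \<omega> c w $ i $ l)"
   by(simp add: wg_def Wg_def germ_sum germ_mult sw smooth_at_intros)
  also have "... = germ ?z (%w. if j = l then -1 else 0)"
   by(rule germ_cong, intro smooth_at_intros sw) (rule eventually_mono[OF ev], rule omega_up_left)
  finally show ?thesis by(auto simp: germ_zero germ_minus[OF smooth_at_const] germ_one)
 qed
 have cl: "\<forall>\<^sub>F w in nhds ?z. wd (Inl k) (%w. \<omega> c w $ i $ j) w = wd (Inl i) (%w. \<omega> c w $ k $ j) w &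
    wd (Inr k) (%w. \<omega> c w $ i $ j) w = wd (Inr j) (%w. \<omega> c w $ i $ k) w" for i j k
  using near_chart_image[OF c] omega_closed c(1) by(auto simp: closed_form11_def elim: eventually_mono)
 show "gD (Inl p) (Wg c x i j) = gD (Inl i) (Wg c x p j)" for p i j unfolding Wg_def germ_wirtinger[OF sw(2), symmetric]
  by(rule germ_cong, intro smooth_at_intros sw) (rule eventually_mono[OF cl[of p i j]], blast)
 show "gD (Inr p) (Wg c x i j) = gD (Inr j) (Wg c x i p)" for p i j unfolding Wg_def germ_wirtinger[OF sw(2), symmetric]
  by(rule germ_cong, intro smooth_at_intros sw) (rule eventually_mono[OF cl[of p i j]], blast)
qed

end

section \<open>The characteristic form of a star product of Wick type\<close>

lemma (in wick_germ) star_const_nth: "(F \<star> cst y) $ n = (SUM i<=n. C (n - i) (F $ i) y)"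
proof - have "rop C (cst y) k f = C k f y" for k f
 proof - have "rop C (cst y) k f = (SUM j<=k. if j = 0 then C k f y else 0)" unfolding rop_def by(rule sum.cong) auto
  thus ?thesis by simp
 qed
 thus ?thesis by(simp add: fstar_rop op_fps_nth)
qed

text \<open>A version of \<open>antihol_if_left_mult\<close> with finitely many orders and with
  conjugate coordinates that need not be centred, as is needed when an equation at one point is used
  at a neighbouring one.\<close>

lemma (in wick_germ) antihol_trunc: fixes F :: "'n germ fps"
 assumes Y: "!!m i. gD (Inl i) (Y m) = 0" "!!m j. gD (Inr j) (Y m) = (if j = m then 1 else 0)"
  and F: "!!m j. j <= Suc n ==> fps_nth (F \<star> cst (Y m)) j = F $ j * Y m" shows "gD (Inl i) (F $ n) = 0"
proof - have CY: "C 1 f (Y m) = X m f" for f m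
 proof - have "C 1 (Y m) f = 0" by(rule C_antihol) (auto simp: Y)
  thus ?thesis using C1[of f "Y m"] by(simp add: Y X_def if_distrib[of "%x. _ * x"] cong: if_cong)
 qed
 have "k <= n ==> ALL i. gD (Inl i) (F $ k) = 0" for k
 proof(induction k rule: less_induct)
  case (less k) have "X m (F $ k) = 0" for m
  proof - have "(SUM i<=Suc k. C (Suc k - i) (F $ i) (Y m)) = F $ Suc k * Y m" using F[of "Suc k" m] less.prems by(simp add: star_const_nth)
   moreover have "(SUM i<k. C (Suc k - i) (F $ i) (Y m)) = 0" by(rule sum.neutral) (use less in \<open>auto intro!: C_antihol\<close>)
   ultimately show ?thesis using CY[unfolded One_nat_def] by(simp add: atMost_Suc lessThan_Suc_atMost[symmetric] C0)
  qed
  thus ?case by(simp add: gD_X)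
 qed
 thus ?thesis by blast
qed

context atlas begin

text \<open>Equality of germs at a point is equality on a neighbourhood, hence equality of germs at
  all nearby points.\<close>

lemma eventually_eventually_cg: assumes c: "c : \<A>" and f: "sf f" and g: "sf g"
  and x: "x : fst c" "cg c x f = cg c x g" shows "near x (%y. y : fst c & cg c y f = cg c y g)"
proof - have "near x (%y. f y = g y)" using x cg_eq_iff[OF c x(1) f g] by simp
 hence "near x (%y. \<forall>\<^sub>F p in nhds y. f p = g p)" by(subst eventually_eventually)
 moreover have "near x (%y. y : fst c)" using open_chart[OF c] x(1) eventually_nhds by blast
 ultimately show ?thesis by eventually_elim (simp add: cg_eq_iff[OF c _ f g])
qed

lemma eventually_gD_cg: assumes c: "c : \<A>" "x : fst c" and f: "sf f" and h: "smooth_at (snd c x) h"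
  and e: "gD A (cg c x f) = germ (snd c x) h" shows "near x (%y. y : fst c & gD A (cg c y f) = germ (snd c y) h)"
proof - have s: "smooth_at (snd c y) (lf c f)" if "y : fst c" for y by(rule smooth_funD[OF f c(1) that])
 have "near (snd c x) (%w. wd A (lf c f) w = h w)"
  using e germ_eq_iff[OF smooth_at_wirtinger[OF s[OF c(2)]] h] by(simp add: cg_def germ_wirtinger s c)
 hence "near (snd c x) (%w. \<forall>\<^sub>F v in nhds w. wd A (lf c f) v = h v)" by(subst eventually_eventually)
 hence "near (snd c x) (%w. chart_inv c w : fst c & gD A (cg c (chart_inv c w) f) = germ (snd c (chart_inv c w)) h)"
  using near_chart_image[OF c]
 proof eventually_elim
  case (elim w) hence w: "chart_inv c w : fst c" "snd c (chart_inv c w) = w" using c by auto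
  have "germ w (wd A (lf c f)) = germ w h" by(rule germ_cong[OF smooth_at_wirtinger elim(1)]) (use s[OF w(1)] w in simp)
  thus ?case using w s[OF w(1)] by(simp add: cg_def germ_wirtinger)
 qed
 thus ?thesis using eventually_chart[OF c, of "%y. y : fst c & gD A (cg c y f) = germ (snd c y) h"] by simp
qed

lemma fcg_add: "c : \<A> ==> x : fst c ==> ff F ==> ff G ==> fcg c x (%y. F y + G y) = fcg c x F + fcg c x G"
 and fcg_diff: "c : \<A> ==> x : fst c ==> ff F ==> ff G ==> fcg c x (%y. F y - G y) = fcg c x F - fcg c x G"
 by(rule fps_ext, simp add: fcg_nth cg_add cg_diff formal_fun_def)+

lemma fcg_mult: assumes "c : \<A>" "x : fst c" "ff F" "ff G" shows "fcg c x (%y. F y * G y) = fcg c x F * fcg c x G"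
proof(rule fps_ext)
 fix n have s: "sf (%x. F x $ i)" "sf (%x. G x $ i)" for i using assms by(auto simp: formal_fun_def)
 show "fcg c x (%y. F y * G y) $ n = (fcg c x F * fcg c x G) $ n"
  by(simp add: fcg_nth fps_mult_nth cg_sum[OF assms(1,2)] cg_mult[OF assms(1,2)] smooth_fun_mult s)
qed

lemma formal_fun_add: "ff F ==> ff G ==> ff (%y. F y + G y)" and formal_fun_diff: "ff F ==> ff G ==> ff (%y. F y - G y)"
 and formal_fun_mult: "ff F ==> ff G ==> ff (%y. F y * G y)"
 by(simp_all add: formal_fun_def fps_mult_nth smooth_fun_add smooth_fun_diff smooth_fun_sum smooth_fun_mult)

lemma fcg_eq_change: assumes c: "c : \<A>" "c' : \<A>" "x : fst c" "x : fst c'" and FG: "ff F" "ff G"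
  and e: "fcg c' x F = fcg c' x G" shows "fcg c x F = fcg c x G"
proof(rule fps_ext)
 fix n have s: "sf (%x. F x $ n)" "sf (%x. G x $ n)" using FG by(auto simp: formal_fun_def)
 show "fcg c x F $ n = fcg c x G $ n" using arg_cong[OF e, of "%F. F $ n"] by(simp add: fcg_nth cg_eq_iff[OF _ _ s] c)
qed

text \<open>The chain rule for germs in two charts. The derivatives in the second chart are
  represented by functions \<open>H B\<close> on the manifold, because germs in different charts can
  only be compared through such functions.\<close>

lemma fD_fcg_change: assumes c: "c : \<A>" "c' : \<A>" "x : fst c" "x : fst c'" and F: "ff F"
  and H: "!!B. ff (H B)" "!!B. fcg c' x (H B) = fD B (fcg c' x F)"
 shows "fD A (fcg c x F) = (SS B. cst (germ (snd c x) (jacobian c c' B A)) * fcg c x (H B))"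
proof(rule fps_ext)
 fix n let ?f = "%y. F y $ n" and ?h = "%B y. H B y $ n" have s: "sf ?f" "sf (?h B)" for B using F H by(auto simp: formal_fun_def)
 have sj: "smooth_at (snd c x) (jacobian c c' B A)" for B
  by(rule smooth_atI[OF smooth_on_jacobian[OF c(1,2)] open_overlap[OF c(1,2)]]) (use c in blast)
 have sh: "smooth_at (snd c x) (lf c (?h B))" for B by(rule smooth_funD[OF s(2) c(1,3)])
 have "near (snd c' x) (%w. ALL B. wd B (lf c' ?f) w = lf c' (?h B) w)"
 proof - have "germ (snd c' x) (wd B (lf c' ?f)) = germ (snd c' x) (lf c' (?h B))" for B
   using arg_cong[OF H(2)[of B], of "%F. F $ n"] by(simp add: fcg_nth cg_def germ_wirtinger smooth_funD[OF s(1) c(2,4)])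
  hence "near (snd c' x) (%w. wd B (lf c' ?f) w = lf c' (?h B) w)" for B
   by(subst (asm) germ_eq_iff) (auto intro: smooth_at_intros smooth_funD[OF s(1) c(2,4)] smooth_funD[OF s(2) c(2,4)])
  thus ?thesis by(simp add: eventually_all_finite)
 qed
 hence "near (snd c' x) (%w. ALL B. wd B (lf c' ?f) (snd c' (chart_inv c' w)) = ?h B (chart_inv c' w))"
  using near_chart_image[OF c(2,4)] by eventually_elim (simp add: c lf_def)
 hence "near x (%y. ALL B. wd B (lf c' ?f) (snd c' y) = ?h B y)"
  using eventually_chart[OF c(2,4), of "%y. ALL B. wd B (lf c' ?f) (snd c' y) = ?h B y"] by simp
 moreover have "near x (%y. y : fst c & y : fst c')"
  using eventually_nhds_in_open[OF open_Int[OF open_chart[OF c(1)] open_chart[OF c(2)]], of x] c by simp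
 ultimately have "near x (%y. y : fst c & wd A (lf c ?f) (snd c y) = (SS B. jacobian c c' B A (snd c y) * ?h B y))"
  by eventually_elim (simp add: wirtinger_lf_change[OF c(1,2) _ _ smooth_funD[OF s(1) c(2)]] mult.commute)
 hence "near (snd c x) (%w. chart_inv c w : fst c & wd A (lf c ?f) (snd c (chart_inv c w)) = (SS B. jacobian c c' B A (snd c (chart_inv c w)) * ?h B (chart_inv c w)))"
  using eventually_chart[OF c(1,3), of "%y. y : fst c & wd A (lf c ?f) (snd c y) = (SS B. jacobian c c' B A (snd c y) * ?h B y)"] by simp
 hence "near (snd c x) (%w. wd A (lf c ?f) w = (SS B. jacobian c c' B A w * lf c (?h B) w))"
  using near_chart_image[OF c(1,3)] by eventually_elim (simp add: c lf_def)
 hence "germ (snd c x) (wd A (lf c ?f)) = germ (snd c x) (%w. SS B. jacobian c c' B A w * lf c (?h B) w)"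
  by(rule germ_cong[OF smooth_at_wirtinger[OF smooth_funD[OF s(1) c(1,3)]]])
 thus "fD A (fcg c x F) $ n = (SS B. cst (germ (snd c x) (jacobian c c' B A)) * fcg c x (H B)) $ n"
  by(simp add: fcg_nth cg_def germ_wirtinger smooth_funD[OF s(1) c(1,3)] germ_sum germ_mult sj sh smooth_at_intros fps_sum_nth)
qed

lemma smooth_at_jacobian: assumes c: "c : \<A>" "c' : \<A>" "x : fst c" "x : fst c'" shows "smooth_at (snd c x) (jacobian c c' B A)"
 by(rule smooth_atI[OF smooth_on_jacobian[OF c(1,2)] open_overlap[OF c(1,2)]]) (use c in blast)

text \<open>The conjugate Jacobian consists of antiholomorphic germs, so it may be pulled out of the
  left factor of the product.\<close>

lemma gD_jacobian: assumes c: "c : \<A>" "c' : \<A>" "x : fst c" "x : fst c'"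
 shows "gD (Inl i) (germ (snd c x) (jacobian c c' (Inr q) (Inr l))) = 0"
  and "germ (snd c x) (jacobian c c' (Inl p) (Inr l)) = 0" "germ (snd c x) (jacobian c c' (Inr q) (Inl i)) = 0"
proof - have o: "near (snd c x) (%w. w : overlap c c')" using eventually_nhds_in_open[OF open_overlap[OF c(1,2)]] c by blast
 show z: "germ (snd c x) (jacobian c c' (Inl p) (Inr l)) = 0" "germ (snd c x) (jacobian c c' (Inr q) (Inl i)) = 0" for q i
  unfolding germ_zero[symmetric, of "snd c x"]
  by(rule germ_cong[OF smooth_at_jacobian[OF c]], rule eventually_mono[OF o], simp add: jacobian_mixed[OF c(1,2)])+
 have st: "smooth_at (snd c x) (%w. cnj (transition c c' w $ q))"
  by(intro smooth_at_intros smooth_atI[OF smooth_on_transition[OF c(1,2)] open_overlap[OF c(1,2)]]) (use c in blast)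
 have e: "germ (snd c x) (jacobian c c' (Inr q) A) = gD A (germ (snd c x) (%w. cnj (transition c c' w $ q)))" for A
  by(simp add: germ_wirtinger[OF st, symmetric] jacobian_def[abs_def])
 show "gD (Inl i) (germ (snd c x) (jacobian c c' (Inr q) (Inr l))) = 0" unfolding e gD_commute[of "Inl i"] unfolding e[symmetric] z by simp
qed

end

context kaehler_wick begin

definition Ug :: "('a, 'n) chart => 'a => 'n => 'n germ fps" where "Ug c x l = (SOME U. wick_germ.left_derivation (gC c x) l U)"

lemma pot_at: assumes c: "c : \<A>" "x : fst c" shows "wick_germ_pot (gC c x) (wg c x) (Wg c x) (Ug c x)"
proof - interpret w: wick_germ "gC c x" "wg c x" "Wg c x" by(rule wick_germ_at[OF c])
 show ?thesis by unfold_locales (unfold Ug_def, rule someI_ex, rule w.ex_left_derivation)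
qed

lemma smooth_at_omega: "c : \<A> ==> x : fst c ==> smooth_at (snd c x) (%z. \<omega> c z $ i $ j)"
 and smooth_at_omega_up: "c : \<A> ==> x : fst c ==> smooth_at (snd c x) (%z. omega_up (\<omega> c z) i j)"
 using smooth_at_chart smooth_on_omega smooth_on_omega_up by auto

text \<open>Extending the defining equations of the left derivations from one point to its neighbours
 involves only finitely many powers of the formal parameter at a time.\<close>

lemma Ug_coherent: assumes c: "c : \<A>" "x : fst c" and V: "ff V" "fcg c x V = Ug c x l"
 shows "near x (%y. y : fst c & gD (Inl i) (Ug c y l $ n) = gD (Inl i) (cg c y (%p. V p $ n)))"
proof - have "ALL m. EX f. sf f & gcoord 0 (Inr m) = cg c x f" using cg_exhaust[OF c] by metis
 from choice[OF this] obtain Y where Y: "!!m. sf (Y m)" "!!m. gcoord 0 (Inr m) = cg c x (Y m)" by blast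
 have Yf: "ff (%y. cst (Y m y))" for m by(rule formal_fun_const[OF Y(1)])
 have sV: "sf (%p. V p $ j)" for j using V(1) by(simp add: formal_fun_def)
 interpret x: wick_germ_pot "gC c x" "wg c x" "Wg c x" "Ug c x" by(rule pot_at[OF c])
 have Yx: "gD A (cg c x (Y m)) = germ (snd c x) (%_. if A = Inr m then 1 else 0)" for A m
  unfolding Y(2)[symmetric] gD_gcoord by(cases "A = Inr m") (auto simp: germ_zero germ_one)
 \<comment> \<open>At nearby points the \<open>Y m\<close> are no longer centred but still have the
   derivatives of conjugate coordinates.\<close>
 have Yy: "near x (%y. y : fst c & gD A (cg c y (Y m)) = germ (snd c y) (%_. if A = Inr m then 1 else 0))" for A m
  by(rule eventually_gD_cg[OF c Y(1) smooth_at_const Yx])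
 let ?\<delta> = "%j m. if j = 1 & m = l then 1 else 0 :: complex"
 have sS: "sf (%p. S V (%y. cst (Y m y)) p $ j)" for m j using S_formal[OF V(1) Yf] by(simp add: formal_fun_def)
 have sR: "sf (%p. V p $ j * Y m p + ?\<delta> j m)" for m j by(intro smooth_fun_add smooth_fun_mult sV Y smooth_fun_const)
 have "cg c x (%p. S V (%y. cst (Y m y)) p $ j) = cg c x (%p. V p $ j * Y m p + ?\<delta> j m)" for m j
 proof - have "fcg c x (S V (%y. cst (Y m y))) $ j = (Ug c x l * ybar m + fps_X * fD (Inr l) (ybar m)) $ j"
   using x.U[of l] unfolding fcg_S[OF c V(1) Yf] V(2) fcg_fps_const Y(2)[symmetric] by(simp add: x.left_derivation_def)
  also have "... = cg c x (%p. V p $ j) * cg c x (Y m) + gconst (?\<delta> j m)"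
   unfolding Y(2)[symmetric] V(2)[symmetric] by(simp add: fcg_nth gD_gcoord fps_X_nth)
  finally show ?thesis by(simp add: fcg_nth cg_add[OF c smooth_fun_mult[OF sV Y(1)] smooth_fun_const] cg_mult[OF c sV Y(1)] cg_const)
 qed
 hence "near x (%y. y : fst c & cg c y (%p. S V (%y. cst (Y m y)) p $ j) = cg c y (%p. V p $ j * Y m p + ?\<delta> j m))" for m j
  by(rule eventually_eventually_cg[OF c(1) sS sR c(2)])
 hence "near x (%y. ALL m. ALL j:{..Suc n}. y : fst c & cg c y (%p. S V (%y. cst (Y m y)) p $ j) = cg c y (%p. V p $ j * Y m p + ?\<delta> j m))"
  by(simp add: eventually_all_finite eventually_ball_finite)
 moreover have "near x (%y. ALL m A. y : fst c & gD A (cg c y (Y m)) = germ (snd c y) (%_. if A = Inr m then 1 else 0))"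
  by(rule eventually_all_finite)+ (rule Yy)
 ultimately show ?thesis
 proof eventually_elim
  case (elim y) hence y: "y : fst c" by blast
  interpret y: wick_germ_pot "gC c y" "wg c y" "Wg c y" "Ug c y" by(rule pot_at[OF c(1) y])
  have D: "gD (Inl i) (cg c y (Y m)) = 0" "gD (Inr j) (cg c y (Y m)) = (if j = m then 1 else 0)" for i j m
   using elim(2) by(auto simp: germ_zero germ_one)
  have "gD (Inl i) ((Ug c y l - fcg c y V) $ n) = 0"
  proof(rule y.antihol_trunc[of "%m. cg c y (Y m)", OF D])
   fix m j assume j: "j <= Suc n"
   have "fcg c y (S V (%y. cst (Y m y))) $ j = cg c y (%p. V p $ j) * cg c y (Y m) + gconst (?\<delta> j m)" using elim(1) j
    by(simp add: fcg_nth cg_add[OF c(1) y smooth_fun_mult[OF sV Y(1)] smooth_fun_const] cg_mult[OF c(1) y sV Y(1)] cg_const)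
   moreover have "y.star (Ug c y l) (cst (cg c y (Y m))) $ j = Ug c y l $ j * cg c y (Y m) + gconst (?\<delta> j m)"
    using y.U[of l] unfolding y.left_derivation_def by(simp add: D fps_X_nth)
   ultimately show "y.star (Ug c y l - fcg c y V) (cst (cg c y (Y m))) $ j = (Ug c y l - fcg c y V) $ j * cg c y (Y m)"
    by(simp add: y.star_diff1 fcg_S[OF c(1) y V(1) Yf] fcg_fps_const fcg_nth algebra_simps)
  qed
  thus ?case using y by(simp add: gD_diff fcg_nth)
 qed
qed

text \<open>Pointwise values of the derivatives of the solutions chosen at each point; smoothness
  has to be earned in \<open>germ_alpha\<close>. Only positive orders matter, order zero being minus
  the Kaehler form.\<close>

definition \<alpha> :: "nat => ('a, 'n) form11" where "\<alpha> k c z = (\<chi> i l. gev (gD (Inl i) (Ug c (chart_inv c z) l $ k)))"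

text \<open>Near the point the values agree with derivatives of one extended function
  \<open>V\<close>, by \<open>Ug_coherent\<close>.\<close>

lemma germ_alpha: assumes c: "c : \<A>" "x : fst c"
 shows "smooth_at (snd c x) (%z. \<alpha> k c z $ i $ l)" "germ (snd c x) (%z. \<alpha> k c z $ i $ l) = gD (Inl i) (Ug c x l $ k)"
proof - obtain V where V: "ff V" "Ug c x l = fcg c x V" using fcg_exhaust[OF c] by blast
 let ?V = "%p. V p $ k" have sV: "sf ?V" using V(1) by(simp add: formal_fun_def)
 have "near x (%y. y : fst c & gD (Inl i) (Ug c y l $ k) = gD (Inl i) (cg c y ?V))" by(rule Ug_coherent[OF c V(1) V(2)[symmetric]])
 hence "near (snd c x) (%w. chart_inv c w : fst c & gD (Inl i) (Ug c (chart_inv c w) l $ k) = gD (Inl i) (cg c (chart_inv c w) ?V))"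
  using eventually_chart[OF c, of "%y. y : fst c & gD (Inl i) (Ug c y l $ k) = gD (Inl i) (cg c y ?V)"] by simp
 hence e: "near (snd c x) (%w. wd (Inl i) (lf c ?V) w = \<alpha> k c w $ i $ l)" using near_chart_image[OF c]
 proof eventually_elim
  case (elim w) hence w: "chart_inv c w : fst c" "snd c (chart_inv c w) = w" by(auto simp: c)
  hence "smooth_at w (lf c ?V)" using smooth_funD[OF sV c(1), of "chart_inv c w"] by simp
  thus ?case using elim(1) w by(simp add: \<alpha>_def cg_def germ_wirtinger[symmetric] gev_germ smooth_at_intros)
 qed
 have s: "smooth_at (snd c x) (lf c ?V)" by(rule smooth_funD[OF sV c])
 show "smooth_at (snd c x) (%z. \<alpha> k c z $ i $ l)" by(rule smooth_at_cong[OF smooth_at_wirtinger[OF s] e])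
 have "germ (snd c x) (%z. \<alpha> k c z $ i $ l) = germ (snd c x) (wd (Inl i) (lf c ?V))"
  by(rule germ_cong[OF smooth_at_wirtinger[OF s] e, symmetric])
 thus "germ (snd c x) (%z. \<alpha> k c z $ i $ l) = gD (Inl i) (Ug c x l $ k)" by(simp add: germ_wirtinger s V(2) fcg_nth cg_def)
qed

text \<open>Conjugate derivatives change by the conjugate Jacobian, and so do the functions whose
  left multiplications they complete, since antiholomorphic factors pass through the
  product.\<close>

lemma left_derivation_change: assumes c: "c : \<A>" "c' : \<A>" "x : fst c" "x : fst c'"
  and V: "!!q. ff (V q)" "!!q. fcg c' x (V q) = Ug c' x q"
 shows "wick_germ.left_derivation (gC c x) l (SS q. cst (germ (snd c x) (jacobian c c' (Inr q) (Inr l))) * fcg c x (V q))"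
proof - interpret x: wick_germ_pot "gC c x" "wg c x" "Wg c x" "Ug c x" by(rule pot_at[OF c(1,3)])
 interpret x': wick_germ_pot "gC c' x" "wg c' x" "Wg c' x" "Ug c' x" by(rule pot_at[OF c(2,4)])
 let ?J = "%q. cst (germ (snd c x) (jacobian c c' (Inr q) (Inr l)))" have aJ: "antihol (?J q)" for q by(simp add: gD_jacobian(1)[OF c])
 show ?thesis unfolding x.left_derivation_def
 proof
  fix G obtain G' where G: "ff G'" "G = fcg c x G'" using fcg_exhaust[OF c(1,3)] by blast
  have "ALL B. EX H. ff H & fcg c' x H = fD B (fcg c' x G')" using fcg_exhaust[OF c(2,4)] by metis
  from choice[OF this] obtain H where H: "!!B. ff (H B)" "!!B. fcg c' x (H B) = fD B (fcg c' x G')" by blast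
  have R: "ff (%y. V q y * G' y + fps_X * H (Inr q) y)" for q by(intro formal_fun_add formal_fun_mult V G formal_fun_X H)
  have cX: "ff (%_. fps_X)" using formal_fun_X[OF formal_fun_const[OF smooth_fun_const[of 1]]] by simp
  have fX: "fcg c x (%_. fps_X) = fps_X" for c :: "('a, 'n) chart" by(rule fps_ext) (simp add: fcg_nth cg_const fps_X_nth)
  have "fcg c x (S (V q) G') = fcg c x (%y. V q y * G' y + fps_X * H (Inr q) y)" for q
  proof(rule fcg_eq_change[OF c S_formal[OF V(1) G(1)] R])
   show "fcg c' x (S (V q) G') = fcg c' x (%y. V q y * G' y + fps_X * H (Inr q) y)" using x'.U[of q] unfolding x'.left_derivation_def
    by(simp add: fcg_S[OF c(2,4) V(1) G(1)] fcg_add[OF c(2,4)] fcg_mult[OF c(2,4)] formal_fun_mult formal_fun_X V G(1) H cX fX)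
  qed
  hence st: "x.star (fcg c x (V q)) G = fcg c x (V q) * G + fps_X * fcg c x (H (Inr q))" for q
   by(simp add: fcg_S[OF c(1,3) V(1) G(1)] fcg_add[OF c(1,3)] fcg_mult[OF c(1,3)] formal_fun_mult formal_fun_X V(1) G H cX fX)
  have sum: "x.star (sum f I) G = (SUM i:I. x.star (f i) G)" for f and I :: "'n set"
   by(induction I rule: fin_induct) (auto simp: x.star_add1)
  have fD: "fD (Inr l) G = (SS q. ?J q * fcg c x (H (Inr q)))"
   unfolding G(2) fD_fcg_change[OF c G(1) H] by(simp add: sum_UNIV_sum gD_jacobian[OF c])
  show "x.star (SS q. ?J q * fcg c x (V q)) G = (SS q. ?J q * fcg c x (V q)) * G + fps_X * fD (Inr l) G"
   unfolding sum x.star_antihol_mult[OF aJ] st fD by(simp add: sum_distrib_right sum_distrib_left algebra_simps sum.distrib)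
 qed
qed

text \<open>Uniqueness up to antiholomorphic functions removes the ambiguity after a holomorphic
  derivative; one Jacobian comes from \<open>left_derivation_change\<close>, the other from that
  derivative.\<close>

lemma is_form11_alpha: "is_form11 \<A> (\<alpha> k)" unfolding is_form11_def
proof(intro conjI ballI allI)
 fix c i j assume c: "c : \<A>" show "smooth_on (chart_image c) (%z. \<alpha> k c z $ i $ j)"
  unfolding smooth_on_iff_at[OF open_chart_image[OF c]] using germ_alpha(1)[OF c] by(auto simp: chart_image_def)
next fix c c' z i j assume c: "c : \<A>" "c' : \<A>" and "z : overlap c c'"
 then obtain x where x: "x : fst c" "x : fst c'" and z: "z = snd c x" by blast
 interpret x: wick_germ_pot "gC c x" "wg c x" "Wg c x" "Ug c x" by(rule pot_at[OF c(1) x(1)])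
 have "ALL q. EX V. ff V & fcg c' x V = Ug c' x q" using fcg_exhaust[OF c(2) x(2)] by metis
 from choice[OF this] obtain V where V: "!!q. ff (V q)" "!!q. fcg c' x (V q) = Ug c' x q" by blast
 have "ALL q B. EX H. ff H & fcg c' x H = fD B (fcg c' x (V q))" using fcg_exhaust[OF c(2) x(2)] by metis
 hence "EX H. ALL q B. ff (H q B) & fcg c' x (H q B) = fD B (fcg c' x (V q))" by metis
 then obtain H where H: "!!q B. ff (H q B)" "!!q B. fcg c' x (H q B) = fD B (fcg c' x (V q))" by blast
 let ?J = "%B A. cst (germ (snd c x) (jacobian c c' B A))" have "antihol (Ug c x j - (SS q. ?J (Inr q) (Inr j) * fcg c x (V q)))"
  by(rule x.left_derivation_unique[OF x.U left_derivation_change[OF c x V]])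
 hence "fD (Inl i) (Ug c x j) = (SS q. ?J (Inr q) (Inr j) * fD (Inl i) (fcg c x (V q)))"
  by(simp add: fD_diff fD_sum fD_mult gD_jacobian[OF c x])
 also have "... = (SS q. ?J (Inr q) (Inr j) * (SS p. ?J (Inl p) (Inl i) * fcg c x (H q (Inl p))))"
  using fD_fcg_change[OF c x V(1) H, of "Inl i"] by(simp add: sum_UNIV_sum gD_jacobian[OF c x])
 finally have e: "fev (fD (Inl i) (Ug c x j)) $ k = fev (SS q. ?J (Inr q) (Inr j) * (SS p. ?J (Inl p) (Inl i) * fcg c x (H q (Inl p)))) $ k"
  by simp
 have H': "fev (fcg c x (H q (Inl p))) = fev (fD (Inl p) (Ug c' x q))" for p q
  using fev_fcg[OF c(1) x(1) H(1)] fev_fcg[OF c(2) x(2) H(1), of q "Inl p"] H(2)[of q "Inl p"] V(2) by simp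
 have fc: "fev (cst g) = cst (gev g)" for g :: "'n germ"
 proof(rule fps_ext)
  fix n show "fev (cst g) $ n = cst (gev g) $ n" by(cases n) auto
 qed
 have "\<alpha> k c z $ i $ j = (SS q. jacobian c c' (Inr q) (Inr j) z * (SS p. jacobian c c' (Inl p) (Inl i) z * \<alpha> k c' (snd c' x) $ p $ q))"
  using e c x by(simp add: fev_sum H' fps_sum_nth \<alpha>_def z fc gev_germ smooth_at_jacobian[OF c x])
 also have "... = (SS p q. jacobian c c' (Inl p) (Inl i) z * jacobian c c' (Inr q) (Inr j) z * \<alpha> k c' (snd c' x) $ p $ q)"
  unfolding sum_distrib_left by(subst sum.swap) (simp only: mult_ac)
 finally show "\<alpha> k c z $ i $ j = (SS p q. jacobian c c' (Inl p) (Inl i) z * jacobian c c' (Inr q) (Inr j) z * \<alpha> k c' (transition c c' z) $ p $ q)"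
  by(simp add: z transition_apply[OF c(1) x(1)])
qed

text \<open>The holomorphic condition is the symmetry of second derivatives; the antiholomorphic one
  is \<open>left_derivation_sym\<close>.\<close>

lemma closed_alpha: "closed_form11 \<A> (\<alpha> k)" unfolding closed_form11_def
proof(intro conjI ballI allI is_form11_alpha)
 fix c z i j l assume c: "c : \<A>" and "z : chart_image c"
 then obtain x where x: "x : fst c" and z: "z = snd c x" by(auto simp: chart_image_def)
 interpret x: wick_germ_pot "gC c x" "wg c x" "Wg c x" "Ug c x" by(rule pot_at[OF c(1) x(1)])
 have w: "wd A (%w. \<alpha> k c w $ i $ j) z = gev (gD A (gD (Inl i) (Ug c x j $ k)))" for A i j
  unfolding germ_alpha(2)[OF c x, symmetric] z germ_wirtinger[OF germ_alpha(1)[OF c x], symmetric]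
  by(simp add: gev_germ smooth_at_intros germ_alpha(1)[OF c x])
 show "wd (Inl l) (%w. \<alpha> k c w $ i $ j) z = wd (Inl i) (%w. \<alpha> k c w $ l $ j) z"
  unfolding w by(simp add: gD_commute[of "Inl l" "Inl i"])
 show "wd (Inr l) (%w. \<alpha> k c w $ i $ j) z = wd (Inr j) (%w. \<alpha> k c w $ i $ l) z" unfolding w gD_commute[of "Inr _" "Inl i"]
  using arg_cong[OF x.left_derivation_sym[OF x.U x.U, of i l j], of "%F. F $ k"] by simp
qed

end

section \<open>Contraction of multi-index families\<close>

text \<open>Transformation of a tensor in all its slots by the same matrix, with words as
  multi-indices.\<close>

primrec mc :: "('i => 'j::finite => 'r::comm_ring_1) => 'i list => ('j list => 'r) => 'r" where "mc M [] h = h []"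
| "mc M (A # P) h = (SS B. M A B * mc M P (%Q. h (B # Q)))"

lemma mc_add: "mc M P (%Q. h Q + h' Q) = mc M P h + mc M P h'" by(induction P arbitrary: h h') (simp_all add: sum.distrib distrib_left)

lemma mc_scale: "mc M P (%Q. r * h Q) = r * mc M P h" by(induction P arbitrary: h) (simp_all add: sum_distrib_left mult.left_commute)

lemma mc_zero: "mc M P (%Q. 0) = 0" using mc_scale[of M P 0] by simp

lemma mc_sum: "mc M P (%Q. SUM i:I. h i Q) = (SUM i:I. mc M P (h i))"
 by(induction I rule: fin_induct) (simp_all add: mc_add mc_zero)

lemma mc_eq_sum: "mc M P h = (SUM Q:words (length P). (PROD r<length P. M (P ! r) (Q ! r)) * h Q)" by(induction P arbitrary: h)
  (simp_all add: sum_lists_Suc prod.lessThan_Suc_shift sum_distrib_left mult.assoc del: prod.lessThan_Suc)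

lemma mc_mc: "mc M P (%Q. mc N Q h) = mc (%A C. SS B. M A B * N B C) P h"
proof(induction P arbitrary: h)
 case (Cons A P) have "mc M (A # P) (%Q. mc N Q h) = (SS B C. M A B * N B C * mc M P (%Q. mc N Q (%R. h (C # R))))"
  by(simp add: mc_sum mc_scale sum_distrib_left mult.assoc)
 also have "... = (SS C B. M A B * N B C * mc M P (%Q. mc N Q (%R. h (C # R))))" by(rule sum.swap)
 finally show ?case by(simp add: Cons.IH sum_distrib_right)
qed simp

lemma mc_id: "mc (%A B. if A = B then 1 else 0) P h = h P"
 by(induction P arbitrary: h) (simp_all add: if_distrib[of "%x. x * _"] cong: if_cong)

lemma jprod_add1: "jprod P (%Q. a Q + a' Q) b = jprod P a b + jprod P a' b"
 and jprod_add2: "jprod P a (%Q. b Q + b' Q) = jprod P a b + jprod P a b'"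
 by(induction P arbitrary: a a' b b') (simp_all add: algebra_simps)

lemma jprod_scale1: "jprod P (%Q. r * a Q) b = r * jprod P a b"
 and jprod_scale2: "jprod P a (%Q. r * b Q) = r * jprod P a b" by(induction P arbitrary: a b) (simp_all add: algebra_simps)

lemma jprod_zero1: "jprod P (%Q. 0) b = 0" and jprod_zero2: "jprod P a (%Q. 0) = 0"
 using jprod_scale1[of P 0 "%_. 0" b] jprod_scale2[of P a 0 "%_. 0"] by simp_all

lemma jprod_commute: "jprod P a b = jprod P b a" by(induction P arbitrary: a b) (simp_all add: mult.commute add.commute)

primrec lefts :: "('a + 'b) list => 'a list" where "lefts [] = []"
| "lefts (A # P) = (case A of Inl a => a # lefts P | Inr _ => lefts P)"

primrec rights :: "('a + 'b) list => 'b list" where "rights [] = []"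
| "rights (A # P) = (case A of Inl _ => rights P | Inr b => b # rights P)"

lemma lefts_append [simp]: "lefts (P @ Q) = lefts P @ lefts Q" and rights_append [simp]: "rights (P @ Q) = rights P @ rights Q"
 by(induction P) (auto split: sum.splits)

lemma lefts_map [simp]: "lefts (map Inl K) = K" "lefts (map Inr M) = []"
 and rights_map [simp]: "rights (map Inl K) = []" "rights (map Inr M) = M" by(induction K, auto) (induction M, auto)+

lemma lefts_Nil_iff: "lefts P = [] \<longleftrightarrow> P = map Inr (rights P)" by(induction P) (auto split: sum.splits)

lemma mset_split_lists: "mset P = mset (map Inl (lefts P) @ map Inr (rights P))" by(induction P) (auto split: sum.splits)

lemma mset_lefts: "mset P = mset Q ==> mset (lefts P) = mset (lefts Q)"
 and mset_rights: "mset P = mset Q ==> mset (rights P) = mset (rights Q)"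
proof - have "mset (lefts P) = image_mset projl (filter_mset isl (mset P))" for P :: "('a + 'b) list"
  by(induction P) (auto split: sum.splits)
 thus "mset P = mset Q ==> mset (lefts P) = mset (lefts Q)" by simp
 have "mset (rights P) = image_mset projr (filter_mset (%A. ~ isl A) (mset P))" for P :: "('a + 'b) list"
  by(induction P) (auto split: sum.splits)
 thus "mset P = mset Q ==> mset (rights P) = mset (rights Q)" by simp
qed

text \<open>A block diagonal matrix acts separately on the holomorphic and the antiholomorphic
  letters.\<close>

lemma mc_split: fixes M :: "'i + 'j => 'k::finite + 'l::finite => 'r::comm_ring_1"
 assumes "!!i l. M (Inl i) (Inr l) = 0" "!!j k. M (Inr j) (Inl k) = 0" shows "mc M P (%Q. h (lefts Q) (rights Q)) =
  mc (%i k. M (Inl i) (Inl k)) (lefts P) (%K. mc (%j l. M (Inr j) (Inr l)) (rights P) (h K))"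
proof(induction P arbitrary: h)
 case (Cons A P) show ?case
 proof(cases A)
  case (Inl i) thus ?thesis by(simp add: sum_UNIV_sum assms Cons.IH[of "%K. h (_ # K)"])
 next case (Inr j)
  thus ?thesis by(simp add: sum_UNIV_sum assms Cons.IH[of "%K L. h K (_ # L)"] mc_sum mc_scale)
 qed
qed simp

section \<open>Jets of fibre elements\<close>

text \<open>The fibre derivative along a vector with constant coefficients; \<open>hj\<close>
  collects the Taylor coefficients in the frame whose vectors are the rows of
  \<open>E\<close>.\<close>

definition dl :: "('n + 'n => complex) => 'n::finite fibre => 'n fibre" where "dl v a m = (SS B. cst (v B) * yderiv B a m)"

primrec hj :: "('n + 'n => 'n + 'n => complex) => 'n::finite fibre => ('n + 'n) list => complex fps" where "hj E a [] = a (%_. 0)"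
| "hj E a (A # P) = hj E (dl (E A) a) P"

lemma yderiv_add: "yderiv A (%m. a m + b m) = (%m. yderiv A a m + yderiv A b m)"
 and yderiv_scale: "yderiv A (%m. r * a m) = (%m. r * yderiv A a m)" by(simp_all add: yderiv_def fun_eq_iff algebra_simps)

lemma yderiv_zero: "yderiv A (%m. 0) = (%m. 0)" by(simp add: yderiv_def fun_eq_iff)

lemma yderiv_sum: "yderiv A (%m. SUM i:I. a i m) = (%m. SUM i:I. yderiv A (a i) m)" by(simp add: yderiv_def fun_eq_iff sum_distrib_left)

lemma yderiv_commute: "yderiv A (yderiv B a) = yderiv B (yderiv A a)"
 by(cases "A = B") (auto simp: yderiv_def fun_eq_iff fun_upd_twist mult_ac)

lemma dl_add: "dl v (%m. a m + b m) = (%m. dl v a m + dl v b m)" and dl_scale: "dl v (%m. r * a m) = (%m. r * dl v a m)"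
 by(simp_all add: dl_def yderiv_add yderiv_scale fun_eq_iff algebra_simps sum.distrib sum_distrib_left)

lemma dl_zero: "dl v (%m. 0) = (%m. 0)" by(simp add: dl_def fun_eq_iff yderiv_zero)

lemma dl_sum: "dl v (%m. SUM i:I. a i m) = (%m. SUM i:I. dl v (a i) m)"
 by(induction I rule: fin_induct) (simp_all add: dl_add dl_zero)

lemma dl_commute: "dl v (dl w a) = dl w (dl v a)"
proof
 fix m have e: "dl v (dl w a) m = (SS B C. cst (v B) * cst (w C) * yderiv B (yderiv C a) m)" for v w
  unfolding dl_def[of w, abs_def] dl_def[of v] by(simp only: yderiv_sum yderiv_scale sum_distrib_left mult.assoc)
 show "dl v (dl w a) m = dl w (dl v a) m" unfolding e by(subst sum.swap) (simp only: yderiv_commute mult_ac)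
qed

lemma dl_single: "dl (%B. if A = B then 1 else 0) = yderiv A" by(simp add: dl_def fun_eq_iff if_distrib[of "%x. cst x * _"] cong: if_cong)

lemma fps_const_sum: "cst (sum f I) = (SUM i:I. cst (f i))" by(induction I rule: fin_induct) (simp_all flip: fps_const_add)

lemma dl_lin: "dl (%C. SS B. v B * E B C) a = (%m. SS B. cst (v B) * dl (E B) a m)"
proof
 fix m have "dl (%C. SS B. v B * E B C) a m = (SS C B. cst (v B) * (cst (E B C) * yderiv C a m))"
  unfolding dl_def fps_const_sum sum_distrib_right by(simp add: mult.assoc fps_const_mult[symmetric] del: fps_const_mult)
 thus "dl (%C. SS B. v B * E B C) a m = (SS B. cst (v B) * dl (E B) a m)" by(subst (asm) sum.swap) (simp add: dl_def sum_distrib_left)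
qed

lemma hj_add: "hj E (%m. a m + b m) P = hj E a P + hj E b P"
 and hj_scale: "hj E (%m. r * a m) P = r * hj E a P" by(induction P arbitrary: a b) (simp_all add: dl_add dl_scale)

lemma hj_zero: "hj E (%m. 0) P = 0" using hj_scale[of E 0 "%_. 0" P] by simp

lemma hj_diff: "hj E (%m. a m - b m) P = hj E a P - hj E b P" using hj_add[of E a "%m. (-1) * b m" P] hj_scale[of E "-1" b P] by simp

lemma hj_sum: "hj E (%m. SUM i:I. a i m) P = (SUM i:I. hj E (a i) P)"
 by(induction I rule: fin_induct) (simp_all add: hj_add hj_zero)

lemma foldr_dl: "hj E a P = foldr (%A. dl (E A)) P a (%_. 0)"
proof(induction P arbitrary: a)
 case (Cons A P) have "dl (E A) (foldr (%A. dl (E A)) P a) = foldr (%A. dl (E A)) P (dl (E A) a)"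
  by(induction P) (simp_all add: dl_commute[of "E A"])
 thus ?case by(simp add: Cons.IH)
qed simp

lemma jet_hj: "jet a P = hj (%A B. if A = B then 1 else 0) a P" by(simp add: jet_def foldr_dl dl_single[abs_def])

lemma hj_perm: "mset P = mset Q ==> hj E a P = hj E a Q"
proof(induction P arbitrary: Q a)
 case (Cons A P) then obtain Q1 Q2 where Q: "Q = Q1 @ A # Q2" by(metis list.set_intros(1) mset_eq_setD split_list)
 have "hj E a (Q1 @ A # Q2) = hj E a (A # Q1 @ Q2)" by(induction Q1 arbitrary: a) (simp_all add: dl_commute[of "E A"])
 moreover have "mset P = mset (Q1 @ Q2)" using Cons.prems Q by simp
 ultimately show ?case using Cons.IH[of "Q1 @ Q2" "dl (E A) a"] Q by simp
qed simp

lemma hj_mc: "hj (%A C. SS B. M A B * E B C) a P = mc (%A B. cst (M A B)) P (hj E a)"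
 by(induction P arbitrary: a) (simp_all add: dl_lin hj_sum hj_scale)

text \<open>Passing back to the coordinate frame by the inverse matrix, all ordinary jets vanish;
  induct on the degree of the monomial, dividing by an exponent each time.\<close>

lemma hj_eq_zeroD: assumes E: "!!A C. (SS B. V A B * E B C) = (if A = C then 1 else 0)" and z: "!!P. hj E a P = 0" shows "a m = 0"
proof - have "jet a P = 0" for P using hj_mc[of V E a P] by(simp add: E jet_hj z[abs_def] mc_zero)
 thus ?thesis
 proof(induction "SS A. m A" arbitrary: a m)
  case 0 hence "m = (%_. 0)" by(simp add: fun_eq_iff) thus ?case using 0(2)[of "[]"] by(simp add: jet_def)
 next case (Suc k)
  have "EX A. m A ~= 0"
  proof(rule ccontr)
   assume "~ (EX A. m A ~= 0)" hence "(SS A. m A) = 0" by simp thus False using Suc(2) by simp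
  qed
  then obtain A where A: "m A ~= 0" by blast
  define m' where "m' = m(A := m A - 1)" have "(SUM B:UNIV - {A}. m' B) = (SUM B:UNIV - {A}. m B)" "m' A = m A - 1" by(auto simp: m'_def)
  hence "k = (SS B. m' B)" using sum.remove[of UNIV A m] sum.remove[of UNIV A m'] Suc(2) A by simp
  moreover have "jet (yderiv A a) P = 0" for P using Suc(3)[of "A # P"] by(simp add: jet_hj dl_single)
  ultimately have "yderiv A a m' = 0" by(rule Suc(1))
  moreover have "m'(A := m' A + 1) = m" using A by(auto simp: m'_def)
  ultimately have "of_nat (m' A + 1) * a m = 0" by(simp only: yderiv_def)
  moreover have "(of_nat (m' A + 1) :: complex fps) ~= 0" by(simp only: of_nat_eq_0_iff)
  ultimately show ?case by(simp only: mult_eq_0_iff simp_thms)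
 qed
qed

lemma ydeg_upd: "ydeg (m(A := k)) + (if isl A then m A else 0) = ydeg m + (if isl A then k else 0)"
proof(cases A)
 case (Inl i) define m' where "m' = m(A := k)"
 have "(SUM j:UNIV - {i}. m' (Inl j)) = (SUM j:UNIV - {i}. m (Inl j))" "m' (Inl i) = k" by(auto simp: Inl m'_def)
 thus ?thesis using sum.remove[of UNIV i "%j. m (Inl j)"] sum.remove[of UNIV i "%j. m' (Inl j)"]
  by(simp add: ydeg_def Inl flip: m'_def[unfolded Inl])
qed (simp add: ydeg_def)

text \<open>A jet sees only the part whose degree in the holomorphic variables equals its number of
  holomorphic letters. This evaluates series whose range of summation depends on
  \<open>ydeg\<close>.\<close>

lemma jet_cong_ydeg: assumes "!!m. ydeg m = length (lefts P) ==> a m = b m" shows "jet a P = jet b P" using assms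
proof(induction P arbitrary: a b)
 case Nil thus ?case by(simp add: jet_def ydeg_def)
next case (Cons A P)
 have "yderiv A a m = yderiv A b m" if "ydeg m = length (lefts P)" for m
 proof - have "a (m(A := m A + 1)) = b (m(A := m A + 1))"
  proof(rule Cons.prems)
   define m' where "m' = m(A := m A + 1)" show "ydeg (m(A := m A + 1)) = length (lefts (A # P))"
    using that ydeg_upd[of m A "m A + 1"] unfolding m'_def[symmetric] by(cases A) simp_all
  qed
  thus ?thesis by(simp only: yderiv_def)
 qed
 hence "jet (yderiv A a) P = jet (yderiv A b) P" by(rule Cons.IH)
 thus ?case by(simp add: jet_hj dl_single)
qed

lemma hj_cong_ydeg: assumes E: "!!i j. E (Inl i) (Inr j) = 0" "!!i j. E (Inr i) (Inl j) = 0"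
  and ab: "!!m. ydeg m = length (lefts P) ==> a m = b m" shows "hj E a P = hj E b P"
proof - have "E = (%A C. SS B. E A B * (if B = C then 1 else 0))" by(simp add: fun_eq_iff if_distrib[of "%x. _ * x"] cong: if_cong)
 hence e: "hj E a P = mc (%A B. cst (E A B)) P (jet a)" for a
  using hj_mc[of E "%B C. if B = C then 1 else 0" a P] by(simp add: jet_hj[abs_def])
 have "mc (%A B. cst (E A B)) P h = mc (%A B. cst (E A B)) P h'"
  if "!!Q. length (lefts Q) = length (lefts P) ==> h Q = h' Q" for h h' using that
 proof(induction P arbitrary: h h')
  case (Cons A P)
  have "cst (E A B) * mc (%A B. cst (E A B)) P (%Q. h (B # Q)) = cst (E A B) * mc (%A B. cst (E A B)) P (%Q. h' (B # Q))" for B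
  proof(cases "isl A = isl B")
   case True hence "mc (%A B. cst (E A B)) P (%Q. h (B # Q)) = mc (%A B. cst (E A B)) P (%Q. h' (B # Q))"
    by(intro Cons.IH Cons.prems) (auto split: sum.splits)
   thus ?thesis by simp
  next case False
   hence "E A B = 0" using E by(cases A; cases B) auto
   thus ?thesis by simp
  qed
  thus ?case unfolding mc.simps by(rule sum.cong[OF refl])
 qed simp
 thus ?thesis unfolding e by this (intro jet_cong_ydeg ab, simp)
qed

definition exp_list :: "('n::finite + 'n => nat) => ('n + 'n) list" where "exp_list m = (SOME P. ALL A. count (mset P) A = m A)"

lemma count_exp_list: "count (mset (exp_list m)) A = m A"
proof - have "count (Abs_multiset m) = m" by(simp add: Abs_multiset_inverse)
 moreover obtain P where "mset P = Abs_multiset m" using ex_mset by blast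
 ultimately have "count (mset P) = m" by simp
 hence "EX P. ALL A. count (mset P) A = m A" by blast
 hence "ALL A. count (mset (exp_list m)) A = m A" unfolding exp_list_def by(rule someI_ex)
 thus ?thesis by blast
qed

text \<open>The inverse of taking jets, for symmetric families: Taylor coefficients are divided by
  the factorials of the exponents.\<close>

definition fibre_of :: "(('n::finite + 'n) list => complex fps) => 'n fibre" where
 "fibre_of h m = cst (1 / (PROD A:UNIV. fact (m A))) * h (exp_list m)"

lemma yderiv_fibre_of: fixes h :: "('n::finite + 'n) list => complex fps" assumes h: "!!P Q. mset P = mset Q ==> h P = h Q"
 shows "yderiv A (fibre_of h) = fibre_of (%P. h (A # P))"
proof
 fix m :: "'n + 'n => nat" define fa where "fa m = (PROD A:UNIV. fact (m A) :: complex)" for m :: "'n + 'n => nat"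
 define m' where "m' = m(A := m A + 1)"
 have "mset (exp_list m') = mset (A # exp_list m)" by(rule multiset_eqI) (simp add: count_exp_list m'_def)
 hence l: "h (exp_list m') = h (A # exp_list m)" by(rule h)
 have "(PROD B:UNIV - {A}. fact (m' B)) = (PROD B:UNIV - {A}. fact (m B) :: complex)" "m' A = m A + 1" by(auto simp: m'_def)
 hence f: "fa m' = of_nat (m A + 1) * fa m"
  using prod.remove[of UNIV A "%B. fact (m' B) :: complex"] prod.remove[of UNIV A "%B. fact (m B) :: complex"] by(simp add: fa_def)
 have "fa m ~= 0" by(simp add: fa_def)
 hence "of_nat (m A + 1) * (1 / fa m') = 1 / fa m" unfolding f by(simp del: of_nat_Suc of_nat_add)
 hence "of_nat (m A + 1) * cst (1 / fa m') = cst (1 / fa m)" unfolding fps_of_nat[symmetric] fps_const_mult by simp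
 thus "yderiv A (fibre_of h) m = fibre_of (%P. h (A # P)) m"
  unfolding yderiv_def fibre_of_def m'_def[symmetric] fa_def[symmetric] l mult.assoc[symmetric] by(simp only:)
qed

lemma jet_fibre_of: assumes "!!P Q. mset P = mset Q ==> h P = h Q" shows "jet (fibre_of h) P = h P" using assms
proof(induction P arbitrary: h)
 case Nil have "mset (exp_list (%_. 0)) = mset []" by(rule multiset_eqI) (simp add: count_exp_list)
 hence "h (exp_list (%_. 0)) = h []" by(rule Nil)
 thus ?case by(simp add: jet_def fibre_of_def)
next case (Cons A P)
 have "jet (fibre_of (%P. h (A # P))) P = h (A # P)" by(rule Cons.IH) (rule Cons.prems, simp)
 thus ?case by(simp add: jet_hj dl_single yderiv_fibre_of[OF Cons.prems])
qed

lemma finite_exponents: "finite {p. p <= (m :: 'i::finite => nat)}"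
proof - have "{p. p <= m} = PiE UNIV (%A. {..m A})" by(auto simp: le_fun_def)
 thus ?thesis by(simp add: finite_PiE)
qed

text \<open>Write the factor m + 1 as the sum of the exponents in the two factors; each half is
  reindexed separately.\<close>

lemma yderiv_fmult: fixes a b :: "'n::finite fibre" shows "yderiv A (fmult a b) m = fmult (yderiv A a) b m + fmult a (yderiv A b) m"
proof - let ?e = "%p. p(A := p A + 1)" and ?m = "m(A := m A + 1)"
 let ?t = "%p. a p * b (%v. ?m v - p v)" let ?P = "{p. p <= ?m}" and ?Q = "{p. p <= m}" have fin: "finite ?P" by(rule finite_exponents)
 have "yderiv A (fmult a b) m = (SUM p:?P. of_nat (m A + 1) * ?t p)" unfolding yderiv_def fmult_def sum_distrib_left ..
 also have "... = (SUM p:?P. of_nat (p A) * ?t p + of_nat (m A + 1 - p A) * ?t p)"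
 proof(rule sum.cong[OF refl])
  fix p assume "p : ?P" hence "p A <= m A + 1" by(auto simp: le_fun_def dest: spec[of _ A]) hence "m A + 1 = p A + (m A + 1 - p A)" by simp
  hence "(of_nat (m A + 1) :: complex fps) = of_nat (p A) + of_nat (m A + 1 - p A)" by(metis of_nat_add)
  thus "of_nat (m A + 1) * ?t p = of_nat (p A) * ?t p + of_nat (m A + 1 - p A) * ?t p" by(simp only: distrib_right)
 qed
 also have "... = (SUM p:?P. of_nat (p A) * ?t p) + (SUM p:?P. of_nat (m A + 1 - p A) * ?t p)" by(rule sum.distrib)
 also have "(SUM p:?P. of_nat (p A) * ?t p) = (SUM p:?P \<inter> {p. p A ~= 0}. of_nat (p A) * ?t p)"
  by(rule sum.mono_neutral_right[OF fin]) auto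
 also have "... = (SUM p:?Q. of_nat (p A + 1) * ?t (?e p))"
 proof(rule sum.reindex_bij_witness[of _ ?e "%p. p(A := p A - 1)"])
  show "p(A := p A - 1) : ?Q" if "p : ?P \<inter> {p. p A ~= 0}" for p using that by(fastforce simp: le_fun_def split: if_splits)
  show "?e p : ?P \<inter> {p. p A ~= 0}" if "p : ?Q" for p using that by(auto simp: le_fun_def)
  show e: "?e (p(A := p A - 1)) = p" if "p : ?P \<inter> {p. p A ~= 0}" for p using that by auto
  show "(?e p)(A := ?e p A - 1) = p" for p :: "'n + 'n => nat" by(auto simp: fun_eq_iff)
  show "of_nat ((p(A := p A - 1)) A + 1) * ?t (?e (p(A := p A - 1))) = of_nat (p A) * ?t p" if "p : ?P \<inter> {p. p A ~= 0}" for p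
  proof - have 1: "(p(A := p A - 1)) A + 1 = p A" using that by simp
   show ?thesis unfolding 1 by simp
  qed
 qed
 also have "... = fmult (yderiv A a) b m" unfolding fmult_def
 proof(rule sum.cong[OF refl])
  fix p assume "p : ?Q" have "(%v. ?m v - ?e p v) = (%v. m v - p v)" by(auto simp: fun_eq_iff)
  thus "of_nat (p A + 1) * ?t (?e p) = yderiv A a p * b (%v. m v - p v)" by(simp only: yderiv_def mult.assoc)
 qed
 also have "(SUM p:?P. of_nat (m A + 1 - p A) * ?t p) = (SUM p:?Q. of_nat (m A + 1 - p A) * ?t p)"
 proof(rule sum.mono_neutral_right[OF fin])
  show "?Q \<subseteq> ?P" by(auto simp: le_fun_def intro: le_SucI)
  show "ALL p:?P - ?Q. of_nat (m A + 1 - p A) * ?t p = 0"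
  proof
   fix p assume p: "p : ?P - ?Q" then obtain B where "~ p B <= m B" by(auto simp: le_fun_def)
   moreover have "p B <= ?m B" using p by(auto simp: le_fun_def)
   ultimately have "B = A" "p A = m A + 1" by(auto split: if_splits)
   thus "of_nat (m A + 1 - p A) * ?t p = 0" by simp
  qed
 qed
 also have "... = fmult a (yderiv A b) m" unfolding fmult_def
 proof(rule sum.cong[OF refl])
  fix p assume "p : ?Q" hence "p A <= m A" by(auto simp: le_fun_def)
  hence "m A + 1 - p A = (m A - p A) + 1" "(%v. ?m v - p v) = (%v. m v - p v)(A := m A - p A + 1)" by(auto simp: fun_eq_iff)
  thus "of_nat (m A + 1 - p A) * ?t p = a p * yderiv A b (%v. m v - p v)" by(simp only: yderiv_def mult_ac)
 qed
 finally show ?thesis .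
qed

lemma fmult_add1: "fmult (%m. a m + a' m) b = (%m. fmult a b m + fmult a' b m)"
 and fmult_add2: "fmult b (%m. a m + a' m) = (%m. fmult b a m + fmult b a' m)"
 and fmult_scale1: "fmult (%m. r * a m) b = (%m. r * fmult a b m)" and fmult_scale2: "fmult b (%m. r * a m) = (%m. r * fmult b a m)"
 by(simp_all add: fmult_def fun_eq_iff algebra_simps sum.distrib sum_distrib_left)

lemma fmult_zero [simp]: "fmult (%m. 0) b = (%m. 0)" "fmult b (%m. 0) = (%m. 0)" by(simp_all add: fmult_def fun_eq_iff)

lemma fmult_sum1: "fmult (%m. SUM i:I. a i m) b = (%m. SUM i:I. fmult (a i) b m)"
 and fmult_sum2: "fmult b (%m. SUM i:I. a i m) = (%m. SUM i:I. fmult b (a i) m)"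
 by(induction I rule: fin_induct) (simp_all add: fmult_add1 fmult_add2)

lemma fmult_0: fixes a b :: "'n::finite fibre" shows "fmult a b (%_. 0) = a (%_. 0) * b (%_. 0)"
proof - have "{p. p <= (%_ :: 'n + 'n. 0 :: nat)} = {%_. 0}" by(auto simp: le_fun_def)
 thus ?thesis by(simp add: fmult_def)
qed

lemma dl_fmult: "dl v (fmult a b) = (%m. fmult (dl v a) b m + fmult a (dl v b) m)"
proof
 fix m show "dl v (fmult a b) m = fmult (dl v a) b m + fmult a (dl v b) m"
  unfolding dl_def[of v a, abs_def] dl_def[of v b, abs_def] dl_def[of v "fmult a b"] fmult_sum1 fmult_sum2 fmult_scale1 fmult_scale2 yderiv_fmult
  by(simp add: algebra_simps sum.distrib)
qed

lemma hj_fmult: "hj E (fmult a b) P = jprod P (hj E a) (hj E b)" by(induction P arbitrary: a b) (simp_all add: fmult_0 dl_fmult hj_add)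

lemma ymult_conv: "ymult A a = fmult (yvar A) a"
proof
 fix m let ?\<delta> = "(%_. 0)(A := 1 :: nat)" have y: "yvar A p = (if p = ?\<delta> then 1 else 0)" for p
  by(auto simp: yvar_def ymult_def yconst_def fun_eq_iff split: if_splits)
 have "fmult (yvar A) a m = (SUM p:{p. p <= m}. if p = ?\<delta> then a (%v. m v - ?\<delta> v) else 0)"
  unfolding fmult_def y by(intro sum.cong refl) auto
 also have "... = (if ?\<delta> <= m then a (%v. m v - ?\<delta> v) else 0)"
  using sum.delta[OF finite_exponents[of m], of ?\<delta> "%_. a (%v. m v - ?\<delta> v)"] by simp
 also have "... = ymult A a m"
 proof(cases "m A = 0")
  case True hence "~ ?\<delta> <= m" by(auto simp: le_fun_def intro!: exI[of _ A]) thus ?thesis using True by(simp add: ymult_def)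
 next case False
  hence "?\<delta> <= m" by(auto simp: le_fun_def)
  moreover have "(%v. m v - ?\<delta> v) = m(A := m A - 1)" by auto
  ultimately show ?thesis using False by(simp add: ymult_def)
 qed
 finally show "ymult A a m = fmult (yvar A) a m" by simp
qed

lemma dl_yconst: "dl v (yconst h) = (%m. 0)" by(auto simp: dl_def yderiv_def yconst_def fun_eq_iff intro!: sum.neutral)

lemma dl_yvar: "dl v (yvar A) = yconst (cst (v A))"
proof
 fix m have "yderiv B (yvar A) m = (if B = A & m = (%_. 0) then 1 else 0)" for B
 proof(cases "m = (%_. 0)")
  case True thus ?thesis by(auto simp: yderiv_def yvar_def ymult_def yconst_def fun_eq_iff)
 next case False
  have "yvar A (m(B := m B + 1)) = 0"
  proof(rule ccontr)
   assume "yvar A (m(B := m B + 1)) ~= 0"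
   hence n: "(m(B := m B + 1)) A ~= 0" and e: "(m(B := m B + 1))(A := (m(B := m B + 1)) A - 1) = (%_. 0)"
    by(auto simp: yvar_def ymult_def yconst_def split: if_splits)
   have "B = A" using fun_cong[OF e, of B] by(auto split: if_splits)
   hence "m = (%_. 0)" using e by(simp add: fun_upd_idem)
   thus False using False by blast
  qed
  thus ?thesis using False by(simp add: yderiv_def)
 qed
 hence "dl v (yvar A) m = (SS B. if B = A then (if m = (%_. 0) then cst (v A) else 0) else 0)" unfolding dl_def by(intro sum.cong refl) simp
 thus "dl v (yvar A) m = yconst (cst (v A)) m" by(simp add: yconst_def)
qed

lemma hj_yconst: "hj E (yconst h) P = (if P = [] then h else 0)" by(cases P) (simp_all add: dl_yconst hj_zero, simp add: yconst_def)

lemma hj_yvar: "hj E (yvar A) P = (case P of [B] => cst (E B A) | _ => 0)"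
proof(cases P rule: remdups_adj.cases)
 case 1 thus ?thesis by(simp add: yvar_def ymult_def)
qed (simp_all add: dl_yvar dl_yconst hj_zero, simp add: yconst_def)

section \<open>The fibrewise Wick product on jets\<close>

lemma wick_term_dl: "dl v (wick_term W k a b) = (%m. wick_term W k (dl v a) b m + wick_term W k a (dl v b) m)"
proof(induction k arbitrary: a b)
 case (Suc k) have y: "yderiv A (dl v x) = dl v (yderiv A x)" for A and x :: "'a fibre"
  using dl_commute[of "%B. if A = B then 1 else 0" v x] by(simp add: dl_single)
 show ?case by(simp add: dl_sum dl_scale Suc y sum.distrib algebra_simps)
qed (simp add: dl_fmult)

lemma wick_term_add1: "wick_term W k (%m. a m + a' m) b = (%m. wick_term W k a b m + wick_term W k a' b m)"
 and wick_term_add2: "wick_term W k b (%m. a m + a' m) = (%m. wick_term W k b a m + wick_term W k b a' m)"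
 and wick_term_scale1: "wick_term W k (%m. r * a m) b = (%m. r * wick_term W k a b m)"
 and wick_term_scale2: "wick_term W k b (%m. r * a m) = (%m. r * wick_term W k b a m)"
proof - show "wick_term W k (%m. a m + a' m) b = (%m. wick_term W k a b m + wick_term W k a' b m)"
  by(induction k arbitrary: a a' b) (simp_all add: fmult_add1 yderiv_add sum.distrib algebra_simps)
 show "wick_term W k b (%m. a m + a' m) = (%m. wick_term W k b a m + wick_term W k b a' m)"
  by(induction k arbitrary: a a' b) (simp_all add: fmult_add2 yderiv_add sum.distrib algebra_simps)
 show "wick_term W k (%m. r * a m) b = (%m. r * wick_term W k a b m)"
  by(induction k arbitrary: a b) (simp_all add: fmult_scale1 yderiv_scale sum_distrib_left mult_ac)
 show "wick_term W k b (%m. r * a m) = (%m. r * wick_term W k b a m)"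
  by(induction k arbitrary: a b) (simp_all add: fmult_scale2 yderiv_scale sum_distrib_left mult_ac)
qed

text \<open>The fields \<open>X\<close> acting on the fibre variables, completed by the coordinate
  vectors of the conjugate variables.\<close>

definition fr :: "complex^'n::finite^'n => 'n + 'n => 'n + 'n => complex" where
 "fr W A B = (case (A, B) of (Inl a, Inl i) => omega_up W i a | (Inr a, Inr b) => (if a = b then 1 else 0) | _ => 0)"

lemma fr_simps [simp]: "fr W (Inl a) (Inl i) = omega_up W i a" "fr W (Inr a) (Inr b) = (if a = b then 1 else 0)"
 "fr W (Inl a) (Inr b) = 0" "fr W (Inr b) (Inl a) = 0" by(simp_all add: fr_def)

lemma dl_fr: "dl (fr W (Inl a)) x m = (SS i. cst (omega_up W i a) * yderiv (Inl i) x m)" "dl (fr W (Inr j)) x m = yderiv (Inr j) x m"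
 by(simp_all add: dl_def sum_UNIV_sum if_distrib[of cst] if_distrib[of "%x. x * _"] cong: if_cong)

text \<open>The frame absorbs the inverse form, and the contraction becomes the plain pairing of
  frame vectors with equal index.\<close>

lemma wick_term_Suc_fr: "wick_term W (Suc k) a b m = (SS j. wick_term W k (dl (fr W (Inl j)) a) (dl (fr W (Inr j)) b) m)"
proof - have s: "wick_term W k (%m. SUM i:I. f i m) b = (%m. SUM i:I. wick_term W k (f i) b m)" for I :: "'a set" and f b
 proof(induction I rule: fin_induct)
  case (insert x F) thus ?case by(simp add: wick_term_add1)
 qed (use wick_term_scale1[of W k 0 "%_. 0" b] in simp_all)
 have "wick_term W (Suc k) a b m = (SS j i. cst (omega_up W i j) * wick_term W k (yderiv (Inl i) a) (yderiv (Inr j) b) m)"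
  unfolding wick_term.simps by(rule sum.swap)
 thus ?thesis unfolding dl_fr[abs_def] by(simp add: s wick_term_scale1)
qed

text \<open>The k-fold contraction on jets in the frame; it makes sense in any commutative ring and
  is therefore used for germs as well as for values.\<close>

primrec jwt :: "nat => ('n::finite + 'n) list => (('n + 'n) list => 'r::comm_ring_1) => (('n + 'n) list => 'r) => 'r" where
 "jwt 0 P a b = jprod P a b"
| "jwt (Suc k) P a b = (SS j. jwt k P (%Q. a (Inl j # Q)) (%Q. b (Inr j # Q)))"

definition jwick :: "('n::finite + 'n) list => (('n + 'n) list => 'r::{comm_ring_1,real_algebra_1} fps) => (('n + 'n) list => 'r fps) => 'r fps" where
 "jwick P a b = Abs_fps (%n. SUM k<=n. (1 / fact k) *R (jwt k P a b $ (n - k)))"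

lemma hj_wick_term: "hj (fr W) (wick_term W k a b) P = jwt k P (hj (fr W) a) (hj (fr W) b)"
proof(induction k arbitrary: a b)
 case 0 thus ?case by(simp add: hj_fmult)
next case (Suc k)
 have "wick_term W (Suc k) a b = (%m. SS j. wick_term W k (dl (fr W (Inl j)) a) (dl (fr W (Inr j)) b) m)"
  by(rule ext, rule wick_term_Suc_fr)
 thus ?case by(simp add: hj_sum Suc.IH del: wick_term.simps)
qed

lemma hj_wick: "hj (fr W) (wick W a b) P = jwick P (hj (fr W) a) (hj (fr W) b)"
proof(rule fps_ext)
 fix n have "hj (fr W) (wick W a b) P $ n = (SUM k<=n. (1 / fact k) * (hj (fr W) (wick_term W k a b) P $ (n - k)))"
 proof(induction P arbitrary: a b)
  case Nil show ?case by(simp add: wick_def)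
 next case (Cons A P)
  have "dl v (wick W a b) = (%m. wick W (dl v a) b m + wick W a (dl v b) m)" for v
  proof(rule ext, rule fps_ext)
   fix m n have "dl v (wick W a b) m $ n = (SUM k<=n. (dl v (wick_term W k a b) m $ (n - k)) / fact k)"
    by(simp add: dl_def yderiv_def wick_def fps_sum_nth sum_distrib_left sum_divide_distrib sum.swap[of _ "{..n}"] mult_ac flip: fps_of_nat)
   thus "dl v (wick W a b) m $ n = (wick W (dl v a) b m + wick W a (dl v b) m) $ n"
    by(simp add: wick_term_dl wick_def sum.distrib add_divide_distrib)
  qed
  thus ?case by(simp add: hj_add Cons.IH wick_term_dl sum.distrib distrib_left)
 qed
 thus "hj (fr W) (wick W a b) P $ n = jwick P (hj (fr W) a) (hj (fr W) b) $ n" by(simp add: jwick_def hj_wick_term scaleR_conv_of_real)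
qed

section \<open>The Levi-Civita connection in the flat frame\<close>

lemma fwirtinger_add: "fsmooth_at z F ==> fsmooth_at z G ==> fwd A (%w. F w + G w) z = fwd A F z + fwd A G z"
 and fwirtinger_mult: "fsmooth_at z F ==> fsmooth_at z G ==> fwd A (%w. F w * G w) z = fwd A F z * G z + F z * fwd A G z"
 by(simp_all add: fwirtinger_fev fsmooth_at_intros fgerm_add fgerm_diff fgerm_mult fD_add fD_diff fD_mult fev_fgerm)

lemma fwirtinger_const: "fwd A (%_. c) z = 0" by(simp add: fwirtinger_def fps_eq_iff)

lemma fwirtinger_fps_const: "fwd A (%w. cst (f w)) z = cst (wd A f z)"
proof(rule fps_ext)
 fix n show "fwd A (%w. cst (f w)) z $ n = cst (wd A f z) $ n" by(cases "n = 0") (simp_all add: fwirtinger_def)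
qed

lemma fwirtinger_scale: "smooth_at z f ==> fsmooth_at z G ==> fwd A (%w. cst (f w) * G w) z = cst (wd A f z) * G z + cst (f z) * fwd A G z"
 by(simp add: fwirtinger_mult fsmooth_at_fps_const fwirtinger_fps_const)

lemma fwirtinger_cscale: "fsmooth_at z G ==> fwd A (%w. c * G w) z = c * fwd A G z"
 by(simp add: fwirtinger_mult fsmooth_at_const fwirtinger_const)

lemma fwirtinger_sum: "(!!i. i : I ==> fsmooth_at z (F i)) ==> fwd A (%w. SUM i:I. F i w) z = (SUM i:I. fwd A (F i) z)"
 by(induction I rule: fin_induct) (simp_all add: fwirtinger_const fwirtinger_add fsmooth_at_sum)

lemma fwirtinger_cong: "near z (%w. F w = G w) ==> fwd A F z = fwd A G z"
 unfolding fwirtinger_def by(intro arg_cong[of _ _ Abs_fps] ext wirtinger_eventually_cong) (auto elim: eventually_mono)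

lemma fmult_yconst: "fmult (yconst h) x = (%m. h * x m)"
proof
 fix m have "fmult (yconst h) x m = (SUM p:{p. p <= m}. if p = (%_. 0) then h * x m else 0)"
  unfolding fmult_def yconst_def by(rule sum.cong) auto
 thus "fmult (yconst h) x m = h * x m" using sum.delta[OF finite_exponents[of m], of "%_. 0" "%_. h * x m"] by(simp add: le_fun_def)
qed

lemma dl_ymult: "dl v (ymult C x) = (%m. cst (v C) * x m + ymult C (dl v x) m)" by(simp add: ymult_conv dl_fmult dl_yvar fmult_yconst)

lemma dl_vadd: "dl (%E. v E + w E) x m = dl v x m + dl w x m" by(simp add: dl_def sum.distrib algebra_simps flip: fps_const_add)

lemma dl_vzero: "dl (%E. 0) x m = 0" by(simp add: dl_def)

lemma dl_yderiv: "dl v (yderiv A x) = yderiv A (dl v x)" using dl_commute[of v "%B. if A = B then 1 else 0" x] by(simp add: dl_single)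

lemma dl_diff: "dl v (%m. a m - b m) = (%m. dl v a m - dl v b m)" using dl_add[of v a "%m. (-1) * b m"] dl_scale[of v "-1" b] by simp

text \<open>If every way of removing one letter contributes the same amount, the total is the number
  of letters times that amount.\<close>

lemma zsum_const: assumes "!!A N. mset (A # N) = mset P ==> (SUM k:I. c k A * t k N) = v"
 shows "(SUM k:I. zsum P (c k) (t k)) = of_nat (length P) * v" using assms
proof(induction P arbitrary: t)
 case (Cons a M) have "(SUM k:I. zsum M (c k) (%N. t k (a # N))) = of_nat (length M) * v" by(rule Cons.IH, rule Cons.prems) simp
 moreover have "(SUM k:I. c k a * t k M) = v" by(rule Cons.prems) simp
 ultimately show ?case by(simp add: sum.distrib algebra_simps)
qed simp

lemma zsum_zero: "(!!A N. mset (A # N) = mset P ==> c A * t N = 0) ==> zsum P c t = 0"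
 using zsum_const[where I = "{()}" and c = "%_. c" and t = "%_. t" and v = 0 and P = P] by simp

lemma hj_ymult: "hj E (ymult C x) P = zsum P (%A. cst (E A C)) (hj E x)"
proof - have "hj E (ymult C x) P = jprod P (hj E (yvar C)) (hj E x)" by(simp add: ymult_conv hj_fmult)
 also have "... = hj E (yvar C) [] * hj E x P + zsum P (%A. hj E (yvar C) [A]) (hj E x)"
  by(rule jprod_short) (auto simp: hj_yvar split: list.split)
 finally show ?thesis by(simp add: hj_yvar del: hj.simps)
qed

text \<open>The Kaehler form on an open set of coordinates. The set is a parameter, since some
  arguments need to shrink to where local functions exist.\<close>

locale kaehler_local = fixes V :: "(complex^'n::finite) set" and \<Omega> :: "complex^'n => complex^'n^'n"
 assumes open_V: "open V" and smooth_on_Om: "smooth_on V (%z. \<Omega> z $ i $ j)" and inv_Om: "z : V ==> invertible (\<Omega> z)"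
  and closed1: "z : V ==> wd (Inl k) (%w. \<Omega> w $ i $ j) z = wd (Inl i) (%w. \<Omega> w $ k $ j) z"
  and closed2: "z : V ==> wd (Inr k) (%w. \<Omega> w $ i $ j) z = wd (Inr j) (%w. \<Omega> w $ i $ k) z" begin

abbreviation om :: "complex^'n => 'n => 'n => complex" where "om z i a == omega_up (\<Omega> z) i a"
abbreviation dO :: "'n + 'n => 'n => 'n => complex^'n => complex" where "dO A i j == wd A (%w. \<Omega> w $ i $ j)"

lemma eventually_V: "z : V ==> near z (%w. w : V)" by(rule eventually_nhds_in_open[OF open_V])

lemma sO: "z : V ==> smooth_at z (%z. \<Omega> z $ i $ j)" by(rule smooth_atI[OF smooth_on_Om open_V])

lemma som: "z : V ==> smooth_at z (%z. om z i a)" unfolding omega_up_def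
 by(rule smooth_at_minus, rule smooth_atI[OF smooth_on_matrix_inv[OF open_V smooth_on_Om inv_Om] open_V])

lemma sfr: "z : V ==> smooth_at z (%w. fr (\<Omega> w) B C)" by(cases B; cases C) (auto intro: som smooth_at_const)

section \<open>Inverse metric and Christoffel symbols of the Kaehler form\<close>

lemma metric_inv: assumes z: "z : V"
 shows "matrix_inv (metric (\<Omega> z)) = (\<chi> A B. case (A, B) of (Inl i, Inr j) => - \<i> * om z i j | (Inr j, Inl i) => - \<i> * om z i j | _ => 0)"
  (is "_ = ?N")
proof - have 1: "(SS j. \<Omega> z $ p $ j * om z i j) = (if i = p then -1 else 0)" for i p
  using omega_up_right[OF inv_Om[OF z], of i p] by(simp add: mult.commute)
 have 2: "(SS i. \<Omega> z $ i $ l * om z i j) = (if j = l then -1 else 0)" for j l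
  using omega_up_left[OF inv_Om[OF z], of j l] by(simp add: mult.commute)
 have ii: "\<i> * x * \<i> * y = - (x * y)" for x y :: complex
 proof - have "\<i> * x * \<i> * y = (\<i> * \<i>) * (x * y)" by(simp only: mult_ac)
  thus ?thesis by simp
 qed
 have r: "metric (\<Omega> z) ** ?N = mat 1" unfolding vec_eq_iff matrix_matrix_mult_def
 proof(intro allI)
  fix A B show "(\<chi> i j. SS k. metric (\<Omega> z) $ i $ k * ?N $ k $ j) $ A $ B = mat 1 $ A $ B" by(cases A; cases B)
    (auto simp: sum_UNIV_sum metric_def herm_def mat_def mult.assoc[symmetric] ii 1 2 sum_negf)
 qed
 hence l: "?N ** metric (\<Omega> z) = mat 1" by(simp only: matrix_left_right_inverse)
 have "invertible (metric (\<Omega> z))" using r l unfolding invertible_def by blast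
 hence "matrix_inv (metric (\<Omega> z)) ** (metric (\<Omega> z) ** ?N) = ?N" by(simp only: matrix_mul_assoc matrix_inv_left matrix_mul_lid)
 thus ?thesis by(simp only: r matrix_mul_rid)
qed

text \<open>The Christoffel symbols with only holomorphic indices; \<open>q\<close> below gives
  those with only antiholomorphic ones.\<close>

definition G :: "'n => 'n => 'n => complex^'n => complex" where "G a i p z = - (SS j. om z a j * dO (Inl i) p j z)"

definition q :: "'n => 'n => 'n => complex^'n => complex" where "q b l m z = - (SS i. om z i b * dO (Inr l) i m z)"

lemma dmetric: assumes z: "z : V" shows "wd A (%w. metric (\<Omega> w) $ Inl i $ Inr j) z = - \<i> * dO A i j z"
  "wd A (%w. metric (\<Omega> w) $ Inr j $ Inl i) z = - \<i> * dO A i j z"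
  "wd A (%w. metric (\<Omega> w) $ Inl i $ Inl k) z = 0" "wd A (%w. metric (\<Omega> w) $ Inr i $ Inr k) z = 0"
 using wirtinger_cmult[OF smooth_at_differentiable[OF sO[OF z, of i j]], of A "- \<i>"] by(simp_all add: metric_def herm_def)

text \<open>On a Kaehler manifold closedness of the form kills all mixed symbols.\<close>

lemma christoffel_eq: assumes z: "z : V"
 shows "christoffel \<Omega> (Inl a) (Inl i) (Inl p) z = G a i p z" "christoffel \<Omega> (Inr b) (Inr l) (Inr m) z = q b l m z"
  "christoffel \<Omega> (Inr b) (Inl i) C z = 0" "christoffel \<Omega> (Inl a) (Inr l) C z = 0"
  "christoffel \<Omega> B (Inl i) (Inr l) z = 0" "christoffel \<Omega> B (Inr l) (Inl i) z = 0"
proof - have i2: "\<i> * a * (2 * (\<i> * b)) = - 2 * (a * b)" for a b :: complex by(simp add: mult.left_commute)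
 show 1: "christoffel \<Omega> (Inl a) (Inl i) (Inl p) z = G a i p z" using closed1[OF z, of p i]
  by(simp add: christoffel_def metric_inv[OF z] sum_UNIV_sum dmetric[OF z] G_def)
   (simp add: i2 sum_negf sum_distrib_left[symmetric] mult.commute)
 show "christoffel \<Omega> (Inr b) (Inr l) (Inr m) z = q b l m z" using closed2[OF z, of m _ l]
  by(simp add: christoffel_def metric_inv[OF z] sum_UNIV_sum dmetric[OF z] q_def)
   (simp add: i2 sum_negf sum_distrib_left[symmetric] mult.commute)
 show i: "christoffel \<Omega> (Inr b) (Inl i) C z = 0" for b i C
  using closed1[OF z, of i] by(cases C) (simp_all add: christoffel_def metric_inv[OF z] sum_UNIV_sum dmetric[OF z])
 show ii: "christoffel \<Omega> (Inl a) (Inr l) C z = 0" for a l C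
  using closed2[OF z, of l] by(cases C) (simp_all add: christoffel_def metric_inv[OF z] sum_UNIV_sum dmetric[OF z])
 have sym: "christoffel \<Omega> B A C z = christoffel \<Omega> B C A z" for A B C
 proof - have m: "metric W $ A $ C = metric W $ C $ A" for W by(simp add: metric_def split: sum.split)
  show ?thesis unfolding christoffel_def by(simp only: add.commute[of "wd A _ z"] m)
 qed
 show "christoffel \<Omega> B (Inl i) (Inr l) z = 0" "christoffel \<Omega> B (Inr l) (Inl i) z = 0" using i ii sym by(cases B; metis)+
qed

text \<open>Differentiate the relation between the matrix and its inverse.\<close>

lemma d_omega_up: assumes z: "z : V" shows "wd A (%w. om w i a) z = (SS p j. om z p a * om z i j * dO A p j z)"
proof - let ?d = "%j. wd A (%w. om w i j) z"
 have e: "(SS j. ?d j * \<Omega> z $ p $ j) = - (SS j. om z i j * dO A p j z)" for p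
 proof - have "wd A (%w. SS j. om w i j * \<Omega> w $ p $ j) z = wd A (%w. if i = p then -1 else 0) z"
   by(rule wirtinger_cong[OF open_V z]) (rule omega_up_right[OF inv_Om])
  moreover have "wd A (%w. SS j. om w i j * \<Omega> w $ p $ j) z = (SS j. ?d j * \<Omega> z $ p $ j + om z i j * dO A p j z)"
   using smooth_at_differentiable[OF som[OF z]] smooth_at_differentiable[OF sO[OF z]]
   by(simp add: wirtinger_sum wirtinger_mult differentiable_mult)
  ultimately show ?thesis by(simp add: sum.distrib eq_neg_iff_add_eq_0)
 qed
 have "(SS p. om z p a * (SS j. ?d j * \<Omega> z $ p $ j)) = (SS j. ?d j * (SS p. om z p a * \<Omega> z $ p $ j))"
  unfolding sum_distrib_left by(subst sum.swap) (simp only: mult_ac)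
 also have "... = - ?d a" by(simp add: omega_up_left[OF inv_Om[OF z]] if_distrib[of "%x. _ * x"] cong: if_cong)
 finally show ?thesis by(simp add: e sum_negf sum_distrib_left mult.assoc)
qed

lemma d_omega_up_hol: "z : V ==> wd (Inl k) (%w. om w i a) z = - (SS p. G i k p z * om z p a)"
 and d_omega_up_anti: "z : V ==> wd (Inr l) (%w. om w i a) z = - (SS j. q a l j z * om z i j)"
proof - show "z : V ==> wd (Inl k) (%w. om w i a) z = - (SS p. G i k p z * om z p a)"
  by(simp add: d_omega_up G_def sum_negf sum_distrib_right sum_distrib_left mult_ac)
 assume z: "z : V" show "wd (Inr l) (%w. om w i a) z = - (SS j. q a l j z * om z i j)" unfolding d_omega_up[OF z] q_def
  by(subst sum.swap) (simp add: sum_negf sum_distrib_right sum_distrib_left mult_ac)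
qed

lemma smooth_G: "z : V ==> smooth_at z (G a i p)" and smooth_q: "z : V ==> smooth_at z (q b l m)" unfolding G_def[abs_def] q_def[abs_def]
 by(intro smooth_at_minus smooth_at_sum smooth_at_mult som smooth_at_wirtinger sO; assumption)+

lemma smooth_christoffel: assumes z: "z : V" shows "smooth_at z (christoffel \<Omega> B A C)"
proof - have c: "smooth_at z (christoffel \<Omega> B A C)" if "smooth_at z f" "!!w. w : V ==> f w = christoffel \<Omega> B A C w" for f
  by(rule smooth_at_cong[OF that(1)]) (use eventually_V[OF z] that(2) in \<open>auto elim: eventually_mono\<close>)
 consider (l) a i p where "B = Inl a" "A = Inl i" "C = Inl p" | (r) b l m where "B = Inr b" "A = Inr l" "C = Inr m"
  | (o) "!!w. w : V ==> christoffel \<Omega> B A C w = 0" by(cases B; cases A; cases C) (auto simp: christoffel_eq(3-6))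
 thus ?thesis
 proof cases
  case l show ?thesis by(rule c[OF smooth_G[OF z]]) (simp add: l christoffel_eq)
 next case r
  show ?thesis by(rule c[OF smooth_q[OF z]]) (simp add: r christoffel_eq)
 next case o
  show ?thesis by(rule c[OF smooth_at_const]) (simp add: o)
 qed
qed

section \<open>Covariant derivatives of jets in the frame\<close>

definition sm :: "'n local_section => bool" where "sm s \<longleftrightarrow> (ALL z:V. ALL m. fsmooth_at z (%w. s w m))"

lemma smD: "sm s ==> z : V ==> fsmooth_at z (%w. s w m)" by(simp add: sm_def)

lemma sm_yderiv: "sm s ==> sm (%z. yderiv A (s z))" unfolding sm_def yderiv_def by(intro ballI allI fsmooth_at_mult fsmooth_at_const) blast

lemma sm_ymult: assumes "sm s" shows "sm (%z. ymult A (s z))" unfolding sm_def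
proof(intro ballI allI)
 fix z m assume "z : V"
 thus "fsmooth_at z (%w. ymult A (s w) m)" using smD[OF assms] by(cases "m A = 0") (simp_all add: ymult_def fsmooth_at_const)
qed

lemma sm_sum: "(!!i. i : I ==> sm (s i)) ==> sm (%z m. SUM i:I. s i z m)" unfolding sm_def by(intro ballI allI fsmooth_at_sum) blast

lemma sm_add: "sm s ==> sm t ==> sm (%z m. s z m + t z m)" unfolding sm_def by(intro ballI allI fsmooth_at_add) blast+

lemma sm_scale: "(!!z. z : V ==> smooth_at z f) ==> sm s ==> sm (%z m. cst (f z) * s z m)"
 unfolding sm_def by(intro ballI allI fsmooth_at_mult fsmooth_at_fps_const) blast+

lemma sm_mscale: "sm s ==> sm (%z m. c m * s z m)" unfolding sm_def by(intro ballI allI fsmooth_at_mult fsmooth_at_const) blast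

lemma sm_dl: "(!!z B. z : V ==> smooth_at z (%w. v w B)) ==> sm s ==> sm (%z. dl (v z) (s z))"
 unfolding dl_def[abs_def] by(intro sm_sum sm_scale sm_yderiv) auto

lemma sm_nabla: assumes "sm s" shows "sm (nabla \<Omega> A s)"
proof - have a: "sm (%z m. SS B C. cst (christoffel \<Omega> B A C z) * ymult C (yderiv B (s z)) m)"
  by(intro sm_sum sm_scale sm_ymult sm_yderiv assms) (simp add: smooth_christoffel)
 show ?thesis unfolding sm_def nabla_def by(intro ballI allI fsmooth_at_diff fsmooth_at_fwirtinger smD[OF a] smD[OF assms])
qed

lemma sm_delta_inv: "(!!i. sm (T i)) ==> sm (delta_inv T)" unfolding delta_inv_def[abs_def] by(intro sm_sum sm_ymult sm_mscale)

lemma fwirtinger_dl: assumes z: "z : V" and v: "!!B. smooth_at z (%w. v w B)" and s: "sm s"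
 shows "fwd A (%w. dl (v w) (s w) m) z = dl (%B. wd A (%w. v w B) z) (s z) m + dl (v z) (%m. fwd A (%w. s w m) z) m"
proof - have y: "fsmooth_at z (%w. yderiv B (s w) m)" for B by(rule smD[OF sm_yderiv[OF s] z])
 have "fwd A (%w. yderiv B (s w) m) z = yderiv B (%m. fwd A (%w. s w m) z) m" for B
  unfolding yderiv_def by(rule fwirtinger_cscale[OF smD[OF s z]])
 thus ?thesis unfolding dl_def by(simp add: fwirtinger_sum fwirtinger_scale fsmooth_at_mult fsmooth_at_fps_const v y sum.distrib)
qed

text \<open>The Leibniz rule: the defect is the covariant derivative of the vector along which the
  fibre derivative is taken.\<close>

lemma nabla_dl: assumes z: "z : V" and v: "!!B. smooth_at z (%w. v w B)" and s: "sm s"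
 shows "nabla \<Omega> A (%w. dl (v w) (s w)) z m = dl (v z) (nabla \<Omega> A s z) m
  + dl (%E. wd A (%w. v w E) z + (SS C. christoffel \<Omega> E A C z * v z C)) (s z) m"
proof - let ?\<Gamma> = "%B C. cst (christoffel \<Omega> B A C z)"
 have "dl (%E. SS C. christoffel \<Omega> E A C z * v z C) (s z) m = (SS B C. ?\<Gamma> B C * (cst (v z C) * yderiv B (s z) m))"
  unfolding dl_def fps_const_sum sum_distrib_right by(simp add: mult.assoc flip: fps_const_mult)
 moreover have "dl (v z) (nabla \<Omega> A s z) m = dl (v z) (%m. fwd A (%w. s w m) z) m
  - (SS B C. ?\<Gamma> B C * (cst (v z C) * yderiv B (s z) m + ymult C (yderiv B (dl (v z) (s z))) m))"
  unfolding nabla_def[abs_def] dl_diff dl_sum dl_scale dl_ymult dl_yderiv ..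
 ultimately show ?thesis unfolding nabla_def[of \<Omega> A "%w. dl (v w) (s w)"] fwirtinger_dl[OF z v s] dl_vadd
  by(simp add: distrib_left sum.distrib)
qed

text \<open>The frame is parallel in the holomorphic directions, because the inverse form is
  parallel and its antiholomorphic index has no connection term there.\<close>

lemma kappa_hol: assumes z: "z : V"
 shows "wd (Inl k) (%w. fr (\<Omega> w) B E) z + (SS C. christoffel \<Omega> E (Inl k) C z * fr (\<Omega> z) B C) = 0"
 by(cases B; cases E) (simp_all add: sum_UNIV_sum christoffel_eq[OF z] d_omega_up_hol[OF z])

definition kp :: "'n => complex^'n => 'n + 'n => 'n + 'n => complex" where
 "kp l z B E = (case (B, E) of (Inl a, Inl j) => - q a l j z | (Inr m, Inr b) => q b l m z | _ => 0)"

text \<open>In the antiholomorphic directions the frame rotates by the symbols \<open>q\<close>,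
  with opposite signs on its two halves.\<close>

lemma kappa_anti: assumes z: "z : V"
 shows "wd (Inr l) (%w. fr (\<Omega> w) B E) z + (SS C. christoffel \<Omega> E (Inr l) C z * fr (\<Omega> z) B C)
  = (SS F. kp l z B F * fr (\<Omega> z) F E)"
proof(cases B; cases E)
 fix m b assume "B = Inr m" "E = Inr b" thus ?thesis
  by(simp add: sum_UNIV_sum christoffel_eq[OF z] kp_def if_distrib[of "%x. _ * x"] cong: if_cong) (simp add: eq_commute)?
qed (simp_all add: sum_UNIV_sum christoffel_eq[OF z] d_omega_up_anti[OF z] kp_def sum_negf)

definition hat :: "'n local_section => ('n + 'n) list => complex^'n => complex fps" where "hat s P z = hj (fr (\<Omega> z)) (s z) P"

lemma hat_Cons: "hat s (B # P) = hat (%w. dl (fr (\<Omega> w) B) (s w)) P" by(simp add: hat_def fun_eq_iff)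

lemma nabla_0: "nabla \<Omega> A s z (%_. 0) = fwd A (%w. s w (%_. 0)) z" by(simp add: nabla_def ymult_def)

lemma hat_nabla_hol: "sm s ==> z : V ==> hat (nabla \<Omega> (Inl k) s) P z = fwd (Inl k) (hat s P) z"
proof(induction P arbitrary: s)
 case Nil thus ?case by(simp add: hat_def nabla_0)
next case (Cons B P)
 have "dl (fr (\<Omega> z) B) (nabla \<Omega> (Inl k) s z) = nabla \<Omega> (Inl k) (%w. dl (fr (\<Omega> w) B) (s w)) z"
  by(rule ext) (simp add: nabla_dl[OF Cons.prems(2) sfr[OF Cons.prems(2)] Cons.prems(1)] kappa_hol[OF Cons.prems(2)] dl_vzero)
 hence "hat (nabla \<Omega> (Inl k) s) (B # P) z = hat (nabla \<Omega> (Inl k) (%w. dl (fr (\<Omega> w) B) (s w))) P z"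
  by(simp add: hat_def)
 also have "... = fwd (Inl k) (hat (%w. dl (fr (\<Omega> w) B) (s w)) P) z" by(intro Cons.IH sm_dl sfr Cons.prems)
 finally show ?case unfolding hat_Cons .
qed

text \<open>The connection matrix of the frame as a quadratic fibre element of degree one in each
  kind of variable. Having opposite signs on the two halves, it acts as a commutator.\<close>

definition H1 :: "'n => complex^'n => ('n + 'n) list => complex fps" where
 "H1 l z P = (case (lefts P, rights P) of ([a], [m]) => cst (- q a l m z) | _ => 0)"

text \<open>Each letter of the word is hit once by the connection matrix, so its action is a sum
  over single letters, that is a commutator with the quadratic element \<open>H1\<close>.\<close>

lemma hat_nabla_anti: "sm s ==> z : V ==> hat (nabla \<Omega> (Inr l) s) P z = fwd (Inr l) (hat s P) z
  + (SS j. zsum P (%A. H1 l z [Inl j, A]) (%N. hat s (Inr j # N) z) - zsum P (%A. H1 l z [Inr j, A]) (%N. hat s (Inl j # N) z))"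
proof(induction P arbitrary: s)
 case Nil thus ?case by(simp add: hat_def nabla_0)
next case (Cons B P)
 let ?s = "%w. dl (fr (\<Omega> w) B) (s w)"
 have "dl (fr (\<Omega> z) B) (nabla \<Omega> (Inr l) s z) = (%m. nabla \<Omega> (Inr l) ?s z m - (SS F. cst (kp l z B F) * dl (fr (\<Omega> z) F) (s z) m))"
  by(rule ext) (simp add: nabla_dl[OF Cons.prems(2) sfr[OF Cons.prems(2)] Cons.prems(1)] kappa_anti[OF Cons.prems(2)] dl_lin)
 hence e1: "hat (nabla \<Omega> (Inr l) s) (B # P) z = hat (nabla \<Omega> (Inr l) ?s) P z - (SS F. cst (kp l z B F) * hat s (F # P) z)"
  by(simp add: hat_def hj_diff hj_sum hj_scale)
 have e2: "hat (nabla \<Omega> (Inr l) ?s) P z = fwd (Inr l) (hat ?s P) z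
  + (SS j. zsum P (%A. H1 l z [Inl j, A]) (%N. hat ?s (Inr j # N) z) - zsum P (%A. H1 l z [Inr j, A]) (%N. hat ?s (Inl j # N) z))"
  by(intro Cons.IH sm_dl sfr Cons.prems)
 have e3: "hat ?s (A # N) z = hat s (A # B # N) z" for A N unfolding hat_Cons[symmetric] unfolding hat_def by(rule hj_perm) simp
 have e4: "(SS F. cst (kp l z B F) * hat s (F # P) z) =
  - (SS j. H1 l z [Inl j, B] * hat s (Inr j # P) z - H1 l z [Inr j, B] * hat s (Inl j # P) z)"
  by(cases B) (simp_all add: sum_UNIV_sum kp_def H1_def sum_negf flip: fps_const_neg)
 show ?case unfolding e1 e2 e3 e4 hat_Cons[of s B P, symmetric] zsum.simps by(simp add: sum.distrib sum_subtractf)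
qed

section \<open>Iterated frame derivatives and the series of the Fedosov connection\<close>

definition fXv :: "'n => (complex^'n => complex fps) => complex^'n => complex fps" where
 "fXv a F z = (SS i. cst (om z i a) * fwd (Inl i) F z)"

definition fXs :: "'n list => (complex^'n => complex fps) => complex^'n => complex fps" where "fXs K F = foldr fXv K F"

lemma fXs_simps [simp]: "fXs [] F = F" "fXs (a # K) F = fXv a (fXs K F)" by(simp_all add: fXs_def)

lemma fXv_cong: "near z (%w. F w = F' w) ==> fXv a F z = fXv a F' z" by(simp add: fXv_def fwirtinger_cong)

lemma fXv_smooth: "z : V ==> fsmooth_at z F ==> fsmooth_at z (fXv a F)"
 unfolding fXv_def[abs_def] by(intro fsmooth_at_sum fsmooth_at_mult fsmooth_at_fps_const som fsmooth_at_fwirtinger)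

lemma fXs_smooth: "z : V ==> fsmooth_at z F ==> fsmooth_at z (fXs K F)" by(induction K) (auto simp: fXv_smooth)

lemma fwirtinger_fXv: assumes z: "z : V" and F: "fsmooth_at z F"
 shows "fwd A (fXv b F) z = (SS p. cst (wd A (%w. om w p b) z) * fwd (Inl p) F z
  + cst (om z p b) * fwd A (fwd (Inl p) F) z)" unfolding fXv_def[abs_def]
 by(simp add: fwirtinger_sum fwirtinger_scale fsmooth_at_mult fsmooth_at_fps_const som[OF z] F fsmooth_at_fwirtinger)

text \<open>The second covariant derivative contracted with the inverse form; its symmetry makes the
  fields commute.\<close>

lemma fXv_fXv: assumes z: "z : V" and F: "fsmooth_at z F" shows "fXv a (fXv b F) z = (SS i p. cst (om z i a * om z p b) *
  (fwd (Inl i) (fwd (Inl p) F) z - (SS r. cst (G r i p z) * fwd (Inl r) F z)))"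
proof - have "(SS p. cst (wd (Inl i) (%w. om w p b) z) * fwd (Inl p) F z)
  = - (SS p. cst (om z p b) * (SS r. cst (G r i p z) * fwd (Inl r) F z))" for i
 proof - have "(SS r. cst (wd (Inl i) (%w. om w r b) z) * fwd (Inl r) F z)
   = - (SS r p. cst (om z p b) * (cst (G r i p z) * fwd (Inl r) F z))"
   unfolding d_omega_up_hol[OF z] fps_const_neg[symmetric] fps_const_sum fps_const_mult[symmetric] mult_minus_left sum_negf sum_distrib_right
   by(simp only: mult_ac)
  thus ?thesis by(subst (asm) sum.swap) (simp add: sum_distrib_left)
 qed
 thus ?thesis unfolding fXv_def[of a] fwirtinger_fXv[OF z F]
  by(simp add: sum.distrib sum_distrib_left sum_subtractf right_diff_distrib mult.assoc distrib_left flip: fps_const_mult)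
qed

lemma G_sym: "z : V ==> G r i p z = G r p i z" by(simp add: G_def closed1[of z p])

lemma fwirtinger_commute: "fsmooth_at z F ==> fwd A (fwd B F) z = fwd B (fwd A F) z"
 by(simp add: fwirtinger_fev fsmooth_at_fwirtinger fgerm_fwirtinger fD_commute)

lemma fXv_commute: assumes z: "z : V" and F: "fsmooth_at z F" shows "fXv a (fXv b F) z = fXv b (fXv a F) z" unfolding fXv_fXv[OF z F]
 by(subst sum.swap) (simp only: fwirtinger_commute[OF F, of "Inl _" "Inl _"] G_sym[OF z] mult.commute)

lemma fXs_perm: assumes F: "!!z. z : V ==> fsmooth_at z F" shows "mset K = mset L ==> z : V ==> fXs K F z = fXs L F z"
proof(induction K arbitrary: L z)
 case (Cons a K) obtain L1 L2 where L: "L = L1 @ a # L2" by(metis Cons.prems(1) list.set_intros(1) mset_eq_setD split_list)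
 have "mset K = mset (L1 @ L2)" using Cons.prems L by simp
 hence "near z (%w. fXs K F w = fXs (L1 @ L2) F w)" using eventually_V[OF Cons.prems(2)] Cons.IH by(auto elim: eventually_mono)
 hence "fXs (a # K) F z = fXs (a # L1 @ L2) F z" by(simp add: fXv_cong)
 moreover have "z : V ==> fXs (L1 @ a # L2) F z = fXs (a # L1 @ L2) F z" for z
 proof(induction L1 arbitrary: z)
  case (Cons b L1) have "fXs (b # L1 @ a # L2) F z = fXv b (fXs (a # L1 @ L2) F) z"
   unfolding fXs_simps(2)[of b] by(rule fXv_cong) (use eventually_V[OF Cons.prems] Cons.IH in \<open>auto elim: eventually_mono\<close>)
  thus ?case using fXv_commute[OF Cons.prems fXs_smooth[OF Cons.prems F[OF Cons.prems]], of a b] by simp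
 qed simp
 ultimately show ?case using Cons.prems(2) L by simp
qed simp

lemma hat_delta_inv: "hat (delta_inv T) P z = (SS k. zsum P (%A. cst (fr (\<Omega> z) A (Inl k)))
  (%Q. cst (1 / of_nat (1 + length (lefts Q))) * hat (T k) Q z))"
proof - have "hj (fr (\<Omega> z)) (%p. cst (1 / of_nat (1 + ydeg p)) * T k z p)
  = (%Q. cst (1 / of_nat (1 + length (lefts Q))) * hat (T k) Q z)" for k
  unfolding hat_def hj_scale[symmetric] by(rule ext, rule hj_cong_ydeg) simp_all
 moreover have "delta_inv T z = (%m. SS k. ymult (Inl k) (%p. cst (1 / of_nat (1 + ydeg p)) * T k z p) m)" by(rule ext) (rule delta_inv_def)
 ultimately show ?thesis unfolding hat_def[of "delta_inv T"] by(simp only: hj_sum hj_ymult)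
qed

text \<open>A section homogeneous of degree r in the holomorphic variables alone, whose jets in the
  frame are the r-fold derivatives of one function.\<close>

definition tower :: "(complex^'n => complex fps) => nat => 'n local_section => bool" where
 "tower h r s \<longleftrightarrow> sm s & (ALL P. ALL z:V. hat s P z = (if rights P = [] & length P = r then fXs (lefts P) h z else 0))"

lemma length_lefts_rights: "length (lefts P) + length (rights P) = length P" by(induction P) (auto split: sum.split)

text \<open>In a frame parallel in holomorphic directions the operator of the recursion just
  prolongs the jets by one derivative.\<close>

lemma tower_Suc: assumes h: "!!z. z : V ==> fsmooth_at z h" and s: "tower h r s"
 shows "tower h (Suc r) (delta_inv (%i. nabla \<Omega> (Inl i) s))" unfolding tower_def
proof(intro conjI allI ballI)
 have sm: "sm s" using s by(simp add: tower_def)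
 show "sm (delta_inv (%i. nabla \<Omega> (Inl i) s))" by(intro sm_delta_inv sm_nabla sm)
 fix P :: "('n + 'n) list" and z assume z: "z : V" define v where "v = (if rights P = [] & length P = Suc r then fXs (lefts P) h z else 0)"
 have hs: "fwd A (hat s Q) z = (if rights Q = [] & length Q = r then fwd A (fXs (lefts Q) h) z else 0)" for A Q
 proof - have "fwd A (hat s Q) z = fwd A (%w. if rights Q = [] & length Q = r then fXs (lefts Q) h w else 0) z"
   by(rule fwirtinger_cong) (use eventually_V[OF z] s in \<open>auto simp: tower_def elim: eventually_mono\<close>)
  thus ?thesis by(auto simp: fwirtinger_const)
 qed
 \<comment> \<open>All ways of removing a letter contribute equally, and their number cancels the
   weight of the homotopy operator.\<close>
 have "hat (delta_inv (%i. nabla \<Omega> (Inl i) s)) P z = of_nat (length P) * (cst (1 / of_nat (length P)) * v)"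
  unfolding hat_delta_inv hat_nabla_hol[OF sm z]
 proof(rule zsum_const)
  fix A Q assume AQ: "mset (A # Q) = mset P"
  have r: "mset (rights (A # Q)) = mset (rights P)" and l: "mset (lefts (A # Q)) = mset (lefts P)"
   using mset_rights[OF AQ] mset_lefts[OF AQ] .
  have len: "length P = Suc (length Q)" using mset_eq_length[OF AQ] by simp
  show "(SS k. cst (fr (\<Omega> z) A (Inl k)) * (cst (1 / of_nat (1 + length (lefts Q))) * fwd (Inl k) (hat s Q) z))
   = cst (1 / of_nat (length P)) * v"
  proof(cases A)
   case (Inr b) hence "rights P ~= []" using r by auto thus ?thesis by(simp add: Inr v_def)
  next case (Inl a)
   hence rQ: "rights Q = [] \<longleftrightarrow> rights P = []" using r by auto
   show ?thesis
   proof(cases "rights P = [] & length P = Suc r")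
    case True hence "length (lefts Q) = r" "length Q = r" using rQ len length_lefts_rights[of Q] by auto
    moreover have "fXs (lefts P) h z = fXv a (fXs (lefts Q) h) z" using fXs_perm[OF h l[symmetric] z] Inl by simp
    ultimately show ?thesis using True rQ by(simp add: hs v_def Inl fXv_def sum_distrib_left mult.left_commute)
   next case False
    thus ?thesis using rQ len by(auto simp: hs v_def)
   qed
  qed
 qed
 also have "... = v"
 proof(cases "length P = 0")
  case False hence "of_nat (length P) * cst (1 / of_nat (length P)) = (1 :: complex fps)"
   unfolding fps_of_nat[symmetric] fps_const_mult by simp
  thus ?thesis by(simp only: mult.assoc[symmetric] mult_1)
 qed (simp add: v_def)
 finally show "hat (delta_inv (%i. nabla \<Omega> (Inl i) s)) P z = (if rights P = [] & length P = Suc r then fXs (lefts P) h z else 0)"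
  by(simp add: v_def)
qed

lemma tower_0: assumes h: "!!z. z : V ==> fsmooth_at z h" shows "tower h 0 (%w. yconst (h w))"
proof - have "fsmooth_at z (%w. yconst (h w) m)" if "z : V" for z m
  using h[OF that] by(cases "m = (%_. 0)") (simp_all add: yconst_def fsmooth_at_const)
 thus ?thesis by(auto simp: tower_def sm_def hat_def hj_yconst)
qed

text \<open>The series is a sum of towers over the conjugate derivative of the potential, one for
  each positive degree.\<close>

lemma hat_J_pot: assumes g: "!!z. z : V ==> fsmooth_at z g" and z: "z : V"
 shows "hat (J_pot \<Omega> g l) P z = (if lefts P ~= [] & rights P = [] then fXs (lefts P) (fwd (Inr l) g) z else 0)"
proof - let ?h = "fwd (Inr l) g"
 let ?it = "%k. ((%s. delta_inv (%i. nabla \<Omega> (Inl i) s)) ^^ k) (%w. yconst (?h w))"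
 have h: "!!z. z : V ==> fsmooth_at z ?h" by(intro fsmooth_at_fwirtinger g)
 have t: "tower ?h k (?it k)" for k
 proof(induction k)
  case (Suc k) show ?case using tower_Suc[OF h Suc] by simp
 qed (simp add: tower_0[OF h])
 let ?r = "length (lefts P)" have "hat (J_pot \<Omega> g l) P z = hj (fr (\<Omega> z)) (%m. SUM k=1..?r. ?it k z m) P"
  unfolding hat_def by(rule hj_cong_ydeg) (simp_all add: J_pot_def)
 also have "... = (SUM k=1..?r. hat (?it k) P z)" by(simp add: hj_sum hat_def)
 also have "... = (SUM k=1..?r. if k = length P & rights P = [] then fXs (lefts P) ?h z else 0)"
  using t z by(intro sum.cong refl) (auto simp: tower_def)
 also have "... = (if lefts P ~= [] & rights P = [] then fXs (lefts P) ?h z else 0)"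
 proof(cases "rights P = []")
  case True hence "length P = ?r" using length_lefts_rights[of P] by simp
  thus ?thesis using True by(cases "lefts P") (simp_all add: sum.delta)
 qed simp
 finally show ?thesis .
qed

lemma nabla_yvar: assumes z: "z : V" shows "nabla \<Omega> (Inr l) (%_. yvar (Inl j)) z m = 0"
  and "nabla \<Omega> (Inl i) (%_. yvar (Inl j)) z m = - (SS p. cst (G j i p z) * yvar (Inl p) m)"
proof - have y: "yderiv B (yvar (Inl j)) = (if B = Inl j then yconst 1 else (%_. 0))" for B :: "'n + 'n"
  using dl_yvar[of "%C. if B = C then 1 else 0" "Inl j"] by(auto simp: dl_single yconst_def fun_eq_iff)
 have e: "(SS B C. cst (christoffel \<Omega> B A C z) * ymult C (yderiv B (yvar (Inl j))) m)
  = (SS C. cst (christoffel \<Omega> (Inl j) A C z) * yvar C m)" for A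
 proof - have "(SS B C. cst (christoffel \<Omega> B A C z) * ymult C (yderiv B (yvar (Inl j))) m)
   = (SUM B:(UNIV :: ('n + 'n) set). if B = Inl j then SS C. cst (christoffel \<Omega> (Inl j) A C z) * yvar C m else 0)"
   unfolding y by(rule sum.cong[OF refl]) (auto simp: yvar_def ymult_def)
  thus ?thesis by simp
 qed
 show "nabla \<Omega> (Inr l) (%_. yvar (Inl j)) z m = 0"
  "nabla \<Omega> (Inl i) (%_. yvar (Inl j)) z m = - (SS p. cst (G j i p z) * yvar (Inl p) m)"
  unfolding nabla_def e by(simp_all add: fwirtinger_const sum_UNIV_sum christoffel_eq[OF z])
qed

text \<open>The conjugate derivatives annihilate the holomorphic fibre coordinates, so only the
  derivative of the Christoffel symbols survives in the commutator.\<close>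

lemma curv_eq: assumes z: "z : V" shows "curv \<Omega> i l k j z = wd (Inr l) (G j i k) z"
proof - let ?\<delta> = "(%_. 0)(Inl k := 1 :: nat) :: 'n + 'n => nat"
 have y: "yvar (Inl p) ?\<delta> = (if p = k then 1 else 0)" for p :: 'n by(auto simp: yvar_def ymult_def yconst_def fun_eq_iff)
 let ?s = "nabla \<Omega> (Inr l) (%_. yvar (Inl j))" have "nabla \<Omega> (Inl i) ?s z ?\<delta> = 0"
 proof - have "fwd (Inl i) (%w. ?s w m) z = fwd (Inl i) (%w. 0) z" for m
   by(rule fwirtinger_cong) (use eventually_V[OF z] nabla_yvar(1) in \<open>auto elim: eventually_mono\<close>)
  moreover have "?s z = (%_. 0)" using nabla_yvar(1)[OF z] by auto
  ultimately show ?thesis by(simp add: nabla_def[of \<Omega> "Inl i" ?s] fwirtinger_const yderiv_zero ymult_def)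
 qed
 moreover have "nabla \<Omega> (Inr l) (nabla \<Omega> (Inl i) (%_. yvar (Inl j))) z ?\<delta> = - cst (wd (Inr l) (G j i k) z)"
 proof - let ?t = "nabla \<Omega> (Inl i) (%_. yvar (Inl j))"
  have "fwd (Inr l) (%w. ?t w ?\<delta>) z = fwd (Inr l) (%w. cst (- G j i k w)) z"
  proof(rule fwirtinger_cong)
   show "near z (%w. ?t w ?\<delta> = cst (- G j i k w))" using eventually_V[OF z]
    by eventually_elim (simp only: nabla_yvar(2) y, simp add: if_distrib[of "%x. _ * x"] cong: if_cong)
  qed
  moreover have "yderiv (Inr b) (?t z) = (%_. 0)" for b
  proof - have "?t z = (%m. - (SS p. cst (G j i p z) * yvar (Inl p) m))" by(rule ext) (rule nabla_yvar(2)[OF z])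
   moreover have "yvar (Inl p) (m(Inr b := m (Inr b) + 1)) = 0" for p m
    by(auto simp: yvar_def ymult_def yconst_def fun_eq_iff split: if_splits intro!: exI[of _ "Inr b"])
   ultimately show ?thesis unfolding yderiv_def by(simp del: fun_upd_apply)
  qed
  moreover have "(SS B C. cst (christoffel \<Omega> B (Inr l) C z) * ymult C (yderiv B (?t z)) ?\<delta>) = 0"
   using calculation(2) by(simp add: sum_UNIV_sum christoffel_eq[OF z] ymult_def)
  ultimately show ?thesis unfolding nabla_def[of \<Omega> "Inr l" ?t]
   by(simp only: fwirtinger_fps_const wirtinger_uminus[OF smooth_at_differentiable[OF smooth_G[OF z]]]) simp
 qed
 ultimately show ?thesis by(simp add: curv_def del: fun_upd_apply)
qed

lemma Om_G: "z : V ==> (SS j. \<Omega> z $ j $ k * G j i p z) = dO (Inl i) p k z"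
proof - assume z: "z : V"
 have "(SS j. \<Omega> z $ j $ k * G j i p z) = - (SS r. (SS j. om z j r * \<Omega> z $ j $ k) * dO (Inl i) p r z)"
  unfolding G_def sum_distrib_right by(subst sum.swap) (simp add: sum_negf sum_distrib_left mult_ac)
 also have "... = dO (Inl i) p k z" by(simp add: omega_up_left[OF inv_Om[OF z]] if_distrib[of "%x. x * _"] cong: if_cong)
 finally show ?thesis .
qed

lemma smooth_curv: assumes z: "z : V" shows "smooth_at z (curv \<Omega> i l k j)"
 by(rule smooth_at_cong[OF smooth_at_wirtinger[OF smooth_G[OF z]]])
  (use eventually_V[OF z] curv_eq in \<open>auto elim: eventually_mono\<close>)

lemma sm_Rst: "sm (Rst \<Omega> r l j)"
proof(induction r arbitrary: j)
 case 0 have "sm (%z. ymult (Inl i) (yvar (Inl k)))" for i k :: 'n by(simp add: sm_def fsmooth_at_const)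
 moreover have "smooth_at z (%z. curv \<Omega> i l k j z / 2)" if "z : V" for z i k
  using smooth_at_mult[OF smooth_curv[OF that] smooth_at_const[of _ "1/2"]] by simp
 ultimately show ?case unfolding Rst.simps by(intro sm_sum sm_scale)
next case (Suc r)
 show ?case unfolding Rst.simps by(intro sm_delta_inv sm_add sm_nabla sm_sum sm_scale Suc) (rule smooth_christoffel)
qed

text \<open>The vector index is lowered with the Kaehler form, which turns the sections with values
  in vector fields into scalar ones.\<close>

definition Qr :: "nat => 'n => 'n => 'n local_section" where "Qr r l k z m = (SS j. cst (\<Omega> z $ j $ k) * Rst \<Omega> r l j z m)"

lemma sm_Qr: "sm (Qr r l k)" unfolding Qr_def[abs_def] by(intro sm_sum sm_scale sm_Rst sO)

text \<open>The Kaehler form is parallel, so lowering the index commutes with the covariant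
  derivative.\<close>

lemma nabla_Qr: assumes z: "z : V" shows "nabla \<Omega> (Inl i) (Qr r l k) z m = (SS j. cst (\<Omega> z $ j $ k) *
  (nabla \<Omega> (Inl i) (Rst \<Omega> r l j) z m + (SS p. cst (G j i p z) * Rst \<Omega> r l p z m)))"
proof -
 have ys: "ymult C (yderiv B (Qr r l k z)) m = (SS j. cst (\<Omega> z $ j $ k) * ymult C (yderiv B (Rst \<Omega> r l j z)) m)" for B C
  unfolding Qr_def[abs_def] yderiv_sum yderiv_scale by(simp add: ymult_def)
 have "(SS j. cst (dO (Inl i) j k z) * Rst \<Omega> r l j z m) =
  (SS p j. cst (\<Omega> z $ j $ k) * (cst (G j i p z) * Rst \<Omega> r l p z m))"
  unfolding Om_G[OF z, symmetric] fps_const_sum sum_distrib_right by(simp only: fps_const_mult[symmetric] mult.assoc)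
 also have "... = (SS j. cst (\<Omega> z $ j $ k) * (SS p. cst (G j i p z) * Rst \<Omega> r l p z m))"
  by(subst sum.swap) (simp only: sum_distrib_left)
 finally have 1: "(SS j. cst (dO (Inl i) j k z) * Rst \<Omega> r l j z m) = ..." .
 have 2: "fwd (Inl i) (%w. Qr r l k w m) z = (SS j. cst (dO (Inl i) j k z) * Rst \<Omega> r l j z m
  + cst (\<Omega> z $ j $ k) * fwd (Inl i) (%w. Rst \<Omega> r l j w m) z)" unfolding Qr_def
  by(simp add: fwirtinger_sum fwirtinger_scale fsmooth_at_mult fsmooth_at_fps_const sO[OF z] smD[OF sm_Rst z])
 have 3: "(SS B C. cst (christoffel \<Omega> B (Inl i) C z) * ymult C (yderiv B (Qr r l k z)) m)
  = (SS j. cst (\<Omega> z $ j $ k) * (SS B C. cst (christoffel \<Omega> B (Inl i) C z) * ymult C (yderiv B (Rst \<Omega> r l j z)) m))"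
 proof - have "(SS B C. cst (christoffel \<Omega> B (Inl i) C z) * ymult C (yderiv B (Qr r l k z)) m)
   = (SS B j C. cst (\<Omega> z $ j $ k) * (cst (christoffel \<Omega> B (Inl i) C z) * ymult C (yderiv B (Rst \<Omega> r l j z)) m))"
   unfolding ys sum_distrib_left by(subst sum.swap) (simp only: mult.left_commute)
  thus ?thesis by(subst (asm) sum.swap) (simp only: sum_distrib_left)
 qed
 show ?thesis unfolding nabla_def[of \<Omega> "Inl i" "Qr r l k"] 2 3 sum.distrib 1 nabla_def[of \<Omega> "Inl i" "Rst \<Omega> r l _"]
  by(simp add: distrib_left right_diff_distrib sum.distrib sum_subtractf)
qed

lemma ymult_sum: "ymult A (%m. SUM i:I. c i * a i m) m = (SUM i:I. c i * ymult A (a i) m)" by(simp add: ymult_def)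

lemma hat_cong: "(!!m. s z m = t z m) ==> hat s P z = hat t P z" unfolding hat_def by(rule arg_cong[of _ _ "%a. hj _ a P"]) (rule ext)

lemma Qr_Suc: assumes z: "z : V" shows "Qr (Suc r) l k z m = delta_inv (%i. nabla \<Omega> (Inl i) (Qr r l k)) z m"
proof - have "delta_inv (%i. nabla \<Omega> (Inl i) (Qr r l k)) z m = (SS i j. cst (\<Omega> z $ j $ k) *
  ymult (Inl i) (%p. cst (1 / of_nat (1 + ydeg p)) * (nabla \<Omega> (Inl i) (Rst \<Omega> r l j) z p + (SS q. cst (G j i q z) * Rst \<Omega> r l q z p))) m)"
  unfolding delta_inv_def nabla_Qr[OF z] sum_distrib_left mult.left_commute[of "cst (1 / _)" "cst (\<Omega> z $ _ $ k)"] ymult_sum ..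
 also have "... = (SS j. cst (\<Omega> z $ j $ k) * Rst \<Omega> (Suc r) l j z m)"
  by(subst sum.swap) (simp add: delta_inv_def sum_distrib_left[symmetric] christoffel_eq[OF z])
 finally show ?thesis by(simp add: Qr_def)
qed

text \<open>In the application \<open>h k\<close> is minus the derivative in direction \<open>Inr l\<close> of a local function
 whose derivative in direction \<open>Inl p\<close> is \<open>- \<Omega> p k\<close>.\<close>

lemma tower_Qr: assumes h: "!!z. z : V ==> smooth_at z h" and dh: "!!z p. z : V ==> wd (Inl p) h z = dO (Inr l) p k z"
 shows "tower (%w. cst (h w)) (r + 2) (Qr r l k)"
proof(induction r)
 case 0 show ?case unfolding tower_def
 proof(intro conjI allI ballI sm_Qr)
  fix P :: "('n + 'n) list" and z assume z: "z : V"
  have fh: "fsmooth_at w (%w. cst (h w))" if "w : V" for w by(rule fsmooth_at_fps_const[OF h[OF that]])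
  let ?R = "%i p. wd (Inr l) (dO (Inl i) p k) z - (SS j. G j i p z * dO (Inr l) j k z)"
  \<comment> \<open>Differentiating \<open>Om_G\<close> shows that the curvature with its index
    lowered is the second covariant derivative of \<open>h\<close>.\<close>
  have R: "(SS j. \<Omega> z $ j $ k * curv \<Omega> i l p j z) = ?R i p" for i p
  proof - have "wd (Inr l) (dO (Inl i) p k) z = wd (Inr l) (%w. SS j. \<Omega> w $ j $ k * G j i p w) z"
    by(rule wirtinger_cong[OF open_V z]) (simp add: Om_G)
   also have "... = (SS j. dO (Inr l) j k z * G j i p z + \<Omega> z $ j $ k * wd (Inr l) (G j i p) z)"
    using smooth_at_differentiable[OF smooth_G[OF z]] smooth_at_differentiable[OF sO[OF z]]
    by(simp add: wirtinger_sum wirtinger_mult differentiable_mult)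
   finally show ?thesis by(simp add: curv_eq[OF z] sum.distrib mult.commute)
  qed
  have X2: "fXv a (fXv b (%w. cst (h w))) z = cst (SS i p. om z i a * om z p b * ?R i p)" for a b
  proof - have "fwd (Inl i) (fwd (Inl p) (%w. cst (h w))) z = cst (wd (Inr l) (dO (Inl i) p k) z)" for i p
   proof - have "fwd (Inl i) (fwd (Inl p) (%w. cst (h w))) z = fwd (Inl i) (%w. cst (dO (Inr l) p k w)) z"
     by(rule fwirtinger_cong) (use eventually_V[OF z] in \<open>auto simp: fwirtinger_fps_const dh elim: eventually_mono\<close>)
    also have "wd (Inl i) (dO (Inr l) p k) z = wd (Inr l) (dO (Inl i) p k) z" by(rule wirtinger_commute[OF open_V smooth_on_Om z])
    hence "fwd (Inl i) (%w. cst (dO (Inr l) p k w)) z = cst (wd (Inr l) (dO (Inl i) p k) z)" by(simp add: fwirtinger_fps_const)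
    finally show ?thesis .
   qed
   thus ?thesis unfolding fXv_fXv[OF z fh[OF z]] by(simp add: fwirtinger_fps_const dh[OF z] flip: fps_const_sum)
  qed
  have Qe: "Qr 0 l k z m = (SS i p. cst (?R i p / 2) * ymult (Inl i) (yvar (Inl p)) m)" for m
  proof - have "Qr 0 l k z m = (SS j i p. cst (\<Omega> z $ j $ k * curv \<Omega> i l p j z / 2) * ymult (Inl i) (yvar (Inl p)) m)"
    unfolding Qr_def Rst.simps sum_distrib_left mult.assoc[symmetric] fps_const_mult by simp
   also have "... = (SS i p j. cst (\<Omega> z $ j $ k * curv \<Omega> i l p j z / 2) * ymult (Inl i) (yvar (Inl p)) m)"
    by(subst sum.swap) (rule sum.cong[OF refl], rule sum.swap)
   also have "... = (SS i p. cst (?R i p / 2) * ymult (Inl i) (yvar (Inl p)) m)"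
    unfolding sum_distrib_right[symmetric] fps_const_sum[symmetric] sum_divide_distrib[symmetric] R ..
   finally show ?thesis .
  qed
  have Rsym: "?R i p = ?R p i" for i p
  proof - have "wd (Inr l) (dO (Inl i) p k) z = wd (Inr l) (dO (Inl p) i k) z" by(rule wirtinger_cong[OF open_V z]) (rule closed1)
   thus ?thesis by(simp add: G_sym[OF z, of _ i p])
  qed
  let ?f = "%A i. cst (fr (\<Omega> z) A (Inl i))"
  have "hat (Qr 0 l k) P z = (SS i p. cst (?R i p / 2) * zsum P (%A. ?f A i) (hj (fr (\<Omega> z)) (yvar (Inl p))))"
  proof - have "Qr 0 l k z = (%m. SS i p. cst (?R i p / 2) * ymult (Inl i) (yvar (Inl p)) m)" by(rule ext) (rule Qe)
   thus ?thesis by(simp only: hat_def hj_sum hj_scale hj_ymult)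
  qed
  also have "... = (if rights P = [] & length P = 0 + 2 then fXs (lefts P) (%w. cst (h w)) z else 0)"
  proof(cases "length P = 2")
   case True then obtain A B where P: "P = [A, B]" by(metis (no_types, lifting) One_nat_def Suc_1 length_0_conv length_Suc_conv)
   have zs: "zsum P (%A. ?f A i) (hj (fr (\<Omega> z)) (yvar (Inl p))) = ?f B i * ?f A p + ?f A i * ?f B p" for i p
    by(simp add: P hj_yvar del: hj.simps)
   show ?thesis
   proof(cases "rights P = []")
    case False hence "isl A --> ~ isl B" using P by(cases A; cases B) auto
    hence "?f B i * ?f A p = 0" "?f A i * ?f B p = 0" for i p by(cases A; cases B; simp)+
    thus ?thesis using False unfolding zs by(simp only: simp_thms if_False add_0 mult_zero_right sum.neutral_const)
   next case rP: True
    then obtain a b where ab: "A = Inl a" "B = Inl b" using P by(cases A; cases B) auto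
    \<comment> \<open>The two ways of distributing the letters agree by the symmetry of the second
      covariant derivative; this consumes the factor 1/2 in the quadratic term.\<close>
    define s where "s a b = (SS i p. om z i a * om z p b * ?R i p)" for a b
    have "s b a = (SS p i. om z i b * om z p a * ?R i p)" unfolding s_def by(rule sum.swap)
    also have "... = s a b" unfolding s_def by(intro sum.cong refl) (simp only: Rsym mult.commute)
    finally have ss: "s b a = s a b" .
    have "(SS i p. cst (?R i p / 2) * zsum P (%A. ?f A i) (hj (fr (\<Omega> z)) (yvar (Inl p))))
     = cst (SS i p. ?R i p / 2 * (om z i b * om z p a + om z i a * om z p b))"
     unfolding zs ab fr_simps fps_const_mult fps_const_add fps_const_sum ..
    also have "(SS i p. ?R i p / 2 * (om z i b * om z p a + om z i a * om z p b)) = s b a / 2 + s a b / 2"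
    proof - have "x / 2 * (u + v) = u * x / 2 + v * x / 2" for x u v :: complex by(simp add: algebra_simps)
     thus ?thesis unfolding s_def sum_divide_distrib sum.distrib[symmetric] by(intro sum.cong refl)
    qed
    also have "... = s a b" using ss by simp
    finally show ?thesis using rP by(simp add: P ab X2 s_def)
   qed
  next case False
   have "zsum P (%A. ?f A i) (hj (fr (\<Omega> z)) (yvar (Inl p))) = 0" for i p
   proof(rule zsum_zero)
    fix A N assume "mset (A # N) = mset P" hence "length N ~= 1" using False mset_eq_length by fastforce
    thus "?f A i * hj (fr (\<Omega> z)) (yvar (Inl p)) N = 0" by(cases N rule: remdups_adj.cases) (simp_all add: hj_yvar del: hj.simps)
   qed
   thus ?thesis using False by simp
  qed
  finally show "hat (Qr 0 l k) P z = (if rights P = [] & length P = 0 + 2 then fXs (lefts P) (%w. cst (h w)) z else 0)" .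
 qed
next case (Suc r)
 have fh: "fsmooth_at w (%w. cst (h w))" if "w : V" for w by(rule fsmooth_at_fps_const[OF h[OF that]])
 have "tower (%w. cst (h w)) (Suc (r + 2)) (delta_inv (%i. nabla \<Omega> (Inl i) (Qr r l k)))" by(rule tower_Suc[OF fh Suc])
 moreover have "hat (Qr (Suc r) l k) P z = hat (delta_inv (%i. nabla \<Omega> (Inl i) (Qr r l k))) P z" if "z : V" for P z
  by(rule hat_cong) (rule Qr_Suc[OF that])
 ultimately show ?case unfolding tower_def using sm_Qr by simp
qed

text \<open>The factor in the conjugate variables takes up exactly one antiholomorphic letter, and
  the rest of the jet is that of a tower.\<close>

lemma hat_I_curv: assumes h: "!!z k. z : V ==> smooth_at z (h k)" and dh: "!!z p k. z : V ==> wd (Inl p) (h k) z = dO (Inr l) p k z"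
  and z: "z : V" shows "hat (I_curv \<Omega> l) P z = (if 2 <= length (lefts P) then
  (case rights P of [k] => fXs (lefts P) (%w. cst (h k w)) z | _ => 0) else 0)"
proof - have t: "tower (%w. cst (h k w)) (n - 2 + 2) (Qr (n - 2) l k)" for k n by(rule tower_Qr[OF h dh])
 let ?r = "length (lefts P)" let ?P = "map Inr (rights P) @ map Inl (lefts P)"
 have mP: "mset P = mset ?P" using mset_split_lists[of P] by simp
 have "I_curv \<Omega> l z m = (SUM n=2..ydeg m. SS k. ymult (Inr k) (Qr (n - 2) l k z) m)" for m
  unfolding I_curv_def Qr_def[abs_def] ymult_sum by(rule sum.cong[OF refl], rule sum.swap)
 hence "hat (I_curv \<Omega> l) P z = hj (fr (\<Omega> z)) (%m. SUM n=2..?r. SS k. ymult (Inr k) (Qr (n - 2) l k z) m) P"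
  unfolding hat_def by(intro hj_cong_ydeg) simp_all
 also have "... = hj (fr (\<Omega> z)) (%m. SUM n=2..?r. SS k. ymult (Inr k) (Qr (n - 2) l k z) m) ?P" by(rule hj_perm[OF mP])
 also have "... = (SUM n=2..?r. SS k. zsum ?P (%A. cst (fr (\<Omega> z) A (Inr k))) (%Q. hat (Qr (n - 2) l k) Q z))"
  unfolding hj_sum hj_ymult hat_def ..
 also have "... = (SUM n=2..?r. if n = ?r then (case rights P of [k] => fXs (lefts P) (%w. cst (h k w)) z | _ => 0) else 0)"
 proof(rule sum.cong[OF refl])
  fix n assume n: "n : {2..?r}"
  have hQ: "hat (Qr (n - 2) l k) Q z = (if rights Q = [] & length Q = n then fXs (lefts Q) (%w. cst (h k w)) z else 0)" for k Q
  proof - have "2 <= n" using n by simp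
   hence "n - 2 + 2 = n" by linarith
   hence "tower (%w. cst (h k w)) n (Qr (n - 2) l k)" using t[of k n] by simp
   thus ?thesis using z by(simp add: tower_def)
  qed
  \<comment> \<open>A conjugate fibre variable is invisible to holomorphic letters.\<close>
  have z0: "zsum (map Inl K) (%A. cst (fr (\<Omega> z) A (Inr k))) t = 0" for K k t by(induction K arbitrary: t) simp_all
  show "(SS k. zsum ?P (%A. cst (fr (\<Omega> z) A (Inr k))) (%Q. hat (Qr (n - 2) l k) Q z))
   = (if n = ?r then (case rights P of [k] => fXs (lefts P) (%w. cst (h k w)) z | _ => 0) else 0)"
  proof(cases "rights P" rule: remdups_adj.cases)
   case 1 thus ?thesis by(simp add: z0)
  next case (2 m)
   thus ?thesis by(simp add: z0 hQ if_distrib[of cst] if_distrib[of "%x. x * _"] cong: if_cong)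
  next case (3 m m' M)
   have "zsum ?P (%A. cst (fr (\<Omega> z) A (Inr k))) (%Q. hat (Qr (n - 2) l k) Q z) = 0" for k
   proof(rule zsum_zero)
    fix A Q assume "mset (A # Q) = mset ?P" from mset_eq_length[OF mset_rights[OF this]] have "rights Q ~= []" by(cases A) (auto simp: 3)
    thus "cst (fr (\<Omega> z) A (Inr k)) * hat (Qr (n - 2) l k) Q z = 0" by(simp add: hQ)
   qed
   thus ?thesis by(simp add: 3)
  qed
 qed
 also have "... = (if 2 <= ?r then (case rights P of [k] => fXs (lefts P) (%w. cst (h k w)) z | _ => 0) else 0)" by simp
 finally show ?thesis .
qed

end

section \<open>The Wick product of jets\<close>

definition jsym :: "('i list => 'r) => bool" where "jsym a \<longleftrightarrow> (ALL P Q. mset P = mset Q --> a P = a Q)"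

lemma jsymD: "jsym a ==> mset P = mset Q ==> a P = a Q" unfolding jsym_def by blast

lemma jsym_Cons: "jsym a ==> jsym (%Q. a (A # Q))" by(simp add: jsym_def)

text \<open>Symmetry of the families is used to move the new letter past the contracted
  ones.\<close>

lemma jwt_Cons: assumes "jsym a" "jsym b" shows "jwt k (A # P) a b = jwt k P (%Q. a (A # Q)) b + jwt k P a (%Q. b (A # Q))" using assms
proof(induction k arbitrary: a b)
 case (Suc k) have "a (Inl j # A # Q) = a (A # Inl j # Q)" "b (Inr j # A # Q) = b (A # Inr j # Q)" for j Q
  by(rule jsymD[OF Suc.prems(1)], simp) (rule jsymD[OF Suc.prems(2)], simp)
 thus ?case by(simp add: Suc.IH[OF jsym_Cons[OF Suc.prems(1)] jsym_Cons[OF Suc.prems(2)]] sum.distrib)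
qed simp

lemma jwt_add1: "jwt k P (%Q. a Q + a' Q) b = jwt k P a b + jwt k P a' b"
 and jwt_add2: "jwt k P b (%Q. a Q + a' Q) = jwt k P b a + jwt k P b a'"
 by(induction k arbitrary: a a' b) (simp_all add: jprod_add1 jprod_add2 sum.distrib)

lemma jwt_lists: "jwt k P a b = (SUM J:words k. jprod P (%Q. a (map Inl J @ Q)) (%Q. b (map Inr J @ Q)))"
 by(induction k arbitrary: a b) (simp_all add: sum_lists_Suc lists_length_0[simplified])

lemma jprod_map: "jprod (map f M) a b = jprod M (%N. a (map f N)) (%N. b (map f N))" by(induction M arbitrary: a b) simp_all

lemma jwick_nth: "jwick P a b $ n = (SUM k<=n. (1 / fact k) *R (jwt k P a b $ (n - k)))" by(simp add: jwick_def)

lemma jwick_add1: "jwick P (%Q. a Q + a' Q) b = jwick P a b + jwick P a' b"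
 and jwick_add2: "jwick P b (%Q. a Q + a' Q) = jwick P b a + jwick P b a'"
 by(simp_all add: fps_eq_iff jwick_nth jwt_add1 jwt_add2 scaleR_add_right sum.distrib)

lemma jwick_Cons: "jsym a ==> jsym b ==> jwick (A # P) a b = jwick P (%Q. a (A # Q)) b + jwick P a (%Q. b (A # Q))"
 by(simp add: fps_eq_iff jwick_nth jwt_Cons scaleR_add_right sum.distrib)

lemma jprod_derivation: assumes "!!f g. D (f * g) = D f * g + f * D g" "!!f g. D (f + g) = D f + D g"
 shows "D (jprod P a b) = jprod P (%Q. D (a Q)) b + jprod P a (%Q. D (b Q))"
 by(induction P arbitrary: a b) (simp_all add: assms algebra_simps)

lemma jwt_derivation: fixes a b :: "('n::finite + 'n) list => 'r::comm_ring_1"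
 assumes "!!f g. D (f * g) = D f * g + f * D g" "!!f g. D (f + g) = D f + D g" "D 0 = 0"
 shows "D (jwt k P a b) = jwt k P (%Q. D (a Q)) b + jwt k P a (%Q. D (b Q))"
proof(induction k arbitrary: a b)
 case (Suc k) have "D (sum f I) = (SUM i:I. D (f i))" for f and I :: "'n set"
  by(induction I rule: fin_induct) (simp_all add: assms)
 thus ?case by(simp add: Suc.IH sum.distrib)
qed (simp add: jprod_derivation[of D] assms)

text \<open>The pointwise products cancel, so the commutator is divisible by the parameter and the
  contractions begin at k = 1.\<close>

lemma jwick_commutator: "fps_shift 1 (jwick P a b - jwick P b a) $ n =
  (SUM k=1..Suc n. (1 / fact k) *R ((jwt k P a b - jwt k P b a) $ (Suc n - k)))"
proof - have "{..Suc n} = insert 0 {1..Suc n}" by auto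
 hence "(SUM k<=Suc n. f k) = f 0 + (SUM k=1..Suc n. f k)" for f :: "nat => 'a" by simp
 thus ?thesis by(simp add: jwick_nth jprod_commute[of P b a] scaleR_diff_right sum_subtractf)
qed

lemma jwick_commutator_linear: assumes "!!k. 2 <= k ==> jwt k P a b = 0" "!!k. 2 <= k ==> jwt k P b a = 0"
 shows "fps_shift 1 (jwick P a b - jwick P b a) = jwt 1 P a b - jwt 1 P b a"
proof(rule fps_ext)
 fix n have "fps_shift 1 (jwick P a b - jwick P b a) $ n = (SUM k=1..Suc n. if k = 1 then (jwt 1 P a b - jwt 1 P b a) $ n else 0)"
  unfolding jwick_commutator by(rule sum.cong) (auto simp: assms)
 thus "fps_shift 1 (jwick P a b - jwick P b a) $ n = (jwt 1 P a b - jwt 1 P b a) $ n" by simp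
qed

context wick_germ_pot begin

lemma X_scaleR: "X a (r *R f) = r *R X a f" by(simp add: X_def gD_scaleR scaleR_sum_right)

lemma X_sum: "X a (sum f I) = (SUM i:I. X a (f i))" by(induction I rule: fin_induct) (simp_all add: X_add)

lemma X_mult: "X a (f * g) = X a f * g + f * X a g" by(simp add: X_def gD_mult algebra_simps sum.distrib sum_distrib_left)

lemma fX_add: "fX_op (X a) (F + F') = fX_op (X a) F + fX_op (X a) F'"
 and fX_diff: "fX_op (X a) (F - F') = fX_op (X a) F - fX_op (X a) F'" and fX_minus: "fX_op (X a) (- F) = - fX_op (X a) F"
 and fX_zero: "fX_op (X a) 0 = 0" by(simp_all add: fps_eq_iff X_add X_diff X_minus)

lemma fX_mult: "fX_op (X a) (F * F') = fX_op (X a) F * F' + F * fX_op (X a) F'"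
 by(simp add: fps_eq_iff fps_mult_nth X_sum X_mult sum.distrib)

lemma fX_commute: "fX_op (X a) (fX_op (X b) F) = fX_op (X b) (fX_op (X a) F)" by(simp add: fps_eq_iff X_commute[of a b])

lemma fX_jwick: "fX_op (X a) (jwick P f g) = jwick P (%Q. fX_op (X a) (f Q)) g + jwick P f (%Q. fX_op (X a) (g Q))"
proof(rule fps_ext)
 fix n have "X a (jwt k P f g $ m) = (jwt k P (%Q. fX_op (X a) (f Q)) g + jwt k P f (%Q. fX_op (X a) (g Q))) $ m" for k m
  unfolding fX_op_nth[symmetric] by(subst jwt_derivation[of "fX_op (X a)"]) (simp_all only: fX_add fX_mult fX_zero)
 thus "fX_op (X a) (jwick P f g) $ n = (jwick P (%Q. fX_op (X a) (f Q)) g + jwick P f (%Q. fX_op (X a) (g Q))) $ n"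
  by(simp add: jwick_nth X_sum X_scaleR scaleR_add_right sum.distrib)
qed

lemma Xs_perm: "mset K = mset L ==> Xs K F = Xs L F"
proof(induction K arbitrary: L)
 case (Cons a K) then obtain L1 L2 where L: "L = L1 @ a # L2" by(metis list.set_intros(1) mset_eq_setD split_list)
 have "Xs (L1 @ a # L2) F = Xs (a # L1 @ L2) F" by(induction L1) (simp_all add: fX_commute[of _ a])
 moreover have "Xs K F = Xs (L1 @ L2) F" by(rule Cons.IH) (use Cons.prems L in simp)
 ultimately show ?case using L by simp
qed simp

lemma Xs_minus: "Xs K (- F) = - Xs K F" by(induction K) (simp_all add: fX_minus)

text \<open>The frame jets of the element in the Fedosov equation, for arbitrary words. Words
  without holomorphic letters are set to zero, as this part of the connection form has none.\<close>

definition hlg :: "'n => ('n + 'n) list => 'n germ fps" where "hlg l P = (if lefts P = [] then 0 else hc l (lefts P) (rights P))"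

lemma hc_perm1: "mset K = mset L ==> hc l K M = hc l L M" by(auto simp: hc_def Xs_perm[of K L] split: list.split)

lemma hc_perm2: "mset M = mset N ==> hc l K M = hc l K N"
proof - assume mn: "mset M = mset N"
 show ?thesis
 proof(cases M rule: remdups_adj.cases)
  case 1 thus ?thesis using mn by simp
 next case (2 m)
  hence "N = [m]" using mn by(metis mset_single_iff mset.simps(1) mset.simps(2))
  thus ?thesis using 2 by simp
 next case (3 m m' M')
  hence "length N = Suc (Suc (length M'))" using mset_eq_length[OF mn] by simp
  then obtain n n' N' where "N = n # n' # N'" by(metis length_Suc_conv)
  thus ?thesis using 3 by(simp add: hc_def)
 qed
qed

lemma jsym_hlg: "jsym (hlg l)" unfolding jsym_def
proof(intro allI impI)
 fix P Q :: "('n + 'n) list" assume PQ: "mset P = mset Q"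
 have "lefts P = [] \<longleftrightarrow> lefts Q = []" using mset_eq_length[OF mset_lefts[OF PQ]] by auto
 thus "hlg l P = hlg l Q" using hc_perm1[OF mset_lefts[OF PQ]] hc_perm2[OF mset_rights[OF PQ]] by(simp add: hlg_def)
qed

lemma hc_Cons: "hc l (a # K) M = fX_op (X a) (hc l K M)" by(simp add: hc_def fX_minus fX_zero split: list.split)

context fixes G :: "'n germ fps" begin

text \<open>The candidate for the jets of the flat lift: antiholomorphic letters select a symbol,
  holomorphic letters differentiate it.\<close>

definition Og :: "('n + 'n) list => 'n germ fps" where "Og P = Xs (lefts P) (T G (rights P))"

lemma Og_Inl: "Og (Inl a # P) = fX_op (X a) (Og P)" by(simp add: Og_def)

lemma jsym_Og: "jsym Og" unfolding jsym_def Og_def using Xs_perm[OF mset_lefts] T_perm[OF mset_rights] by metis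

text \<open>The defect of flatness of the jets \<open>Og\<close>.\<close>

definition Eg :: "'n => ('n + 'n) list => 'n germ fps" where
 "Eg l P = fD (Inr l) (Og P) - Og (Inr l # P) + fps_shift 1 (jwick P (hlg l) Og - jwick P Og (hlg l))"

text \<open>This is \<open>T_Cons\<close>: the other order of the commutator gives nothing, since
  there \<open>hlg\<close> meets no holomorphic letter.\<close>

lemma Eg_Inr: "Eg l (map Inr M) = 0"
proof(rule fps_ext)
 fix n let ?P = "map Inr M :: ('n + 'n) list"
 have 1: "jwt k ?P (hlg l) Og = (SUM J:words k. jprod M (hc l J) (%N. T G (J @ N)))" if "1 <= k" for k
 proof - have "hlg l (map Inl J @ map Inr N) = hc l J N" if "length J = k" for J N using that `1 <= k` by(auto simp: hlg_def)
  thus ?thesis unfolding jwt_lists jprod_map by(intro sum.cong refl) (simp add: Og_def)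
 qed
 have 2: "jwt k ?P Og (hlg l) = 0" for k unfolding jwt_lists jprod_map by(simp add: hlg_def jprod_zero2)
 have "fps_shift 1 (jwick ?P (hlg l) Og - jwick ?P Og (hlg l)) $ n =
  (SUM k:{1..Suc n}. (1 / fact k) *R ((SUM J:words k. jprod M (hc l J) (%N. T G (J @ N))) $ (Suc n - k)))"
  unfolding jwick_commutator by(rule sum.cong[OF refl]) (simp add: 1 2)
 thus "Eg l ?P $ n = 0 $ n" using T_Cons[of G l M n] by(simp add: Eg_def Og_def)
qed

text \<open>Differentiating along \<open>X a\<close> prolongs all jets except that
  \<open>hlg\<close> is cut off on words without holomorphic letters. The resulting extra term
  \<open>Ra\<close> has a commutator that equals the failure of \<open>X a\<close> to commute with
  the conjugate derivative.\<close>

lemma Eg_Inl: "Eg l (Inl a # P) = fX_op (X a) (Eg l P)"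
proof - define Ra where "Ra Q = (if lefts Q = [] then hc l [a] (rights Q) else 0)" for Q :: "('n + 'n) list"
 have h: "hlg l (Inl a # Q) = fX_op (X a) (hlg l Q) + Ra Q" for Q by(simp add: hlg_def Ra_def hc_Cons fX_zero)
 have j1: "jwick (Inl a # P) (hlg l) Og = fX_op (X a) (jwick P (hlg l) Og) + jwick P Ra Og"
  unfolding jwick_Cons[OF jsym_hlg jsym_Og] h Og_Inl jwick_add1 fX_jwick by(simp add: algebra_simps)
 have j2: "jwick (Inl a # P) Og (hlg l) = fX_op (X a) (jwick P Og (hlg l)) + jwick P Og Ra"
  unfolding jwick_Cons[OF jsym_Og jsym_hlg] h Og_Inl jwick_add2 fX_jwick by(simp add: algebra_simps)
 \<comment> \<open>The contraction supplies \<open>Ra\<close> with holomorphic letters, on which it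
   vanishes.\<close>
 have r1: "jwt k P Ra Og = 0" if "1 <= k" for k
 proof - have "jprod P (%Q. Ra (map Inl J @ Q)) g = 0" if "length J = k" for J g
  proof - have "Ra (map Inl J @ Q) = 0" for Q using that `1 <= k` by(auto simp: Ra_def)
   thus ?thesis by(simp add: jprod_zero1)
  qed
  thus ?thesis unfolding jwt_lists by simp
 qed
 \<comment> \<open>At most one antiholomorphic letter is seen by \<open>Ra\<close>.\<close>
 have r2: "jwt k P Og Ra = 0" if "2 <= k" for k
 proof - have "jprod P g (%Q. Ra (map Inr J @ Q)) = 0" if "length J = k" for J g
  proof -
   obtain j j' J' where "J = j # j' # J'" using `length J = k` `2 <= k` by(cases J rule: remdups_adj.cases) auto
   hence "Ra (map Inr J @ Q) = 0" for Q by(simp add: Ra_def hc_def)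
   thus ?thesis by(simp add: jprod_zero2)
  qed
  thus ?thesis unfolding jwt_lists by simp
 qed
 have r3: "jwt 1 P Og Ra = - (SS j. fX_op (X a) (fD (Inr l) (uc j)) * fX_op (X j) (Og P))"
 proof - have "jprod P (%Q. Og (Inl j # Q)) (%Q. Ra (Inr j # Q)) = Ra [Inr j] * Og (Inl j # P)" for j
   unfolding jprod_commute[of P "%Q. Og (Inl j # Q)"]
  proof(rule jprod_const)
   fix N :: "('n + 'n) list" assume "N ~= []" hence "lefts N = [] ==> rights N ~= []" using lefts_Nil_iff[of N] by auto
   thus "Ra (Inr j # N) = 0" by(cases "rights N") (auto simp: Ra_def hc_def)
  qed
  moreover have "Ra [Inr j] = - fX_op (X a) (fD (Inr l) (uc j))" for j by(simp add: Ra_def hc_def)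
  ultimately show ?thesis by(simp add: Og_Inl sum_negf)
 qed
 have R: "fps_shift 1 (jwick P Ra Og - jwick P Og Ra) = (SS j. fX_op (X a) (fD (Inr l) (uc j)) * fX_op (X j) (Og P))"
 proof - have "fps_shift 1 (jwick P Ra Og - jwick P Og Ra) = jwt 1 P Ra Og - jwt 1 P Og Ra"
   by(rule jwick_commutator_linear) (auto intro: r1 r2)
  thus ?thesis unfolding r3 r1[OF order_refl] by simp
 qed
 \<comment> \<open>\<open>V_commute\<close>, applied to each coefficient.\<close>
 have V: "fD (Inr l) (fX_op (X a) F) + (SS j. fX_op (X a) (fD (Inr l) (uc j)) * fX_op (X j) F) = fX_op (X a) (fD (Inr l) F)" for F
 proof(rule fps_ext)
  fix n have "fX_op (X a) (cst f) = cst (X a f)" for f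
  proof(rule fps_ext)
   fix n show "fX_op (X a) (cst f) $ n = cst (X a f) $ n" by(cases n) simp_all
  qed
  thus "(fD (Inr l) (fX_op (X a) F) + (SS j. fX_op (X a) (fD (Inr l) (uc j)) * fX_op (X j) F)) $ n = fX_op (X a) (fD (Inr l) F) $ n"
   using V_commute[of a l "F $ n"] by(simp add: fps_sum_nth algebra_simps)
 qed
 have s: "fps_shift 1 (fX_op (X a) F) = fX_op (X a) (fps_shift 1 F)" for F by(simp add: fps_eq_iff)
 have "fps_shift 1 (jwick (Inl a # P) (hlg l) Og - jwick (Inl a # P) Og (hlg l)) =
  fX_op (X a) (fps_shift 1 (jwick P (hlg l) Og - jwick P Og (hlg l))) + fps_shift 1 (jwick P Ra Og - jwick P Og Ra)"
  unfolding j1 j2 s[symmetric] fX_diff by(simp add: fps_eq_iff)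
 moreover have "Og (Inr l # Inl a # P) = fX_op (X a) (Og (Inr l # P))" by(simp add: Og_def)
 ultimately show ?thesis unfolding Eg_def R by(simp add: Og_Inl V[symmetric] fX_add fX_diff)
qed

text \<open>Words of this ordered shape suffice, since all families involved are symmetric.\<close>

theorem Eg_zero: "Eg l (map Inl K @ map Inr M) = 0" by(induction K) (simp_all add: Eg_Inr Eg_Inl fX_zero)

end

end

section \<open>Coherence and covariance of the symbols\<close>

text \<open>Iterated commutators for operators on global formal functions. They give global
  functions whose germs represent the symbols at all nearby points simultaneously.\<close>

primrec gads :: "('i => 'a => complex) => 'i list => (('a => complex fps) => 'a => complex fps) => ('a => complex fps) => 'a => complex fps" where
 "gads u [] R = R"
| "gads u (a # L) R = gads u L (%F y. R (%p. cst (u a p) * F p) y - cst (u a y) * R F y)"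

text \<open>An operator commuting with the coefficients \<open>J\<close> has iterated commutators
  that transform as a tensor when the functions are recombined by \<open>J\<close>.\<close>

lemma ads_mc: fixes v :: "'j::finite => 'r::comm_ring_1" assumes "!!l q F. R (J l q * F) = J l q * R F" "!!F F'. R (F + F') = R F + R F'"
 shows "ads (%l. SS q. J l q * v q) L R F = mc J L (%Q. ads v Q R F)" using assms
proof(induction L arbitrary: R)
 case (Cons l L) let ?x = "%l. SS q. J l q * v q" have R0: "R 0 = 0" using Cons.prems(2)[of 0 0] by simp
 have Rs: "R (sum f I) = (SUM i:I. R (f i))" for f and I :: "'j set"
  by(induction I rule: fin_induct) (simp_all add: R0 Cons.prems(2))
 have a: "ad (?x l) R = (%F. SS q. J l q * ad (v q) R F)"
  by(rule ext) (simp add: ad_def sum_distrib_right Rs Cons.prems(1) mult.assoc sum_subtractf right_diff_distrib)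
 have s: "ads ?x L (%F. SUM q:I. J l q * ad (v q) R F) F = (SUM q:I. J l q * ads ?x L (ad (v q) R) F)" for I :: "'j set"
 proof(induction I rule: fin_induct)
  case (insert q I) show ?case
   using insert ads_lin[of "%F. SUM q:insert q I. J l q * ad (v q) R F" "J l q" "ad (v q) R" 1 "%F. SUM q:I. J l q * ad (v q) R F" ?x L F] by simp
 qed (simp_all add: ads_zero)
 have "ads ?x L (ad (v q) R) F = mc J L (%Q. ads v Q (ad (v q) R) F)" for q
 proof(rule Cons.IH)
  fix l p F have "R (v q * (J l p * F)) = J l p * R (v q * F)" by(metis Cons.prems(1) mult.left_commute)
  thus "ad (v q) R (J l p * F) = J l p * ad (v q) R F" by(simp add: ad_def Cons.prems(1) right_diff_distrib mult.left_commute)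
 qed (simp add: ad_def Cons.prems(2) algebra_simps)
 thus ?case by(simp add: a s)
qed simp

lemma mc_swap: "mc A P (%Q. mc B R (%S. h Q S)) = mc B R (%S. mc A P (%Q. h Q S))"
 by(induction P arbitrary: h) (simp_all add: mc_sum mc_scale)

lemma mc_cong_length: "(!!Q. length Q = length P ==> h Q = h' Q) ==> mc M P h = mc M P h'"
proof(induction P arbitrary: h h')
 case (Cons A P) have "mc M P (%Q. h (B # Q)) = mc M P (%Q. h' (B # Q))" for B by(rule Cons.IH) (simp add: Cons.prems) thus ?case by simp
qed simp

lemma mc_fps_shift: "fps_shift n (mc (%A B. cst (M A B)) P h) = mc (%A B. cst (M A B)) P (%Q. fps_shift n (h Q))"
proof(induction P arbitrary: h)
 case (Cons A P) have "fps_shift n (SUM B:I. cst (M A B) * f B) = (SUM B:I. cst (M A B) * fps_shift n (f B))" for f I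
  by(rule fps_ext) (simp add: fps_sum_nth)
 thus ?case by(simp add: Cons.IH)
qed simp

lemma fev_mc: "fev (mc M P h) = mc (%A B. fev (M A B)) P (%Q. fev (h Q))" by(induction P arbitrary: h) (simp_all add: fev_sum)

context atlas begin

lemma formal_fun_smult: "sf f ==> ff F ==> ff (%p. cst (f p) * F p)" by(intro formal_fun_mult formal_fun_const)

lemma fcg_smult: "c : \<A> ==> x : fst c ==> sf f ==> ff F ==> fcg c x (%p. cst (f p) * F p) = cst (cg c x f) * fcg c x F"
 by(simp add: fcg_mult formal_fun_const fcg_fps_const)

lemma gads_formal: assumes "!!a. sf (u a)" "!!F. ff F ==> ff (R F)" shows "ff F ==> ff (gads u L R F)" using assms(2)
proof(induction L arbitrary: R)
 case (Cons a L)
 show ?case unfolding gads.simps by(rule Cons.IH[OF Cons.prems(1)]) (intro formal_fun_diff formal_fun_smult Cons.prems assms(1))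
qed simp

lemma fcg_gads: assumes c: "c : \<A>" "x : fst c" and u: "!!a. sf (u a)" and F: "ff F"
  and R: "!!F. ff F ==> ff (R F)" "!!F. ff F ==> fcg c x (R F) = Rx (fcg c x F)"
 shows "fcg c x (gads u L R F) = ads (%a. cst (cg c x (u a))) L Rx (fcg c x F)" using R
proof(induction L arbitrary: R Rx)
 case (Cons a L) show ?case unfolding gads.simps ads.simps
 proof(rule Cons.IH)
  show "ff (%y. R (%p. cst (u a p) * F p) y - cst (u a y) * R F y)" if "ff F" for F
   by(intro formal_fun_diff formal_fun_smult Cons.prems(1) u that)
  show "fcg c x (%y. R (%p. cst (u a p) * F p) y - cst (u a y) * R F y) = ad (cst (cg c x (u a))) Rx (fcg c x F)"
   if "ff F" for F by(simp add: ad_def fcg_diff[OF c] formal_fun_smult Cons.prems u that fcg_smult[OF c])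
 qed
qed (simp add: F)

end

context kaehler_wick begin

text \<open>The symbols computed from functions \<open>u\<close> on the whole manifold, which are
  right only near the point where the \<open>u\<close> were fitted.\<close>

definition Tgl :: "('n => 'a => complex) => ('a => complex fps) => 'n list => 'a => complex fps" where
 "Tgl u G L y = fps_shift (length L) (gads u L (%F. S F G) (%_. 1) y)"

lemma formal_fun_one: "ff (%_. 1)" using formal_fun_const[OF smooth_fun_const[of 1]] by simp

lemma formal_gads: "(!!a. sf (u a)) ==> ff G ==> ff (gads u L (%F. S F G) (%_. 1))"
 by(rule gads_formal) (auto intro: S_formal formal_fun_one)

lemma formal_Tgl: "(!!a. sf (u a)) ==> ff G ==> ff (Tgl u G L)" using formal_gads[of u G L] by(simp add: formal_fun_def Tgl_def)

lemma fcg_one: "fcg c x (%_. 1) = 1" using fcg_fps_const[of c x "%_. 1"] by(simp add: cg_const)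

lemma fcg_Tgl: assumes c: "c : \<A>" "x : fst c" and u: "!!a. sf (u a)" and G: "ff G"
 shows "fcg c x (Tgl u G L) = fps_shift (length L) (ads (%a. cst (cg c x (u a))) L (%F. fstar (gC c x) F (fcg c x G)) 1)"
proof - have "fcg c x (gads u L (%F. S F G) (%_. 1)) = ads (%a. cst (cg c x (u a))) L (%F. fstar (gC c x) F (fcg c x G)) (fcg c x (%_. 1))"
  by(rule fcg_gads[OF c u formal_fun_one]) (auto intro: S_formal G simp: fcg_S[OF c] G)
 thus ?thesis by(simp add: fps_eq_iff fcg_nth Tgl_def fcg_one)
qed

text \<open>The symbols at a point, computed from the solutions chosen there; by
  \<open>Tg_eq\<close> any functions with the right holomorphic derivatives give the same.\<close>

definition Tg :: "('a, 'n) chart => 'a => ('a => complex fps) => 'n list => 'n germ fps" where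
 "Tg c x G = wick_germ_pot.T (gC c x) (Ug c x) (fcg c x G)"

lemma Tg_eq: assumes c: "c : \<A>" "x : fst c" and v: "!!a i. gD (Inl i) (v a) = - Wg c x i a"
 shows "Tg c x G L = fps_shift (length L) (ads (%a. cst (v a)) L (%F. fstar (gC c x) F (fcg c x G)) 1)"
proof - interpret x: wick_germ_pot "gC c x" "wg c x" "Wg c x" "Ug c x" by(rule pot_at[OF c])
 show ?thesis unfolding Tg_def x.T_def x.S_independent[OF v] ..
qed

definition tt :: "('a => complex fps) => 'n list => ('a, 'n) chart => complex^'n => complex fps" where
 "tt G L c z = fev (Tg c (chart_inv c z) G L)"

text \<open>Order zero functions fitted at one point keep the right holomorphic derivatives in a
  neighbourhood, because minus the Kaehler form is smooth.\<close>

lemma eventually_local_potential: assumes c: "c : \<A>" "x : fst c" and u: "!!a. sf (u a)" "!!a. cg c x (u a) = Ug c x a $ 0"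
 shows "near x (%y. y : fst c & (ALL a i. gD (Inl i) (cg c y (u a)) = - Wg c y i a))"
proof - interpret x: wick_germ_pot "gC c x" "wg c x" "Wg c x" "Ug c x" by(rule pot_at[OF c])
 have so: "smooth_at (snd c y) (%z. - \<omega> c z $ i $ a)" if "y : fst c" for y i a by(intro smooth_at_minus smooth_at_omega c that)
 have W: "germ (snd c y) (%z. - \<omega> c z $ i $ a) = - Wg c y i a" if "y : fst c" for y i a
  by(simp add: Wg_def germ_minus smooth_at_omega c that)
 have "near x (%y. y : fst c & gD (Inl i) (cg c y (u a)) = germ (snd c y) (%z. - \<omega> c z $ i $ a))" for i a
  by(rule eventually_gD_cg[OF c u(1) so[OF c(2)]]) (use x.gD_u[of i a] in \<open>simp add: u W[OF c(2)] x.u_def\<close>)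
 hence "near x (%y. y : fst c & gD (Inl i) (cg c y (u a)) = - Wg c y i a)" for i a by eventually_elim (auto simp: W)
 hence "near x (%y. ALL a i. y : fst c & gD (Inl i) (cg c y (u a)) = - Wg c y i a)" by(intro eventually_all_finite)
 thus ?thesis by eventually_elim blast
qed

lemma ex_local_potential: assumes c: "c : \<A>" "x : fst c" obtains u where "!!a. sf (u a)" "!!a. cg c x (u a) = Ug c x a $ 0"
proof - have "ALL a. EX f. sf f & cg c x f = Ug c x a $ 0" using cg_exhaust[OF c] by metis
 from choice[OF this] show ?thesis using that by blast
qed

text \<open>The values of the symbols chosen point by point form smooth functions, whose germs are
  again the symbols: near a point they all come from the global functions
  \<open>Tgl\<close>.\<close>

lemma tt_coherent: assumes c: "c : \<A>" "x : fst c" and G: "ff G"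
 shows "fsmooth_at (snd c x) (tt G L c)" "fgerm (snd c x) (tt G L c) = Tg c x G L"
proof - obtain u where u: "!!a. sf (u a)" "!!a. cg c x (u a) = Ug c x a $ 0" using ex_local_potential[OF c] by metis
 have T: "ff (Tgl u G L)" by(rule formal_Tgl[OF u(1) G])
 have eT: "fcg c y (Tgl u G L) = Tg c y G L" if "y : fst c" "!!a i. gD (Inl i) (cg c y (u a)) = - Wg c y i a" for y
  unfolding Tg_eq[OF c(1) that] by(rule fcg_Tgl[OF c(1) that(1) u(1) G])
 have ev: "near x (%y. y : fst c & (ALL a i. gD (Inl i) (cg c y (u a)) = - Wg c y i a))" by(rule eventually_local_potential[OF c u])
 hence "near x (%y. y : fst c & Tgl u G L y = fev (Tg c y G L))"
 proof eventually_elim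
  case (elim y) thus ?case using fev_fcg[OF c(1) _ T, of y] eT[of y] by simp
 qed
 hence "near (snd c x) (%w. chart_inv c w : fst c & Tgl u G L (chart_inv c w) = fev (Tg c (chart_inv c w) G L))"
  using eventually_chart[OF c, of "%y. y : fst c & Tgl u G L y = fev (Tg c y G L)"] by simp
 hence e: "near (snd c x) (%w. lf c (Tgl u G L) w = tt G L c w)" by eventually_elim (simp add: lf_def tt_def)
 have s: "fsmooth_at (snd c x) (lf c (Tgl u G L))" unfolding fsmooth_at_def
 proof
  fix n have "sf (%y. Tgl u G L y $ n)" using T by(simp add: formal_fun_def)
  from smooth_funD[OF this c] show "smooth_at (snd c x) (%w. lf c (Tgl u G L) w $ n)" by(simp add: lf_def)
 qed
 show "fsmooth_at (snd c x) (tt G L c)" by(rule fsmooth_at_cong[OF s e])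
 have "fgerm (snd c x) (tt G L c) = fcg c x (Tgl u G L)" unfolding fcg_def by(rule fgerm_cong[OF s e, symmetric])
 also have "... = Tg c x G L" by(rule eT[OF c(2)]) (use eventually_nhds_x_imp_x[OF ev] in blast)
 finally show "fgerm (snd c x) (tt G L c) = Tg c x G L" .
qed

abbreviation "hlc c x == wick_germ_pot.hlg (wg c x) (Ug c x)"

abbreviation Xop :: "('a, 'n) chart => 'a => 'n => 'n germ fps => 'n germ fps" where "Xop c x a == fX_op (wick_germ.X (wg c x) a)"

abbreviation Xops :: "('a, 'n) chart => 'a => 'n list => 'n germ fps => 'n germ fps" where "Xops c x K F == foldr (%a. Xop c x a) K F"

lemma Xop_fcg: assumes c: "c : \<A>" "x : fst c" and F: "ff F" shows "Xop c x a (fcg c x F) $ n = germ (snd c x) (Xv c a (%y. F y $ n))"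
proof - interpret x: wick_germ_pot "gC c x" "wg c x" "Wg c x" "Ug c x" by(rule pot_at[OF c])
 have s: "smooth_at (snd c x) (lf c (%y. F y $ n))" using F by(intro smooth_funD[OF _ c]) (simp add: formal_fun_def)
 show ?thesis unfolding Xv_def[abs_def]
  by(simp add: x.X_def fcg_nth cg_def wg_def germ_sum germ_mult germ_wirtinger s smooth_at_omega_up[OF c] smooth_at_intros)
qed

text \<open>\<open>Xv_change\<close> at the level of germs, with derivatives in the other chart
  represented by functions on the manifold.\<close>

lemma Xop_change: assumes c: "c : \<A>" "c' : \<A>" "x : fst c" "x : fst c'" and F: "ff F" "ff H"
  and H: "fcg c' x H = Xop c' x q (fcg c' x F)"
 shows "fcg c x H = (SS j. cst (germ (snd c x) (jacobian c c' (Inr q) (Inr j))) * Xop c x j (fcg c x F))"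
proof(rule fps_ext)
 fix n let ?f = "%y. F y $ n" and ?h = "%y. H y $ n" have s: "sf ?f" "sf ?h" using F by(auto simp: formal_fun_def)
 have sX: "smooth_at (snd c y) (Xv c a ?f)" if "c : \<A>" "y : fst c" for c y a
  unfolding Xv_def[abs_def] by(intro smooth_at_intros smooth_at_omega_up smooth_funD[OF s(1)] that)
 have "germ (snd c' x) (lf c' ?h) = germ (snd c' x) (Xv c' q ?f)"
  using arg_cong[OF H, of "%F. F $ n"] unfolding Xop_fcg[OF c(2,4) F(1)] by(simp add: fcg_nth cg_def)
 hence "near (snd c' x) (%w. lf c' ?h w = Xv c' q ?f w)" using germ_eq_iff[OF smooth_funD[OF s(2) c(2,4)] sX[OF c(2,4)]] by blast
 hence "near (snd c' x) (%w. ?h (chart_inv c' w) = Xv c' q ?f (snd c' (chart_inv c' w)))"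
  using near_chart_image[OF c(2,4)] by eventually_elim (simp add: lf_def c)
 hence "near x (%y. ?h y = Xv c' q ?f (snd c' y))" using eventually_chart[OF c(2,4), of "%y. ?h y = Xv c' q ?f (snd c' y)"] by simp
 moreover have "near x (%y. y : fst c & y : fst c')"
  using eventually_nhds_in_open[OF open_Int[OF open_chart[OF c(1)] open_chart[OF c(2)]], of x] c by simp
 ultimately have "near x (%y. ?h y = (SS j. jacobian c c' (Inr q) (Inr j) (snd c y) * Xv c j ?f (snd c y)))"
  by eventually_elim (simp add: Xv_change[OF c(1,2) _ _ s(1)])
 hence "near (snd c x) (%w. ?h (chart_inv c w) = (SS j. jacobian c c' (Inr q) (Inr j) (snd c (chart_inv c w)) * Xv c j ?f (snd c (chart_inv c w))))"
  using eventually_chart[OF c(1,3), of "%y. ?h y = (SS j. jacobian c c' (Inr q) (Inr j) (snd c y) * Xv c j ?f (snd c y))"] by simp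
 hence "near (snd c x) (%w. lf c ?h w = (SS j. jacobian c c' (Inr q) (Inr j) w * Xv c j ?f w))"
  using near_chart_image[OF c(1,3)] by eventually_elim (simp add: c lf_def)
 hence "germ (snd c x) (lf c ?h) = germ (snd c x) (%w. SS j. jacobian c c' (Inr q) (Inr j) w * Xv c j ?f w)"
  by(rule germ_cong[OF smooth_funD[OF s(2) c(1,3)]])
 thus "fcg c x H $ n = (SS j. cst (germ (snd c x) (jacobian c c' (Inr q) (Inr j))) * Xop c x j (fcg c x F)) $ n"
  by(simp add: fps_sum_nth Xop_fcg[OF c(1,3) F(1)] germ_sum germ_mult smooth_at_jacobian[OF c] sX[OF c(1,3)] smooth_at_intros del: fX_op_nth)
   (simp add: fcg_nth cg_def)
qed

lemma Xop_antihol_scale: assumes c: "c : \<A>" "x : fst c" and J: "antihol j" shows "Xop c x a (j * F) = j * Xop c x a F"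
proof - interpret x: wick_germ_pot "gC c x" "wg c x" "Wg c x" "Ug c x" by(rule pot_at[OF c])
 have "gD (Inl i) (j $ n) = 0" for i n using J by(metis fD_nth fps_zero_nth)
 hence "Xop c x a j = 0" by(simp add: fps_eq_iff x.X_def)
 thus ?thesis by(simp add: x.fX_mult)
qed

text \<open>Antiholomorphic coefficients are constants for the fields \<open>X\<close>.\<close>

lemma Xop_mc: fixes J :: "'i => 'q::finite => 'n germ fps" assumes c: "c : \<A>" "x : fst c" and J: "!!l q. antihol (J l q)"
 shows "Xop c x a (mc J L h) = mc J L (%Q. Xop c x a (h Q))"
proof - interpret x: wick_germ_pot "gC c x" "wg c x" "Wg c x" "Ug c x" by(rule pot_at[OF c])
 have "Xop c x a (sum f I) = (SUM i:I. Xop c x a (f i))" for f and I :: "'q set"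
  by(induction I rule: fin_induct) (simp_all add: x.fX_add x.fX_zero)
 thus ?thesis by(induction L arbitrary: h) (simp_all add: Xop_antihol_scale[OF c J])
qed

lemma Xops_mc: assumes "c : \<A>" "x : fst c" "!!l q. antihol (J l q)"
 shows "Xops c x K (mc J L h) = mc J L (%Q. Xops c x K (h Q))" by(induction K) (simp_all add: Xop_mc[OF assms])

text \<open>At each step the derivative in the second chart is represented by a new global function,
  because a germ in one chart cannot be differentiated in another.\<close>

lemma Xops_change: assumes c: "c : \<A>" "c' : \<A>" "x : fst c" "x : fst c'" and F: "ff F"
 shows "EX H. ff H & fcg c' x H = Xops c' x K (fcg c' x F) &
  fcg c x H = mc (%q j. cst (germ (snd c x) (jacobian c c' (Inr q) (Inr j)))) K (%K'. Xops c x K' (fcg c x F))"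
proof(induction K)
 case Nil thus ?case using F by auto
next case (Cons q K)
 let ?J = "%q j. cst (germ (snd c x) (jacobian c c' (Inr q) (Inr j)))"
 have aJ: "antihol (?J q j)" for q j by(simp add: gD_jacobian(1)[OF c])
 obtain H where H: "ff H" "fcg c' x H = Xops c' x K (fcg c' x F)" "fcg c x H = mc ?J K (%K'. Xops c x K' (fcg c x F))" using Cons by blast
 obtain H' where H': "ff H'" "fcg c' x H' = Xop c' x q (fcg c' x H)" using fcg_exhaust[OF c(2,4)] by metis
 have "fcg c x H' = mc ?J (q # K) (%K'. Xops c x K' (fcg c x F))" unfolding Xop_change[OF c H(1) H'] H(3) by(simp add: Xop_mc[OF c(1,3) aJ])
 thus ?case using H' H(2) by auto
qed

text \<open>The recombination of the second chart's functions by the conjugate Jacobian is an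
  admissible choice in the first, so \<open>Tg_eq\<close> and \<open>ads_mc\<close> give the tensor
  law.\<close>

lemma Tg_change: assumes c: "c : \<A>" "c' : \<A>" "x : fst c" "x : fst c'" and G: "ff G"
 obtains u where "!!Q. ff (Tgl u G Q)" "!!Q. fcg c' x (Tgl u G Q) = Tg c' x G Q"
  "!!L. Tg c x G L = mc (%l q. cst (germ (snd c x) (jacobian c c' (Inr q) (Inr l)))) L (%Q. fcg c x (Tgl u G Q))"
proof - interpret x: wick_germ_pot "gC c x" "wg c x" "Wg c x" "Ug c x" by(rule pot_at[OF c(1,3)])
 interpret x': wick_germ_pot "gC c' x" "wg c' x" "Wg c' x" "Ug c' x" by(rule pot_at[OF c(2,4)])
 let ?J = "%l q. cst (germ (snd c x) (jacobian c c' (Inr q) (Inr l)))"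
 have aJ: "antihol (?J l q)" for q l by(simp add: gD_jacobian(1)[OF c])
 have "ALL q. EX V. ff V & fcg c' x V = Ug c' x q" using fcg_exhaust[OF c(2,4)] by metis
 from choice[OF this] obtain V where V: "!!q. ff (V q)" "!!q. fcg c' x (V q) = Ug c' x q" by blast
 define u where "u q y = V q y $ 0" for q y have u: "sf (u q)" for q using V(1) unfolding u_def formal_fun_def by blast
 have ux: "cg c' x (u q) = Ug c' x q $ 0" for q unfolding V(2)[symmetric] by(simp add: fcg_nth u_def[abs_def])
 show ?thesis
 proof(rule that[of u])
  show "ff (Tgl u G Q)" for Q by(rule formal_Tgl[OF u G])
  show "fcg c' x (Tgl u G Q) = Tg c' x G Q" for Q
   unfolding fcg_Tgl[OF c(2,4) u G] by(rule Tg_eq[OF c(2,4), symmetric]) (use x'.gD_u in \<open>simp add: ux x'.u_def\<close>)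
  show "Tg c x G L = mc ?J L (%Q. fcg c x (Tgl u G Q))" for L
  proof - define v where "v l = (SS q. germ (snd c x) (jacobian c c' (Inr q) (Inr l)) * cg c x (u q))" for l
   have "gD (Inl i) (v l) = - Wg c x i l" for i l using x.left_derivation_leading[OF left_derivation_change[OF c V], of i l]
    by(simp add: v_def fps_sum_nth fcg_nth u_def[abs_def])
   hence "Tg c x G L = fps_shift (length L) (ads (%a. cst (v a)) L (%F. fstar (gC c x) F (fcg c x G)) 1)" by(rule Tg_eq[OF c(1,3)])
   also have "(%a. cst (v a)) = (%l. SS q. ?J l q * cst (cg c x (u q)))"
   proof - have "cst (sum f I) = (SUM i:I. cst (f i))" for f :: "'n => 'n germ" and I
     by(induction I rule: fin_induct) (simp_all flip: fps_const_add)
    thus ?thesis by(simp add: fun_eq_iff v_def)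
   qed
   also have "ads (%l. SS q. ?J l q * cst (cg c x (u q))) L (%F. fstar (gC c x) F (fcg c x G)) 1
    = mc ?J L (%Q. ads (%q. cst (cg c x (u q))) Q (%F. fstar (gC c x) F (fcg c x G)) 1)"
    by(rule ads_mc) (simp_all only: x.star_antihol_mult[OF aJ] x.star_add1)
   also have "fps_shift (length L) ... = mc ?J L (%Q. fcg c x (Tgl u G Q))"
    unfolding mc_fps_shift fcg_Tgl[OF c(1,3) u G] by(rule mc_cong_length) simp
   finally show ?thesis .
  qed
 qed
qed

text \<open>The family \<open>e\<close> mixes the two charts: the vector fields belong to one of them and the symbols to the other.\<close>

lemma hat_change: assumes c: "c : \<A>" "c' : \<A>" "x : fst c" "x : fst c'" and G: "ff G" obtains e where
  "!!K M. fev (Xops c x K (Tg c x G M)) = mc (%l q. cst (jacobian c c' (Inr q) (Inr l) (snd c x))) M (e K)"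
  "!!K M. fev (Xops c' x K (Tg c' x G M)) = mc (%q j. cst (jacobian c c' (Inr q) (Inr j) (snd c x))) K (%K'. e K' M)"
proof - obtain u where u: "!!Q. ff (Tgl u G Q)" "!!Q. fcg c' x (Tgl u G Q) = Tg c' x G Q"
  "!!L. Tg c x G L = mc (%l q. cst (germ (snd c x) (jacobian c c' (Inr q) (Inr l)))) L (%Q. fcg c x (Tgl u G Q))"
  using Tg_change[OF c G] by metis
 have fJ: "fev (cst (germ (snd c x) (jacobian c c' B A))) = cst (jacobian c c' B A (snd c x))" for A B
  by(simp add: gev_germ smooth_at_jacobian[OF c])
 show ?thesis
 proof(rule that)
  fix K M
  show "fev (Xops c x K (Tg c x G M)) = mc (%l q. cst (jacobian c c' (Inr q) (Inr l) (snd c x))) M (%M'. fev (Xops c x K (fcg c x (Tgl u G M'))))"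
  proof -
   have "Xops c x K (Tg c x G M) = mc (%l q. cst (germ (snd c x) (jacobian c c' (Inr q) (Inr l)))) M (%M'. Xops c x K (fcg c x (Tgl u G M')))"
    unfolding u(3) by(rule Xops_mc[OF c(1,3)]) (simp add: gD_jacobian(1)[OF c])
   thus ?thesis by(simp only: fev_mc fJ)
  qed
  obtain H where H: "ff H" "fcg c' x H = Xops c' x K (fcg c' x (Tgl u G M))"
   "fcg c x H = mc (%q j. cst (germ (snd c x) (jacobian c c' (Inr q) (Inr j)))) K (%K'. Xops c x K' (fcg c x (Tgl u G M)))"
   using Xops_change[OF c u(1)] by metis
  have "fev (fcg c' x H) = fev (fcg c x H)" by(simp add: fev_fcg[OF c(1,3) H(1)] fev_fcg[OF c(2,4) H(1)])
  thus "fev (Xops c' x K (Tg c' x G M)) = mc (%q j. cst (jacobian c c' (Inr q) (Inr j) (snd c x))) K (%K'. fev (Xops c x K' (fcg c x (Tgl u G M))))"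
   unfolding H(2,3) u(2) by(simp only: fev_mc fJ)
 qed
qed

end

section \<open>The Fedosov connection in the flat frame\<close>

context kaehler_wick begin

lemma kaehler_local_at: assumes c: "c : \<A>" and V: "open V" "V \<subseteq> chart_image c" shows "kaehler_local V (\<omega> c)"
proof
 show "open V" by(rule V)
 show "smooth_on V (%z. \<omega> c z $ i $ j)" for i j by(rule smooth_on_subset[OF smooth_on_omega[OF c] V(2)])
 show "invertible (\<omega> c z)" if "z : V" for z by(rule invertible_omega[OF c]) (use that V in blast)
 have cl: "ALL z:chart_image c. ALL i j k. wd (Inl k) (%w. \<omega> c w $ i $ j) z = wd (Inl i) (%w. \<omega> c w $ k $ j) z &
    wd (Inr k) (%w. \<omega> c w $ i $ j) z = wd (Inr j) (%w. \<omega> c w $ i $ k) z"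
  using omega_closed c unfolding closed_form11_def by blast
 show "wd (Inl k) (%w. \<omega> c w $ i $ j) z = wd (Inl i) (%w. \<omega> c w $ k $ j) z" if "z : V" for z i j k using cl that V by blast
 show "wd (Inr k) (%w. \<omega> c w $ i $ j) z = wd (Inr j) (%w. \<omega> c w $ i $ k) z" if "z : V" for z i j k using cl that V by blast
qed

lemma kaehler_chart: "c : \<A> ==> kaehler_local (chart_image c) (\<omega> c)" by(rule kaehler_local_at) (auto simp: open_chart_image)

abbreviation XX :: "('a, 'n) chart => 'n list => (complex^'n => complex fps) => complex^'n => complex fps" where
 "XX c == kaehler_local.fXs (\<omega> c)"

text \<open>Links the derivatives of local functions with the operators on germs.\<close>

lemma fgerm_XX: assumes c: "c : \<A>" "x : fst c" and F: "fsmooth_at (snd c x) F"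
 shows "fsmooth_at (snd c x) (XX c K F)" "fgerm (snd c x) (XX c K F) = Xops c x K (fgerm (snd c x) F)"
proof - interpret K: kaehler_local "chart_image c" "\<omega> c" by(rule kaehler_chart[OF c(1)])
 interpret x: wick_germ_pot "gC c x" "wg c x" "Wg c x" "Ug c x" by(rule pot_at[OF c])
 have z: "snd c x : chart_image c" using c by simp
 show "fsmooth_at (snd c x) (XX c K F)" for K by(rule K.fXs_smooth[OF z F])
 show "fgerm (snd c x) (XX c K F) = Xops c x K (fgerm (snd c x) F)"
 proof(induction K)
  case (Cons a K) have s: "fsmooth_at (snd c x) (XX c K F)" by(rule K.fXs_smooth[OF z F])
  have "fgerm (snd c x) (K.fXv a (XX c K F)) = (SS i. cst (wg c x i a) * fD (Inl i) (fgerm (snd c x) (XX c K F)))"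
   unfolding K.fXv_def[abs_def] by(simp add: fgerm_sum fsmooth_at_mult fsmooth_at_fps_const smooth_at_omega_up[OF c] fsmooth_at_fwirtinger s
     fgerm_mult fgerm_fps_const fgerm_fwirtinger wg_def)
  also have "... = Xop c x a (fgerm (snd c x) (XX c K F))" by(rule fps_ext) (simp add: x.X_def fps_sum_nth)
  finally show ?case using Cons by simp
 qed simp
qed

lemma XX_value: assumes c: "c : \<A>" "x : fst c" and F: "fsmooth_at (snd c x) F"
 shows "XX c K F (snd c x) = fev (Xops c x K (fgerm (snd c x) F))"
 using fev_fgerm[OF fgerm_XX(1)[OF c F], of K] fgerm_XX(2)[OF c F, of K] by simp

text \<open>Guarantees that the potential selected by choice in the definition of the connection
  really exists.\<close>

lemma ex_alpha_potential: assumes c: "c : \<A>" "x : fst c" shows "EX g V. snd c x : V & local_potential \<alpha> c V g"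
proof - let ?z = "snd c x"
 have "?z : chart_image c" using c by simp
 then obtain e where e: "e > 0" "ball ?z e \<subseteq> chart_image c" using open_chart_image[OF c(1)] open_contains_ball by blast
 obtain r where r: "r > 0" "polydisc ?z r \<subseteq> ball ?z e" using polydisc_subset_ball[OF e(1)] by metis
 \<comment> \<open>One polydisc serves all orders, since every \<alpha> k is smooth on the whole
   chart.\<close>
 let ?D = "polydisc ?z r" and ?D' = "polydisc ?z (r / 2)" have D: "?D \<subseteq> chart_image c" using r e by blast
 have D': "?D' \<subseteq> ?D" by(rule polydisc_mono) (use r in simp)
 have sm: "smooth_on ?D (%w. \<alpha> k c w $ i $ l)" for k i l
  using is_form11_alpha[of k] c(1) D smooth_on_subset unfolding is_form11_def by blast
 have "EX g. smooth_on ?D' g & (ALL w:?D'. ALL i l. wd (Inr l) (wd (Inl i) g) w = - \<alpha> k c w $ i $ l)" for k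
 proof(rule ddbar_poincare[where \<alpha> = "%i l w. - \<alpha> k c w $ i $ l" and r = r])
  show "smooth_on ?D (%w. - \<alpha> k c w $ i $ l)" for i l by(intro smooth_intros open_polydisc sm)
  fix i j l w assume w: "w : ?D"
  have d: "(%w. \<alpha> k c w $ i $ l) differentiable (at w)" for i l using smooth_on_deriv[OF sm w] by simp
  have "ALL z:chart_image c. ALL i j l. wd (Inl l) (%w. \<alpha> k c w $ i $ j) z = wd (Inl i) (%w. \<alpha> k c w $ l $ j) z &
    wd (Inr l) (%w. \<alpha> k c w $ i $ j) z = wd (Inr j) (%w. \<alpha> k c w $ i $ l) z"
   using closed_alpha[of k] c(1) unfolding closed_form11_def by blast
  hence "wd (Inl j) (%w. \<alpha> k c w $ i $ l) w = wd (Inl i) (%w. \<alpha> k c w $ j $ l) w"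
   "wd (Inr j) (%w. \<alpha> k c w $ i $ l) w = wd (Inr l) (%w. \<alpha> k c w $ i $ j) w" using w D by blast+
  thus "wd (Inl j) (%w. - \<alpha> k c w $ i $ l) w = wd (Inl i) (%w. - \<alpha> k c w $ j $ l) w"
   "wd (Inr j) (%w. - \<alpha> k c w $ i $ l) w = wd (Inr l) (%w. - \<alpha> k c w $ i $ j) w" by(simp_all add: wirtinger_uminus d)
 qed (use r in auto)
 then obtain G where G: "!!k. smooth_on ?D' (G k)" "!!k w i l. w : ?D' ==> wd (Inr l) (wd (Inl i) (G k)) w = - \<alpha> k c w $ i $ l"
  by metis
 define g where "g w = Abs_fps (%k. if k = 0 then 0 else G k w)" for w
 have g: "(%w. g w $ k) = (if k = 0 then (%_. 0) else G k)" for k by(auto simp: g_def fun_eq_iff)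
 have "local_potential \<alpha> c ?D' g" unfolding local_potential_def
 proof(intro conjI ballI allI)
  show "open ?D'" by(rule open_polydisc)
  show "?D' \<subseteq> chart_image c" using D D' by blast
  show "fsmooth_on ?D' g" unfolding fsmooth_on_def g using G(1) by(simp add: smooth_on_const open_polydisc)
  fix w i j assume w: "w : ?D'" show "formal_coeff \<alpha> c i j w = - fwd (Inr j) (fwd (Inl i) g) w"
  proof(rule fps_ext)
   fix n have "fwd (Inr j) (fwd (Inl i) g) w $ n = wd (Inr j) (wd (Inl i) (%w. g w $ n)) w" by(simp add: fwirtinger_def)
   also have "... = (if n = 0 then 0 else - \<alpha> n c w $ i $ j)"
   proof(cases "n = 0")
    case True have "wd (Inl i) (%_. 0) = (%_ :: complex^'n. 0 :: complex)" by(simp add: fun_eq_iff) thus ?thesis using True by(simp add: g)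
   qed (simp add: g G(2)[OF w])
   finally show "formal_coeff \<alpha> c i j w $ n = (- fwd (Inr j) (fwd (Inl i) g) w) $ n" by(simp add: formal_coeff_def)
  qed
 qed
 moreover have "?z : ?D'" by(rule center_in_polydisc) (use r in simp)
 ultimately show ?thesis by blast
qed

text \<open>A nonempty word sees only the holomorphic gradient, so antiholomorphic ambiguities of
  potentials disappear.\<close>

lemma Xops_cong: assumes c: "c : \<A>" "x : fst c" and K: "K ~= []" and e: "!!i. fD (Inl i) F = fD (Inl i) F'"
 shows "Xops c x K F = Xops c x K F'"
proof - interpret x: wick_germ_pot "gC c x" "wg c x" "Wg c x" "Ug c x" by(rule pot_at[OF c])
 have "gD (Inl i) (F $ n) = gD (Inl i) (F' $ n)" for i n using e by(metis fD_nth)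
 hence "Xop c x a F = Xop c x a F'" for a by(simp add: fps_eq_iff x.X_def)
 thus ?thesis using K
 proof(induction K)
  case (Cons a K) thus ?case by(cases "K = []") auto
 qed simp
qed

text \<open>Up to antiholomorphic functions the conjugate derivative of the potential is minus
  \<open>ub\<close>; the sign is the one relating the potential to \<alpha>.\<close>

lemma potential_germ: assumes c: "c : \<A>" "x : fst c" and V: "snd c x : V" "local_potential \<alpha> c V g"
 shows "fD (Inl i) (fD (Inr l) (fgerm (snd c x) g)) = - fD (Inl i) (wick_germ_pot.ub (Ug c x) l)"
proof(rule fps_ext)
 fix n let ?z = "snd c x"
 interpret x: wick_germ_pot "gC c x" "wg c x" "Wg c x" "Ug c x" by(rule pot_at[OF c])
 have oV: "open V" and fs: "fsmooth_on V g" and e: "!!w. w : V ==> formal_coeff \<alpha> c i l w = - fwd (Inr l) (fwd (Inl i) g) w"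
  using V(2) unfolding local_potential_def by blast+
 have s: "smooth_at ?z (%w. g w $ n)" using fs V(1) oV smooth_atI unfolding fsmooth_on_def by blast
 have "gD (Inl i) (gD (Inr l) (germ ?z (%w. g w $ n))) = germ ?z (wd (Inr l) (wd (Inl i) (%w. g w $ n)))"
  by(simp add: germ_wirtinger smooth_at_wirtinger s gD_commute[of "Inr l"])
 also have "... = germ ?z (%w. - (if n = 0 then 0 else \<alpha> n c w $ i $ l))"
 proof(rule germ_cong)
  show "smooth_at ?z (wd (Inr l) (wd (Inl i) (%w. g w $ n)))" by(intro smooth_at_wirtinger s)
  have "wd (Inr l) (wd (Inl i) (%w. g w $ n)) w = - (if n = 0 then 0 else \<alpha> n c w $ i $ l)" if "w : V" for w
   using arg_cong[OF e[OF that], of "%F. - (F $ n)"] by(simp add: formal_coeff_def fwirtinger_def)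
  thus "\<forall>\<^sub>F w in nhds ?z. wd (Inr l) (wd (Inl i) (%w. g w $ n)) w = - (if n = 0 then 0 else \<alpha> n c w $ i $ l)"
   using eventually_nhds_in_open[OF oV V(1)] by(auto elim: eventually_mono)
 qed
 also have "... = - gD (Inl i) (x.ub l $ n)"
 proof(cases "n = 0")
  case False thus ?thesis using germ_alpha[OF c, of n i l] by(simp add: germ_minus x.ub_def)
 qed (simp add: germ_zero)
 finally show "fD (Inl i) (fD (Inr l) (fgerm ?z g)) $ n = (- fD (Inl i) (x.ub l)) $ n" by simp
qed

text \<open>The three parts of the connection form fill disjoint places of one element: the
  Christoffel symbols have one holomorphic and one antiholomorphic letter, the curvature series at
  least two holomorphic and one antiholomorphic, and the series of \<alpha> has holomorphic letters
  only.\<close>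

theorem hat_I_alpha: assumes c: "c : \<A>" "x : fst c"
 shows "kaehler_local.H1 (\<omega> c) l (snd c x) P + hj (fr (\<omega> c (snd c x))) (I_alpha \<omega> \<alpha> c l (snd c x)) P
  = fev (hlc c x l P)"
proof - let ?z = "snd c x"
 interpret x: wick_germ_pot "gC c x" "wg c x" "Wg c x" "Ug c x" by(rule pot_at[OF c])
 define g where "g = (SOME g. EX V. ?z : V & local_potential \<alpha> c V g)"
 have "EX V. ?z : V & local_potential \<alpha> c V g" using ex_alpha_potential[OF c] unfolding g_def by(rule someI_ex)
 then obtain V1 where V1: "?z : V1" "local_potential \<alpha> c V1 g" by blast
 obtain u where u: "!!a. sf (u a)" "!!a. cg c x (u a) = Ug c x a $ 0" using ex_local_potential[OF c] by metis
 have su: "smooth_at (snd c y) (lf c (u a))" if "y : fst c" for y a by(rule smooth_funD[OF u(1) c(1) that])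
 have "near x (%y. y : fst c & (ALL a i. gD (Inl i) (cg c y (u a)) = - Wg c y i a))" by(rule eventually_local_potential[OF c u])
 hence "near x (%y. ALL a i. wd (Inl i) (lf c (u a)) (snd c y) = - \<omega> c (snd c y) $ i $ a)"
 proof eventually_elim
  case (elim y) hence y: "y : fst c" by blast have "gev (gD (Inl i) (cg c y (u a))) = gev (- Wg c y i a)" for a i using elim by simp
  thus ?case by(simp add: cg_def germ_wirtinger[symmetric] su[OF y] gev_germ smooth_at_wirtinger Wg_def smooth_at_omega[OF c(1) y])
 qed
 hence "\<forall>\<^sub>F w in nhds ?z. ALL a i. wd (Inl i) (lf c (u a)) (snd c (chart_inv c w)) = - \<omega> c (snd c (chart_inv c w)) $ i $ a"
  using eventually_chart[OF c, of "%y. ALL a i. wd (Inl i) (lf c (u a)) (snd c y) = - \<omega> c (snd c y) $ i $ a"] by simp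
 hence "\<forall>\<^sub>F w in nhds ?z. w : chart_image c & (ALL a i. wd (Inl i) (lf c (u a)) w = - \<omega> c w $ i $ a)"
  using near_chart_image[OF c] by eventually_elim (simp add: c)
 then obtain V2 where V2: "open V2" "?z : V2" "!!w. w : V2 ==> w : chart_image c & (ALL a i. wd (Inl i) (lf c (u a)) w = - \<omega> c w $ i $ a)"
  unfolding eventually_nhds by blast
 define V where "V = V1 \<inter> V2" have oV1: "open V1" and gs: "fsmooth_on V1 g" using V1(2) unfolding local_potential_def by auto
 have V: "open V" "?z : V" "V \<subseteq> chart_image c" using V1 V2 oV1 by(auto simp: V_def intro: open_Int)
 interpret K: kaehler_local V "\<omega> c" by(rule kaehler_local_at[OF c(1) V(1,3)])
 \<comment> \<open>Commuting its derivatives with those of \<open>u\<close> gives the derivatives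
   that \<open>hat_I_curv\<close> asks for.\<close>
 define h where "h k w = - wd (Inr l) (lf c (u k)) w" for k w have suV: "smooth_at w (lf c (u k))" if "w : V" for w k
 proof - have w: "w : chart_image c" using that V by blast
  show ?thesis using su[OF chart_inv_in[OF c(1) w]] w by(simp add: c)
 qed
 have h: "smooth_at w (h k)" if "w : V" for w k unfolding h_def[abs_def] by(intro smooth_at_minus smooth_at_wirtinger suV that)
 have dh: "wd (Inl p) (h k) w = K.dO (Inr l) p k w" if w: "w : V" for w p k
 proof - have "smooth_on V (lf c (u k))" using suV by(simp add: smooth_on_iff_at V(1))
  hence cm: "wd (Inl p) (wd (Inr l) (lf c (u k))) w = wd (Inr l) (wd (Inl p) (lf c (u k))) w" by(rule wirtinger_commute[OF V(1) _ w])
  have "wd (Inr l) (wd (Inl p) (lf c (u k))) w = wd (Inr l) (%w. - \<omega> c w $ p $ k) w"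
   by(rule wirtinger_cong[OF V(1) w]) (use V2(3) in \<open>auto simp: V_def\<close>)
  also have "... = - K.dO (Inr l) p k w" by(rule wirtinger_uminus[OF smooth_at_differentiable[OF K.sO[OF w]]])
  finally show ?thesis
   unfolding h_def[abs_def] wirtinger_uminus[OF smooth_at_differentiable[OF smooth_at_wirtinger[OF suV[OF w]]]] cm by simp
 qed
 have g: "fsmooth_at w g" if "w : V" for w using gs fsmooth_on_iff[OF oV1] that by(auto simp: V_def)
 have hcm: "XX c K (%w. cst (h k w)) ?z = fev (x.hc l K [k])" for K k
 proof - have "fgerm ?z (%w. cst (h k w)) = - fD (Inr l) (cst (Ug c x k $ 0))"
  proof - have "germ ?z (h k) = - gD (Inr l) (Ug c x k $ 0)" unfolding h_def[abs_def] u(2)[symmetric] cg_def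
    by(simp add: germ_minus germ_wirtinger smooth_at_intros suV[OF V(2)])
   thus ?thesis by(simp add: fgerm_fps_const[OF h[OF V(2)]])
  qed
  thus ?thesis unfolding XX_value[OF c fsmooth_at_fps_const[OF h[OF V(2)]]] x.hc_def x.u_def by(simp only: x.Xs_minus list.case)
 qed
 have hc0: "XX c K (fwd (Inr l) g) ?z = fev (x.hc l K [])" if "K ~= []" for K
 proof - have "Xops c x K (fD (Inr l) (fgerm ?z g)) = Xops c x K (- x.ub l)"
   by(rule Xops_cong[OF c that]) (simp only: potential_germ[OF c V1] fD_minus)
  thus ?thesis unfolding XX_value[OF c fsmooth_at_fwirtinger[OF g[OF V(2)]]] fgerm_fwirtinger[OF g[OF V(2)]]
   by(simp add: x.hc_def x.Xs_minus)
 qed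
 have I: "hj (fr (\<omega> c ?z)) (I_alpha \<omega> \<alpha> c l ?z) P = K.hat (I_curv (\<omega> c) l) P ?z + K.hat (J_pot (\<omega> c) g l) P ?z"
 proof - have "I_alpha \<omega> \<alpha> c l ?z = (%m. I_curv (\<omega> c) l ?z m + J_pot (\<omega> c) g l ?z m)"
   by(rule ext) (simp add: I_alpha_def J_alpha_def g_def)
  thus ?thesis by(simp only: hj_add K.hat_def)
 qed
 \<comment> \<open>The Christoffel symbols are the first derivatives of \<open>h\<close> along the
   fields \<open>X\<close>, so they continue the curvature towers down to degree one.\<close>
 have H1: "K.H1 l ?z P = (if length (lefts P) = 1 then (case rights P of [k] => fev (x.hc l (lefts P) [k]) | _ => 0) else 0)"
 proof(cases "length (lefts P) = 1")
  case True then obtain a where a: "lefts P = [a]" by(metis One_nat_def length_0_conv length_Suc_conv)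
  have "XX c [a] (%w. cst (h k w)) ?z = cst (- K.q a l k ?z)" for k
   by(simp add: K.fXv_def fwirtinger_fps_const dh[OF V(2)] K.q_def fps_const_sum)
  thus ?thesis by(auto simp: K.H1_def a hcm[symmetric] simp del: K.fXs_simps split: list.split)
 next case False
  thus ?thesis by(auto simp: K.H1_def split: list.split)
 qed
 have hI: "K.hat (I_curv (\<omega> c) l) P ?z = (if 2 <= length (lefts P) then (case rights P of [k] => fev (x.hc l (lefts P) [k]) | _ => 0) else 0)"
  using K.hat_I_curv[OF h dh V(2), of P] by(simp only: hcm)
 have hJ: "K.hat (J_pot (\<omega> c) g l) P ?z = (if lefts P ~= [] & rights P = [] then XX c (lefts P) (fwd (Inr l) g) ?z else 0)"
  by(rule K.hat_J_pot[OF g V(2)])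
 show ?thesis
 proof(cases "lefts P = []")
  case True thus ?thesis unfolding I H1 hI hJ by(simp add: x.hlg_def)
 next case False
  hence e: "length (lefts P) = 1 \<longleftrightarrow> ~ 2 <= length (lefts P)" by(cases "lefts P" rule: remdups_adj.cases) auto
  have z: "x.hc l K (m # m' # M) = 0" for K m m' M by(simp add: x.hc_def)
  show ?thesis unfolding I H1 hI hJ e using False hc0[OF False] by(cases "rights P" rule: remdups_adj.cases) (auto simp: x.hlg_def z)
 qed
qed

end

lemma fev_shift: "fev (fps_shift n F) = fps_shift n (fev F)" by(simp add: fps_eq_iff)

lemma fev_jprod: "fev (jprod P a b) = jprod P (%Q. fev (a Q)) (%Q. fev (b Q))" by(induction P arbitrary: a b) simp_all

lemma fev_jwt: "fev (jwt k P a b) = jwt k P (%Q. fev (a Q)) (%Q. fev (b Q))"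
 by(induction k arbitrary: a b) (simp_all add: fev_jprod fev_sum)

lemma fev_jwick: "fev (jwick P a b) = jwick P (%Q. fev (a Q)) (%Q. fev (b Q))" by(simp add: fps_eq_iff jwick_nth gev_sum fev_jwt[symmetric])

lemma hj_shift: "hj E (%m. fps_shift 1 (a m)) P = fps_shift 1 (hj E a P)"
proof(induction P arbitrary: a)
 case (Cons A P) have "dl v (%m. fps_shift 1 (a m)) = (%m. fps_shift 1 (dl v a m))" for v
  by(rule ext, rule fps_ext) (simp add: dl_def yderiv_def fps_sum_nth flip: fps_of_nat)
 thus ?case by(simp add: Cons.IH[unfolded One_nat_def])
qed simp

lemma jprod_nth_zero: fixes a b :: "'i list => 'r::comm_ring_1 fps"
 assumes "!!N N'. length N + length N' = length M ==> (a N * b N') $ i = 0" shows "jprod M a b $ i = 0" using assms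
proof(induction M arbitrary: a b)
 case (Cons A M) have "jprod M (%N. a (A # N)) b $ i = 0" "jprod M a (%N. b (A # N)) $ i = 0" by(rule Cons.IH, rule Cons.prems, simp)+
 thus ?case by simp
qed simp

lemma jwick_diff1: "jwick P (%Q. a Q - a' Q) b = jwick P a b - jwick P a' b"
 and jwick_diff2: "jwick P b (%Q. a Q - a' Q) = jwick P b a - jwick P b a'"
 using jwick_add1[of P "%Q. a Q - a' Q" a' b] jwick_add2[of P b "%Q. a Q - a' Q" a'] by simp_all

text \<open>Interchanging two letters interchanges two finite sums; symmetry of the family restores
  the argument.\<close>

lemma mc_perm: assumes h: "jsym h" shows "mset P = mset Q ==> mc M P h = mc M Q h" using h
proof(induction P arbitrary: Q h)
 case (Cons A P) have sw: "mc M (Q1 @ A # Q2) h = mc M (A # Q1 @ Q2) h" if "jsym h" for Q1 Q2 h using that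
 proof(induction Q1 arbitrary: h)
  case (Cons B Q1) have "mc M ((B # Q1) @ A # Q2) h = (SS C. M B C * mc M (A # Q1 @ Q2) (%Q. h (C # Q)))"
   using Cons.IH[OF jsym_Cons[OF Cons.prems]] by simp
  also have "... = (SS C D. M B C * (M A D * mc M (Q1 @ Q2) (%Q. h (C # D # Q))))" by(simp add: sum_distrib_left)
  also have "... = (SS D C. M A D * (M B C * mc M (Q1 @ Q2) (%Q. h (D # C # Q))))"
  proof - have "h (C # D # Q) = h (D # C # Q)" for C D Q by(rule jsymD[OF Cons.prems]) simp
   thus ?thesis by(subst sum.swap) (simp only: mult.left_commute)
  qed
  finally show ?case by(simp add: sum_distrib_left)
 qed simp
 obtain Q1 Q2 where Q: "Q = Q1 @ A # Q2" by(metis Cons.prems(1) list.set_intros(1) mset_eq_setD split_list)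
 have "mset P = mset (Q1 @ Q2)" using Cons.prems(1) Q by simp
 hence "mc M P (%Q. h (B # Q)) = mc M (Q1 @ Q2) (%Q. h (B # Q))" for B by(rule Cons.IH) (rule jsym_Cons[OF Cons.prems(2)])
 thus ?case unfolding Q sw[OF Cons.prems(2)] by simp
qed simp

lemma fsmooth_mc: assumes "!!A B. smooth_at z (%w. M w A B)" "!!Q. fsmooth_at z (h Q)"
 shows "fsmooth_at z (%w. mc (%A B. cst (M w A B)) P (%Q. h Q w))" using assms(2)
proof(induction P arbitrary: h)
 case (Cons A P) show ?case unfolding mc.simps
  by(intro fsmooth_at_sum fsmooth_at_mult fsmooth_at_fps_const assms(1)) (rule Cons.IH, rule Cons.prems)
qed simp

context kaehler_local begin

text \<open>Since \<open>H1\<close> is quadratic, contractions of order two and more vanish and the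
  commutator is exact at first order.\<close>

lemma H1_commutator: "fps_shift 1 (jwick P (H1 l z) h - jwick P h (H1 l z)) =
  (SS j. zsum P (%A. H1 l z [Inl j, A]) (%N. h (Inr j # N)) - zsum P (%A. H1 l z [Inr j, A]) (%N. h (Inl j # N)))"
proof - have z: "H1 l z (A # B # C # Q) = 0" "H1 l z [A] = 0" for A B C Q
  by(cases A; cases B; cases C; simp add: H1_def split: list.split) (cases A; simp add: H1_def)
 have l2: "H1 l z (map Inl J @ Q) = 0" "H1 l z (map Inr J @ Q) = 0" if J: "2 <= length J" for J Q
 proof - obtain j j' J' where "J = j # j' # J'" using J by(cases J rule: remdups_adj.cases) auto
  thus "H1 l z (map Inl J @ Q) = 0" "H1 l z (map Inr J @ Q) = 0" by(simp_all add: H1_def split: list.split)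
 qed
 have "fps_shift 1 (jwick P (H1 l z) h - jwick P h (H1 l z)) = jwt 1 P (H1 l z) h - jwt 1 P h (H1 l z)"
  by(rule jwick_commutator_linear) (simp_all add: jwt_lists l2 jprod_zero1 jprod_zero2)
 moreover have "jprod P (%Q. H1 l z (B # Q)) t = zsum P (%A. H1 l z [B, A]) t" for B t
 proof - have "jprod P (%Q. H1 l z (B # Q)) t = H1 l z [B] * t P + zsum P (%A. H1 l z [B, A]) t"
  proof(rule jprod_short)
   fix N :: "('n + 'n) list" assume "2 <= length N" then obtain C D N' where "N = C # D # N'" by(cases N rule: remdups_adj.cases) auto
   thus "H1 l z (B # N) = 0" using z(1) by simp
  qed
  thus ?thesis by(simp add: z)
 qed
 ultimately show ?thesis by(simp add: jprod_commute[of P "%Q. h (_ # Q)"] sum_subtractf)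
qed

end

context kaehler_wick begin

text \<open>The inverse of the frame matrix, expressing coordinate vectors through the
  frame.\<close>

definition Vm :: "('a, 'n) chart => complex^'n => 'n + 'n => 'n + 'n => complex" where
 "Vm c z A B = (case (A, B) of (Inl i, Inl a) => - \<omega> c z $ i $ a | (Inr a, Inr b) => (if a = b then 1 else 0) | _ => 0)"

lemma Vm_simps [simp]: "Vm c z (Inl i) (Inl a) = - \<omega> c z $ i $ a" "Vm c z (Inr a) (Inr b) = (if a = b then 1 else 0)"
 "Vm c z (Inl i) (Inr b) = 0" "Vm c z (Inr a) (Inl i) = 0" by(simp_all add: Vm_def)

lemma Vm_fr: assumes "c : \<A>" "z : chart_image c" shows "(SS B. Vm c z A B * fr (\<omega> c z) B C) = (if A = C then 1 else 0)"
  and "(SS B. fr (\<omega> c z) A B * Vm c z B C) = (if A = C then 1 else 0)"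
proof - have r: "(SS a. \<omega> c z $ i $ a * omega_up (\<omega> c z) k a) = (if k = i then -1 else 0)" for i k
  using omega_up_right[OF invertible_omega[OF assms], of k i] by(simp add: mult.commute)
 have l: "(SS i. omega_up (\<omega> c z) i a * \<omega> c z $ i $ b) = (if a = b then -1 else 0)" for a b
  by(rule omega_up_left[OF invertible_omega[OF assms]])
 show "(SS B. Vm c z A B * fr (\<omega> c z) B C) = (if A = C then 1 else 0)"
  by(cases A; cases C) (simp_all add: sum_UNIV_sum sum_negf r if_distrib[of "%x. x * _"] cong: if_cong)
 show "(SS B. fr (\<omega> c z) A B * Vm c z B C) = (if A = C then 1 else 0)"
  by(cases A; cases C) (simp_all add: sum_UNIV_sum sum_negf l if_distrib[of "%x. x * _"] cong: if_cong)
qed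

definition oh :: "('a => complex fps) => ('a, 'n) chart => ('n + 'n) list => complex^'n => complex fps" where
 "oh F c P z = XX c (lefts P) (tt F (rights P) c) z"

lemma oh_germ: assumes c: "c : \<A>" "x : fst c" and F: "ff F" shows "fsmooth_at (snd c x) (oh F c P)"
  and "fgerm (snd c x) (oh F c P) = wick_germ_pot.Og (gC c x) (wg c x) (Ug c x) (fcg c x F) P"
  and "oh F c P (snd c x) = fev (Xops c x (lefts P) (Tg c x F (rights P)))"
proof - interpret x: wick_germ_pot "gC c x" "wg c x" "Wg c x" "Ug c x" by(rule pot_at[OF c])
 note t = tt_coherent[OF c F]
 show s: "fsmooth_at (snd c x) (oh F c P)" unfolding oh_def[abs_def] by(rule fgerm_XX(1)[OF c t(1)])
 show e: "fgerm (snd c x) (oh F c P) = x.Og (fcg c x F) P" unfolding oh_def[abs_def] fgerm_XX(2)[OF c t(1)] t(2) x.Og_def Tg_def ..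
 show "oh F c P (snd c x) = fev (Xops c x (lefts P) (Tg c x F (rights P)))" unfolding oh_def XX_value[OF c t(1)] t(2) ..
qed

lemma jsym_oh: assumes c: "c : \<A>" "x : fst c" and F: "ff F" shows "jsym (%P. oh F c P (snd c x))"
proof - interpret x: wick_germ_pot "gC c x" "wg c x" "Wg c x" "Ug c x" by(rule pot_at[OF c])
 have "oh F c P (snd c x) = fev (x.Og (fcg c x F) P)" for P using fev_fgerm[OF oh_germ(1)[OF c F]] oh_germ(2)[OF c F] by metis
 thus ?thesis using x.jsym_Og[of "fcg c x F"] unfolding jsym_def by metis
qed

text \<open>The candidate for the flat lift: frame jets are converted to coordinate jets and these
  to Taylor coefficients. Outside the charts it has the normalised value zero.\<close>

definition Osec :: "('a => complex fps) => ('a, 'n) weyl" where "Osec F c z = (if c : \<A> & z : chart_image c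
   then fibre_of (%P. mc (%A B. cst (Vm c z A B)) P (%Q. oh F c Q z)) else (%_. 0))"

lemma jet_Osec: assumes c: "c : \<A>" "x : fst c" and F: "ff F"
 shows "jet (Osec F c (snd c x)) P = mc (%A B. cst (Vm c (snd c x) A B)) P (%Q. oh F c Q (snd c x))"
proof - have "Osec F c (snd c x) = fibre_of (%P. mc (%A B. cst (Vm c (snd c x) A B)) P (%Q. oh F c Q (snd c x)))"
  using c by(simp add: Osec_def)
 thus ?thesis by(simp only: jet_fibre_of[OF mc_perm[OF jsym_oh[OF c F]]])
qed

lemma hj_Osec: assumes c: "c : \<A>" "x : fst c" and F: "ff F"
 shows "hj (fr (\<omega> c (snd c x))) (Osec F c (snd c x)) P = oh F c P (snd c x)"
proof - let ?z = "snd c x" and ?E = "fr (\<omega> c (snd c x))"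
 have z: "?z : chart_image c" using c by simp
 have "?E = (%A C. SS B. ?E A B * (if B = C then 1 else 0))" by(simp add: fun_eq_iff if_distrib[of "%x. _ * x"] cong: if_cong)
 hence "hj ?E (Osec F c ?z) P = mc (%A B. cst (?E A B)) P (jet (Osec F c ?z))"
  using hj_mc[of ?E "%B C. if B = C then 1 else 0" "Osec F c ?z" P] by(simp add: jet_hj[abs_def])
 also have "... = mc (%A C. SS B. cst (?E A B) * cst (Vm c ?z B C)) P (%Q. oh F c Q ?z)" unfolding jet_Osec[OF c F, abs_def] mc_mc ..
 also have "(%A C. SS B. cst (?E A B) * cst (Vm c ?z B C)) = (%A C. if A = C then 1 else 0 :: complex fps)"
 proof(intro ext)
  fix A C have "(SS B. cst (?E A B) * cst (Vm c ?z B C)) = cst (SS B. ?E A B * Vm c ?z B C)" by(simp add: fps_const_sum)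
  thus "(SS B. cst (?E A B) * cst (Vm c ?z B C)) = (if A = C then 1 else 0 :: complex fps)" unfolding Vm_fr(2)[OF c(1) z] by simp
 qed
 finally show ?thesis by(simp only: mc_id)
qed

lemma fsmooth_Osec: assumes c: "c : \<A>" "x : fst c" and F: "ff F" shows "fsmooth_at (snd c x) (%z. Osec F c z m)"
proof - have V: "smooth_at (snd c x) (%w. Vm c w A B)" for A B
  by(cases A; cases B) (simp_all add: smooth_at_minus[OF smooth_at_omega[OF c]] smooth_at_const)
 let ?r = "cst (1 / (PROD A:UNIV. fact (m A)))"
 have s: "fsmooth_at (snd c x) (%w. ?r * mc (%A B. cst (Vm c w A B)) (exp_list m) (%Q. oh F c Q w))"
  by(intro fsmooth_at_mult fsmooth_at_const fsmooth_mc V oh_germ(1)[OF c F])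
 show ?thesis by(rule fsmooth_at_cong[OF s]) (rule eventually_mono[OF near_chart_image[OF c]], simp add: Osec_def c fibre_of_def)
qed

lemma sm_Osec: "c : \<A> ==> ff F ==> kaehler_local.sm (chart_image c) (Osec F c)"
 unfolding kaehler_local.sm_def[OF kaehler_chart] using fsmooth_Osec by(auto simp: chart_image_def)

text \<open>In coordinates only the holomorphic letters are transformed, by minus the Kaehler form;
  the antiholomorphic half of the frame is already the coordinate one.\<close>

lemma jet_Osec_split: assumes c: "c : \<A>" "x : fst c" and F: "ff F"
 shows "jet (Osec F c (snd c x)) P = mc (%i a. cst (- \<omega> c (snd c x) $ i $ a)) (lefts P) (%K. fev (Xops c x K (Tg c x F (rights P))))"
proof - let ?V = "%A B. cst (Vm c (snd c x) A B)"
 have "mc ?V P (%Q. fev (Xops c x (lefts Q) (Tg c x F (rights Q)))) =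
  mc (%i k. ?V (Inl i) (Inl k)) (lefts P) (%K. mc (%j l. ?V (Inr j) (Inr l)) (rights P) (%M. fev (Xops c x K (Tg c x F M))))"
  by(rule mc_split) simp_all
 moreover have "(%j l. ?V (Inr j) (Inr l)) = (%j l. if j = l then 1 else 0)" by(simp add: fun_eq_iff)
 ultimately show ?thesis unfolding jet_Osec[OF c F] oh_germ(3)[OF c F] by(simp only: mc_id Vm_simps)
qed

text \<open>Frame jets change by conjugate Jacobians in both kinds of letters. For the holomorphic
  letters lowering with the Kaehler form converts this into the required holomorphic
  Jacobian.\<close>

lemma weyl_section_Osec: assumes F: "ff F" shows "weyl_section \<A> (Osec F)" unfolding weyl_section_def
proof(intro conjI ballI allI)
 show "fsmooth_on (chart_image c) (%z. Osec F c z m)" if "c : \<A>" for c m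
  unfolding fsmooth_on_iff[OF open_chart_image[OF that]] using fsmooth_Osec[OF that _ F] by(auto simp: chart_image_def)
 show "c ~: \<A> \<or> z ~: chart_image c --> Osec F c z = (%_. 0)" for c z by(auto simp: Osec_def)
 fix c c' z and P :: "('n + 'n) list" assume c: "c : \<A>" "c' : \<A>" and "z : overlap c c'"
 then obtain x where x: "x : fst c" "x : fst c'" and z: "z = snd c x" by blast
 have zo: "z : overlap c c'" using x z by blast
 obtain e where e: "!!K M. fev (Xops c x K (Tg c x F M)) = mc (%l q. cst (jacobian c c' (Inr q) (Inr l) (snd c x))) M (e K)"
  "!!K M. fev (Xops c' x K (Tg c' x F M)) = mc (%q j. cst (jacobian c c' (Inr q) (Inr j) (snd c x))) K (%K'. e K' M)"
  using hat_change[OF c x F] by metis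
 let ?J = "%A B. cst (jacobian c c' B A z)"
 let ?V' = "%p q. cst (- \<omega> c' (snd c' x) $ p $ q)" and ?Jl = "%q j. cst (jacobian c c' (Inr q) (Inr j) z)"
 have j': "jet (Osec F c' (snd c' x)) Q = mc (%p j. SS q. ?V' p q * ?Jl q j) (lefts Q) (%K. e K (rights Q))" for Q
  unfolding jet_Osec_split[OF c(2) x(2) F] e(2) z[symmetric] mc_mc ..
 have "(SUM Q:words (length P). (PROD r<length P. cst (jacobian c c' (Q ! r) (P ! r) z)) * jet (Osec F c' (snd c' x)) Q)
  = mc ?J P (%Q. mc (%p j. SS q. ?V' p q * ?Jl q j) (lefts Q) (%K. e K (rights Q)))" unfolding mc_eq_sum[of ?J] j' ..
 also have "... = mc (%i p. ?J (Inl i) (Inl p)) (lefts P) (%L. mc (%l q. ?J (Inr l) (Inr q)) (rights P)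
   (%M. mc (%p j. SS q. ?V' p q * ?Jl q j) L (%K. e K M)))" by(rule mc_split) (simp_all add: jacobian_mixed[OF c zo])
 also have "... = mc (%i j. SS p. ?J (Inl i) (Inl p) * (SS q. ?V' p q * ?Jl q j)) (lefts P)
   (%K. mc (%l q. ?J (Inr l) (Inr q)) (rights P) (e K))" unfolding mc_swap[of "%l q. ?J (Inr l) (Inr q)"] mc_mc ..
 \<comment> \<open>The transformation law of the Kaehler form absorbs both Jacobians.\<close>
 also have "(%i j. SS p. ?J (Inl i) (Inl p) * (SS q. ?V' p q * ?Jl q j)) = (%i j. cst (- \<omega> c z $ i $ j))"
  by(intro ext) (simp add: z omega_change[OF c x] sum_negf sum_distrib_left mult_ac flip: fps_const_sum)
 finally show "jet (Osec F c z) P = (SUM Q:words (length P). (PROD r<length P. cst (jacobian c c' (Q ! r) (P ! r) z)) * jet (Osec F c' (transition c c' z)) Q)"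
  unfolding z transition_apply[OF c(1) x(1)] jet_Osec_split[OF c(1) x(1) F] e(1) by simp
qed

lemma symbol_Osec: assumes F: "ff F" shows "symbol \<A> (Osec F) = F"
proof
 fix x let ?c = "chart_at \<A> x"
 interpret x: wick_germ_pot "gC ?c x" "wg ?c x" "Wg ?c x" "Ug ?c x" by(rule pot_at[OF chart_at])
 have "symbol \<A> (Osec F) x = jet (Osec F ?c (snd ?c x)) []" by(simp add: symbol_def Let_def jet_def)
 also have "... = F x" unfolding jet_Osec_split[OF chart_at F] by(simp add: Tg_def fev_fcg[OF chart_at F])
 finally show "symbol \<A> (Osec F) x = F x" .
qed

lemma hj_yderiv: assumes c: "c : \<A>" "z : chart_image c"
 shows "hj (fr (\<omega> c z)) (yderiv (Inl i) a) P = - (SS b. cst (\<omega> c z $ i $ b) * hj (fr (\<omega> c z)) a (Inl b # P))"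
  and "hj (fr (\<omega> c z)) (yderiv (Inr l) a) P = hj (fr (\<omega> c z)) a (Inr l # P)"
proof - have e: "yderiv A a = (%m. SS B. cst (Vm c z A B) * dl (fr (\<omega> c z) B) a m)" for A
  using dl_lin[of "Vm c z A" "fr (\<omega> c z)" a] by(simp add: Vm_fr(1)[OF c] dl_single)
 have "hj (fr (\<omega> c z)) (yderiv A a) P = (SS B. cst (Vm c z A B) * hj (fr (\<omega> c z)) a (B # P))" for A
  unfolding e by(simp add: hj_sum hj_scale)
 thus "hj (fr (\<omega> c z)) (yderiv (Inl i) a) P = - (SS b. cst (\<omega> c z $ i $ b) * hj (fr (\<omega> c z)) a (Inl b # P))"
  "hj (fr (\<omega> c z)) (yderiv (Inr l) a) P = hj (fr (\<omega> c z)) a (Inr l # P)"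
  by(simp_all add: sum_UNIV_sum sum_negf if_distrib[of cst] if_distrib[of "%x. x * _"] cong: if_cong flip: fps_const_neg)
qed

text \<open>In the frame the Levi-Civita part of the connection is itself a commutator and combines
  with that of the connection form, so that only \<open>hlg\<close> remains.\<close>

lemma hj_fedosov: assumes c: "c : \<A>" "x : fst c" and s: "kaehler_local.sm (chart_image c) s"
 defines "E == fr (\<omega> c (snd c x))" and "h == kaehler_local.hat (\<omega> c) s"
 shows "hj E (fedosov \<omega> \<alpha> c (Inl i) s (snd c x)) P = fwd (Inl i) (h P) (snd c x)
   + (SS a. cst (\<omega> c (snd c x) $ i $ a) * h (Inl a # P) (snd c x))"
  and "hj E (fedosov \<omega> \<alpha> c (Inr l) s (snd c x)) P = fwd (Inr l) (h P) (snd c x) - h (Inr l # P) (snd c x)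
   + fps_shift 1 (jwick P (%Q. fev (hlc c x l Q)) (%Q. h Q (snd c x)) - jwick P (%Q. h Q (snd c x)) (%Q. fev (hlc c x l Q)))"
proof - let ?z = "snd c x"
 have z: "?z : chart_image c" using c by simp
 interpret K: kaehler_local "chart_image c" "\<omega> c" by(rule kaehler_chart[OF c(1)])
 have "fedosov \<omega> \<alpha> c (Inl i) s ?z = (%m. nabla (\<omega> c) (Inl i) s ?z m - yderiv (Inl i) (s ?z) m)"
  by(simp add: fedosov_def fun_eq_iff)
 thus "hj E (fedosov \<omega> \<alpha> c (Inl i) s ?z) P = fwd (Inl i) (h P) ?z + (SS a. cst (\<omega> c ?z $ i $ a) * h (Inl a # P) ?z)"
  using K.hat_nabla_hol[OF s z, of i P] hj_yderiv(1)[OF c(1) z, of i "s ?z" P]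
  by(simp add: hj_diff E_def h_def K.hat_def[of _ _ ?z] del: hj.simps)
 let ?I = "I_alpha \<omega> \<alpha> c l ?z" and ?H = "K.H1 l ?z" and ?h = "%Q. h Q ?z"
 have "fedosov \<omega> \<alpha> c (Inr l) s ?z = (%m. (nabla (\<omega> c) (Inr l) s ?z m - yderiv (Inr l) (s ?z) m)
  + fps_shift 1 (wick (\<omega> c ?z) ?I (s ?z) m - wick (\<omega> c ?z) (s ?z) ?I m))" by(simp add: fedosov_def fun_eq_iff)
 hence "hj E (fedosov \<omega> \<alpha> c (Inr l) s ?z) P = K.hat (nabla (\<omega> c) (Inr l) s) P ?z - h (Inr l # P) ?z
  + fps_shift 1 (jwick P (hj E ?I) ?h - jwick P ?h (hj E ?I))" using hj_yderiv(2)[OF c(1) z, of l "s ?z" P]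
  by(simp add: hj_add hj_diff hj_shift[unfolded One_nat_def] E_def hj_wick h_def K.hat_def[of _ _ ?z] K.hat_def[of _ _ ?z, abs_def] del: hj.simps)
 also have "K.hat (nabla (\<omega> c) (Inr l) s) P ?z = fwd (Inr l) (h P) ?z + fps_shift 1 (jwick P ?H ?h - jwick P ?h ?H)"
  unfolding K.H1_commutator h_def by(rule K.hat_nabla_anti[OF s z])
 also have "fwd (Inr l) (h P) ?z + fps_shift 1 (jwick P ?H ?h - jwick P ?h ?H) - h (Inr l # P) ?z
  + fps_shift 1 (jwick P (hj E ?I) ?h - jwick P ?h (hj E ?I)) = fwd (Inr l) (h P) ?z - h (Inr l # P) ?z
   + fps_shift 1 (jwick P (%Q. ?H Q + hj E ?I Q) ?h - jwick P ?h (%Q. ?H Q + hj E ?I Q))"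
  unfolding jwick_add1 jwick_add2 by(rule fps_ext) simp
 also have "(%Q. ?H Q + hj E ?I Q) = (%Q. fev (hlc c x l Q))" unfolding E_def by(rule ext) (rule hat_I_alpha[OF c])
 finally show "hj E (fedosov \<omega> \<alpha> c (Inr l) s ?z) P = fwd (Inr l) (h P) ?z - h (Inr l # P) ?z
   + fps_shift 1 (jwick P (%Q. fev (hlc c x l Q)) ?h - jwick P ?h (%Q. fev (hlc c x l Q)))" .
qed

lemma hat_Osec: assumes c: "c : \<A>" "z : chart_image c" and F: "ff F" shows "kaehler_local.hat (\<omega> c) (Osec F c) P z = oh F c P z"
 using hj_Osec[OF c(1) chart_inv_in[OF c] F] c by(simp add: kaehler_local.hat_def[OF kaehler_chart[OF c(1)]])

lemma flat_section_Osec: assumes F: "ff F" shows "flat_section \<A> \<omega> \<alpha> (Osec F)" unfolding flat_section_def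
proof(intro conjI ballI allI weyl_section_Osec[OF F])
 fix c z A m assume c: "c : \<A>" and z: "z : chart_image c" define x where "x = chart_inv c z"
 have x: "x : fst c" and zx: "z = snd c x" using c z by(simp_all add: x_def)
 interpret x: wick_germ_pot "gC c x" "wg c x" "Wg c x" "Ug c x" by(rule pot_at[OF c x])
 interpret K: kaehler_local "chart_image c" "\<omega> c" by(rule kaehler_chart[OF c])
 have hat: "K.hat (Osec F c) P w = oh F c P w" if "w : chart_image c" for P w by(rule hat_Osec[OF c that F])
 have ev: "near z (%w. K.hat (Osec F c) P w = oh F c P w)" for P by(rule eventually_mono[OF K.eventually_V[OF z] hat])
 have fw: "fwd B (K.hat (Osec F c) P) z = fev (fD B (x.Og (fcg c x F) P))" for B P
  using fwirtinger_cong[OF ev[of P], of B] fwirtinger_fev[OF oh_germ(1)[OF c x F, of P], of B] oh_germ(2)[OF c x F, of P] by(simp add: zx)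
 have oh: "oh F c P z = fev (x.Og (fcg c x F) P)" for P using fev_fgerm[OF oh_germ(1)[OF c x F, of P]] oh_germ(2)[OF c x F, of P] zx by simp
 note hf = hj_fedosov[OF c x sm_Osec[OF c F], folded zx]
 show "fedosov \<omega> \<alpha> c A (Osec F c) z m = 0"
 proof(rule hj_eq_zeroD[OF Vm_fr(1)[OF c z]])
  fix P :: "('n + 'n) list" let ?P = "map Inl (lefts P) @ map Inr (rights P)"
  have "hj (fr (\<omega> c z)) (fedosov \<omega> \<alpha> c A (Osec F c) z) ?P = 0"
  proof(cases A)
   \<comment> \<open>In the holomorphic directions flatness only says that jets are prolonged by the
     fields \<open>X\<close>, which are dual to minus the Kaehler form.\<close>
   case (Inl i) have "fD (Inl i) G + (SS a. cst (Wg c x i a) * Xop c x a G) = 0" for G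
   proof(rule fps_ext)
    fix n show "(fD (Inl i) G + (SS a. cst (Wg c x i a) * Xop c x a G)) $ n = 0 $ n" using x.gD_X[of i "G $ n"] by(simp add: fps_sum_nth)
   qed
   hence "fev (fD (Inl i) (x.Og (fcg c x F) ?P) + (SS a. cst (Wg c x i a) * x.Og (fcg c x F) (Inl a # ?P))) = 0" unfolding x.Og_Inl by simp
   thus ?thesis unfolding Inl hf fw hat[OF z] oh by(simp add: fev_sum Wg_def gev_germ smooth_at_omega[OF c x] zx)
  next case (Inr l)
   \<comment> \<open>The antiholomorphic component is exactly the defect \<open>Eg\<close>.\<close>
   have "fev (x.Eg (fcg c x F) l ?P) = 0" unfolding x.Eg_zero by simp
   thus ?thesis unfolding Inr hf fw hat[OF z] oh x.Eg_def by(simp add: fev_shift fev_jwick)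
  qed
  thus "hj (fr (\<omega> c z)) (fedosov \<omega> \<alpha> c A (Osec F c) z) P = 0" using hj_perm[OF mset_split_lists[of P]] by metis
 qed
qed

section \<open>Uniqueness of flat sections with given symbol\<close>

lemma hlg_value: assumes c: "c : \<A>" "x : fst c" defines "hl == %l Q. fev (hlc c x l Q)"
 shows "lefts Q = [] ==> hl l Q = 0" "2 <= length (rights Q) ==> hl l Q = 0" "rights Q = [] ==> fps_nth (hl l Q) 0 = 0"
proof - interpret x: wick_germ_pot "gC c x" "wg c x" "Wg c x" "Ug c x" by(rule pot_at[OF c])
 show "lefts Q = [] ==> hl l Q = 0" by(simp add: hl_def x.hlg_def)
 show "hl l Q = 0" if r: "2 <= length (rights Q)"
 proof - obtain m m' M where "rights Q = m # m' # M" using r by(cases "rights Q" rule: remdups_adj.cases) auto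
  thus ?thesis by(simp add: hl_def x.hlg_def x.hc_def)
 qed
 have "foldr x.X K 0 = 0" for K by(induction K) simp_all
 thus "rights Q = [] ==> hl l Q $ 0 = 0" by(simp add: hl_def x.hlg_def x.hc_def foldr_fX_nth)
qed

text \<open>By induction on the power of the formal parameter and the number of antiholomorphic directions.\<close>

lemma flat_section_unique:
 assumes s: "flat_section \<A> \<omega> \<alpha> s" and t: "flat_section \<A> \<omega> \<alpha> t" and st: "symbol \<A> s = symbol \<A> t"
 shows "s = t"
proof(rule ext, rule ext)
 fix c z have ws: "weyl_section \<A> s" "weyl_section \<A> t" using s t by(simp_all add: flat_section_def) show "s c z = t c z"
 proof(cases "c : \<A> & z : chart_image c")
  case False hence "s c z = (%_. 0)" "t c z = (%_. 0)" using ws unfolding weyl_section_def by blast+ thus ?thesis by simp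
 next case True
  hence c: "c : \<A>" and z: "z : chart_image c" by auto
  interpret K: kaehler_local "chart_image c" "\<omega> c" by(rule kaehler_chart[OF c])
  have "K.sm (u c)" if "weyl_section \<A> u" for u
  proof - have "fsmooth_on (chart_image c) (%z. u c z m)" for m using that c unfolding weyl_section_def by blast
   thus ?thesis unfolding K.sm_def fsmooth_on_iff[OF open_chart_image[OF c]] by blast
  qed
  hence sm: "K.sm (s c)" "K.sm (t c)" using ws by auto
  \<comment> \<open>The difference of the frame jets of the two sections; their equality is deduced
    from its vanishing.\<close>
  define D where "D P w = K.hat (s c) P w - K.hat (t c) P w" for P w
  have flat: "fedosov \<omega> \<alpha> c A (s c) w = (%_. 0)" "fedosov \<omega> \<alpha> c A (t c) w = (%_. 0)" if "w : chart_image c" for A w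
   using s t c that unfolding flat_section_def by blast+
  have Dperm: "D P w = D Q w" if "mset P = mset Q" for P Q w unfolding D_def K.hat_def using hj_perm[OF that] by metis
  have dD: "wd A (%w. K.hat (s c) P w $ n) w - wd A (%w. K.hat (t c) P w $ n) w = 0"
   if "!!w. w : chart_image c ==> D P w $ n = 0" "w : chart_image c" for A P n w
  proof - have "wd A (%w. K.hat (s c) P w $ n) w = wd A (%w. K.hat (t c) P w $ n) w"
    by(rule wirtinger_cong[OF open_chart_image[OF c] that(2)]) (use that(1) in \<open>simp add: D_def\<close>)
   thus ?thesis by simp
  qed
  \<comment> \<open>Solving the holomorphic flatness equation for the jet with one more letter:
    holomorphic letters are derivatives along \<open>X\<close>.\<close>
  have Inl: "K.hat u (Inl a # P) w = K.fXv a (K.hat u P) w"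
   if u: "K.sm u" "!!A. fedosov \<omega> \<alpha> c A u w = (%_. 0)" and w: "w : chart_image c" for u a P w
  proof - have x: "chart_inv c w : fst c" "snd c (chart_inv c w) = w" using c w by auto
   have "fwd (Inl i) (K.hat u P) w = - (SS b. cst (\<omega> c w $ i $ b) * K.hat u (Inl b # P) w)" for i
    using hj_fedosov(1)[OF c x(1) u(1), of i P] by(simp add: x(2) u(2) hj_zero eq_neg_iff_add_eq_0)
   hence "K.fXv a (K.hat u P) w = - (SS i b. cst (omega_up (\<omega> c w) i a * \<omega> c w $ i $ b) * K.hat u (Inl b # P) w)"
    unfolding K.fXv_def by(simp add: sum_distrib_left sum_negf mult.assoc flip: fps_const_mult)
   also have "... = - (SS b. cst (SS i. omega_up (\<omega> c w) i a * \<omega> c w $ i $ b) * K.hat u (Inl b # P) w)"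
    by(subst sum.swap) (simp only: fps_const_sum sum_distrib_right)
   also have "... = K.hat u (Inl a # P) w" unfolding omega_up_left[OF invertible_omega[OF c w]]
    by(simp add: if_distrib[of cst] if_distrib[of "%x. x * _"] cong: if_cong flip: fps_const_neg)
   finally show ?thesis by simp
  qed
  have DInl: "D (Inl a # P) w $ n = 0" if "!!w. w : chart_image c ==> D P w $ n = 0" "w : chart_image c" for a P n w
  proof - have "D (Inl a # P) w $ n = (SS i. omega_up (\<omega> c w) i a *
    (wd (Inl i) (%w. K.hat (s c) P w $ n) w - wd (Inl i) (%w. K.hat (t c) P w $ n) w))"
    unfolding D_def Inl[OF sm(1) flat(1)[OF that(2)] that(2)] Inl[OF sm(2) flat(2)[OF that(2)] that(2)] K.fXv_def
    by(simp add: fps_sum_nth fwirtinger_def right_diff_distrib sum_subtractf)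
   thus ?thesis by(simp add: dD[OF that])
  qed
  \<comment> \<open>The antiholomorphic flatness equation solved for the jet with one more letter.
    The division by the parameter may raise the order consulted, which is why the induction needs
    the number of letters as well.\<close>
  have DInr: "D (Inr l # P) w = fwd (Inr l) (K.hat (s c) P) w - fwd (Inr l) (K.hat (t c) P) w
    + fps_shift 1 (jwick P (%Q. fev (hlc c x l Q)) (%Q. D Q w) - jwick P (%Q. D Q w) (%Q. fev (hlc c x l Q)))"
   if x: "x : fst c" "w = snd c x" for l P w x
  proof - have w: "w : chart_image c" using x by simp
   let ?hl = "%Q. fev (hlc c x l Q)" have e: "K.hat u (Inr l # P) w = fwd (Inr l) (K.hat u P) w
    + fps_shift 1 (jwick P ?hl (%Q. K.hat u Q w) - jwick P (%Q. K.hat u Q w) ?hl)"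
    if u: "K.sm u" "!!A. fedosov \<omega> \<alpha> c A u w = (%_. 0)" for u
   proof - have "fwd (Inr l) (K.hat u P) w - K.hat u (Inr l # P) w
     + fps_shift 1 (jwick P ?hl (%Q. K.hat u Q w) - jwick P (%Q. K.hat u Q w) ?hl) = 0"
     using hj_fedosov(2)[OF c x(1) u(1), of l P] u(2) by(simp only: x(2)[symmetric] hj_zero)
    moreover have "a - b + d = 0 ==> b = a + d" for a b d :: "complex fps" by(simp add: algebra_simps)
    ultimately show ?thesis by blast
   qed
   show ?thesis unfolding D_def jwick_diff1 jwick_diff2 e[OF sm(1) flat(1)[OF w]] e[OF sm(2) flat(2)[OF w]] by(rule fps_ext) simp
  qed
  \<comment> \<open>The symbol is read in the chart selected at the point, but scalar components
    agree in all charts.\<close>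
  have D0: "D [] w = 0" if "w : chart_image c" for w
  proof - define x where "x = chart_inv c w"
   let ?d = "chart_at \<A> x" have x: "x : fst c" "w = snd c x" using c that by(simp_all add: x_def)
   have sy: "u c w (%_. 0) = symbol \<A> u x" if u: "weyl_section \<A> u" for u
   proof - have "w : overlap c ?d" using x chart_at(2)[of x] by blast
    hence "jet (u c w) [] = (SUM Q:{Q. length Q = length ([] :: ('n + 'n) list)}.
      (PROD r<length ([] :: ('n + 'n) list). cst (jacobian c ?d (Q ! r) ([] ! r) w)) * jet (u ?d (transition c ?d w)) Q)"
     using u c chart_at(1)[of x] unfolding weyl_section_def by blast
    also have "... = jet (u ?d (snd ?d x)) []" unfolding x(2) transition_apply[OF c x(1)] by simp
    finally show ?thesis by(simp add: jet_def symbol_def Let_def)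
   qed
   show ?thesis using sy[OF ws(1)] sy[OF ws(2)] st by(simp add: D_def K.hat_def)
  qed
  have main: "length (rights P) = p ==> w : chart_image c ==> D P w $ n = 0" for n p P w
  proof(induction n arbitrary: p P w rule: less_induct)
   case (less n) show ?case using less.prems
   proof(induction p arbitrary: P w rule: less_induct)
    case (less p) have IHn: "D Q v $ m = 0" if "m < n" "v : chart_image c" for m Q v
     by(rule `!!y p P w. y < n ==> length (rights P) = p ==> w : chart_image c ==> D P w $ y = 0`[OF that(1) refl that(2)])
    have IHp: "D Q v $ n = 0" if "length (rights Q) < p" "v : chart_image c" for Q v by(rule less.IH[OF that(1) refl that(2)])
    have right: "D (map Inr M) w $ n = 0" if M: "length M = p" and w: "w : chart_image c" for M w
    proof(cases M)
     case Nil thus ?thesis by(simp add: D0[OF w])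
    next case (Cons l N)
     define x where "x = chart_inv c w" have x: "x : fst c" "w = snd c x" using c w by(simp_all add: x_def)
     define hl where "hl Q = fev (hlc c x l Q)" for Q note hlv = hlg_value[OF c x(1), where l = l, folded hl_def]
     let ?P = "map Inr N :: ('n + 'n) list" have p: "p = Suc (length N)" using M Cons by simp
     have 1: "jwt k ?P (%Q. D Q w) hl = 0" for k unfolding jwt_lists jprod_map by(simp add: hlv(1) jprod_zero2)
     \<comment> \<open>Order n of the difference is consulted only for k = 1 and order zero of
       \<open>hl\<close>. This is nonzero only with exactly one further antiholomorphic letter, and
       then the difference has one letter fewer than the word treated.\<close>
     have 2: "jwt k ?P hl (%Q. D Q w) $ (Suc n - k) = 0" if k: "k : {1..Suc n}" for k
     proof - have "jprod N (%M. hl (map Inl J @ map Inr M)) (%M. D (map Inr J @ map Inr M) w) $ (Suc n - k) = 0" if J: "length J = k" for J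
      proof(rule jprod_nth_zero)
       fix M1 M2 :: "'n list" assume len: "length M1 + length M2 = length N"
       have "hl (map Inl J @ map Inr M1) $ i * D (map Inr J @ map Inr M2) w $ (Suc n - k - i) = 0" if i: "i <= Suc n - k" for i
       proof(cases "Suc n - k - i < n")
        case True thus ?thesis using IHn[OF True w] by simp
       next case False
        hence ki: "k = 1" "i = 0" using k i by auto
        consider "M1 = []" | "length M1 = 1" | "2 <= length M1" by(cases M1 rule: remdups_adj.cases) auto
        thus ?thesis
        proof cases
         case 1 thus ?thesis by(simp add: ki hlv(3))
        next case 2
         hence "length (rights (map Inr J @ map Inr M2 :: ('n + 'n) list)) < p" using len p J ki by simp
         thus ?thesis using IHp[OF _ w] by(simp add: ki)
        next case 3
         thus ?thesis by(simp add: hlv(2))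
        qed
       qed
       thus "(hl (map Inl J @ map Inr M1) * D (map Inr J @ map Inr M2) w) $ (Suc n - k) = 0"
        unfolding fps_mult_nth by(intro sum.neutral ballI) (simp del: mult_eq_0_iff)
      qed
      thus ?thesis unfolding jwt_lists jprod_map by(simp add: fps_sum_nth)
     qed
     have "fps_shift 1 (jwick ?P hl (%Q. D Q w) - jwick ?P (%Q. D Q w) hl) $ n = 0"
      unfolding jwick_commutator by(intro sum.neutral ballI) (simp only: 1 2 diff_zero scaleR_zero_right)
     moreover have "(fwd (Inr l) (K.hat (s c) ?P) w - fwd (Inr l) (K.hat (t c) ?P) w) $ n = 0"
      using dD[of ?P n w "Inr l"] IHp[of ?P] w p by(simp add: fwirtinger_def)
     ultimately show ?thesis using DInr[OF x, of l ?P, folded hl_def] Cons by simp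
    qed
    have "D (map Inl L @ map Inr (rights P)) w $ n = 0" if "w : chart_image c" for L w using that
    proof(induction L arbitrary: w)
     case Nil thus ?case using right[OF less.prems(1)] by simp
    next case (Cons a L)
     thus ?case using DInl[OF Cons.IH Cons.prems] by simp
    qed
    thus ?case using Dperm[OF mset_split_lists[of P]] less.prems(2) by metis
   qed
  qed
  have "hj (fr (\<omega> c z)) (%m. s c z m - t c z m) P = 0" for P
   using main[OF refl z, of P] by(simp add: hj_diff D_def K.hat_def fps_eq_iff)
  hence "s c z m - t c z m = 0" for m by(rule hj_eq_zeroD[OF Vm_fr(1)[OF c z], rotated])
  thus ?thesis by(simp add: fun_eq_iff)
 qed
qed

lemma flat_lift_eq: "ff F ==> flat_lift \<A> \<omega> \<alpha> F = Osec F" unfolding flat_lift_def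
proof(rule the_equality)
 assume F: "ff F" show o: "flat_section \<A> \<omega> \<alpha> (Osec F) & symbol \<A> (Osec F) = F"
  using flat_section_Osec[OF F] symbol_Osec[OF F] by blast
 show "s = Osec F" if "flat_section \<A> \<omega> \<alpha> s & symbol \<A> s = F" for s
  by(rule flat_section_unique) (use that o in simp_all)
qed

text \<open>At the symbol only the full contractions of holomorphic jets of one lift with
  antiholomorphic jets of the other remain. The former are derivatives of the function itself and
  the latter its symbols, so the sum is \<open>star_T\<close>.\<close>

theorem S_eq_star_alpha: assumes F: "ff F" and G: "ff G" shows "S F G = star_alpha \<A> \<omega> \<alpha> F G"
proof
 fix x let ?c = "chart_at \<A> x" let ?z = "snd ?c x" note c = chart_at[of x]
 interpret x: wick_germ_pot "gC ?c x" "wg ?c x" "Wg ?c x" "Ug ?c x" by(rule pot_at[OF c])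
 have oF: "oh F ?c (map Inl J) ?z = fev (Xops ?c x J (fcg ?c x F))" for J unfolding oh_germ(3)[OF c F] by(simp add: Tg_def)
 have oG: "oh G ?c (map Inr J) ?z = fev (x.T (fcg ?c x G) J)" for J unfolding oh_germ(3)[OF c G] by(simp add: Tg_def)
 have "star_alpha \<A> \<omega> \<alpha> F G x = hj (fr (\<omega> ?c ?z)) (wick (\<omega> ?c ?z) (Osec F ?c ?z) (Osec G ?c ?z)) []"
  by(simp add: star_alpha_def flat_lift_eq F G symbol_def Let_def weyl_wick_def)
 also have "... = jwick [] (%P. oh F ?c P ?z) (%P. oh G ?c P ?z)" unfolding hj_wick hj_Osec[OF c F, abs_def] hj_Osec[OF c G, abs_def] ..
 also have "... = fev (fstar (gC ?c x) (fcg ?c x F) (fcg ?c x G))"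
 proof(rule fps_ext)
  fix n show "jwick [] (%P. oh F ?c P ?z) (%P. oh G ?c P ?z) $ n = fev (fstar (gC ?c x) (fcg ?c x F) (fcg ?c x G)) $ n"
  proof - have "jwt k [] (%P. oh F ?c P ?z) (%P. oh G ?c P ?z) = fev (SUM J:words k. Xops ?c x J (fcg ?c x F) * x.T (fcg ?c x G) J)" for k
    unfolding jwt_lists by(simp add: oF oG fev_sum)
   thus ?thesis by(simp add: jwick_nth x.star_T gev_sum)
  qed
 qed
 also have "... = S F G x" unfolding fcg_S[OF c F G, symmetric] by(rule fev_fcg[OF c S_formal[OF F G]])
 finally show "S F G x = star_alpha \<A> \<omega> \<alpha> F G x" ..
qed

end

theorem corollary2p27:
  fixes \<A> :: "('a::{t2_space, second_countable_topology}, 'n::finite) chart set"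
    and \<omega> :: "('a, 'n) form11"
    and S :: "'a star"
  assumes "kaehler_manifold \<A> \<omega>"
    and "deformation_quantization \<A> \<omega> S"
    and "wick_type \<A> S"
  shows "\<exists>\<alpha> :: nat \<Rightarrow> ('a, 'n) form11.
           (\<forall>k\<ge>1. closed_form11 \<A> (\<alpha> k)) \<and>
           (\<forall>f g. formal_fun \<A> f \<longrightarrow> formal_fun \<A> g \<longrightarrow> S f g = star_alpha \<A> \<omega> \<alpha> f g)"
proof - interpret kaehler_wick \<A> \<omega> S
 proof
  show "complex_atlas \<A>" using assms(1) unfolding kaehler_manifold_def by blast
 qed (rule assms)+
 show ?thesis using closed_alpha S_eq_star_alpha by blast
qed

end
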